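(* Let $s,\sigma>0$ be such that $s+\sigma\ge 1$, and let $t\in\mathbf R$. Then the following is true: (1) if $a\in(\mathcal S_{s,\sigma}^{\sigma,s})'(\mathbf R^{2d})$, then $\operatorname{Op}_{\mathrm{BJ}}(a)=\operatorname{Op}_t(b)$ for some $b\in(\mathcal S_{s,\sigma}^{\sigma,s})'(\mathbf R^{2d})$; (2) if $a\in\mathcal S_{s,\sigma}^{\sigma,s}(\mathbf R^{2d})$, then $\operatorname{Op}_{\mathrm{BJ}}(a)=\operatorname{Op}_t(b)$ for some $b\in\mathcal S_{s,\sigma}^{\sigma,s}(\mathbf R^{2d})$. The same holds true with $\mathscr S$ or $\Sigma_{s,\sigma}^{\sigma,s}$ in place of $\mathcal S_{s,\sigma}^{\sigma,s}$ at each occurrence.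
   Context: $\mathscr S$ is the Schwartz space and $\mathscr S'$ the space of tempered distributions. Gelfand-Shilov spaces: for $h,s,\sigma>0$, $\mathcal S_{s;h}^\sigma(\mathbf R^d)$ is the Banach space of all $f\in C^\infty(\mathbf R^d)$ with $\sup_{\alpha,\beta}\sup_x \frac{|x^\alpha\partial^\beta f(x)|}{h^{|\alpha+\beta|}\alpha!^s\beta!^\sigma}<\infty$. $\mathcal S_s^\sigma(\mathbf R^d)=\bigcup_{h>0}\mathcal S_{s;h}^\sigma(\mathbf R^d)$ with the inductive limit topology and $\Sigma_s^\sigma(\mathbf R^d)=\bigcap_{h>0}\mathcal S_{s;h}^\sigma(\mathbf R^d)$ with the projective limit topology; $(\mathcal S_s^\sigma)'$ and $(\Sigma_s^\sigma)'$ are their duals. The space $\mathcal S_{s,\sigma}^{\sigma,s}(\mathbf R^{2d})$ (respectively $\Sigma_{s,\sigma}^{\sigma,s}(\mathbf R^{2d})$) consists of all $F\in C^\infty(\mathbf R^{2d})$ such that $$|x^{\alpha_1}\xi^{\alpha_2}\partial_x^{\beta_1}\partial_\xi^{\beta_2}F(x,\xi)|\le C h^{|\alpha_1+\beta_1|+|\alpha_2+\beta_2|}\alpha_1!^{s}\alpha_2!^{\sigma}\beta_1!^{\sigma}\beta_2!^{s}$$ for all $x,\xi\in\mathbf R^d$ and all multi-indices, for some $C,h>0$ (respectively for every $h>0$ and some $C=C_h>0$). Topologies and duals are defined analogously. For $t\in\mathbf R$, $W_t(f,\phi)(x,\xi)=(2\pi)^{-d/2}\int_{\mathbf R^d} f(x+ty)\overline{\phi(x-(1-t)y)}e^{-i\langle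 y,\xi\rangle}\,dy$, and $W_{\mathrm{BJ}}(f,\phi)=\int_0^1W_t(f,\phi)\,dt$. The operators $\operatorname{Op}_t(a)$ and $\operatorname{Op}_{\mathrm{BJ}}(a)$ with symbol $a$ are defined by $$(\operatorname{Op}_t(a)f,g)=(2\pi)^{-d/2}(a,W_t(g,f)),\qquad (\operatorname{Op}_{\mathrm{BJ}}(a)f,g)=(2\pi)^{-d/2}(a,W_{\mathrm{BJ}}(g,f))$$ for test functions $f,g$ on $\mathbf R^d$, in $\mathcal S_s^\sigma(\mathbf R^d)$ (respectively $\Sigma_s^\sigma(\mathbf R^d)$, $\mathscr S(\mathbf R^d)$) when $a\in(\mathcal S_{s,\sigma}^{\sigma,s})'(\mathbf R^{2d})$ (respectively $(\Sigma_{s,\sigma}^{\sigma,s})'(\mathbf R^{2d})$, $\mathscr S'(\mathbf R^{2d})$), where $(\cdot,\cdot)$ is the extension of the $L^2$ scalar product to dual pairs. For $a\in\mathscr S(\mathbf R^{2d})$ this means $\operatorname{Op}_t(a)f(x)=(2\pi)^{-d}\iint a((1-t)x+ty,\xi)f(y)e^{i\langle x-y,\xi\rangle}\,dy\,d\xi$ and $\operatorname{Op}_{\mathrm{BJ}}(a)=\int_0^1\operatorname{Op}_t(a)\,dt$. *)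

theory Defs
  imports "HOL-Analysis.Analysis"
begin

section \<open>Multi-indices and smooth functions\<close>

text \<open>
  Functions live on a Euclidean space \<open>'a\<close>, and a multi-index is a map \<open>'a \<Rightarrow> nat\<close> of
  which only the values on \<^const>\<open>Basis\<close> matter.  Phase space is \<open>'a \<times> 'a\<close>; its
  basis consists of the vectors \<open>(b, 0)\<close> (the \<open>x\<close>-directions) and \<open>(0, b)\<close>
  (the \<open>\<xi>\<close>-directions).
\<close>

definition partial :: "'a::euclidean_space \<Rightarrow> ('a \<Rightarrow> complex) \<Rightarrow> 'a \<Rightarrow> complex" where
  "partial b f = (\<lambda>x. frechet_derivative f (at x) b)"

definition smooth :: "('a::euclidean_space \<Rightarrow> complex) \<Rightarrow> bool" where
  "smooth f \<longleftrightarrow> (\<forall>bs. set bs \<subseteq> Basis \<longrightarrow> foldr partial bs f differentiable_on UNIV)"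

text \<open>The order of differentiation is fixed by an arbitrary enumeration of the basis; it is
  immaterial for smooth functions, the only ones to which \<open>mderiv\<close> is applied.\<close>

definition basis_list :: "'a::euclidean_space list" where
  "basis_list = (SOME bs. distinct bs \<and> set bs = Basis)"

definition mderiv :: "('a::euclidean_space \<Rightarrow> nat) \<Rightarrow> ('a \<Rightarrow> complex) \<Rightarrow> 'a \<Rightarrow> complex" where
  "mderiv \<beta> f = foldr (\<lambda>b g. (partial b ^^ \<beta> b) g) basis_list f"

definition mpower :: "'a::euclidean_space \<Rightarrow> ('a \<Rightarrow> nat) \<Rightarrow> real" where
  "mpower x \<alpha> = (\<Prod>b\<in>Basis. (x \<bullet> b) ^ \<alpha> b)"

definition mlen :: "('a::euclidean_space \<Rightarrow> nat) \<Rightarrow> nat" where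
  "mlen \<alpha> = (\<Sum>b\<in>Basis. \<alpha> b)"

definition mfact_powr :: "('a::euclidean_space \<Rightarrow> real) \<Rightarrow> ('a \<Rightarrow> nat) \<Rightarrow> real" where
  "mfact_powr p \<alpha> = (\<Prod>b\<in>Basis. fact (\<alpha> b) powr p b)"


section \<open>Locally convex topologies on spaces of functions\<close>

definition seminorm_topology ::
    "('a \<Rightarrow> complex) set \<Rightarrow> (('a \<Rightarrow> complex) \<Rightarrow> real) set \<Rightarrow> ('a \<Rightarrow> complex) topology" where
  "seminorm_topology V P = topology_generated_by
     {{g \<in> V. p (\<lambda>x. g x - f x) < e} | p f e. p \<in> P \<and> f \<in> V \<and> 0 < e}"

text \<open>The coarsest topology on \<open>V\<close> for which the inclusions of \<open>V\<close> into the spaces \<open>T i\<close>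
  are continuous.\<close>

definition proj_limit_topology ::
    "('a \<Rightarrow> complex) set \<Rightarrow> 'i set \<Rightarrow> ('i \<Rightarrow> ('a \<Rightarrow> complex) topology)
       \<Rightarrow> ('a \<Rightarrow> complex) topology" where
  "proj_limit_topology V I T = topology_generated_by {V \<inter> U | U i. i \<in> I \<and> openin (T i) U}"

definition abs_convex :: "('a \<Rightarrow> complex) set \<Rightarrow> bool" where
  "abs_convex W \<longleftrightarrow>
     (\<forall>f\<in>W. \<forall>g\<in>W. \<forall>c d. cmod c + cmod d \<le> 1 \<longrightarrow> (\<lambda>x. c * f x + d * g x) \<in> W)"

text \<open>The finest locally convex topology on \<open>V\<close> for which the inclusions of the spaces
  \<open>T i\<close> into \<open>V\<close> are continuous: the absolutely convex sets that contain a neighbourhood of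
  \<open>0\<close> in each \<open>T i\<close> form a base of the neighbourhoods of \<open>0\<close>.\<close>

definition ind_limit_nhd ::
    "('a \<Rightarrow> complex) set \<Rightarrow> 'i set \<Rightarrow> ('i \<Rightarrow> ('a \<Rightarrow> complex) topology)
       \<Rightarrow> ('a \<Rightarrow> complex) set \<Rightarrow> bool" where
  "ind_limit_nhd V I T W \<longleftrightarrow> W \<subseteq> V \<and> abs_convex W \<and>
     (\<forall>i\<in>I. \<exists>N. openin (T i) N \<and> (\<lambda>x. 0) \<in> N \<and> N \<subseteq> W)"

definition ind_limit_topology ::
    "('a \<Rightarrow> complex) set \<Rightarrow> 'i set \<Rightarrow> ('i \<Rightarrow> ('a \<Rightarrow> complex) topology)
       \<Rightarrow> ('a \<Rightarrow> complex) topology" where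
  "ind_limit_topology V I T = topology (\<lambda>U. U \<subseteq> V \<and>
     (\<forall>f\<in>U. \<exists>W. ind_limit_nhd V I T W \<and> (\<forall>g\<in>W. (\<lambda>x. f x + g x) \<in> U)))"

lemma ind_limit_nhd_Int:
  assumes "ind_limit_nhd V I T W" "ind_limit_nhd V I T W'"
  shows "ind_limit_nhd V I T (W \<inter> W')"
proof -
  have "\<exists>N. openin (T i) N \<and> (\<lambda>x. 0) \<in> N \<and> N \<subseteq> W \<inter> W'" if i: "i \<in> I" for i
  proof -
    obtain N N' where "openin (T i) N" "(\<lambda>x. 0) \<in> N" "N \<subseteq> W"
        "openin (T i) N'" "(\<lambda>x. 0) \<in> N'" "N' \<subseteq> W'"
      using assms i unfolding ind_limit_nhd_def by meson
    then show ?thesis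
      by (intro exI[of _ "N \<inter> N'"]) auto
  qed
  then show ?thesis
    using assms unfolding ind_limit_nhd_def abs_convex_def by auto
qed

lemma openin_ind_limit_topology:
  "openin (ind_limit_topology V I T) U \<longleftrightarrow> U \<subseteq> V \<and>
     (\<forall>f\<in>U. \<exists>W. ind_limit_nhd V I T W \<and> (\<forall>g\<in>W. (\<lambda>x. f x + g x) \<in> U))"
proof -
  let ?P = "\<lambda>U. U \<subseteq> V \<and>
     (\<forall>f\<in>U. \<exists>W. ind_limit_nhd V I T W \<and> (\<forall>g\<in>W. (\<lambda>x. f x + g x) \<in> U))"
  have "?P (S \<inter> S')" if S: "?P S" and S': "?P S'" for S S'
  proof (intro conjI ballI)
    show "S \<inter> S' \<subseteq> V" using S by blast
    fix f assume f: "f \<in> S \<inter> S'"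
    obtain W where W: "ind_limit_nhd V I T W" "\<forall>g\<in>W. (\<lambda>x. f x + g x) \<in> S"
      using S f by blast
    obtain W' where W': "ind_limit_nhd V I T W'" "\<forall>g\<in>W'. (\<lambda>x. f x + g x) \<in> S'"
      using S' f by blast
    show "\<exists>W. ind_limit_nhd V I T W \<and> (\<forall>g\<in>W. (\<lambda>x. f x + g x) \<in> S \<inter> S')"
      using ind_limit_nhd_Int[OF W(1) W'(1)] W(2) W'(2) by blast
  qed
  moreover have "?P (\<Union>\<K>)" if K: "\<forall>K\<in>\<K>. ?P K" for \<K>
  proof (intro conjI ballI)
    show "\<Union>\<K> \<subseteq> V" using K by blast
    fix f assume "f \<in> \<Union>\<K>"
    then obtain K where "K \<in> \<K>" "f \<in> K" by blast
    then obtain W where "ind_limit_nhd V I T W" "\<forall>g\<in>W. (\<lambda>x. f x + g x) \<in> K"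
      using K by blast
    with \<open>K \<in> \<K>\<close> show "\<exists>W. ind_limit_nhd V I T W \<and> (\<forall>g\<in>W. (\<lambda>x. f x + g x) \<in> \<Union>\<K>)"
      by blast
  qed
  ultimately have "istopology ?P"
    unfolding istopology_def by blast
  then show ?thesis
    unfolding ind_limit_topology_def by (simp add: topology_inverse')
qed

text \<open>Continuous linear functionals on \<open>V\<close>, set to \<^const>\<open>undefined\<close> outside \<open>V\<close>.\<close>

definition dual_space ::
    "('a \<Rightarrow> complex) set \<Rightarrow> ('a \<Rightarrow> complex) topology \<Rightarrow> (('a \<Rightarrow> complex) \<Rightarrow> complex) set" where
  "dual_space V T = {u \<in> extensional V.
     (\<forall>f\<in>V. \<forall>g\<in>V. \<forall>c d. u (\<lambda>x. c * f x + d * g x) = c * u f + d * u g) \<and>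
     continuous_map T euclidean u}"


section \<open>Schwartz space\<close>

definition schwartz_seminorm ::
    "('a::euclidean_space \<Rightarrow> nat) \<Rightarrow> ('a \<Rightarrow> nat) \<Rightarrow> ('a \<Rightarrow> complex) \<Rightarrow> real" where
  "schwartz_seminorm \<alpha> \<beta> f = (SUP x. \<bar>mpower x \<alpha>\<bar> * cmod (mderiv \<beta> f x))"

definition schwartz :: "('a::euclidean_space \<Rightarrow> complex) set" where
  "schwartz = {f. smooth f \<and>
     (\<forall>\<alpha> \<beta>. bdd_above (range (\<lambda>x. \<bar>mpower x \<alpha>\<bar> * cmod (mderiv \<beta> f x))))}"

definition schwartz_topology :: "('a::euclidean_space \<Rightarrow> complex) topology" where
  "schwartz_topology = seminorm_topology schwartz {schwartz_seminorm \<alpha> \<beta> | \<alpha> \<beta>. True}"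

definition tempered :: "(('a::euclidean_space \<Rightarrow> complex) \<Rightarrow> complex) set" where
  "tempered = dual_space schwartz schwartz_topology"


section \<open>Gelfand--Shilov spaces\<close>

text \<open>
  The exponents \<open>p b\<close> (for decay) and \<open>q b\<close> (for derivatives) may depend on the coordinate
  direction \<open>b\<close>, so that the isotropic spaces on \<open>'a\<close> and the anisotropic ones on phase
  space are instances of the same construction.
\<close>

definition gs_quotient :: "('a::euclidean_space \<Rightarrow> real) \<Rightarrow> ('a \<Rightarrow> real) \<Rightarrow> real
    \<Rightarrow> ('a \<Rightarrow> complex) \<Rightarrow> ('a \<Rightarrow> nat) \<times> ('a \<Rightarrow> nat) \<times> 'a \<Rightarrow> real" where
  "gs_quotient p q h f = (\<lambda>(\<alpha>, \<beta>, x).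
     \<bar>mpower x \<alpha>\<bar> * cmod (mderiv \<beta> f x) /
     (h ^ (mlen \<alpha> + mlen \<beta>) * mfact_powr p \<alpha> * mfact_powr q \<beta>))"

definition gs_step :: "('a::euclidean_space \<Rightarrow> real) \<Rightarrow> ('a \<Rightarrow> real) \<Rightarrow> real
    \<Rightarrow> ('a \<Rightarrow> complex) set" where
  "gs_step p q h = {f. smooth f \<and> bdd_above (range (gs_quotient p q h f))}"

definition gs_norm :: "('a::euclidean_space \<Rightarrow> real) \<Rightarrow> ('a \<Rightarrow> real) \<Rightarrow> real
    \<Rightarrow> ('a \<Rightarrow> complex) \<Rightarrow> real" where
  "gs_norm p q h f = Sup (range (gs_quotient p q h f))"

definition gs_step_topology :: "('a::euclidean_space \<Rightarrow> real) \<Rightarrow> ('a \<Rightarrow> real) \<Rightarrow> real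
    \<Rightarrow> ('a \<Rightarrow> complex) topology" where
  "gs_step_topology p q h = seminorm_topology (gs_step p q h) {gs_norm p q h}"

definition gs_roumieu ::
    "('a::euclidean_space \<Rightarrow> real) \<Rightarrow> ('a \<Rightarrow> real) \<Rightarrow> ('a \<Rightarrow> complex) set" where
  "gs_roumieu p q = (\<Union>h\<in>{0<..}. gs_step p q h)"

definition gs_roumieu_dual ::
    "('a::euclidean_space \<Rightarrow> real) \<Rightarrow> ('a \<Rightarrow> real) \<Rightarrow> (('a \<Rightarrow> complex) \<Rightarrow> complex) set" where
  "gs_roumieu_dual p q = dual_space (gs_roumieu p q)
     (ind_limit_topology (gs_roumieu p q) {0<..} (gs_step_topology p q))"

definition gs_beurling ::
    "('a::euclidean_space \<Rightarrow> real) \<Rightarrow> ('a \<Rightarrow> real) \<Rightarrow> ('a \<Rightarrow> complex) set" where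
  "gs_beurling p q = (\<Inter>h\<in>{0<..}. gs_step p q h)"

definition gs_beurling_dual ::
    "('a::euclidean_space \<Rightarrow> real) \<Rightarrow> ('a \<Rightarrow> real) \<Rightarrow> (('a \<Rightarrow> complex) \<Rightarrow> complex) set" where
  "gs_beurling_dual p q = dual_space (gs_beurling p q)
     (proj_limit_topology (gs_beurling p q) {0<..} (gs_step_topology p q))"

text \<open>Exponent \<open>u\<close> in the \<open>x\<close>-directions and \<open>v\<close> in the \<open>\<xi>\<close>-directions of phase space.\<close>

definition phase_exps :: "real \<Rightarrow> real \<Rightarrow> 'a::euclidean_space \<times> 'a \<Rightarrow> real" where
  "phase_exps u v = (\<lambda>b. if snd b = 0 then u else v)"

lemma prod_Basis_phase:
  "(\<Prod>b\<in>(Basis :: ('a::euclidean_space \<times> 'a) set). F b) =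
     (\<Prod>b\<in>Basis. F (b, 0)) * (\<Prod>b\<in>Basis. (F (0, b) :: real))"
  unfolding Basis_prod_def
  by (subst prod.union_disjoint) (auto simp: prod.reindex inj_on_def)

lemma mfact_powr_phase_exps:
  "mfact_powr (phase_exps u v) \<alpha> =
     mfact_powr (\<lambda>_. u) (\<lambda>b. \<alpha> (b, 0)) * mfact_powr (\<lambda>_. v) (\<lambda>b. \<alpha> (0, b))"
  unfolding mfact_powr_def prod_Basis_phase phase_exps_def
  by (auto intro!: arg_cong2[where f = "(*)"] prod.cong)

definition GS :: "real \<Rightarrow> real \<Rightarrow> ('a::euclidean_space \<Rightarrow> complex) set" where
  "GS s \<sigma> = gs_roumieu (\<lambda>_. s) (\<lambda>_. \<sigma>)"

definition GS_Sigma :: "real \<Rightarrow> real \<Rightarrow> ('a::euclidean_space \<Rightarrow> complex) set" where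
  "GS_Sigma s \<sigma> = gs_beurling (\<lambda>_. s) (\<lambda>_. \<sigma>)"

definition GS_phase :: "real \<Rightarrow> real \<Rightarrow> ('a::euclidean_space \<times> 'a \<Rightarrow> complex) set" where
  "GS_phase s \<sigma> = gs_roumieu (phase_exps s \<sigma>) (phase_exps \<sigma> s)"

definition GS_phase_dual ::
    "real \<Rightarrow> real \<Rightarrow> (('a::euclidean_space \<times> 'a \<Rightarrow> complex) \<Rightarrow> complex) set" where
  "GS_phase_dual s \<sigma> = gs_roumieu_dual (phase_exps s \<sigma>) (phase_exps \<sigma> s)"

definition GS_Sigma_phase :: "real \<Rightarrow> real \<Rightarrow> ('a::euclidean_space \<times> 'a \<Rightarrow> complex) set" where
  "GS_Sigma_phase s \<sigma> = gs_beurling (phase_exps s \<sigma>) (phase_exps \<sigma> s)"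

definition GS_Sigma_phase_dual ::
    "real \<Rightarrow> real \<Rightarrow> (('a::euclidean_space \<times> 'a \<Rightarrow> complex) \<Rightarrow> complex) set" where
  "GS_Sigma_phase_dual s \<sigma> = gs_beurling_dual (phase_exps s \<sigma>) (phase_exps \<sigma> s)"


section \<open>Wigner distributions and pseudo-differential operators\<close>

definition wigner :: "real \<Rightarrow> ('a::euclidean_space \<Rightarrow> complex) \<Rightarrow> ('a \<Rightarrow> complex)
    \<Rightarrow> 'a \<times> 'a \<Rightarrow> complex" where
  "wigner t f \<phi> = (\<lambda>(x, \<xi>). of_real ((2 * pi) powr (- (real DIM('a) / 2))) *
     (\<integral>y. f (x + t *\<^sub>R y) * cnj (\<phi> (x - (1 - t) *\<^sub>R y)) * exp (- (\<i> * of_real (y \<bullet> \<xi>)))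
        \<partial>lborel))"

definition wigner_BJ :: "('a::euclidean_space \<Rightarrow> complex) \<Rightarrow> ('a \<Rightarrow> complex)
    \<Rightarrow> 'a \<times> 'a \<Rightarrow> complex" where
  "wigner_BJ f \<phi> = (\<lambda>z. set_lebesgue_integral lborel {0..1} (\<lambda>t. wigner t f \<phi> z))"

text \<open>Distributions are linear functionals; the pairing \<open>(u, \<phi>)\<close> extends the \<open>L\<^sup>2\<close> scalar
  product \<open>\<integral> u \<phi>\<^sup>*\<close>, hence is conjugate linear in \<open>\<phi>\<close>.\<close>

definition pairing :: "(('a \<Rightarrow> complex) \<Rightarrow> complex) \<Rightarrow> ('a \<Rightarrow> complex) \<Rightarrow> complex" where
  "pairing u \<phi> = u (\<lambda>x. cnj (\<phi> x))"

text \<open>The functional on \<open>V\<close> identified with the function \<open>a\<close>.\<close>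

definition dist_of :: "('a::euclidean_space \<Rightarrow> complex) set \<Rightarrow> ('a \<Rightarrow> complex)
    \<Rightarrow> ('a \<Rightarrow> complex) \<Rightarrow> complex" where
  "dist_of V a = (\<lambda>\<psi>\<in>V. \<integral>z. a z * \<psi> z \<partial>lborel)"

text \<open>The operators with symbol \<open>a\<close> map a space \<open>V\<close> of test functions into its dual.
  The argument \<open>\<psi>\<close> of the functional \<open>Op_t V t a f\<close> is the conjugate of the \<open>g\<close> in
  \<open>(Op\<^sub>t(a) f, g)\<close>; see the two lemmas following the definitions.\<close>

definition Op_t :: "('a::euclidean_space \<Rightarrow> complex) set \<Rightarrow> real
    \<Rightarrow> (('a \<times> 'a \<Rightarrow> complex) \<Rightarrow> complex) \<Rightarrow> ('a \<Rightarrow> complex) \<Rightarrow> ('a \<Rightarrow> complex) \<Rightarrow> complex" where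
  "Op_t V t a = (\<lambda>f\<in>V. \<lambda>\<psi>\<in>V. of_real ((2 * pi) powr (- (real DIM('a) / 2))) *
     pairing a (wigner t (\<lambda>x. cnj (\<psi> x)) f))"

definition Op_BJ :: "('a::euclidean_space \<Rightarrow> complex) set
    \<Rightarrow> (('a \<times> 'a \<Rightarrow> complex) \<Rightarrow> complex) \<Rightarrow> ('a \<Rightarrow> complex) \<Rightarrow> ('a \<Rightarrow> complex) \<Rightarrow> complex" where
  "Op_BJ V a = (\<lambda>f\<in>V. \<lambda>\<psi>\<in>V. of_real ((2 * pi) powr (- (real DIM('a) / 2))) *
     pairing a (wigner_BJ (\<lambda>x. cnj (\<psi> x)) f))"

lemma pairing_Op_t:
  assumes "f \<in> V" "(\<lambda>x. cnj (g x)) \<in> V"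
  shows "pairing (Op_t V t a f) g =
     of_real ((2 * pi) powr (- (real DIM('a::euclidean_space) / 2))) *
       pairing a (wigner t (g :: 'a \<Rightarrow> complex) f)"
  using assms by (simp add: Op_t_def pairing_def)

lemma pairing_Op_BJ:
  assumes "f \<in> V" "(\<lambda>x. cnj (g x)) \<in> V"
  shows "pairing (Op_BJ V a f) g =
     of_real ((2 * pi) powr (- (real DIM('a::euclidean_space) / 2))) *
       pairing a (wigner_BJ (g :: 'a \<Rightarrow> complex) f)"
  using assms by (simp add: Op_BJ_def pairing_def)

end

theory Submission
  imports Defs "HOL-Probability.Characteristic_Functions" "HOL-Probability.Sinc_Integral"
begin

text \<open>
  After the partial Fourier transform in the second variable, \<open>W\<^sub>t(f, \<phi>)\<close> becomes the pullback of
  the tensor product of \<open>f\<close> and the conjugate of \<open>\<phi>\<close> under a linear map, and the linear maps for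
  \<open>\<tau>\<close> and \<open>t\<close> differ by the shear \<open>(x, y) \<mapsto> (x + (\<tau> - t) y, y)\<close>.  Hence \<open>W\<^sub>B\<^sub>J = \<Phi> W\<^sub>t\<close>, where
  \<open>\<Phi>\<close> is the average of these shears over \<open>\<tau> \<in> [0, 1]\<close>, conjugated by the partial Fourier transform,
  and \<open>b = a \<circ> \<Phi>\<close>; if \<open>a\<close> is a function, \<open>b\<close> is the transpose of \<open>\<Phi>\<close> applied to \<open>a\<close>.

  That \<open>\<Phi>\<close> is continuous on each space is seen from bounds on words in the operators
  \<open>X\<^sub>b\<close> (multiplication by a coordinate) and \<open>D\<^sub>b\<close> (partial derivative).  The partial Fourier
  transform exchanges \<open>X\<^sub>b\<close> and \<open>D\<^sub>b\<close> in the second variable, and a linear substitution replaces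
  a letter by a combination of two letters of the same kind.  Bringing a word with \<open>k\<close> contractions
  \<open>D\<^sub>b X\<^sub>b = X\<^sub>b D\<^sub>b + 1\<close> to normal order costs \<open>k!\<close>, which \<open>k!\<^sup>s\<^sup>+\<^sup>\<sigma>\<close> absorbs.  This fails only for the
  spaces \<open>\<Sigma>\<close> with \<open>s + \<sigma> = 1\<close>, but these are trivial, since for every \<open>\<epsilon> > 0\<close>
  \<open>n! \<integral> \<bar>f\<bar>\<^sup>2 = \<bar>\<integral> x\<^sub>b\<^sup>n D\<^sub>b\<^sup>n \<bar>f\<bar>\<^sup>2\<bar> \<le> C \<epsilon>\<^sup>n n!\<close>.
\<close>

section \<open>Partial derivatives and smooth functions\<close>

text \<open>Why two classes of letters suffice: in phase space x-multiplications and
  \<xi>-derivatives carry the exponent s, \<xi>-multiplications and x-derivatives carry \<sigma>.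
  Undoing the partial Fourier transform turns this into: all multiplications carry s, all
  derivatives \<sigma>. Every operation inside \<Phi> preserves the number of letters of each class,
  so a bound that depends on these two numbers alone, for words in any order, passes through \<Phi>
  without restoring normal order; the k! is paid once, on entry. Absolute convergence of the Fourier
  integrals costs two more letters per coordinate, which a geometric factor absorbs. Every loss thus
  replaces the step h by \<kappa> h with \<kappa> independent of h. The projective limit depends on
  this uniformity, since arbitrarily small target steps have to be reached. The pairing conjugates
  its second argument, so \<Phi> acts on conjugated Wigner distributions, whose kernels contain no
  conjugation. A sign e = 1 or -1 is carried along because the transpose of \<Phi> has the same form
  with the opposite sign.\<close>

lemma smooth_differentiable:
  assumes "smooth f" shows "f differentiable (at x)"
proof -
  have "foldr partial [] f differentiable_on UNIV"
    using assms unfolding smooth_def by (metis empty_set empty_subsetI)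
  then show ?thesis by (simp add: differentiable_on_def)
qed

lemma smooth_partial: 
  assumes "smooth f" "b \<in> Basis" shows "smooth (partial b f)"
  unfolding smooth_def
proof (intro allI impI)
  fix bs :: "'a list" assume "set bs \<subseteq> Basis"
  then have "foldr partial (bs @ [b]) f differentiable_on UNIV"
    using assms unfolding smooth_def by (metis Un_insert_right empty_set insert_subset list.simps(15) set_append sup_bot.right_neutral)
  then show "foldr partial bs (partial b f) differentiable_on UNIV" by simp
qed

text \<open>Coinduction replaces inductions over lists of derivatives: for slices, transforms,
  averages and tensor products the invariant \<open>Q\<close> is the class of all functions of the
  same shape.\<close>

lemma smooth_coinduct:
  assumes "f \<in> Q" "\<And>g x. g \<in> Q \<Longrightarrow> g differentiable (at x)"
    "\<And>g b. g \<in> Q \<Longrightarrow> b \<in> Basis \<Longrightarrow> partial b g \<in> Q"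
  shows "smooth f"
proof -
  have "foldr partial bs f \<in> Q" if "set bs \<subseteq> Basis" for bs
    using that by (induction bs) (use assms in auto)
  then show ?thesis unfolding smooth_def differentiable_on_def
    using assms(2) by (metis differentiable_at_withinI)
qed

lemma has_derivative_partial:
  assumes "f differentiable (at x)"
  shows "(f has_derivative (\<lambda>v. partial v f x)) (at x)"
  using assms unfolding partial_def by (simp add: frechet_derivative_works)

lemma has_derivative_imp_partial:
  "(f has_derivative f') (at x) \<Longrightarrow> partial v f x = f' v"
  unfolding partial_def by (metis frechet_derivative_at)

lemma has_derivative_coordinates:
  assumes "f differentiable (at x)"
  shows "partial v f x = (\<Sum>b\<in>Basis. of_real (v \<bullet> b) * partial b f x)"
proof -
  interpret linear "\<lambda>v. partial v f x"
    using has_derivative_partial[OF assms] by (rule has_derivative_linear)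
  have "partial v f x = partial (\<Sum>b\<in>Basis. (v \<bullet> b) *\<^sub>R b) f x" by (simp add: euclidean_representation)
  also have "\<dots> = (\<Sum>b\<in>Basis. of_real (v \<bullet> b) * partial b f x)"
    by (simp add: sum scale scaleR_conv_of_real)
  finally show ?thesis .
qed

lemma smooth_continuous_on: "smooth f \<Longrightarrow> continuous_on S f"
  by (meson continuous_at_imp_continuous_on differentiable_imp_continuous_within smooth_differentiable)

lemma smooth_measurable: "smooth f \<Longrightarrow> f \<in> borel_measurable borel"
  by (simp add: borel_measurable_continuous_onI smooth_continuous_on)

lemma has_vector_derivative_line:
  assumes "f differentiable (at (x + u *\<^sub>R b))"
  shows "((\<lambda>u. f (x + u *\<^sub>R b)) has_vector_derivative partial b f (x + u *\<^sub>R b)) (at u within S)"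
proof -
  have "((\<lambda>u. f (x + u *\<^sub>R b)) has_derivative (\<lambda>h. partial (h *\<^sub>R b) f (x + u *\<^sub>R b))) (at u within S)"
    by (rule has_derivative_compose[where f = "\<lambda>u. x + u *\<^sub>R b" and g = f, OF _ has_derivative_partial[OF assms]])
       (auto intro!: derivative_eq_intros)
  moreover have "partial (h *\<^sub>R b) f (x + u *\<^sub>R b) = h *\<^sub>R partial b f (x + u *\<^sub>R b)" for h
    using linear_scale[OF has_derivative_linear[OF has_derivative_partial[OF assms]]] by simp
  ultimately show ?thesis by (simp add: has_vector_derivative_def)
qed

text \<open>The mean value inequality for \<open>g u - u *\<^sub>R L\<close>. Complex values admit
  no mean value equality; comparison with a fixed slope \<open>L\<close> serves mixed differences as
  well as first and second order Taylor remainders.\<close>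

lemma vector_mean_bound:
  fixes g :: "real \<Rightarrow> complex"
  assumes "\<And>u. u \<in> {0..h} \<Longrightarrow> (g has_vector_derivative g' u) (at u within {0..h})"
    "\<And>u. u \<in> {0..h} \<Longrightarrow> cmod (g' u - L) \<le> e" "0 \<le> h"
  shows "cmod (g h - g 0 - of_real h * L) \<le> e * h"
proof -
  have "norm ((g h - h *\<^sub>R L) - (g 0 - 0 *\<^sub>R L)) \<le> e * norm (h - 0)"
  proof (rule differentiable_bound[of "{0..h}" "\<lambda>u. g u - u *\<^sub>R L" "\<lambda>u k. k *\<^sub>R (g' u - L)"])
    fix u assume u: "u \<in> {0..h}"
    show "((\<lambda>u. g u - u *\<^sub>R L) has_derivative (\<lambda>k. k *\<^sub>R (g' u - L))) (at u within {0..h})"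
      using assms(1)[OF u] unfolding has_vector_derivative_def
      by (auto intro!: derivative_eq_intros simp: scaleR_right_diff_distrib)
    show "onorm (\<lambda>k. k *\<^sub>R (g' u - L)) \<le> e"
      using assms(2)[OF u] by (intro onorm_le) (simp add: mult.commute[of e] mult_left_mono)
  qed (use assms in auto)
  then show ?thesis using assms(3) by (simp add: scaleR_conv_of_real algebra_simps)
qed

text \<open>The second difference over a square of side \<open>h\<close> is an increment in the
  direction \<open>b\<close> of increments in the direction \<open>c\<close>;
  \<open>vector_mean_bound\<close> is applied once for each.\<close>

lemma mixed_difference_bound:
  assumes f: "smooth f" and b: "b \<in> Basis" and c: "c \<in> Basis" and "0 \<le> h"
    and e: "\<And>u v. u \<in> {0..h} \<Longrightarrow> v \<in> {0..h} \<Longrightarrow> 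
      cmod (partial c (partial b f) (x + u *\<^sub>R b + v *\<^sub>R c) - L) \<le> e"
  shows "cmod (f (x + h *\<^sub>R b + h *\<^sub>R c) - f (x + h *\<^sub>R b) - f (x + h *\<^sub>R c) + f x - of_real (h * h) * L) \<le> e * h * h"
proof -
  define g where "g = (\<lambda>u. f (x + h *\<^sub>R c + u *\<^sub>R b) - f (x + u *\<^sub>R b))"
  define g' where "g' = (\<lambda>u. partial b f (x + h *\<^sub>R c + u *\<^sub>R b) - partial b f (x + u *\<^sub>R b))"
  have sb: "smooth (partial b f)" by (rule smooth_partial[OF f b])
  have "cmod (g h - g 0 - of_real h * (of_real h * L)) \<le> (e * h) * h"
  proof (rule vector_mean_bound[where g' = g'])
    fix u assume u: "u \<in> {0..h}"
    show "(g has_vector_derivative g' u) (at u within {0..h})"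
      unfolding g_def g'_def
      by (intro has_vector_derivative_diff has_vector_derivative_line smooth_differentiable f)
    have "cmod (partial b f (x + u *\<^sub>R b + h *\<^sub>R c) - partial b f (x + u *\<^sub>R b + 0 *\<^sub>R c) - of_real h * L) \<le> e * h"
      by (rule vector_mean_bound[where g' = "\<lambda>v. partial c (partial b f) (x + u *\<^sub>R b + v *\<^sub>R c)"])
         (use u e assms in \<open>auto intro!: has_vector_derivative_line smooth_differentiable sb\<close>)
    then show "cmod (g' u - of_real h * L) \<le> e * h"
      unfolding g'_def by (simp add: algebra_simps)
  qed (use assms in auto)
  then show ?thesis unfolding g_def by (simp add: algebra_simps)
qed

text \<open>Second differences are symmetric in \<open>b\<close> and \<open>c\<close>; divided by
  \<open>h * h\<close> they tend to one mixed derivative or to the other, according to the order in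
  which the two mean value steps are made.\<close>

lemma partial_commute:
  assumes f: "smooth f" and b: "b \<in> Basis" and c: "c \<in> Basis"
  shows "partial b (partial c f) = partial c (partial b f)"
proof
  fix x
  let ?L = "partial c (partial b f) x" and ?M = "partial b (partial c f) x"
  \<comment> \<open>The directions are quantified anew, so that the estimate can be used in both
    orders.\<close>
  have key: "\<exists>h0>0. \<forall>h. 0 \<le> h \<and> h \<le> h0 \<longrightarrow> cmod (f (x + h *\<^sub>R b + h *\<^sub>R c) - f (x + h *\<^sub>R b) - f (x + h *\<^sub>R c) + f x
       - of_real (h * h) * partial c (partial b f) x) \<le> e * h * h" 
    if b: "b \<in> Basis" and c: "c \<in> Basis" and e: "e > 0" for b c e
  proof -
    have "continuous_on UNIV (partial c (partial b f))"
      by (intro smooth_continuous_on smooth_partial f b c)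
    then obtain d where d: "d > 0" "\<And>y. dist y x < d \<Longrightarrow> dist (partial c (partial b f) y) (partial c (partial b f) x) < e"
      using e unfolding continuous_on_iff by (metis UNIV_I)
    show ?thesis
    proof (intro exI[of _ "d/4"] conjI allI impI)
      show "d/4 > 0" using d by simp
      fix h assume h: "0 \<le> h \<and> h \<le> d/4"
      show "cmod (f (x + h *\<^sub>R b + h *\<^sub>R c) - f (x + h *\<^sub>R b) - f (x + h *\<^sub>R c) + f x
       - of_real (h * h) * partial c (partial b f) x) \<le> e * h * h"
      proof (rule mixed_difference_bound[OF f b c])
        fix u v assume uv: "u \<in> {0..h}" "v \<in> {0..h}"
        have "norm (u *\<^sub>R b + v *\<^sub>R c) \<le> u + v"
          by (rule norm_triangle_le) (use uv b c in simp)
        also have "\<dots> < d" using uv h d(1) by auto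
        finally have "dist (x + u *\<^sub>R b + v *\<^sub>R c) x < d" by (simp add: dist_norm add.assoc)
        from d(2)[OF this] show "cmod (partial c (partial b f) (x + u *\<^sub>R b + v *\<^sub>R c) - partial c (partial b f) x) \<le> e"
          by (simp add: dist_norm)
      qed (use h in auto)
    qed
  qed
  have "cmod (?M - ?L) \<le> e" if "e > 0" for e
  proof -
    have e2: "e/2 > 0" using that by simp
    obtain h0 where h0: "h0 > 0" "\<forall>h. 0 \<le> h \<and> h \<le> h0 \<longrightarrow> cmod (f (x + h *\<^sub>R b + h *\<^sub>R c) - f (x + h *\<^sub>R b) - f (x + h *\<^sub>R c) + f x
       - of_real (h * h) * ?L) \<le> e/2 * h * h" using key[OF b c e2] by auto
    obtain h1 where h1: "h1 > 0" "\<forall>h. 0 \<le> h \<and> h \<le> h1 \<longrightarrow> cmod (f (x + h *\<^sub>R c + h *\<^sub>R b) - f (x + h *\<^sub>R c) - f (x + h *\<^sub>R b) + f x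
       - of_real (h * h) * ?M) \<le> e/2 * h * h" using key[OF c b e2] by auto
    define h where "h = min h0 h1"
    have h: "h > 0" "h \<le> h0" "h \<le> h1" using h0 h1 by (auto simp: h_def)
    define A where "A = f (x + h *\<^sub>R b + h *\<^sub>R c) - f (x + h *\<^sub>R b) - f (x + h *\<^sub>R c) + f x"
    have 1: "cmod (A - of_real (h * h) * ?L) \<le> e/2 * h * h" using h0 h unfolding A_def by auto
    have A': "A = f (x + h *\<^sub>R c + h *\<^sub>R b) - f (x + h *\<^sub>R c) - f (x + h *\<^sub>R b) + f x"
      unfolding A_def by (simp add: algebra_simps)
    have 2: "cmod (A - of_real (h * h) * ?M) \<le> e/2 * h * h" using h1 h unfolding A' by auto
    have "h * h * cmod (?M - ?L) = cmod (of_real (h * h) * (?M - ?L))"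
      by (simp only: norm_mult norm_of_real) simp
    also have "\<dots> = cmod ((A - of_real (h * h) * ?L) - (A - of_real (h * h) * ?M))"
      by (simp only: right_diff_distrib) simp
    also have "\<dots> \<le> e/2 * h * h + e/2 * h * h" by (rule norm_triangle_le_diff) (use 1 2 in simp)
    finally have "(h * h) * cmod (?M - ?L) \<le> (h * h) * e" by (simp add: algebra_simps)
    then show ?thesis using h by (simp add: mult_le_cancel_left)
  qed
  then show "?M = ?L"
    by (metis field_le_epsilon add.left_neutral norm_le_zero_iff right_minus_eq)
qed

lemma foldr_partial_smooth:
  "smooth f \<Longrightarrow> set bs \<subseteq> Basis \<Longrightarrow> smooth (foldr partial bs f)"
  by (induction bs) (auto intro: smooth_partial)

lemma partial_foldr_commute:
  "smooth f \<Longrightarrow> set bs \<subseteq> Basis \<Longrightarrow> c \<in> Basis \<Longrightarrow>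
    foldr partial bs (partial c f) = partial c (foldr partial bs f)"
  by (induction bs) (auto simp: foldr_partial_smooth partial_commute)

text \<open>Frees derivatives from the order fixed by \<open>basis_list\<close>: only multiplicities
  matter, which is what links words to multi-indices.\<close>

lemma foldr_partial_mset:
  assumes "smooth f" "set bs \<subseteq> Basis" "mset bs = mset cs"
  shows "foldr partial bs f = foldr partial cs f"
  using assms(2,3)
proof (induction bs arbitrary: cs)
  case (Cons b bs)
  have "b \<in> set cs" using Cons.prems(2) by (metis list.set_intros(1) set_mset_mset)
  then obtain us vs where cs: "cs = us @ b # vs" by (meson split_list)
  have sets: "set cs \<subseteq> Basis" using Cons.prems by (metis set_mset_mset)
  have "foldr partial bs f = foldr partial (us @ vs) f"
    by (rule Cons.IH) (use Cons.prems cs in auto)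
  moreover have "foldr partial cs f = partial b (foldr partial (us @ vs) f)"
    using sets cs assms(1) by (simp add: partial_foldr_commute foldr_partial_smooth)
  ultimately show ?case by simp
qed simp

section \<open>Words in multiplications and derivatives\<close>

text \<open>Coinduction up to finite sums: by the product rule the derivative of
  \<open>mulc b f\<close> leaves the invariant, but it is a sum of two members.\<close>

lemma smooth_sum_list_coinduct:
  assumes "f \<in> Q" "\<And>g x. g \<in> Q \<Longrightarrow> g differentiable (at x)"
    "\<And>g b. g \<in> Q \<Longrightarrow> b \<in> Basis \<Longrightarrow> \<exists>h\<in>Q. \<exists>k\<in>Q. partial b g = (\<lambda>x. h x + k x)"
  shows "smooth f"
proof (rule smooth_coinduct)
  let ?Q = "{\<lambda>x. \<Sum>g\<leftarrow>gs. g x | gs. set gs \<subseteq> Q}"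
  show "f \<in> ?Q" using assms(1) by (intro CollectI exI[of _ "[f]"]) auto
  have diff: "(\<lambda>x. \<Sum>g\<leftarrow>gs. g x) differentiable (at x)" if "set gs \<subseteq> Q" for gs x
    using that by (induction gs) (auto intro!: differentiable_add simp: assms(2))
  show "g differentiable (at x)" if "g \<in> ?Q" for g x
    using that diff by auto
  show "partial b g \<in> ?Q" if "g \<in> ?Q" and b: "b \<in> Basis" for g b
  proof -
    have "partial b (\<lambda>x. \<Sum>g\<leftarrow>gs. g x) \<in> ?Q" if "set gs \<subseteq> Q" for gs
      using that
    proof (induction gs)
      case Nil
      have "partial b (\<lambda>x. 0) = (\<lambda>x. 0)" by (simp add: partial_def)
      then show ?case by (auto intro: exI[of _ "[]"])
    next
      case (Cons g gs)
      then obtain gs' where gs': "set gs' \<subseteq> Q" "partial b (\<lambda>x. \<Sum>g\<leftarrow>gs. g x) = (\<lambda>x. \<Sum>g\<leftarrow>gs'. g x)" by auto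
      obtain h k where hk: "h \<in> Q" "k \<in> Q" "partial b g = (\<lambda>x. h x + k x)" using assms(3) b Cons.prems by (metis list.set_intros(1) subsetD)
      have "partial b (\<lambda>x. \<Sum>g\<leftarrow>g # gs. g x) = (\<lambda>x. partial b g x + partial b (\<lambda>x. \<Sum>g\<leftarrow>gs. g x) x)"
      proof
        fix x
        have "((\<lambda>x. g x + (\<Sum>g\<leftarrow>gs. g x)) has_derivative (\<lambda>v. partial v g x + partial v (\<lambda>x. \<Sum>g\<leftarrow>gs. g x) x)) (at x)"
          using Cons.prems by (intro has_derivative_add has_derivative_partial assms(2) diff) auto
        then show "partial b (\<lambda>x. \<Sum>g\<leftarrow>g # gs. g x) x = partial b g x + partial b (\<lambda>x. \<Sum>g\<leftarrow>gs. g x) x"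
          by (simp add: has_derivative_imp_partial)
      qed
      also have "\<dots> = (\<lambda>x. \<Sum>g\<leftarrow>h # k # gs'. g x)"
        by (simp add: gs' hk add.assoc)
      finally show ?case using hk gs' by (intro CollectI exI[of _ "h # k # gs'"]) auto
    qed
    then show ?thesis using that(1) by auto
  qed
qed

text \<open>In a word, \<open>(True, b)\<close> stands for \<open>X\<^sub>b\<close> and \<open>(False, b)\<close> for \<open>D\<^sub>b\<close>.\<close>

definition mulc :: "'a::euclidean_space \<Rightarrow> ('a \<Rightarrow> complex) \<Rightarrow> 'a \<Rightarrow> complex" where
  "mulc b f = (\<lambda>x. of_real (x \<bullet> b) * f x)"

fun letter :: "bool \<times> 'a::euclidean_space \<Rightarrow> ('a \<Rightarrow> complex) \<Rightarrow> 'a \<Rightarrow> complex" where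
  "letter (e, b) f = (if e then mulc b f else partial b f)"

abbreviation word :: "(bool \<times> 'a::euclidean_space) list \<Rightarrow> ('a \<Rightarrow> complex) \<Rightarrow> 'a \<Rightarrow> complex" where
  "word w f \<equiv> foldr letter w f"

section \<open>Linearity and smoothness of letters and words\<close>

lemma smooth_add:
  assumes "smooth f" "smooth g" shows "smooth (\<lambda>x. f x + g x)"
    and partial_add: "partial b (\<lambda>x. f x + g x) = (\<lambda>x. partial b f x + partial b g x)"
proof -
  have *: "partial b (\<lambda>x. f x + g x) = (\<lambda>x. partial b f x + partial b g x)" if "smooth f" "smooth g" for f g :: "'a \<Rightarrow> complex" and b
  proof
    fix x
    have "((\<lambda>x. f x + g x) has_derivative (\<lambda>v. partial v f x + partial v g x)) (at x)"
      using that by (intro has_derivative_add has_derivative_partial smooth_differentiable)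
    then show "partial b (\<lambda>x. f x + g x) x = partial b f x + partial b g x"
      by (rule has_derivative_imp_partial)
  qed
  show "partial b (\<lambda>x. f x + g x) = (\<lambda>x. partial b f x + partial b g x)" by (rule *[OF assms])
  show "smooth (\<lambda>x. f x + g x)"
  proof (rule smooth_coinduct[where Q = "{\<lambda>x. f x + g x | f g. smooth f \<and> smooth g}"])
    fix h :: "'a \<Rightarrow> complex" and b :: 'a assume "h \<in> {\<lambda>x. f x + g x | f g. smooth f \<and> smooth g}" "b \<in> Basis"
    then show "partial b h \<in> {\<lambda>x. f x + g x | f g. smooth f \<and> smooth g}"
      using * smooth_partial by fastforce
  qed (use assms in \<open>auto intro!: differentiable_add differentiable_mult simp: smooth_differentiable\<close>)
qed

lemma smooth_cmult:
  assumes "smooth f" shows "smooth (\<lambda>x. c * f x)"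
    and partial_cmult: "partial b (\<lambda>x. c * f x) = (\<lambda>x. c * partial b f x)"
proof -
  have *: "partial b (\<lambda>x. c * f x) = (\<lambda>x. c * partial b f x)" if "smooth f" for f :: "'a \<Rightarrow> complex" and b
  proof
    fix x
    have "((\<lambda>x. c * f x) has_derivative (\<lambda>v. c * partial v f x)) (at x)"
      using that by (intro has_derivative_mult_right has_derivative_partial smooth_differentiable)
    then show "partial b (\<lambda>x. c * f x) x = c * partial b f x"
      by (rule has_derivative_imp_partial)
  qed
  show "partial b (\<lambda>x. c * f x) = (\<lambda>x. c * partial b f x)" by (rule *[OF assms])
  show "smooth (\<lambda>x. c * f x)"
  proof (rule smooth_coinduct[where Q = "{\<lambda>x. c * f x | f. smooth f}"])
    fix h :: "'a \<Rightarrow> complex" and b :: 'a assume "h \<in> {\<lambda>x. c * f x | f. smooth f}" "b \<in> Basis"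
    then show "partial b h \<in> {\<lambda>x. c * f x | f. smooth f}"
      using * smooth_partial by fastforce
  qed (use assms in \<open>auto intro!: differentiable_mult simp: smooth_differentiable\<close>)
qed

lemma partial_mulc:
  assumes "smooth f"
  shows "partial c (mulc b f) = (\<lambda>x. of_real (c \<bullet> b) * f x + mulc b (partial c f) x)"
proof
  fix x
  have "((\<lambda>x. complex_of_real (x \<bullet> b) * f x) has_derivative
     (\<lambda>v. of_real (x \<bullet> b) * partial v f x + of_real (v \<bullet> b) * f x)) (at x)"
    using assms by (intro has_derivative_mult has_derivative_partial smooth_differentiable)
       (auto intro!: derivative_eq_intros)
  then show "partial c (mulc b f) x = of_real (c \<bullet> b) * f x + mulc b (partial c f) x"
    unfolding mulc_def by (simp add: has_derivative_imp_partial)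
qed

lemma differentiable_of_real_inner:
  "(\<lambda>x. complex_of_real (x \<bullet> b)) differentiable (at x)"
  unfolding differentiable_def by (rule exI) (auto intro!: derivative_eq_intros)

lemma smooth_mulc:
  assumes "smooth f" shows "smooth (mulc b f)"
proof (rule smooth_sum_list_coinduct[where Q = "mulc b ` {f. smooth f} \<union> {f. smooth f}"])
  fix g and c :: 'a assume g: "g \<in> mulc b ` {f. smooth f} \<union> {f. smooth f}" and c: "c \<in> Basis"
  show "\<exists>h\<in>mulc b ` {f. smooth f} \<union> {f. smooth f}.
            \<exists>k\<in>mulc b ` {f. smooth f} \<union> {f. smooth f}. partial c g = (\<lambda>x. h x + k x)"
  proof (cases "smooth g")
    case True
    \<comment> \<open>A zero second summand provides the two-summand form that the coinduction rule
      asks for.\<close>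
    have "partial c g = (\<lambda>x. partial c g x + 0 * g x)" by simp
    moreover have "smooth (partial c g)" "smooth (\<lambda>x. 0 * g x)"
      using True c by (intro smooth_partial smooth_cmult; simp)+
    ultimately show ?thesis
      by (intro bexI[of _ "partial c g"] bexI[of _ "\<lambda>x. 0 * g x"]) auto
  next
    case False
    then obtain f where f: "smooth f" "g = mulc b f" using g by auto
    then show ?thesis
      by (intro bexI[of _ "\<lambda>x. of_real (c \<bullet> b) * f x"] bexI[of _ "mulc b (partial c f)"])
         (auto simp: partial_mulc intro: smooth_partial c smooth_cmult)
  qed
next
  fix g x assume "g \<in> mulc b ` {f. smooth f} \<union> {f. smooth f}"
  then show "g differentiable (at x)"
    by (auto simp: mulc_def smooth_differentiable intro!: differentiable_mult differentiable_of_real_inner)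
qed (use assms in auto)

lemma smooth_letter: "smooth f \<Longrightarrow> snd l \<in> Basis \<Longrightarrow> smooth (letter l f)"
  by (cases l) (auto intro: smooth_mulc smooth_partial)

lemma smooth_word: "smooth f \<Longrightarrow> snd ` set w \<subseteq> Basis \<Longrightarrow> smooth (word w f)"
  by (induction w) (auto intro: smooth_letter)

lemma mulc_add: "mulc b (\<lambda>x. f x + g x) = (\<lambda>x. mulc b f x + mulc b g x)"
  by (simp add: mulc_def algebra_simps)
lemma mulc_cmult: "mulc b (\<lambda>x. c * f x) = (\<lambda>x. c * mulc b f x)"
  by (simp add: mulc_def algebra_simps)

lemma letter_add: "smooth f \<Longrightarrow> smooth g \<Longrightarrow> letter l (\<lambda>x. f x + g x) = (\<lambda>x. letter l f x + letter l g x)"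
  by (cases l) (auto simp: mulc_add partial_add)
lemma letter_cmult: "smooth f \<Longrightarrow> letter l (\<lambda>x. c * f x) = (\<lambda>x. c * letter l f x)"
  by (cases l) (auto simp: mulc_cmult partial_cmult)

lemma word_add: "smooth f \<Longrightarrow> smooth g \<Longrightarrow> snd ` set w \<subseteq> Basis \<Longrightarrow>
    word w (\<lambda>x. f x + g x) = (\<lambda>x. word w f x + word w g x)"
  by (induction w) (auto simp: letter_add smooth_word)
lemma word_cmult: "smooth f \<Longrightarrow> snd ` set w \<subseteq> Basis \<Longrightarrow>
    word w (\<lambda>x. c * f x) = (\<lambda>x. c * word w f x)"
  by (induction w) (auto simp: letter_cmult smooth_word)

text \<open>The letters fall into an \<open>s\<close>-class and a \<open>\<sigma>\<close>-class, according to the exponent of the factorial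
  that they contribute.  The predicate \<open>\<rho> b\<close> tells whether \<open>X\<^sub>b\<close> is in the \<open>s\<close>-class; \<open>D\<^sub>b\<close> is
  always in the opposite class.\<close>

definition sclass :: "('a \<Rightarrow> bool) \<Rightarrow> bool \<times> 'a \<Rightarrow> bool" where
  "sclass \<rho> l \<longleftrightarrow> (fst l = \<rho> (snd l))"

definition sdeg :: "('a \<Rightarrow> bool) \<Rightarrow> (bool \<times> 'a) list \<Rightarrow> nat" where
  "sdeg \<rho> w = length (filter (sclass \<rho>) w)"

definition tdeg :: "('a \<Rightarrow> bool) \<Rightarrow> (bool \<times> 'a) list \<Rightarrow> nat" where
  "tdeg \<rho> w = length (filter (\<lambda>l. \<not> sclass \<rho> l) w)"

lemma deg_simps [simp]:
  "sdeg \<rho> [] = 0" "tdeg \<rho> [] = 0"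
  "sdeg \<rho> (l # w) = (if sclass \<rho> l then Suc (sdeg \<rho> w) else sdeg \<rho> w)"
  "tdeg \<rho> (l # w) = (if sclass \<rho> l then tdeg \<rho> w else Suc (tdeg \<rho> w))"
  "sdeg \<rho> (v @ w) = sdeg \<rho> v + sdeg \<rho> w"
  "tdeg \<rho> (v @ w) = tdeg \<rho> v + tdeg \<rho> w"
  by (auto simp: sdeg_def tdeg_def)

lemma sdeg_add_tdeg: "sdeg \<rho> w + tdeg \<rho> w = length w"
  by (induction w) auto

text \<open>Words in arbitrary order, not only normally ordered ones: applying a letter then merely
  shifts the weight \<open>m\<close>, and no commutators appear when letters are moved through a
  transform. Only the number of letters of each class enters, and the bound is uniform in
  \<open>z\<close>.\<close>

definition wbound :: "('a::euclidean_space \<Rightarrow> bool) \<Rightarrow> (nat \<Rightarrow> nat \<Rightarrow> real) \<Rightarrow> ('a \<Rightarrow> complex) \<Rightarrow> bool" where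
  "wbound \<rho> m f \<longleftrightarrow> smooth f \<and>
     (\<forall>w z. snd ` set w \<subseteq> Basis \<longrightarrow> cmod (word w f z) \<le> m (sdeg \<rho> w) (tdeg \<rho> w))"

lemma wboundD:
  assumes "wbound \<rho> m f" 
  shows "smooth f" and "snd ` set w \<subseteq> Basis \<Longrightarrow> cmod (word w f z) \<le> m (sdeg \<rho> w) (tdeg \<rho> w)"
  using assms unfolding wbound_def by auto

lemma wbound_mono:
  "wbound \<rho> m f \<Longrightarrow> (\<And>i j. m i j \<le> m' i j) \<Longrightarrow> wbound \<rho> m' f"
  unfolding wbound_def by (meson order_trans)

lemma wbound_letter:
  assumes "wbound \<rho> m f" "snd l \<in> Basis"
  shows "wbound \<rho> (\<lambda>i j. if sclass \<rho> l then m (Suc i) j else m i (Suc j)) (letter l f)"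
  unfolding wbound_def
proof (intro conjI allI impI)
  show "smooth (letter l f)" using assms by (auto intro: smooth_letter dest: wboundD(1))
  fix w :: "(bool \<times> 'a) list" and z assume "snd ` set w \<subseteq> Basis"
  then show "cmod (word w (letter l f) z) \<le> (if sclass \<rho> l then m (Suc (sdeg \<rho> w)) (tdeg \<rho> w) else m (sdeg \<rho> w) (Suc (tdeg \<rho> w)))"
    using wboundD(2)[OF assms(1), of "w @ [l]" z] assms(2) by (auto split: if_splits)
qed

lemma wbound_cmult:
  assumes "wbound \<rho> m f" "cmod c \<le> 1"
  shows "wbound \<rho> m (\<lambda>x. c * f x)"
  unfolding wbound_def
proof (intro conjI allI impI)
  show "smooth (\<lambda>x. c * f x)" using assms by (auto intro: smooth_cmult dest: wboundD(1))
  fix w :: "(bool \<times> 'a) list" and z assume w: "snd ` set w \<subseteq> Basis"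
  have "cmod c * cmod (word w f z) \<le> 1 * cmod (word w f z)" using assms(2) by (intro mult_right_mono) auto
  then show "cmod (word w (\<lambda>x. c * f x) z) \<le> m (sdeg \<rho> w) (tdeg \<rho> w)"
    using wboundD(2)[OF assms(1) w, of z] w wboundD(1)[OF assms(1)] by (simp add: word_cmult norm_mult)
qed

section \<open>Normal ordering\<close>

text \<open>If normally ordered words with \<open>i\<close> letters of the \<open>s\<close>-class and \<open>j\<close> of the \<open>\<sigma>\<close>-class are bounded
  by \<open>m i j\<close>, then arbitrary words are bounded by \<open>reorder m i j\<close>.  The index \<open>k\<close> counts contractions
  \<open>D\<^sub>b X\<^sub>b = X\<^sub>b D\<^sub>b + 1\<close>; each removes one letter of either class, in at most
  \<open>(i choose k) (j choose k) k!\<close> ways.\<close>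

definition reorder :: "(nat \<Rightarrow> nat \<Rightarrow> real) \<Rightarrow> nat \<Rightarrow> nat \<Rightarrow> real" where
  "reorder m i j = (\<Sum>k\<le>i + j. real (i choose k) * real (j choose k) * fact k * m (i - k) (j - k))"

text \<open>The weight on the left is the one that \<open>nbound_letter\<close> produces for an
  innermost letter of the \<open>s\<close>-class, which may be contracted with up to
  \<open>j\<close> letters of the other class. The two sides agree by Pascal's rule, as the
  contracted terms shift the index \<open>k\<close> by one.\<close>

lemma reorder_Suc_left:
  "reorder (\<lambda>i j. m (Suc i) j + real j * m i (j - 1)) i j = reorder m (Suc i) j"
proof -
  let ?T = "\<lambda>k. real (j choose k) * fact k * m (Suc i - k) (j - k)"
  have A: "real (i choose k) * real (j choose k) * fact k * m (Suc (i - k)) (j - k) = real (i choose k) * ?T k" for k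
    by (cases "k \<le> i") (auto simp: Suc_diff_le)
  have B: "real (i choose k) * real (j choose k) * fact k * (real (j - k) * m (i - k) (j - k - 1))
      = real (i choose k) * ?T (Suc k)" for k
  proof (cases "k < j")
    case True
    \<comment> \<open>Trades the factor \<open>j - k\<close> for \<open>Suc k\<close>, which turns
      \<open>fact k\<close> into \<open>fact (Suc k)\<close>.\<close>
    have "Suc k * (j choose Suc k) = (j - k) * (j choose k)"
      by (simp only: binomial_absorption binomial_absorb_comp)
    then have "real (j choose k) * real (j - k) = real (Suc k) * real (j choose Suc k)"
      by (metis mult.commute of_nat_mult)
    then have "real (i choose k) * fact k * m (i - k) (j - k - 1) * (real (j choose k) * real (j - k)) =
      real (i choose k) * fact k * m (i - k) (j - k - 1) * (real (Suc k) * real (j choose Suc k))" by simp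
    then show ?thesis by (simp add: algebra_simps del: of_nat_Suc)
  qed auto
  have "reorder (\<lambda>i j. m (Suc i) j + real j * m i (j - 1)) i j
    = (\<Sum>k\<le>i + j. real (i choose k) * ?T k) + (\<Sum>k\<le>i + j. real (i choose k) * ?T (Suc k))"
    unfolding reorder_def distrib_left sum.distrib A B ..
  also have "(\<Sum>k\<le>i + j. real (i choose k) * ?T k) = ?T 0 + (\<Sum>k\<le>i + j. real (i choose Suc k) * ?T (Suc k))"
  proof -
    \<comment> \<open>The added summand vanishes because \<open>i < Suc (i + j)\<close>.\<close>
    have "(\<Sum>k\<le>i + j. real (i choose k) * ?T k) = (\<Sum>k\<le>Suc (i + j). real (i choose k) * ?T k)"
      by simp
    then show ?thesis by (simp only: sum.atMost_Suc_shift) simp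
  qed
  also have "?T 0 + (\<Sum>k\<le>i + j. real (i choose Suc k) * ?T (Suc k)) + (\<Sum>k\<le>i + j. real (i choose k) * ?T (Suc k))
    = ?T 0 + (\<Sum>k\<le>i + j. real (Suc i choose Suc k) * ?T (Suc k))"
    by (simp add: sum.distrib[symmetric] distrib_right[symmetric] add.commute)
  also have "\<dots> = (\<Sum>k\<le>Suc (i + j). real (Suc i choose k) * ?T k)"
    by (simp only: sum.atMost_Suc_shift) simp
  also have "\<dots> = reorder m (Suc i) j"
    unfolding reorder_def by (simp add: mult.assoc)
  finally show ?thesis .
qed

lemma reorder_swap: "reorder m i j = reorder (\<lambda>j i. m i j) j i"
  unfolding reorder_def by (intro sum.cong) (auto simp: add.commute mult_ac)

lemma reorder_Suc_right:
  "reorder (\<lambda>i j. m i (Suc j) + real i * m (i - 1) j) i j = reorder m i (Suc j)"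
proof -
  have "reorder (\<lambda>i j. m i (Suc j) + real i * m (i - 1) j) i j
    = reorder (\<lambda>j i. m i (Suc j) + real i * m (i - 1) j) j i" by (rule reorder_swap)
  also have "\<dots> = reorder (\<lambda>j i. m i j) (Suc j) i" by (rule reorder_Suc_left)
  also have "\<dots> = reorder m i (Suc j)" by (rule reorder_swap[symmetric])
  finally show ?thesis .
qed

lemma reorder_self_le:
  assumes m: "\<And>i j. 0 \<le> m i j" shows "m i j \<le> reorder m i j"
proof -
  have "m i j = (\<Sum>k\<in>{0}. real (i choose k) * real (j choose k) * fact k * m (i - k) (j - k))" by simp
  also have "\<dots> \<le> reorder m i j" unfolding reorder_def
    by (rule sum_mono2) (auto simp: m)
  finally show ?thesis .
qed

lemma foldr_mulc: "foldr mulc bs g z = of_real (\<Prod>b\<leftarrow>bs. z \<bullet> b) * g z"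
  by (induction bs) (auto simp: mulc_def)

text \<open>Product rule: every derivative along \<open>b\<close> can hit the linear factor once,
  and since derivatives commute all these terms coincide.\<close>

lemma foldr_partial_mulc:
  assumes "smooth f" "b \<in> Basis" "set cs \<subseteq> Basis"
  shows "foldr partial cs (mulc b f) =
    (\<lambda>z. mulc b (foldr partial cs f) z + of_nat (count_list cs b) * foldr partial (remove1 b cs) f z)"
  using assms(3)
proof (induction cs)
  case (Cons c cs)
  let ?F = "foldr partial cs f" and ?G = "foldr partial (remove1 b cs) f"
  have sF: "smooth ?F" using Cons.prems assms by (intro foldr_partial_smooth) auto
  have sG: "smooth ?G" using Cons.prems assms set_remove1_subset[of b cs] by (intro foldr_partial_smooth) auto
  have c: "c \<in> Basis" "set cs \<subseteq> Basis" using Cons.prems by auto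
  have inn: "c \<bullet> b = (if c = b then 1 else 0)" using assms(2) c by (simp add: inner_Basis)
  have "foldr partial (c # cs) (mulc b f) = partial c (\<lambda>z. mulc b ?F z + of_nat (count_list cs b) * ?G z)"
    using Cons by simp
  also have "\<dots> = (\<lambda>z. (of_real (c \<bullet> b) * ?F z + mulc b (partial c ?F) z) + of_nat (count_list cs b) * partial c ?G z)"
    by (simp add: partial_add smooth_mulc smooth_cmult sF sG partial_mulc partial_cmult)
  also have "\<dots> = (\<lambda>z. mulc b (foldr partial (c # cs) f) z + of_nat (count_list (c # cs) b) * foldr partial (remove1 b (c # cs)) f z)"
  proof (cases "c = b")
    case True
    have "of_nat (count_list cs b) * partial b ?G z = of_nat (count_list cs b) * ?F z" for z
    proof (cases "b \<in> set cs")
      case b: True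
      have "foldr partial (b # remove1 b cs) f = ?F"
        using b c assms by (intro foldr_partial_mset) (use set_remove1_subset[of b cs] in auto)
      then show ?thesis by simp
    qed (simp add: count_notin)
    then show ?thesis using True inn by (simp add: algebra_simps fun_eq_iff)
  next
    case False
    then show ?thesis using inn by simp
  qed
  finally show ?case .
qed (simp add: fun_eq_iff)

lemma deg_map_mulc_partial:
  "sdeg \<rho> (map (Pair e) bs) = length (filter (\<lambda>b. e = \<rho> b) bs)"
  "tdeg \<rho> (map (Pair e) bs) = length (filter (\<lambda>b. e \<noteq> \<rho> b) bs)"
  by (induction bs) (auto simp: sclass_def)

lemma word_map_mulc_partial:
  "word (map (Pair True) bs @ map (Pair False) cs) f = foldr mulc bs (foldr partial cs f)"
proof -
  have "word (map (Pair False) cs) f = foldr partial cs f" for cs by (induction cs) auto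
  moreover have "word (map (Pair True) bs) g = foldr mulc bs g" for g by (induction bs) auto
  ultimately show ?thesis by simp
qed

text \<open>Derivatives act first, multiplications afterwards: these are the expressions that the
  seminorms of the function spaces control directly.\<close>

definition nbound :: "('a::euclidean_space \<Rightarrow> bool) \<Rightarrow> (nat \<Rightarrow> nat \<Rightarrow> real) \<Rightarrow> ('a \<Rightarrow> complex) \<Rightarrow> bool" where
  "nbound \<rho> m f \<longleftrightarrow> smooth f \<and>
     (\<forall>bs cs z. set bs \<subseteq> Basis \<longrightarrow> set cs \<subseteq> Basis \<longrightarrow>
        cmod (foldr mulc bs (foldr partial cs f) z) \<le>
        m (sdeg \<rho> (map (Pair True) bs @ map (Pair False) cs)) (tdeg \<rho> (map (Pair True) bs @ map (Pair False) cs)))"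

text \<open>A derivative joins the inner block and respects the order. A multiplication has to cross
  the derivatives; every contraction removes it together with one derivative in its direction, a
  letter of the opposite class.\<close>

lemma nbound_letter:
  assumes "nbound \<rho> m f" "\<And>i j. 0 \<le> m i j" "snd l \<in> Basis"
  shows "nbound \<rho> (if sclass \<rho> l then (\<lambda>i j. m (Suc i) j + real j * m i (j - 1))
           else (\<lambda>i j. m i (Suc j) + real i * m (i - 1) j)) (letter l f)"
  unfolding nbound_def
proof (intro conjI allI impI)
  note sf = assms(1)[unfolded nbound_def, THEN conjunct1]
  note bd = assms(1)[unfolded nbound_def, THEN conjunct2, rule_format]
  show "smooth (letter l f)" using assms(3) sf by (intro smooth_letter)
  fix bs cs :: "'a list" and z assume bs: "set bs \<subseteq> Basis" and cs: "set cs \<subseteq> Basis"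
  obtain e b where l: "l = (e, b)" by (cases l)
  have b: "b \<in> Basis" using assms(3) l by simp
  let ?w = "map (Pair True) bs @ map (Pair False) cs"
  let ?i = "sdeg \<rho> ?w" and ?j = "tdeg \<rho> ?w"
  let ?m = "if sclass \<rho> l then (\<lambda>i j. m (Suc i) j + real j * m i (j - 1))
           else (\<lambda>i j. m i (Suc j) + real i * m (i - 1) j)"
  show "cmod (foldr mulc bs (foldr partial cs (letter l f)) z) \<le> ?m ?i ?j"
  proof (cases e)
    case False
    have "cmod (foldr mulc bs (foldr partial (cs @ [b]) f) z) \<le>
      m (sdeg \<rho> (map (Pair True) bs @ map (Pair False) (cs @ [b]))) (tdeg \<rho> (map (Pair True) bs @ map (Pair False) (cs @ [b])))"
      by (rule bd) (use bs cs b in auto)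
    also have "\<dots> \<le> ?m ?i ?j"
      using False l by (auto simp: assms(2))
    finally show ?thesis using False l by simp
  next
    case True
    let ?cs = "remove1 b cs" and ?n = "count_list cs b"
    let ?w' = "map (Pair True) bs @ map (Pair False) ?cs"
    have 1: "cmod (foldr mulc (b # bs) (foldr partial cs f) z) \<le> m (sdeg \<rho> (map (Pair True) (b # bs) @ map (Pair False) cs)) (tdeg \<rho> (map (Pair True) (b # bs) @ map (Pair False) cs))"
      by (rule bd) (use bs cs b in auto)
    have 2: "cmod (foldr mulc bs (foldr partial ?cs f) z) \<le> m (sdeg \<rho> ?w') (tdeg \<rho> ?w')"
      by (rule bd) (use bs cs set_remove1_subset[of b cs] in auto)
    have "foldr mulc bs (foldr partial cs (letter l f)) z =
       foldr mulc (b # bs) (foldr partial cs f) z + of_nat ?n * foldr mulc bs (foldr partial ?cs f) z"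
          proof -
      have "letter l f = mulc b f" using True l by simp
      then show ?thesis
        by (simp add: foldr_partial_mulc[OF sf b cs] foldr_mulc) (simp add: mulc_def foldr_mulc algebra_simps)
    qed
    then have "cmod (foldr mulc bs (foldr partial cs (letter l f)) z) \<le>
       cmod (foldr mulc (b # bs) (foldr partial cs f) z) + real ?n * cmod (foldr mulc bs (foldr partial ?cs f) z)"
      by (metis norm_triangle_ineq norm_mult norm_of_nat)
    also have "\<dots> \<le> m (sdeg \<rho> (map (Pair True) (b # bs) @ map (Pair False) cs)) (tdeg \<rho> (map (Pair True) (b # bs) @ map (Pair False) cs))
       + real ?n * m (sdeg \<rho> ?w') (tdeg \<rho> ?w')"
      by (intro add_mono 1 mult_left_mono 2) auto
    also have "\<dots> \<le> ?m ?i ?j"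
    proof (cases "b \<in> set cs")
      case bc: False
      then show ?thesis using True l by (auto simp: count_notin assms(2))
    next
      case bc: True
      obtain us vs where uv: "cs = us @ b # vs" "b \<notin> set us" using bc by (meson split_list_first)
      have rc: "remove1 b (us @ b # vs) = us @ vs" using uv by (simp add: remove1_append)
      \<comment> \<open>Derivatives along \<open>b\<close> are in the class opposite to that of
        multiplication by the coordinate \<open>b\<close>, so their number is at most the degree in
        that class.\<close>
      have n: "?n = length (filter ((=) b) cs)"
        unfolding count_list_eq_length_filter by simp
      have len: "length (filter ((=) b) cs) \<le> length (filter P cs)" if "P b" for P
        using that by (induction cs) auto
      show ?thesis
      proof (cases "\<rho> b")
        case r: True
        have "?n \<le> ?j" using len[of "\<lambda>b. False \<noteq> \<rho> b"] r n by (simp add: deg_map_mulc_partial)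
        moreover have "sdeg \<rho> ?w' = ?i" "tdeg \<rho> ?w' = ?j - 1"
          using r unfolding uv(1) rc by (simp_all add: deg_map_mulc_partial sclass_def)
        ultimately show ?thesis using True l r by (simp add: sclass_def mult_right_mono assms(2))
      next
        case r: False
        have "?n \<le> ?i" using len[of "\<lambda>b. False = \<rho> b"] r n by (simp add: deg_map_mulc_partial)
        moreover have "tdeg \<rho> ?w' = ?j" "sdeg \<rho> ?w' = ?i - 1"
          using r unfolding uv(1) rc by (simp_all add: deg_map_mulc_partial sclass_def)
        ultimately show ?thesis using True l r by (simp add: sclass_def mult_right_mono assms(2))
      qed
    qed
    finally show ?thesis .
  qed
qed

text \<open>Letters are peeled off the inner end with \<open>f\<close> and \<open>m\<close>
  generalised: the function becomes \<open>letter l f\<close>, the weight that of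
  \<open>nbound_letter\<close>, and the recurrences of \<open>reorder\<close> reabsorb the change of
  weight.\<close>

lemma nbound_imp_wbound:
  assumes "nbound \<rho> m f" "\<And>i j. 0 \<le> m i j"
  shows "wbound \<rho> (reorder m) f"
proof -
  have "cmod (word w f z) \<le> reorder m (sdeg \<rho> w) (tdeg \<rho> w)" if "snd ` set w \<subseteq> Basis" for w z
    using that assms
  proof (induction w arbitrary: m f rule: rev_induct)
    case Nil
    have "cmod (f z) \<le> m 0 0"
      using Nil(2)[unfolded nbound_def, THEN conjunct2, rule_format, of "[]" "[]"] by simp
    then show ?case using reorder_self_le[of m 0 0] Nil(3) by (auto intro: order_trans)
  next
    case (snoc l w)
    let ?m = "if sclass \<rho> l then (\<lambda>i j. m (Suc i) j + real j * m i (j - 1))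
           else (\<lambda>i j. m i (Suc j) + real i * m (i - 1) j)"
    have "cmod (word w (letter l f) z) \<le> reorder ?m (sdeg \<rho> w) (tdeg \<rho> w)"
    proof (rule snoc.IH)
      show "nbound \<rho> ?m (letter l f)" by (rule nbound_letter) (use snoc.prems in auto)
    qed (use snoc.prems in auto)
    also have "\<dots> = reorder m (sdeg \<rho> (w @ [l])) (tdeg \<rho> (w @ [l]))"
      using reorder_Suc_left[of m "sdeg \<rho> w" "tdeg \<rho> w"] reorder_Suc_right[of m "sdeg \<rho> w" "tdeg \<rho> w"] by simp
    finally show ?case by simp
  qed
  then show ?thesis using assms(1) unfolding wbound_def nbound_def by blast
qed

section \<open>Gelfand--Shilov norms and words\<close>

lemma basis_list: "distinct (basis_list :: 'a::euclidean_space list)" "set (basis_list :: 'a list) = Basis"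
proof -
  obtain bs :: "'a list" where "set bs = Basis" "distinct bs"
    using finite_distinct_list[OF finite_Basis] by blast
  then have "\<exists>bs::'a list. distinct bs \<and> set bs = Basis" by blast
  from someI_ex[OF this] have "distinct (basis_list :: 'a list) \<and> set (basis_list :: 'a list) = Basis"
    unfolding basis_list_def .
  then show "distinct (basis_list :: 'a list)" "set (basis_list :: 'a list) = Basis" by blast+
qed

lemma length_basis_list: "length (basis_list :: 'a::euclidean_space list) = DIM('a)"
  using distinct_card[OF basis_list(1)[where 'a = 'a]] by (simp add: basis_list(2))

text \<open>A multi-index unfolded in the order of \<open>basis_list\<close>, so that
  \<open>mderiv\<close> and \<open>mpower\<close> can be read as words.\<close>

definition mlist :: "('a::euclidean_space \<Rightarrow> nat) \<Rightarrow> 'a list" where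
  "mlist \<alpha> = concat (map (\<lambda>b. replicate (\<alpha> b) b) basis_list)"

lemma set_mlist: "set (mlist \<alpha>) \<subseteq> Basis"
  unfolding mlist_def by (auto simp: basis_list(2))

lemma mderiv_eq: "mderiv \<beta> f = foldr partial (mlist \<beta>) f"
proof -
  have "foldr partial (concat (map (\<lambda>b. replicate (\<beta> b) b) bs)) f = foldr (\<lambda>b g. (partial b ^^ \<beta> b) g) bs f" for bs
    by (induction bs) (simp_all add: foldr_replicate)
  then show ?thesis unfolding mderiv_def mlist_def by (rule sym)
qed

lemma prod_list_mlist:
  fixes g :: "'a::euclidean_space \<Rightarrow> 'b::comm_monoid_mult"
  shows "(\<Prod>b\<leftarrow>mlist \<alpha>. g b) = (\<Prod>b\<in>Basis. g b ^ \<alpha> b)"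
proof -
  have r: "(\<Prod>b\<leftarrow>replicate n c. g b) = g c ^ n" for n c by (induction n) auto
  have "(\<Prod>b\<leftarrow>concat (map (\<lambda>b. replicate (\<alpha> b) b) bs). g b) = (\<Prod>b\<in>set bs. g b ^ \<alpha> b)" if "distinct bs" for bs
    using that by (induction bs) (auto simp: r)
  then show ?thesis unfolding mlist_def using basis_list by metis
qed

lemma length_filter_mlist: "length (filter P (mlist \<alpha>)) = (\<Sum>b\<in>Basis. if P b then \<alpha> b else 0)"
proof -
  have "length (filter P (concat (map (\<lambda>b. replicate (\<alpha> b) b) bs))) = (\<Sum>b\<in>set bs. if P b then \<alpha> b else 0)" if "distinct bs" for bs
    using that by (induction bs) (auto simp: filter_replicate)
  then show ?thesis unfolding mlist_def using basis_list by metis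
qed

lemma count_list_mlist: "b \<in> Basis \<Longrightarrow> count_list (mlist \<alpha>) b = \<alpha> b"
  using length_filter_mlist[of "(=) b" \<alpha>] by (simp add: count_list_eq_length_filter)

lemma mset_mlist_count_list:
  assumes "set bs \<subseteq> Basis" shows "mset (mlist (count_list bs)) = mset bs"
proof (rule multiset_eqI)
  fix b
  show "count (mset (mlist (count_list bs))) b = count (mset bs) b"
  proof (cases "b \<in> Basis")
    case True then show ?thesis by (simp add: count_mset count_list_mlist)
  next
    case False
    then have "b \<notin> set bs" "b \<notin> set (mlist (count_list bs))" using assms set_mlist by blast+
    then show ?thesis by (simp add: count_mset count_notin)
  qed
qed

lemma cmod_mlist:
  "cmod (foldr mulc (mlist \<alpha>) (foldr partial (mlist \<beta>) f) z) = \<bar>mpower z \<alpha>\<bar> * cmod (mderiv \<beta> f z)"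
  by (simp add: foldr_mulc prod_list_mlist mpower_def mderiv_eq norm_mult prod_norm[symmetric] abs_prod norm_power power_abs)

lemma cmod_count_list:
  assumes "smooth f" "set bs \<subseteq> Basis" "set cs \<subseteq> Basis"
  shows "cmod (foldr mulc bs (foldr partial cs f) z) = \<bar>mpower z (count_list bs)\<bar> * cmod (mderiv (count_list cs) f z)"
proof -
  have "foldr partial cs f = foldr partial (mlist (count_list cs)) f"
    by (rule foldr_partial_mset) (use assms in \<open>auto simp: mset_mlist_count_list\<close>)
  moreover have "(\<Prod>b\<leftarrow>bs. z \<bullet> b) = (\<Prod>b\<leftarrow>mlist (count_list bs). z \<bullet> b)"
    using mset_mlist_count_list[OF assms(2)] by (metis mset_map prod_mset_prod_list)
  ultimately show ?thesis
    by (simp add: cmod_mlist[symmetric] foldr_mulc)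
qed

lemma deg_mlist:
  "sdeg \<rho> (map (Pair True) (mlist \<alpha>) @ map (Pair False) (mlist \<beta>)) = (\<Sum>b\<in>Basis. if \<rho> b then \<alpha> b else \<beta> b)"
  "tdeg \<rho> (map (Pair True) (mlist \<alpha>) @ map (Pair False) (mlist \<beta>)) = (\<Sum>b\<in>Basis. if \<rho> b then \<beta> b else \<alpha> b)"
  by (auto simp: deg_map_mulc_partial length_filter_mlist sum.distrib[symmetric] intro!: sum.cong)

lemma deg_count_list:
  assumes "set bs \<subseteq> Basis" "set cs \<subseteq> Basis"
  shows "sdeg \<rho> (map (Pair True) bs @ map (Pair False) cs) = (\<Sum>b\<in>Basis. if \<rho> b then count_list bs b else count_list cs b)"
  "tdeg \<rho> (map (Pair True) bs @ map (Pair False) cs) = (\<Sum>b\<in>Basis. if \<rho> b then count_list cs b else count_list bs b)"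
proof -
  have *: "length (filter P bs) = length (filter P (mlist (count_list bs)))" if "set bs \<subseteq> Basis" for P and bs :: "'a list"
    using mset_mlist_count_list[OF that] by (metis mset_filter size_mset)
  show "sdeg \<rho> (map (Pair True) bs @ map (Pair False) cs) = (\<Sum>b\<in>Basis. if \<rho> b then count_list bs b else count_list cs b)"
    unfolding deg_mlist(1)[symmetric] by (simp add: deg_map_mulc_partial *[OF assms(1)] *[OF assms(2)])
  show "tdeg \<rho> (map (Pair True) bs @ map (Pair False) cs) = (\<Sum>b\<in>Basis. if \<rho> b then count_list cs b else count_list bs b)"
    unfolding deg_mlist(2)[symmetric] by (simp add: deg_map_mulc_partial *[OF assms(1)] *[OF assms(2)])
qed

section \<open>Factorials of sums against products of factorials\<close>

lemma fact_add_le: "(fact (m + n) :: real) \<le> 2 ^ (m + n) * (fact m * fact n)"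
proof -
  have "real (m + n choose m) \<le> 2 ^ (m + n)"
    using binomial_le_pow2[of "m + n" m] by (metis of_nat_le_iff of_nat_numeral of_nat_power)
  then have "real (m + n choose m) * (fact m * fact n) \<le> 2 ^ (m + n) * (fact m * fact n)" by (intro mult_right_mono) auto
  moreover have "fact m * fact n * real (m + n choose m) = fact (m + n)"
    using binomial_fact_lemma[of m "m + n"] by (metis add_diff_cancel_left' le_add1 of_nat_fact of_nat_mult)
  ultimately show ?thesis by (simp add: mult.commute)
qed

lemma fact_mult_le: "(fact m * fact n :: real) \<le> fact (m + n)"
proof -
  have "fact m * fact n \<le> (fact (m + n) :: nat)"
    by (intro dvd_imp_le) (auto simp: fact_fact_dvd_fact)
  then show ?thesis by (metis of_nat_fact of_nat_le_iff of_nat_mult)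
qed

lemma prod_fact_le: "finite A \<Longrightarrow> (\<Prod>a\<in>A. fact (n a) :: real) \<le> fact (\<Sum>a\<in>A. n a)"
proof (induction A rule: finite_induct)
  case (insert a A)
  have "fact (n a) * (\<Prod>a\<in>A. fact (n a) :: real) \<le> fact (n a) * fact (\<Sum>a\<in>A. n a)"
    by (intro mult_left_mono insert.IH) auto
  also have "\<dots> \<le> fact (n a + (\<Sum>a\<in>A. n a))" by (rule fact_mult_le)
  finally show ?case using insert by simp
qed simp

lemma fact_sum_le: "finite A \<Longrightarrow> fact (\<Sum>a\<in>A. n a) \<le> (2 ^ card A) ^ (\<Sum>a\<in>A. n a) * (\<Prod>a\<in>A. fact (n a) :: real)"
proof (induction A rule: finite_induct)
  case (insert a A)
  let ?N = "\<Sum>a\<in>A. n a" and ?P = "\<Prod>a\<in>A. fact (n a) :: real"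
  have "(fact (n a + ?N) :: real) \<le> 2 ^ (n a + ?N) * (fact (n a) * fact ?N)" by (rule fact_add_le)
  also have "\<dots> \<le> 2 ^ (n a + ?N) * (fact (n a) * ((2 ^ card A) ^ ?N * ?P))"
    by (intro mult_left_mono insert.IH) auto
  also have "\<dots> \<le> 2 ^ (n a + ?N) * (fact (n a) * ((2 ^ card A) ^ (n a + ?N) * ?P))"
    by (intro mult_left_mono mult_right_mono power_increasing prod_nonneg) auto
  also have "\<dots> = (2 * 2 ^ card A) ^ (n a + ?N) * (fact (n a) * ?P)" by (simp add: power_mult_distrib)
  finally show ?case using insert by simp
qed simp

text \<open>The denominators of a Gelfand-Shilov step, with factorials of the total degree in each
  class instead of factorials for each coordinate. The two forms differ by a geometric factor, so
  only \<open>h\<close> is affected.\<close>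

definition gsw :: "real \<Rightarrow> real \<Rightarrow> real \<Rightarrow> nat \<Rightarrow> nat \<Rightarrow> real" where
  "gsw s \<sigma> h i j = h ^ (i + j) * fact i powr s * fact j powr \<sigma>"

lemma gsw_nonneg [simp]: "0 \<le> h \<Longrightarrow> 0 \<le> gsw s \<sigma> h i j"
  by (simp add: gsw_def)

text \<open>With decay exponents \<open>pexp \<rho> s \<sigma>\<close> and derivative exponents
  \<open>pexp \<rho> \<sigma> s\<close> a single predicate describes the isotropic spaces as well as
  those on phase space (\<open>pexp_iso\<close>, \<open>pexp_phase\<close>).\<close>

definition pexp :: "('a \<Rightarrow> bool) \<Rightarrow> real \<Rightarrow> real \<Rightarrow> 'a \<Rightarrow> real" where
  "pexp \<rho> u v b = (if \<rho> b then u else v)"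

lemma mfact_powr_mult:
  fixes \<alpha> \<beta> :: "'a::euclidean_space \<Rightarrow> nat"
  shows "mfact_powr (pexp \<rho> s \<sigma>) \<alpha> * mfact_powr (pexp \<rho> \<sigma> s) \<beta> =
   (\<Prod>b\<in>Basis. fact (if \<rho> b then \<alpha> b else \<beta> b)) powr s * (\<Prod>b\<in>Basis. fact (if \<rho> b then \<beta> b else \<alpha> b)) powr \<sigma>"
proof -
  have "(\<Prod>b\<in>Basis. fact (if \<rho> b then \<alpha> b else \<beta> b)) powr s = (\<Prod>b\<in>(Basis::'a set). fact (if \<rho> b then \<alpha> b else \<beta> b) powr s)"
    "(\<Prod>b\<in>Basis. fact (if \<rho> b then \<beta> b else \<alpha> b)) powr \<sigma> = (\<Prod>b\<in>(Basis::'a set). fact (if \<rho> b then \<beta> b else \<alpha> b) powr \<sigma>)"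
    by (simp_all add: prod_powr_distrib)
  then show ?thesis unfolding mfact_powr_def by (simp only: prod.distrib[symmetric]) (auto simp: pexp_def intro!: prod.cong)
qed

lemma mlen_add: "mlen \<alpha> + mlen \<beta> = (\<Sum>b\<in>Basis. if \<rho> b then \<alpha> b else \<beta> b) + (\<Sum>b\<in>Basis. if \<rho> b then \<beta> b else \<alpha> b)"
  unfolding mlen_def sum.distrib[symmetric] by (rule sum.cong) auto

lemma gs_denom_pos: "0 < h \<Longrightarrow> 0 < h ^ n * mfact_powr p \<alpha> * mfact_powr q \<beta>"
  by (auto simp: mfact_powr_def intro!: mult_pos_pos prod_pos)

lemma gs_step_bound:
  assumes "f \<in> gs_step p q h" "0 < h"
  shows "\<bar>mpower x \<alpha>\<bar> * cmod (mderiv \<beta> f x) \<le> gs_norm p q h f * (h ^ (mlen \<alpha> + mlen \<beta>) * mfact_powr p \<alpha> * mfact_powr q \<beta>)"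
proof -
  have "gs_quotient p q h f (\<alpha>, \<beta>, x) \<le> gs_norm p q h f"
    unfolding gs_norm_def using assms(1) by (intro cSUP_upper) (auto simp: gs_step_def)
  then show ?thesis using gs_denom_pos[OF assms(2), of "mlen \<alpha> + mlen \<beta>" p \<alpha> q \<beta>]
    by (simp add: gs_quotient_def pos_divide_le_eq)
qed

lemma gs_norm_nonneg:
  assumes "f \<in> gs_step p q h" "0 < h" shows "0 \<le> gs_norm p q h f"
proof -
  have "0 \<le> gs_quotient p q h f (\<lambda>_. 0, \<lambda>_. 0, 0)"
    using gs_denom_pos[OF assms(2), of _ p _ q] less_imp_le[OF gs_denom_pos[OF assms(2), of _ p _ q]] by (auto simp: gs_quotient_def)
  also have "\<dots> \<le> gs_norm p q h f"
    unfolding gs_norm_def using assms(1) by (intro cSUP_upper) (auto simp: gs_step_def)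
  finally show ?thesis .
qed

lemma gs_stepI:
  assumes "smooth f" "0 < h"
    "\<And>x \<alpha> \<beta>. \<bar>mpower x \<alpha>\<bar> * cmod (mderiv \<beta> f x) \<le> B * (h ^ (mlen \<alpha> + mlen \<beta>) * mfact_powr p \<alpha> * mfact_powr q \<beta>)"
  shows "f \<in> gs_step p q h" "gs_norm p q h f \<le> B"
proof -
  have q: "gs_quotient p q h f y \<le> B" for y
    using assms(3) by (cases y) (simp add: gs_quotient_def pos_divide_le_eq[OF gs_denom_pos[OF assms(2)]])
  then show "f \<in> gs_step p q h" using assms(1) by (auto simp: gs_step_def intro!: bdd_aboveI)
  show "gs_norm p q h f \<le> B" unfolding gs_norm_def using q by (intro cSUP_least) auto
qed

text \<open>A product of factorials is at most the factorial of the sum, so this direction loses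
  nothing in \<open>h\<close>.\<close>

lemma gs_step_imp_nbound:
  fixes f :: "'a::euclidean_space \<Rightarrow> complex"
  assumes f: "f \<in> gs_step (pexp \<rho> s \<sigma>) (pexp \<rho> \<sigma> s) h" and h: "0 < h" and "0 \<le> s" "0 \<le> \<sigma>"
  shows "nbound \<rho> (\<lambda>i j. gs_norm (pexp \<rho> s \<sigma>) (pexp \<rho> \<sigma> s) h f * gsw s \<sigma> h i j) f"
  unfolding nbound_def
proof (intro conjI allI impI)
  show sf: "smooth f" using f by (simp add: gs_step_def)
  fix bs cs :: "'a list" and z assume bs: "set bs \<subseteq> Basis" and cs: "set cs \<subseteq> Basis"
  let ?\<alpha> = "count_list bs" and ?\<beta> = "count_list cs"
  let ?i = "\<Sum>b\<in>Basis. if \<rho> b then ?\<alpha> b else ?\<beta> b" and ?j = "\<Sum>b\<in>Basis. if \<rho> b then ?\<beta> b else ?\<alpha> b"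
  let ?N = "gs_norm (pexp \<rho> s \<sigma>) (pexp \<rho> \<sigma> s) h f"
  have "cmod (foldr mulc bs (foldr partial cs f) z) \<le> ?N * (h ^ (mlen ?\<alpha> + mlen ?\<beta>) * mfact_powr (pexp \<rho> s \<sigma>) ?\<alpha> * mfact_powr (pexp \<rho> \<sigma> s) ?\<beta>)"
    unfolding cmod_count_list[OF sf bs cs] by (rule gs_step_bound[OF f h])
  also have "\<dots> \<le> ?N * (h ^ (?i + ?j) * (fact ?i powr s * fact ?j powr \<sigma>))"
    unfolding mult.assoc mfact_powr_mult mlen_add[of ?\<alpha> ?\<beta> \<rho>]
    by (intro mult_left_mono mult_mono powr_mono2 prod_fact_le gs_norm_nonneg[OF f h] prod_nonneg) (use assms in auto)
  also have "\<dots> = ?N * gsw s \<sigma> h (sdeg \<rho> (map (Pair True) bs @ map (Pair False) cs)) (tdeg \<rho> (map (Pair True) bs @ map (Pair False) cs))"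
    unfolding gsw_def deg_count_list[OF bs cs] by simp
  finally show "cmod (foldr mulc bs (foldr partial cs f) z) \<le> \<dots>" .
qed

text \<open>Going back from factorials of sums to products costs a factor \<open>2 ^ DIM('a)\<close>
  per letter by \<open>fact_sum_le\<close>; raised to the exponents this becomes \<kappa>.\<close>

lemma wbound_imp_gs_step:
  fixes f :: "'a::euclidean_space \<Rightarrow> complex"
  assumes f: "wbound \<rho> (\<lambda>i j. B * gsw s \<sigma> h i j) f" and h: "0 < h" and "0 \<le> s" "0 \<le> \<sigma>" and B: "0 \<le> B"
    and \<kappa>: "\<kappa> = (2 ^ DIM('a)) powr (s + \<sigma>)"
  shows "f \<in> gs_step (pexp \<rho> s \<sigma>) (pexp \<rho> \<sigma> s) (\<kappa> * h)" "gs_norm (pexp \<rho> s \<sigma>) (pexp \<rho> \<sigma> s) (\<kappa> * h) f \<le> B"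
proof -
  have sf: "smooth f" by (rule wboundD(1)[OF f])
  have \<kappa>0: "0 < \<kappa>" using \<kappa> by simp
  have "\<bar>mpower x \<alpha>\<bar> * cmod (mderiv \<beta> f x) \<le> B * ((\<kappa> * h) ^ (mlen \<alpha> + mlen \<beta>) * mfact_powr (pexp \<rho> s \<sigma>) \<alpha> * mfact_powr (pexp \<rho> \<sigma> s) \<beta>)" for x \<alpha> \<beta>
  proof -
    let ?w = "map (Pair True) (mlist \<alpha>) @ map (Pair False) (mlist \<beta>)"
    let ?i = "\<Sum>b\<in>Basis. if \<rho> b then \<alpha> b else \<beta> b" and ?j = "\<Sum>b\<in>Basis. if \<rho> b then \<beta> b else \<alpha> b"
    let ?P = "(\<Prod>b\<in>Basis. fact (if \<rho> b then \<alpha> b else \<beta> b)) :: real" and ?Q = "(\<Prod>b\<in>Basis. fact (if \<rho> b then \<beta> b else \<alpha> b)) :: real"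
    let ?D = "2 ^ DIM('a) :: real"
    \<comment> \<open>One constant for both classes: the base is at least 1 and both exponents are
      at most \<open>s + \<sigma>\<close>.\<close>
    have pow: "(?D ^ n) powr r \<le> \<kappa> ^ n" if "0 \<le> r" "r \<le> s + \<sigma>" for n r
    proof -
      have "(?D ^ n) powr r = (?D powr r) ^ n" by (simp add: powr_realpow[symmetric] powr_powr mult_ac)
      also have "\<dots> \<le> \<kappa> ^ n" unfolding \<kappa> using that by (intro power_mono powr_mono) auto
      finally show ?thesis .
    qed
    have P: "fact ?i powr s \<le> \<kappa> ^ ?i * ?P powr s"
    proof -
      have "fact ?i powr s \<le> (?D ^ ?i * ?P) powr s" using assms(3) fact_sum_le[OF finite_Basis] by (intro powr_mono2) auto
      also have "\<dots> = (?D ^ ?i) powr s * ?P powr s" by (simp add: powr_mult prod_nonneg)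
      also have "\<dots> \<le> \<kappa> ^ ?i * ?P powr s" using assms by (intro mult_right_mono pow) auto
      finally show ?thesis .
    qed
    have Q: "fact ?j powr \<sigma> \<le> \<kappa> ^ ?j * ?Q powr \<sigma>"
    proof -
      have "fact ?j powr \<sigma> \<le> (?D ^ ?j * ?Q) powr \<sigma>" using assms(4) fact_sum_le[OF finite_Basis] by (intro powr_mono2) auto
      also have "\<dots> = (?D ^ ?j) powr \<sigma> * ?Q powr \<sigma>" by (simp add: powr_mult prod_nonneg)
      also have "\<dots> \<le> \<kappa> ^ ?j * ?Q powr \<sigma>" using assms by (intro mult_right_mono pow) auto
      finally show ?thesis .
    qed
    have "\<bar>mpower x \<alpha>\<bar> * cmod (mderiv \<beta> f x) = cmod (word ?w f x)"
      by (simp only: cmod_mlist[symmetric] word_map_mulc_partial)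
    also have "\<dots> \<le> B * gsw s \<sigma> h (sdeg \<rho> ?w) (tdeg \<rho> ?w)"
      by (rule wboundD(2)[OF f]) (use set_mlist in \<open>force simp: image_Un image_image\<close>)
    also have "\<dots> = B * (h ^ (?i + ?j) * (fact ?i powr s * fact ?j powr \<sigma>))"
      unfolding gsw_def deg_mlist by simp
    also have "\<dots> \<le> B * (h ^ (?i + ?j) * ((\<kappa> ^ ?i * ?P powr s) * (\<kappa> ^ ?j * ?Q powr \<sigma>)))"
      using B h \<kappa>0 by (intro mult_left_mono mult_mono P Q) auto
    also have "\<dots> = B * ((\<kappa> * h) ^ (?i + ?j) * (?P powr s * ?Q powr \<sigma>))"
      by (simp add: power_mult_distrib power_add mult_ac)
    finally show ?thesis
      unfolding mult.assoc mfact_powr_mult mlen_add[of \<alpha> \<beta> \<rho>] .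
  qed
  then show "f \<in> gs_step (pexp \<rho> s \<sigma>) (pexp \<rho> \<sigma> s) (\<kappa> * h)" "gs_norm (pexp \<rho> s \<sigma>) (pexp \<rho> \<sigma> s) (\<kappa> * h) f \<le> B"
    using gs_stepI[OF sf, of "\<kappa> * h" B] h \<kappa>0 by auto
qed

section \<open>Fourier inversion\<close>

text \<open>Lebesgue measure is the image of the product measure over \<open>Basis\<close>, so such
  integrals factorise into one-dimensional ones. Serves both the majorant \<open>wt\<close> and the
  Gaussian.\<close>

lemma lborel_Basis_prod:
  fixes g :: "'a::euclidean_space \<Rightarrow> real \<Rightarrow> 'b::{real_normed_field,banach,second_countable_topology}"
  assumes g: "\<And>b. b \<in> Basis \<Longrightarrow> integrable lborel (g b)"
  shows "integrable lborel (\<lambda>y. \<Prod>b\<in>Basis. g b (y \<bullet> b))"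
    and "(\<integral>y. (\<Prod>b\<in>Basis. g b (y \<bullet> b)) \<partial>lborel) = (\<Prod>b\<in>Basis. \<integral>x. g b x \<partial>lborel)"
proof -
  interpret product_sigma_finite "\<lambda>b::'a. lborel :: real measure" ..
  let ?T = "\<lambda>f. \<Sum>b\<in>(Basis::'a set). f b *\<^sub>R b"
  have T: "?T \<in> measurable (\<Pi>\<^sub>M b\<in>Basis. lborel) borel" by measurable
  have meas: "(\<lambda>y. \<Prod>b\<in>Basis. g b (y \<bullet> b)) \<in> borel_measurable borel"
  proof (rule borel_measurable_prod)
    fix b :: 'a assume "b \<in> Basis"
    from borel_measurable_integrable[OF g[OF this]] have [measurable]: "g b \<in> borel_measurable borel" by simp
    show "(\<lambda>y. g b (y \<bullet> b)) \<in> borel_measurable borel" by measurable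
  qed
  have eq: "(\<Prod>b\<in>Basis. g b (?T f \<bullet> b)) = (\<Prod>b\<in>Basis. g b (f b))" for f
    by (intro prod.cong refl) (simp only: inner_sum_left_Basis)
  show "integrable lborel (\<lambda>y. \<Prod>b\<in>Basis. g b (y \<bullet> b))"
    by (subst lborel_eq, unfold integrable_distr_eq[OF T meas] eq)
       (rule product_integrable_prod[OF finite_Basis g])
  show "(\<integral>y. (\<Prod>b\<in>Basis. g b (y \<bullet> b)) \<partial>lborel) = (\<Prod>b\<in>Basis. \<integral>x. g b x \<partial>lborel)"
    by (subst lborel_eq) (simp only: integral_distr[OF T meas] eq product_integral_prod[OF finite_Basis g])
qed

text \<open>The integrable majorant used throughout. Its reciprocal is the product of the factors
  \<open>1 + (y \<bullet> b)\<^sup>2\<close>, so a bound by a multiple of \<open>wt\<close> amounts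
  to bounds on words with up to two more multiplications per coordinate.\<close>

definition wt :: "'a::euclidean_space \<Rightarrow> real" where
  "wt y = (\<Prod>b\<in>Basis. inverse (1 + (y \<bullet> b)\<^sup>2))"

lemma wt_pos: "0 < wt y"
  unfolding wt_def by (intro prod_pos) (auto intro!: add_pos_nonneg)

lemma wt_boundI:
  fixes z :: "'a::euclidean_space"
  assumes "(\<Prod>b\<leftarrow>basis_list. 1 + (z \<bullet> b)\<^sup>2) * c \<le> D" shows "c \<le> D * wt z"
proof -
  let ?P = "\<Prod>b\<in>Basis. 1 + (z \<bullet> b)\<^sup>2"
  have "(\<Prod>b\<leftarrow>basis_list. 1 + (z \<bullet> b)\<^sup>2) = ?P"
    using prod.distinct_set_conv_list[OF basis_list(1), of "\<lambda>b. 1 + (z \<bullet> b)\<^sup>2"] by (simp add: basis_list(2))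
  then have 1: "?P * c \<le> D" using assms by simp
  have 2: "wt z = inverse ?P" unfolding wt_def by (simp add: prod_inversef[symmetric] o_def)
  have 3: "?P > 0" by (intro prod_pos) (auto intro: add_pos_nonneg)
  show ?thesis
    unfolding 2 divide_inverse[symmetric] pos_le_divide_eq[OF 3] by (subst mult.commute) (rule 1)
qed

lemma integrable_wt [simp]: "integrable lborel (wt :: 'a::euclidean_space \<Rightarrow> real)"
proof -
  have "integrable lborel (\<lambda>x::real. inverse (1 + x\<^sup>2))"
    using integrable_inverse_1_plus_square by (simp add: set_integrable_def)
  then have "integrable lborel (\<lambda>y::'a. \<Prod>b\<in>Basis. inverse (1 + (y \<bullet> b)\<^sup>2))"
    by (rule lborel_Basis_prod(1))
  moreover have "wt = (\<lambda>y::'a. \<Prod>b\<in>Basis. inverse (1 + (y \<bullet> b)\<^sup>2))"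
    by (rule ext) (rule wt_def)
  ultimately show ?thesis by simp
qed

lemma integrable_wt_bound:
  fixes f :: "'a::euclidean_space \<Rightarrow> complex"
  assumes "f \<in> borel_measurable borel" "\<And>y. cmod (f y) \<le> B * wt y"
  shows "integrable lborel f"
proof (rule Bochner_Integration.integrable_bound)
  show "integrable lborel (\<lambda>y::'a. B * wt y)" by simp
  show "AE y in lborel. norm (f y) \<le> norm (B * wt y)"
  proof (rule AE_I2)
    fix y :: 'a
    show "norm (f y) \<le> norm (B * wt y)"
      using order_trans[OF assms(2)[of y] abs_ge_self] by simp
  qed
qed (use assms in simp)

lemma wt_integral_bound:
  fixes f :: "'a::euclidean_space \<Rightarrow> complex"
  assumes "f \<in> borel_measurable borel" "\<And>y. cmod (f y) \<le> B * wt y"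
  shows "cmod (\<integral>y. f y \<partial>lborel) \<le> B * (\<integral>y. wt y \<partial>(lborel :: 'a measure))"
proof -
  have "norm (\<integral>y. f y \<partial>lborel) \<le> (\<integral>y. norm (f y) \<partial>lborel)" by simp
  also have "\<dots> \<le> (\<integral>y. B * wt y \<partial>(lborel :: 'a measure))"
    using integrable_wt_bound[OF assms] assms(2) by (intro integral_mono) auto
  finally show ?thesis by simp
qed

lemma integral_lborel_affine:
  fixes f :: "'a::euclidean_space \<Rightarrow> 'b::{banach, second_countable_topology}"
  assumes "f \<in> borel_measurable borel" "c \<noteq> 0"
  shows "(\<integral>x. f x \<partial>lborel) = \<bar>c\<bar> ^ DIM('a) *\<^sub>R (\<integral>x. f (t + c *\<^sub>R x) \<partial>lborel)"
    and "integrable lborel f \<Longrightarrow> integrable lborel (\<lambda>x. f (t + c *\<^sub>R x))"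
proof -
  have [measurable]: "f \<in> borel_measurable borel" by fact
  have T: "(\<lambda>x. t + c *\<^sub>R x) \<in> measurable lborel borel" by simp
  show "(\<integral>x. f x \<partial>lborel) = \<bar>c\<bar> ^ DIM('a) *\<^sub>R (\<integral>x. f (t + c *\<^sub>R x) \<partial>lborel)"
    by (subst lborel_affine[OF assms(2), of t]) (simp add: integral_density integral_distr[OF T])
  assume "integrable lborel f"
  then have "integrable (density (distr lborel borel (\<lambda>x. t + c *\<^sub>R x)) (\<lambda>_. \<bar>c\<bar> ^ DIM('a))) f"
    using lborel_affine[OF assms(2), of t] by simp
  then have "integrable lborel (\<lambda>x. \<bar>c\<bar> ^ DIM('a) *\<^sub>R f (t + c *\<^sub>R x))"
    by (simp add: integrable_density integrable_distr_eq[OF T])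
  then have "integrable lborel (\<lambda>x. (1 / \<bar>c\<bar> ^ DIM('a)) *\<^sub>R (\<bar>c\<bar> ^ DIM('a) *\<^sub>R f (t + c *\<^sub>R x)))"
    by (rule integrable_scaleR_right)
  then show "integrable lborel (\<lambda>x. f (t + c *\<^sub>R x))" using assms(2) by simp
qed

lemma integral_lborel_translate:
  fixes f :: "'a::euclidean_space \<Rightarrow> 'b::{banach, second_countable_topology}"
  assumes "f \<in> borel_measurable borel"
  shows "(\<integral>x. f (x + t) \<partial>lborel) = (\<integral>x. f x \<partial>lborel)"
    and "integrable lborel f \<Longrightarrow> integrable lborel (\<lambda>x. f (x + t))"
  using integral_lborel_affine[OF assms, of 1 t] by (simp_all add: add.commute)

section \<open>Gaussian densities and their Fourier transforms\<close>

definition gauss :: "'a::euclidean_space \<Rightarrow> real" where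
  "gauss y = (\<Prod>b\<in>Basis. std_normal_density (y \<bullet> b))"

lemma gauss_eq: "gauss (y::'a::euclidean_space) = exp (- (y \<bullet> y) / 2) / sqrt (2 * pi) ^ DIM('a)"
proof -
  have "(\<Prod>b\<in>(Basis::'a set). exp (- (y \<bullet> b)\<^sup>2 / 2)) = exp (- (y \<bullet> y) / 2)"
    by (simp add: exp_sum[symmetric] euclidean_inner[of y y] sum_negf sum_divide_distrib[symmetric] power2_eq_square)
  then show ?thesis
    unfolding gauss_def std_normal_density_def
    by (simp add: prod_dividef)
qed

lemma integrable_std_normal [simp]: "integrable lborel std_normal_density"
  using integrable_normal_moment[of 1 0 0] by simp

text \<open>The integrand is a product over the coordinates, and each factor integrates to the
  characteristic function of the standard normal distribution.\<close>

lemma gauss_cis: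
  fixes t :: "'a::euclidean_space"
  shows "integrable lborel (\<lambda>u. of_real (gauss u) * cis (t \<bullet> u))"
    and "(\<integral>u. of_real (gauss u) * cis (t \<bullet> u) \<partial>lborel) = of_real (exp (- (t \<bullet> t) / 2))"
proof -
  let ?g = "\<lambda>b x. complex_of_real (std_normal_density x) * cis ((t \<bullet> b) * x)"
  have int: "integrable lborel (?g b)" for b
  proof (rule Bochner_Integration.integrable_bound[OF integrable_std_normal])
    show "?g b \<in> borel_measurable lborel"
      by (auto simp: normal_density_def cis_conv_exp)
  qed (auto simp: norm_mult)
  have val: "(\<integral>x. ?g b x \<partial>lborel) = exp (- of_real ((t \<bullet> b)\<^sup>2) / 2)" for b
  proof -
    have "char std_normal_distribution (t \<bullet> b) = (\<integral>x. std_normal_density x *\<^sub>R iexp ((t \<bullet> b) * x) \<partial>lborel)"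
      unfolding char_def by (subst integral_density) auto
    also have "\<dots> = (\<integral>x. ?g b x \<partial>lborel)"
      by (simp add: scaleR_conv_of_real cis_conv_exp)
    finally show ?thesis by (simp add: char_std_normal_distribution exp_of_real[symmetric])
  qed
  have eq: "of_real (gauss u) * cis (t \<bullet> u) = (\<Prod>b\<in>Basis. ?g b (u \<bullet> b))" for u :: 'a
  proof -
    have "cis (t \<bullet> u) = (\<Prod>b\<in>Basis. cis ((t \<bullet> b) * (u \<bullet> b)))"
      by (simp add: cis_conv_exp exp_sum[symmetric] euclidean_inner[of t u] sum_distrib_left)
    then show ?thesis by (simp add: gauss_def prod.distrib)
  qed
  show "integrable lborel (\<lambda>u. of_real (gauss u) * cis (t \<bullet> u))"
    unfolding eq by (rule lborel_Basis_prod(1)) (rule int)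
  have "(\<integral>u. of_real (gauss u) * cis (t \<bullet> u) \<partial>lborel) = (\<Prod>b\<in>Basis. exp (- of_real ((t \<bullet> b)\<^sup>2) / 2))"
    unfolding eq lborel_Basis_prod(2)[OF int] val ..
  also have "\<dots> = of_real (exp (- (t \<bullet> t) / 2))"
    by (simp add: exp_sum[symmetric] exp_of_real[symmetric] euclidean_inner[of t t] sum_negf sum_divide_distrib[symmetric] power2_eq_square)
  finally show "(\<integral>u. of_real (gauss u) * cis (t \<bullet> u) \<partial>lborel) = of_real (exp (- (t \<bullet> t) / 2))" .
qed

lemma gauss_measurable [measurable]: "gauss \<in> borel_measurable borel"
  unfolding gauss_def[abs_def] normal_density_def by measurable

lemma gauss_integral [simp]: "integrable lborel (gauss :: 'a::euclidean_space \<Rightarrow> real)" "(\<integral>u. gauss (u::'a) \<partial>lborel) = 1"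
proof -
  show "integrable lborel (gauss :: 'a::euclidean_space \<Rightarrow> real)"
    unfolding gauss_def[abs_def] by (rule lborel_Basis_prod(1)) simp
  have "(\<integral>u. complex_of_real (gauss (u::'a)) \<partial>lborel) = 1"
    using gauss_cis(2)[of 0] by simp
  then show "(\<integral>u. gauss (u::'a) \<partial>lborel) = 1"
    by (metis integral_complex_of_real of_real_eq_1_iff)
qed

lemma measurable_cis [measurable]: "cis \<in> borel_measurable borel"
  unfolding cis_conv_exp[abs_def] by measurable

text \<open>A substitution in \<open>gauss_cis\<close>. As a function of \<open>z\<close> the
  transform concentrates at scale \<epsilon> and has total mass \<open>(2 * pi) ^ DIM('a)\<close>,
  the origin of the constant in the inversion formula.\<close>

lemma gauss_scaled_cis:
  fixes z :: "'a::euclidean_space"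
  assumes "0 < \<epsilon>"
  shows "(\<integral>\<xi>. cis (z \<bullet> \<xi>) * of_real (exp (- \<epsilon>\<^sup>2 * (\<xi> \<bullet> \<xi>) / 2)) \<partial>lborel) =
    of_real ((2 * pi) ^ DIM('a) * gauss ((1/\<epsilon>) *\<^sub>R z) / \<epsilon> ^ DIM('a))"
    and "integrable lborel (\<lambda>\<xi>::'a. exp (- \<epsilon>\<^sup>2 * (\<xi> \<bullet> \<xi>) / 2))"
proof -
  let ?s = "sqrt (2 * pi) ^ DIM('a)"
  have ss: "?s * ?s = (2 * pi) ^ DIM('a)"
    by (simp only: power_mult_distrib[symmetric] real_sqrt_mult_self) simp
  have g: "gauss (\<epsilon> *\<^sub>R \<xi>) * ?s = exp (- \<epsilon>\<^sup>2 * (\<xi> \<bullet> \<xi>) / 2)" for \<xi> :: 'a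
    by (simp add: gauss_eq power2_eq_square mult.assoc)
  have "integrable lborel (\<lambda>x::'a. gauss (0 + \<epsilon> *\<^sub>R x) * ?s)"
    using assms by (intro integrable_mult_left integral_lborel_affine(2)) auto
  then show "integrable lborel (\<lambda>\<xi>::'a. exp (- \<epsilon>\<^sup>2 * (\<xi> \<bullet> \<xi>) / 2))" by (simp only: add_0 g)
  let ?t = "(1/\<epsilon>) *\<^sub>R z"
  have "of_real (exp (- (?t \<bullet> ?t) / 2)) = (\<integral>u. of_real (gauss u) * cis (?t \<bullet> u) \<partial>lborel)"
    by (rule gauss_cis(2)[symmetric])
  also have "\<dots> = \<bar>\<epsilon>\<bar> ^ DIM('a) *\<^sub>R (\<integral>\<xi>. of_real (gauss (0 + \<epsilon> *\<^sub>R \<xi>)) * cis (?t \<bullet> (0 + \<epsilon> *\<^sub>R \<xi>)) \<partial>lborel)"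
    using assms by (intro integral_lborel_affine) auto
  also have "\<dots> = of_real (\<epsilon> ^ DIM('a)) * (\<integral>\<xi>. of_real (gauss (\<epsilon> *\<^sub>R \<xi>)) * cis (z \<bullet> \<xi>) \<partial>lborel)"
    using assms by (simp add: scaleR_conv_of_real)
  finally have e1: "(\<integral>\<xi>. of_real (gauss (\<epsilon> *\<^sub>R \<xi>)) * cis (z \<bullet> \<xi>) \<partial>lborel) = of_real (exp (- (?t \<bullet> ?t) / 2) / \<epsilon> ^ DIM('a))"
    using assms by (simp add: field_simps)
  have e2: "(\<integral>\<xi>. cis (z \<bullet> \<xi>) * of_real (exp (- \<epsilon>\<^sup>2 * (\<xi> \<bullet> \<xi>) / 2)) \<partial>lborel) = of_real ?s * (\<integral>\<xi>. of_real (gauss (\<epsilon> *\<^sub>R \<xi>)) * cis (z \<bullet> \<xi>) \<partial>lborel)"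
    unfolding g[symmetric] of_real_mult by (subst integral_mult_right_zero[symmetric]) (simp add: mult_ac)
  have e3: "?s * exp (- (?t \<bullet> ?t) / 2) = (2 * pi) ^ DIM('a) * gauss ?t"
    unfolding gauss_eq ss[symmetric] by simp
  show "(\<integral>\<xi>. cis (z \<bullet> \<xi>) * of_real (exp (- \<epsilon>\<^sup>2 * (\<xi> \<bullet> \<xi>) / 2)) \<partial>lborel) =
    of_real ((2 * pi) ^ DIM('a) * gauss ((1/\<epsilon>) *\<^sub>R z) / \<epsilon> ^ DIM('a))"
    by (simp only: e2 e1 e3[symmetric]) simp
qed

text \<open>The double integral over \<open>y\<close> and \<open>\<xi>\<close> is in general not
  absolutely convergent; a Gaussian factor in \<open>\<xi>\<close> makes it so. Fubini then yields
  averages of \<open>g\<close> around \<open>x\<close> at scale \<epsilon>, and dominated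
  convergence applies on both sides as \<epsilon> tends to 0.\<close>

lemma Fourier_inversion:
  fixes g :: "'a::euclidean_space \<Rightarrow> complex"
  assumes cont: "continuous_on UNIV g" and bdd: "\<And>y. cmod (g y) \<le> B" and int: "integrable lborel g"
    and inth: "integrable lborel (\<lambda>\<xi>. \<integral>y. g y * cis (y \<bullet> \<xi>) \<partial>lborel)"
  shows "(\<integral>\<xi>. (\<integral>y. g y * cis (y \<bullet> \<xi>) \<partial>lborel) * cis (- (x \<bullet> \<xi>)) \<partial>lborel) = of_real ((2 * pi) ^ DIM('a)) * g x"
proof -
  let ?h = "\<lambda>\<xi>. \<integral>y. g y * cis (y \<bullet> \<xi>) \<partial>lborel"
  have gm [measurable]: "g \<in> borel_measurable borel" using cont by (rule borel_measurable_continuous_onI)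
  have hm [measurable]: "?h \<in> borel_measurable borel" using borel_measurable_integrable[OF inth] by simp
  define \<epsilon> where "\<epsilon> n = 1 / real (Suc n)" for n
  have \<epsilon>: "0 < \<epsilon> n" for n by (simp add: \<epsilon>_def)
  have \<epsilon>0: "\<epsilon> \<longlonglongrightarrow> 0" unfolding \<epsilon>_def[abs_def] by (rule LIMSEQ_Suc[OF lim_1_over_n])
  let ?I = "\<lambda>n. \<integral>\<xi>. ?h \<xi> * cis (- (x \<bullet> \<xi>)) * of_real (exp (- (\<epsilon> n)\<^sup>2 * (\<xi> \<bullet> \<xi>) / 2)) \<partial>lborel"
  have lim1: "?I \<longlonglongrightarrow> (\<integral>\<xi>. ?h \<xi> * cis (- (x \<bullet> \<xi>)) \<partial>lborel)"
  proof (rule integral_dominated_convergence[where w = "\<lambda>\<xi>. cmod (?h \<xi>)"])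
    show "integrable lborel (\<lambda>\<xi>. cmod (?h \<xi>))" using inth by simp
    show "AE \<xi> in lborel. (\<lambda>n. ?h \<xi> * cis (- (x \<bullet> \<xi>)) * of_real (exp (- (\<epsilon> n)\<^sup>2 * (\<xi> \<bullet> \<xi>) / 2))) \<longlonglongrightarrow> ?h \<xi> * cis (- (x \<bullet> \<xi>))"
    proof (intro AE_I2)
      fix \<xi> :: 'a
      have "(\<lambda>n. ?h \<xi> * cis (- (x \<bullet> \<xi>)) * of_real (exp (- (\<epsilon> n)\<^sup>2 * (\<xi> \<bullet> \<xi>) / 2))) \<longlonglongrightarrow> ?h \<xi> * cis (- (x \<bullet> \<xi>)) * of_real (exp (- 0\<^sup>2 * (\<xi> \<bullet> \<xi>) / 2))"
        by (intro tendsto_intros \<epsilon>0) auto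
      then show "(\<lambda>n. ?h \<xi> * cis (- (x \<bullet> \<xi>)) * of_real (exp (- (\<epsilon> n)\<^sup>2 * (\<xi> \<bullet> \<xi>) / 2))) \<longlonglongrightarrow> ?h \<xi> * cis (- (x \<bullet> \<xi>))" by simp
    qed
    show "AE \<xi> in lborel. norm (?h \<xi> * cis (- (x \<bullet> \<xi>)) * of_real (exp (- (\<epsilon> n)\<^sup>2 * (\<xi> \<bullet> \<xi>) / 2))) \<le> cmod (?h \<xi>)" for n
      by (intro AE_I2) (simp add: norm_mult mult_left_le)
  qed (measurable)
  have In: "?I n = (\<integral>u. of_real ((2 * pi) ^ DIM('a) * gauss u) * g (x + \<epsilon> n *\<^sub>R u) \<partial>lborel)" for n
  proof -
    let ?F = "\<lambda>(\<xi>::'a) y. g y * cis (y \<bullet> \<xi>) * (cis (- (x \<bullet> \<xi>)) * of_real (exp (- (\<epsilon> n)\<^sup>2 * (\<xi> \<bullet> \<xi>) / 2)))"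
    have "integrable (lborel \<Otimes>\<^sub>M lborel) (\<lambda>(\<xi>::'a, y). of_real (exp (- (\<epsilon> n)\<^sup>2 * (\<xi> \<bullet> \<xi>) / 2)) * g y)"
    proof (rule lborel_pair.Fubini_integrable)
      have ex: "integrable lborel (\<lambda>\<xi>::'a. exp (- (\<epsilon> n)\<^sup>2 * (\<xi> \<bullet> \<xi>) / 2))"
        by (rule gauss_scaled_cis(2)[OF \<epsilon>])
      have "integrable lborel (\<lambda>\<xi>::'a. exp (- (\<epsilon> n)\<^sup>2 * (\<xi> \<bullet> \<xi>) / 2) * (\<integral>y. cmod (g y) \<partial>lborel))"
        using ex by (rule integrable_mult_left)
      then show "integrable lborel (\<lambda>\<xi>::'a. \<integral>y. norm (case (\<xi>, y) of (\<xi>::'a, y) \<Rightarrow> of_real (exp (- (\<epsilon> n)\<^sup>2 * (\<xi> \<bullet> \<xi>) / 2)) * g y) \<partial>lborel)"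
        by (simp add: norm_mult)
    qed (use int in auto)
    then have F: "integrable (lborel \<Otimes>\<^sub>M lborel) (case_prod ?F)"
      by (rule Bochner_Integration.integrable_bound) (auto simp: norm_mult intro!: AE_I2)
    have "?I n = (\<integral>\<xi>. \<integral>y. ?F \<xi> y \<partial>lborel \<partial>lborel)"
      by (intro Bochner_Integration.integral_cong refl) (simp only: integral_mult_left_zero mult.assoc[of "?h _"])
    also have "\<dots> = (\<integral>y. \<integral>\<xi>. ?F \<xi> y \<partial>lborel \<partial>lborel)"
      using lborel_pair.Fubini_integral[OF F] by simp
    also have "\<dots> = (\<integral>y. g y * of_real ((2 * pi) ^ DIM('a) * gauss ((1/\<epsilon> n) *\<^sub>R (y - x)) / \<epsilon> n ^ DIM('a)) \<partial>lborel)"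
    proof (rule Bochner_Integration.integral_cong[OF refl])
      fix y
      have Fy: "?F \<xi> y = g y * (cis ((y - x) \<bullet> \<xi>) * of_real (exp (- (\<epsilon> n)\<^sup>2 * (\<xi> \<bullet> \<xi>) / 2)))" for \<xi>
        using cis_mult[of "y \<bullet> \<xi>" "- (x \<bullet> \<xi>)"] by (simp add: inner_diff_left)
      have "(\<integral>\<xi>. ?F \<xi> y \<partial>lborel) = g y * (\<integral>\<xi>. cis ((y - x) \<bullet> \<xi>) * of_real (exp (- (\<epsilon> n)\<^sup>2 * (\<xi> \<bullet> \<xi>) / 2)) \<partial>lborel)"
        by (simp only: Fy integral_mult_right_zero)
      then show "(\<integral>\<xi>. ?F \<xi> y \<partial>lborel) = g y * of_real ((2 * pi) ^ DIM('a) * gauss ((1/\<epsilon> n) *\<^sub>R (y - x)) / \<epsilon> n ^ DIM('a))"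
        by (simp only: gauss_scaled_cis(1)[OF \<epsilon>])
    qed
    \<comment> \<open>Substitution \<open>y = x + \<epsilon> n *\<^sub>R u\<close>, whose Jacobian
      cancels the power of \<open>\<epsilon> n\<close> in the denominator.\<close>
    also have "\<dots> = \<bar>\<epsilon> n\<bar> ^ DIM('a) *\<^sub>R (\<integral>u. g (x + \<epsilon> n *\<^sub>R u) * of_real ((2 * pi) ^ DIM('a) * gauss ((1/\<epsilon> n) *\<^sub>R (x + \<epsilon> n *\<^sub>R u - x)) / \<epsilon> n ^ DIM('a)) \<partial>lborel)"
      using \<epsilon>[of n] by (intro integral_lborel_affine) auto
    also have "\<dots> = (\<integral>u. \<bar>\<epsilon> n\<bar> ^ DIM('a) *\<^sub>R (g (x + \<epsilon> n *\<^sub>R u) * of_real ((2 * pi) ^ DIM('a) * gauss ((1/\<epsilon> n) *\<^sub>R (x + \<epsilon> n *\<^sub>R u - x)) / \<epsilon> n ^ DIM('a))) \<partial>lborel)"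
      by simp
    also have "\<dots> = (\<integral>u. of_real ((2 * pi) ^ DIM('a) * gauss u) * g (x + \<epsilon> n *\<^sub>R u) \<partial>lborel)"
      using \<epsilon>[of n] by (intro Bochner_Integration.integral_cong) (auto simp: scaleR_conv_of_real)
    finally show ?thesis .
  qed
  have lim2: "?I \<longlonglongrightarrow> (\<integral>u. of_real ((2 * pi) ^ DIM('a) * gauss u) * g x \<partial>(lborel :: 'a measure))"
    unfolding In
  proof (rule integral_dominated_convergence[where w = "\<lambda>u::'a. (2 * pi) ^ DIM('a) * gauss u * B"])
    show "integrable lborel (\<lambda>u::'a. (2 * pi) ^ DIM('a) * gauss u * B)" by simp
    have gn: "0 \<le> gauss u" for u :: 'a by (simp add: gauss_eq)
    show "AE u in lborel. norm (of_real ((2 * pi) ^ DIM('a) * gauss u) * g (x + \<epsilon> n *\<^sub>R u)) \<le> (2 * pi) ^ DIM('a) * gauss u * B" for n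
      using gn bdd by (intro AE_I2) (simp add: norm_mult norm_power mult_left_mono)
    show "AE u in lborel. (\<lambda>n. of_real ((2 * pi) ^ DIM('a) * gauss u) * g (x + \<epsilon> n *\<^sub>R u)) \<longlonglongrightarrow> of_real ((2 * pi) ^ DIM('a) * gauss u) * g x"
    proof (intro AE_I2 tendsto_mult tendsto_const)
      fix u :: 'a
      have "(\<lambda>n. x + \<epsilon> n *\<^sub>R u) \<longlonglongrightarrow> x + 0 *\<^sub>R u" by (intro tendsto_intros \<epsilon>0)
      then have "(\<lambda>n. x + \<epsilon> n *\<^sub>R u) \<longlonglongrightarrow> x" by simp
      moreover have "isCont g x" using cont by (simp add: continuous_on_eq_continuous_at)
      ultimately show "(\<lambda>n. g (x + \<epsilon> n *\<^sub>R u)) \<longlonglongrightarrow> g x" by (rule isCont_tendsto_compose[rotated])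
    qed
  qed measurable
  have "(\<integral>u. of_real ((2 * pi) ^ DIM('a) * gauss u) * g x \<partial>(lborel :: 'a measure)) = of_real (\<integral>u. (2 * pi) ^ DIM('a) * gauss (u::'a) \<partial>lborel) * g x"
    by (simp add: gauss_integral(1))
  also have "\<dots> = of_real ((2 * pi) ^ DIM('a)) * g x" by (simp add: gauss_integral)
  finally show ?thesis using LIMSEQ_unique[OF lim1 lim2] by simp
qed

section \<open>Differentiation under the integral sign\<close>

text \<open>Bounds after multiplication by \<open>n\<close> factors \<open>1 + X\<^sub>b\<^sup>2\<close>, which is how integrability is obtained;
  \<open>r\<close> is the class of the letters \<open>X\<^sub>b\<close> involved.\<close>

primrec dec :: "bool \<Rightarrow> nat \<Rightarrow> (nat \<Rightarrow> nat \<Rightarrow> real) \<Rightarrow> nat \<Rightarrow> nat \<Rightarrow> real" where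
  "dec r 0 m = m"
| "dec r (Suc n) m = (\<lambda>i j. dec r n m i j + dec r n (\<lambda>i j. if r then m (Suc (Suc i)) j else m i (Suc (Suc j))) i j)"

lemma dec_shift: "dec r n (\<lambda>i j. m (i + a) (j + c)) i j = dec r n m (i + a) (j + c)"
proof (induction n arbitrary: m)
  case (Suc n)
  show ?case using Suc[of m] Suc[of "\<lambda>i j. if r then m (Suc (Suc i)) j else m i (Suc (Suc j))"] by (cases r) simp_all
qed simp

lemma dec_Suc: 
  "dec r n (\<lambda>i j. m (Suc i) j) i j = dec r n m (Suc i) j"
  "dec r n (\<lambda>i j. m i (Suc j)) i j = dec r n m i (Suc j)"
  using dec_shift[of r n m 1 0 i j] dec_shift[of r n m 0 1 i j] by simp_all

text \<open>Expanding one factor \<open>1 + (y \<bullet> b)\<^sup>2\<close> gives the function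
  itself plus the function after two more letters of class \<open>r\<close>, which is the recursion
  of \<open>dec\<close>.\<close>

lemma wbound_decay_list:
  assumes "wbound \<rho> m G" "\<And>b. b \<in> Basis \<Longrightarrow> \<rho> (0, b) = r" "set bs \<subseteq> Basis"
  shows "(\<Prod>b\<leftarrow>bs. 1 + (y \<bullet> b)\<^sup>2) * cmod (G (x, y)) \<le> dec r (length bs) m 0 0"
  using assms(1,3)
proof (induction bs arbitrary: m G)
  case Nil
  then show ?case using wboundD(2)[of \<rho> m G "[]" "(x, y)"] by simp
next
  case (Cons b bs)
  let ?X = "letter (True, (0, b))" and ?P = "\<Prod>b\<leftarrow>bs. 1 + (y \<bullet> b)\<^sup>2"
  let ?m = "\<lambda>i j. if r then m (Suc (Suc i)) j else m i (Suc (Suc j))"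
  have b: "b \<in> Basis" and bs: "set bs \<subseteq> Basis" using Cons.prems by auto
  have b2: "(0, b) \<in> Basis" using b by (simp add: Basis_prod_def)
  have cl: "sclass \<rho> (True, (0, b)) = r" using assms(2)[OF b] by (simp add: sclass_def)
  have "wbound \<rho> ?m (?X (?X G))"
    using wbound_letter[OF wbound_letter[OF Cons.prems(1), of "(True, (0, b))"], of "(True, (0, b))"] b2 cl by (cases r) simp_all
  from Cons.IH[OF this bs] have 1: "?P * cmod (?X (?X G) (x, y)) \<le> dec r (length bs) ?m 0 0" .
  have "(\<Prod>b\<leftarrow>b # bs. 1 + (y \<bullet> b)\<^sup>2) * cmod (G (x, y)) = ?P * cmod (G (x, y)) + ?P * cmod (?X (?X G) (x, y))"
    by (simp add: mulc_def norm_mult power2_eq_square algebra_simps)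
  also have "\<dots> \<le> dec r (length (b # bs)) m 0 0"
    using 1 Cons.IH[OF Cons.prems(1) bs] by simp
  finally show ?case .
qed

lemma wbound_decay:
  fixes G :: "'a::euclidean_space \<times> 'a \<Rightarrow> complex"
  assumes "wbound \<rho> m G" "\<And>b. b \<in> Basis \<Longrightarrow> \<rho> (0, b) = r"
  shows "cmod (G (x, y)) \<le> dec r DIM('a) m 0 0 * wt y"
  using wbound_decay_list[OF assms(1) assms(2), where bs = basis_list and x = x and y = y]
  by (intro wt_boundI) (simp add: basis_list(2) length_basis_list)

section \<open>Taylor remainders and derivatives of integrals\<close>

lemma smooth_difference_bound:
  assumes g: "smooth g" and S: "\<And>c z. c \<in> Basis \<Longrightarrow> cmod (partial c g z) \<le> S c"
  shows "cmod (g (z + v) - g z) \<le> norm v * (\<Sum>c\<in>Basis. S c)"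
proof -
  have "cmod (g (z + 1 *\<^sub>R v) - g (z + 0 *\<^sub>R v) - of_real 1 * 0) \<le> (norm v * (\<Sum>c\<in>Basis. S c)) * 1"
  proof (rule vector_mean_bound)
    fix u :: real
    show "((\<lambda>u. g (z + u *\<^sub>R v)) has_vector_derivative partial v g (z + u *\<^sub>R v)) (at u within {0..1})"
      by (rule has_vector_derivative_line[OF smooth_differentiable[OF g]])
    have "cmod (partial v g (z + u *\<^sub>R v)) \<le> (\<Sum>b\<in>Basis. cmod (of_real (v \<bullet> b) * partial b g (z + u *\<^sub>R v)))"
      unfolding has_derivative_coordinates[OF smooth_differentiable[OF g], of v] by (rule norm_sum)
    also have "\<dots> \<le> (\<Sum>b\<in>Basis. norm v * S b)"
      by (intro sum_mono) (simp add: norm_mult mult_mono Basis_le_norm S)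
    finally show "cmod (partial v g (z + u *\<^sub>R v) - 0) \<le> norm v * (\<Sum>c\<in>Basis. S c)"
      by (simp add: sum_distrib_left)
  qed simp
  then show ?thesis by simp
qed

text \<open>The mean value inequality with the slope at \<open>z\<close>, combined with
  \<open>smooth_difference_bound\<close> for the variation of that slope. The constant is crude,
  which suffices for \<open>has_derivative_integral\<close>.\<close>

lemma smooth_taylor_bound:
  fixes g :: "'a::euclidean_space \<Rightarrow> complex"
  assumes g: "smooth g" and S: "\<And>b c z. b \<in> Basis \<Longrightarrow> c \<in> Basis \<Longrightarrow> cmod (partial c (partial b g) z) \<le> S b c"
  shows "cmod (g (z + v) - g z - (\<Sum>b\<in>Basis. of_real (v \<bullet> b) * partial b g z)) \<le> (norm v)\<^sup>2 * (\<Sum>b\<in>Basis. \<Sum>c\<in>Basis. S b c)"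
proof -
  let ?L = "\<Sum>b\<in>Basis. of_real (v \<bullet> b) * partial b g z"
  have "cmod (g (z + 1 *\<^sub>R v) - g (z + 0 *\<^sub>R v) - of_real 1 * ?L) \<le> ((norm v)\<^sup>2 * (\<Sum>b\<in>Basis. \<Sum>c\<in>Basis. S b c)) * 1"
  proof (rule vector_mean_bound)
    fix u :: real assume u: "u \<in> {0..1}"
    show "((\<lambda>u. g (z + u *\<^sub>R v)) has_vector_derivative partial v g (z + u *\<^sub>R v)) (at u within {0..1})"
      by (rule has_vector_derivative_line[OF smooth_differentiable[OF g]])
    have "partial v g (z + u *\<^sub>R v) - ?L = (\<Sum>b\<in>Basis. of_real (v \<bullet> b) * (partial b g (z + u *\<^sub>R v) - partial b g z))"
      unfolding has_derivative_coordinates[OF smooth_differentiable[OF g], of v]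
      by (simp add: sum_subtractf right_diff_distrib)
    then have "cmod (partial v g (z + u *\<^sub>R v) - ?L) \<le> (\<Sum>b\<in>Basis. cmod (of_real (v \<bullet> b) * (partial b g (z + u *\<^sub>R v) - partial b g z)))"
      by (simp only: norm_sum)
    also have "\<dots> \<le> (\<Sum>b\<in>Basis. norm v * (norm v * (\<Sum>c\<in>Basis. S b c)))"
    proof (rule sum_mono)
      fix b :: 'a assume b: "b \<in> Basis"
      have S0: "0 \<le> S b c" if "c \<in> Basis" for c
        using S[OF b that, of z] norm_ge_zero order_trans by blast
      have "cmod (partial b g (z + u *\<^sub>R v) - partial b g z) \<le> norm (u *\<^sub>R v) * (\<Sum>c\<in>Basis. S b c)"
        by (rule smooth_difference_bound[OF smooth_partial[OF g b]]) (rule S[OF b])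
      also have "\<dots> \<le> norm v * (\<Sum>c\<in>Basis. S b c)"
        using u by (intro mult_right_mono sum_nonneg S0) (auto simp: mult_left_le_one_le)
      finally show "cmod (of_real (v \<bullet> b) * (partial b g (z + u *\<^sub>R v) - partial b g z)) \<le> norm v * (norm v * (\<Sum>c\<in>Basis. S b c))"
        using b by (simp add: norm_mult mult_mono Basis_le_norm)
    qed
    finally show "cmod (partial v g (z + u *\<^sub>R v) - ?L) \<le> (norm v)\<^sup>2 * (\<Sum>b\<in>Basis. \<Sum>c\<in>Basis. S b c)"
      by (simp add: sum_distrib_left power2_eq_square mult.assoc)
  qed simp
  then show ?thesis by simp
qed

text \<open>A quadratic remainder with an integrable majorant \<open>K\<close> is simply integrated,
  so no limit has to be exchanged with the integral.\<close>

lemma has_derivative_integral: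
  fixes F :: "'a::euclidean_space \<Rightarrow> 'w \<Rightarrow> complex"
  assumes int: "\<And>z. integrable M (F z)" and intD: "\<And>b. b \<in> Basis \<Longrightarrow> integrable M (D b)"
    and K: "integrable M K"
    and bound: "\<And>w v. w \<in> space M \<Longrightarrow> cmod (F (z + v) w - F z w - (\<Sum>b\<in>Basis. of_real (v \<bullet> b) * D b w)) \<le> (norm v)\<^sup>2 * K w"
  shows "((\<lambda>z. \<integral>w. F z w \<partial>M) has_derivative (\<lambda>v. \<Sum>b\<in>Basis. of_real (v \<bullet> b) * (\<integral>w. D b w \<partial>M))) (at z)"
  unfolding has_derivative_at_alt
proof (intro conjI allI impI)
  show "bounded_linear (\<lambda>v. \<Sum>b\<in>Basis. of_real (v \<bullet> b) * (\<integral>w. D b w \<partial>M))"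
    by (intro bounded_linear_sum bounded_linear_mult_const bounded_linear_compose[OF bounded_linear_of_real] bounded_linear_inner_left)
  fix e :: real assume e: "0 < e"
  \<comment> \<open>The summand 1 keeps the radius \<open>e / ?K\<close> meaningful when the
    integral of \<open>K\<close> is 0.\<close>
  let ?K = "\<bar>\<integral>w. K w \<partial>M\<bar> + 1"
  have "norm ((\<integral>w. F y w \<partial>M) - (\<integral>w. F z w \<partial>M) - (\<Sum>b\<in>Basis. of_real ((y - z) \<bullet> b) * (\<integral>w. D b w \<partial>M))) \<le> e * norm (y - z)"
    if y: "norm (y - z) < e / ?K" for y
  proof -
    let ?v = "y - z"
    let ?E = "\<lambda>w. F y w - F z w - (\<Sum>b\<in>Basis. of_real (?v \<bullet> b) * D b w)"
    have "(\<integral>w. F y w \<partial>M) - (\<integral>w. F z w \<partial>M) - (\<Sum>b\<in>Basis. of_real (?v \<bullet> b) * (\<integral>w. D b w \<partial>M)) = (\<integral>w. ?E w \<partial>M)"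
      using int intD by (simp add: Bochner_Integration.integral_diff Bochner_Integration.integral_sum Bochner_Integration.integrable_diff Bochner_Integration.integrable_sum)
    also have "norm \<dots> \<le> (\<integral>w. norm (?E w) \<partial>M)" by simp
    also have "\<dots> \<le> (\<integral>w. (norm ?v)\<^sup>2 * K w \<partial>M)"
    proof (rule integral_mono)
      show "integrable M (\<lambda>w. norm (?E w))"
        using int intD by (intro integrable_norm Bochner_Integration.integrable_diff Bochner_Integration.integrable_sum) auto
      show "integrable M (\<lambda>w. (norm ?v)\<^sup>2 * K w)" using K by simp
      show "norm (?E w) \<le> (norm ?v)\<^sup>2 * K w" if "w \<in> space M" for w
        using bound[OF that, of ?v] by simp
    qed
    also have "\<dots> = norm ?v * (norm ?v * (\<integral>w. K w \<partial>M))" by (simp add: power2_eq_square)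
    also have "\<dots> \<le> norm ?v * (norm ?v * ?K)" by (intro mult_left_mono) auto
    also have "\<dots> \<le> norm ?v * e"
      using y by (intro mult_left_mono) (auto simp: field_simps)
    finally show ?thesis by (simp add: mult.commute)
  qed
  moreover have "0 < e / ?K" using e by (simp add: add_nonneg_pos)
  ultimately show "\<exists>d>0. \<forall>y. norm (y - z) < d \<longrightarrow> norm ((\<integral>w. F y w \<partial>M) - (\<integral>w. F z w \<partial>M) - (\<Sum>b\<in>Basis. of_real ((y - z) \<bullet> b) * (\<integral>w. D b w \<partial>M))) \<le> e * norm (y - z)"
    by blast
qed

text \<open>Integrate \<open>\<partial>\<^sub>b g (y + u b)\<close> over \<open>y\<close> and \<open>u \<in> [0, 1]\<close> in both orders: this needs neither slices
  nor decay of \<open>g\<close>.\<close>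

lemma integral_partial_zero:
  fixes g :: "'a::euclidean_space \<Rightarrow> complex"
  assumes d: "\<And>y. g differentiable (at y)" and c: "continuous_on UNIV (partial b g)"
    and int: "integrable lborel g" and intp: "integrable lborel (partial b g)"
  shows "(\<integral>y. partial b g y \<partial>lborel) = 0"
proof -
  have cg: "continuous_on UNIV g" using d by (simp add: continuous_at_imp_continuous_on differentiable_imp_continuous_within)
  have [measurable]: "partial b g \<in> borel_measurable borel" "g \<in> borel_measurable borel" using c cg by (auto intro: borel_measurable_continuous_onI)
  let ?F = "\<lambda>(u::real) y. indicator {0..1} u *\<^sub>R partial b g (y + u *\<^sub>R b)"
  have tr: "(\<integral>y. partial b g (y + u *\<^sub>R b) \<partial>lborel) = (\<integral>y. partial b g y \<partial>lborel)"
    and tri: "integrable lborel (\<lambda>y. partial b g (y + u *\<^sub>R b))"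
    and trn: "(\<integral>y. cmod (partial b g (y + u *\<^sub>R b)) \<partial>lborel) = (\<integral>y. cmod (partial b g y) \<partial>lborel)" for u
    using integral_lborel_translate[of "partial b g" "u *\<^sub>R b"] integral_lborel_translate[of "\<lambda>y. cmod (partial b g y)" "u *\<^sub>R b"] intp by auto
  have ind: "integrable lborel (\<lambda>u. indicator {0..1::real} u * (C::real))" for C by simp
  have F: "integrable (lborel \<Otimes>\<^sub>M lborel) (case_prod ?F)"
  proof (rule lborel_pair.Fubini_integrable)
    show "integrable lborel (\<lambda>u. \<integral>y. norm (case (u, y) of (u, y) \<Rightarrow> ?F u y) \<partial>lborel)"
      using ind by (simp add: trn)
  qed (auto intro!: AE_I2 integrable_scaleR_right tri)
  have ftc: "(\<integral>u. ?F u y \<partial>lborel) = g (y + b) - g y" for y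
  proof -
    have "(\<integral>u. indicator {0..1} u *\<^sub>R partial b g (y + u *\<^sub>R b) \<partial>lborel) = g (y + 1 *\<^sub>R b) - g (y + 0 *\<^sub>R b)"
      by (rule integral_FTC_Icc)
         (auto intro!: has_vector_derivative_line d continuous_on_compose2[OF c] continuous_intros)
    then show ?thesis by simp
  qed
  have "(\<integral>y. partial b g y \<partial>lborel) = (\<integral>u. indicator {0..1::real} u *\<^sub>R (\<integral>y. partial b g y \<partial>lborel) \<partial>lborel)"
    by simp
  also have "\<dots> = (\<integral>u. \<integral>y. ?F u y \<partial>lborel \<partial>lborel)" by (simp add: tr)
  also have "\<dots> = (\<integral>y. \<integral>u. ?F u y \<partial>lborel \<partial>lborel)" using lborel_pair.Fubini_integral[OF F] by simp
  also have "\<dots> = (\<integral>y. g (y + b) - g y \<partial>lborel)" by (simp add: ftc)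
  also have "\<dots> = 0"
    using integral_lborel_translate[of g b] int by (simp add: Bochner_Integration.integral_diff)
  finally show ?thesis .
qed

section \<open>The partial Fourier transform\<close>

definition PF :: "real \<Rightarrow> ('a::euclidean_space \<times> 'a \<Rightarrow> complex) \<Rightarrow> 'a \<times> 'a \<Rightarrow> complex" where
  "PF e G = (\<lambda>z. of_real ((2 * pi) powr (- (real DIM('a) / 2))) * (\<integral>y. G (fst z, y) * cis (e * (y \<bullet> snd z)) \<partial>lborel))"

text \<open>The integrand of \<open>PF\<close> for a fixed \<open>y\<close>, regarded as a function
  on phase space so that letters can act on it before integration.\<close>

definition slice :: "real \<Rightarrow> 'a::euclidean_space \<Rightarrow> ('a \<times> 'a \<Rightarrow> complex) \<Rightarrow> 'a \<times> 'a \<Rightarrow> complex" where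
  "slice e y G = (\<lambda>z. G (fst z, y) * cis (e * (y \<bullet> snd z)))"

text \<open>The operator that the partial Fourier transform turns into the letter \<open>(k, b)\<close>: in the second variable,
  multiplications and derivatives are exchanged.\<close>

fun dual_letter :: "real \<Rightarrow> bool \<times> 'a::euclidean_space \<times> 'a \<Rightarrow> ('a \<times> 'a \<Rightarrow> complex) \<Rightarrow> 'a \<times> 'a \<Rightarrow> complex" where
  "dual_letter e (k, b) G = (if snd b = 0 then letter (k, b) G else (\<lambda>z. (\<i> * of_real e) * letter (\<not> k, b) G z))"

text \<open>The classes as they appear after the transform: an exchange of multiplications and
  derivatives in the second variable amounts to an exchange of the two classes there.\<close>

definition flip :: "('a \<times> 'a::zero \<Rightarrow> bool) \<Rightarrow> 'a \<times> 'a \<Rightarrow> bool" where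
  "flip \<rho> b = (if snd b = 0 then \<rho> b else \<not> \<rho> b)"

lemma Basis_prod_cases:
  assumes "(b :: 'a::euclidean_space \<times> 'a) \<in> Basis"
  obtains b' where "b = (b', 0)" "b' \<in> Basis" | b' where "b = (0, b')" "b' \<in> Basis"
  using assms unfolding Basis_prod_def by auto

lemma pair_Basis [simp]: "(b, 0) \<in> Basis \<longleftrightarrow> b \<in> Basis" "(0, b) \<in> Basis \<longleftrightarrow> b \<in> Basis"
  by (auto simp: Basis_prod_def)

lemma smooth_dual_letter: "smooth G \<Longrightarrow> snd l \<in> Basis \<Longrightarrow> smooth (dual_letter e l G)"
  by (cases l) (auto intro!: smooth_cmult smooth_mulc smooth_partial)

text \<open>The class of \<open>l\<close> under \<open>flip \<rho>\<close> is the class under \<rho>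
  of the letter that really acts on \<open>G\<close>; hence the same index is shifted before and
  after the transform.\<close>

lemma wbound_dual_letter:
  assumes "wbound \<rho> m G" "snd l \<in> Basis" "e \<in> {1, -1}"
  shows "wbound \<rho> (\<lambda>i j. if sclass (flip \<rho>) l then m (Suc i) j else m i (Suc j)) (dual_letter e l G)"
proof -
  obtain k b where l: "l = (k, b)" by (cases l)
  show ?thesis
  proof (cases "snd b = 0")
    case True
    then show ?thesis using wbound_letter[OF assms(1,2)] l by (simp add: sclass_def flip_def)
  next
    case False
    have "wbound \<rho> (\<lambda>i j. if sclass \<rho> (\<not> k, b) then m (Suc i) j else m i (Suc j)) (letter (\<not> k, b) G)"
      using assms l by (intro wbound_letter) auto
    then have "wbound \<rho> (\<lambda>i j. if sclass \<rho> (\<not> k, b) then m (Suc i) j else m i (Suc j)) (\<lambda>z. (\<i> * of_real e) * letter (\<not> k, b) G z)"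
      by (rule wbound_cmult) (use assms in \<open>auto simp: norm_mult\<close>)
    moreover have "sclass \<rho> (\<not> k, b) = sclass (flip \<rho>) l" using False l by (auto simp: sclass_def flip_def)
    ultimately show ?thesis using False l by simp
  qed
qed

lemma has_derivative_cis: "((\<lambda>z. cis (e * (y \<bullet> snd z))) has_derivative (\<lambda>v. of_real (e * (y \<bullet> snd v)) * \<i> * cis (e * (y \<bullet> snd z)))) (at z)"
proof -
  have "((\<lambda>z. exp (\<i> * of_real (e * (y \<bullet> snd z)))) has_derivative (\<lambda>v. (\<i> * of_real (e * (y \<bullet> snd v))) * exp (\<i> * of_real (e * (y \<bullet> snd z))))) (at z)"
    by (rule has_derivative_compose[where f = "\<lambda>z. \<i> * of_real (e * (y \<bullet> snd z))" and g = exp and g' = "\<lambda>h. h * exp (\<i> * of_real (e * (y \<bullet> snd z)))"])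
      (auto intro!: derivative_eq_intros has_field_derivative_imp_has_derivative[OF DERIV_exp, simplified mult.commute] simp: mult.commute)
  then show ?thesis by (simp add: cis_conv_exp mult_ac)
qed

lemma slice_derivative:
  assumes "smooth G"
  shows "(slice e y G has_derivative (\<lambda>v. partial (fst v, 0) G (fst z, y) * cis (e * (y \<bullet> snd z))
    + G (fst z, y) * (of_real (e * (y \<bullet> snd v)) * \<i> * cis (e * (y \<bullet> snd z))))) (at z)"
proof -
  have "((\<lambda>z. G (fst z, y)) has_derivative (\<lambda>v. partial (fst v, 0) G (fst z, y))) (at z)"
    by (rule has_derivative_compose[where f = "\<lambda>z. (fst z, y)" and g = G, OF _ has_derivative_partial[OF smooth_differentiable[OF assms]]])
       (auto intro!: derivative_eq_intros)
  from has_derivative_mult[OF this has_derivative_cis[of e y z]] show ?thesis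
    unfolding slice_def by (simp add: add.commute)
qed

lemma slice_partial:
  assumes G: "smooth G" and b: "b \<in> Basis"
  shows "partial b (slice e y G) = slice e y (dual_letter e (False, b) G)"
proof
  fix z :: "'a \<times> 'a"
  have "partial b (slice e y G) z = partial (fst b, 0) G (fst z, y) * cis (e * (y \<bullet> snd z))
    + G (fst z, y) * (of_real (e * (y \<bullet> snd b)) * \<i> * cis (e * (y \<bullet> snd z)))"
    by (rule has_derivative_imp_partial[OF slice_derivative[OF G]])
  also have "\<dots> = slice e y (dual_letter e (False, b) G) z"
    using b
  proof (cases rule: Basis_prod_cases)
    case (1 b')
    then show ?thesis by (simp add: slice_def)
  next
    case (2 b')
    have "partial (0, 0) G (fst z, y) = 0"
      using has_derivative_coordinates[OF smooth_differentiable[OF G], of "(0, 0)" "(fst z, y)"] by (simp add: zero_prod_def[symmetric])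
    then show ?thesis using 2 by (auto simp: slice_def mulc_def nonzero_Basis mult_ac)
  qed
  finally show "partial b (slice e y G) z = slice e y (dual_letter e (False, b) G) z" .
qed

lemma smooth_slice: "smooth G \<Longrightarrow> smooth (slice e y G)"
proof (rule smooth_coinduct[where Q = "{slice e y G | G. smooth G}"])
  fix g and b :: "'a \<times> 'a" assume "g \<in> {slice e y G | G. smooth G}" and b: "b \<in> Basis"
  then obtain G where G: "smooth G" "g = slice e y G" by auto
  have "smooth (dual_letter e (False, b) G)" by (rule smooth_dual_letter) (use G b in simp_all)
  then show "partial b g \<in> {slice e y G | G. smooth G}"
    using slice_partial[OF G(1) b] G(2) by blast
next
  fix g x assume "g \<in> {slice e y G | G. smooth G}"
  then show "g differentiable (at x)" using slice_derivative unfolding differentiable_def by blast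
qed blast

text \<open>A single class \<open>r\<close> for the multiplications in the second variable allows
  the decay that makes the integral converge to be drawn from one index of the weight.
  \<open>e\<close> is the sign of the exponent; inversion involves both signs.\<close>

locale partial_fourier =
  fixes \<rho> :: "'a::euclidean_space \<times> 'a \<Rightarrow> bool" and r :: bool and e :: real
  assumes \<rho>: "\<And>b. b \<in> Basis \<Longrightarrow> \<rho> (0, b) = r" and e: "e \<in> {1, -1}"
begin

lemma slice_bound:
  assumes "wbound \<rho> m G"
  shows "cmod (slice e y G z) \<le> dec r DIM('a) m 0 0 * wt y"
  using wbound_decay[OF assms \<rho>, of "fst z" y] by (simp add: slice_def norm_mult)

lemma slice_measurable: 
  assumes "smooth G" shows "(\<lambda>y. slice e y G z) \<in> borel_measurable borel"
  unfolding slice_def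
  by (intro borel_measurable_continuous_onI continuous_intros continuous_on_compose2[OF smooth_continuous_on[OF assms]]) auto

lemma slice_integrable:
  assumes "wbound \<rho> m G" shows "integrable lborel (\<lambda>y. slice e y G z)"
  using slice_measurable[OF wboundD(1)[OF assms]] slice_bound[OF assms] by (rule integrable_wt_bound)

lemma PF_slice:
  fixes G :: "'a \<times> 'a \<Rightarrow> complex"
  shows "PF e G z = of_real ((2 * pi) powr (- (real DIM('a) / 2))) * (\<integral>y. slice e y G z \<partial>lborel)"
  by (simp add: PF_def slice_def)

lemma PF_derivative:
  assumes G: "wbound \<rho> m G"
  shows "(PF e G has_derivative (\<lambda>v. \<Sum>b\<in>Basis. of_real (v \<bullet> b) * PF e (dual_letter e (False, b) G) z)) (at z)"
proof -
  define c where "c = complex_of_real ((2 * pi) powr (- (real DIM('a) / 2)))"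
  let ?D = "\<lambda>b. dual_letter e (False, b)"
  \<comment> \<open>Weights after one and after two derivatives. The second ones, made integrable in
    \<open>y\<close> by \<open>dec\<close>, supply the majorant of the Taylor remainder.\<close>
  define m1 where "m1 b = (\<lambda>i j. if sclass (flip \<rho>) (False, b) then m (Suc i) j else m i (Suc j))" for b
  define m2 where "m2 b c = (\<lambda>i j. if sclass (flip \<rho>) (False, c) then m1 b (Suc i) j else m1 b i (Suc j))" for b c
  have sG: "smooth G" by (rule wboundD(1)[OF G])
  have D1: "wbound \<rho> (m1 b) (?D b G)" if "b \<in> Basis" for b
    unfolding m1_def using that by (intro wbound_dual_letter[OF G _ e]) auto
  have D2: "wbound \<rho> (m2 b c) (?D c (?D b G))" if "b \<in> Basis" "c \<in> Basis" for b c
    unfolding m2_def using that by (intro wbound_dual_letter[OF D1 _ e]) auto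
  have "((\<lambda>z. \<integral>y. slice e y G z \<partial>lborel) has_derivative (\<lambda>v. \<Sum>b\<in>Basis. of_real (v \<bullet> b) * (\<integral>y. slice e y (?D b G) z \<partial>lborel))) (at z)"
  proof (rule has_derivative_integral)
    show "integrable lborel (\<lambda>y. slice e y G z)" for z by (rule slice_integrable[OF G])
    show "integrable lborel (\<lambda>y. slice e y (?D b G) z)" if "b \<in> Basis" for b by (rule slice_integrable[OF D1[OF that]])
    show "integrable lborel (\<lambda>y::'a. \<Sum>b\<in>Basis. \<Sum>c\<in>Basis. dec r DIM('a) (m2 b c) 0 0 * wt y)"
      by (intro Bochner_Integration.integrable_sum integrable_mult_right integrable_wt)
    show "cmod (slice e y G (z + v) - slice e y G z - (\<Sum>b\<in>Basis. of_real (v \<bullet> b) * slice e y (?D b G) z))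
       \<le> (norm v)\<^sup>2 * (\<Sum>b\<in>Basis. \<Sum>c\<in>Basis. dec r DIM('a) (m2 b c) 0 0 * wt y)" for y v
    proof -
      have eq: "(\<Sum>b\<in>Basis. of_real (v \<bullet> b) * slice e y (?D b G) z) = (\<Sum>b\<in>Basis. of_real (v \<bullet> b) * partial b (slice e y G) z)"
        by (intro sum.cong refl) (simp only: slice_partial[OF sG])
      show ?thesis unfolding eq
      proof (rule smooth_taylor_bound[OF smooth_slice[OF sG]])
        fix b c :: "'a \<times> 'a" and z assume b: "b \<in> Basis" and c: "c \<in> Basis"
        have "partial c (partial b (slice e y G)) = slice e y (?D c (?D b G))"
          by (simp only: slice_partial[OF sG b] slice_partial[OF wboundD(1)[OF D1[OF b]] c])
        then show "cmod (partial c (partial b (slice e y G)) z) \<le> dec r DIM('a) (m2 b c) 0 0 * wt y"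
          by (simp only: slice_bound[OF D2[OF b c]])
      qed
    qed
  qed
  from has_derivative_mult_right[OF this, of c]
  have "((\<lambda>z. c * (\<integral>y. slice e y G z \<partial>lborel)) has_derivative (\<lambda>v. \<Sum>b\<in>Basis. of_real (v \<bullet> b) * (c * (\<integral>y. slice e y (?D b G) z \<partial>lborel)))) (at z)"
    by (simp add: sum_distrib_left mult.left_commute)
  then show ?thesis unfolding PF_slice[abs_def] c_def .
qed

lemma PF_partial:
  assumes G: "wbound \<rho> m G" and b: "b \<in> Basis"
  shows "partial b (PF e G) = PF e (dual_letter e (False, b) G)"
proof
  fix z
  have "partial b (PF e G) z = (\<Sum>c\<in>Basis. of_real (b \<bullet> c) * PF e (dual_letter e (False, c) G) z)"
    by (rule has_derivative_imp_partial[OF PF_derivative[OF G]])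
  also have "\<dots> = (\<Sum>c\<in>Basis. if c = b then PF e (dual_letter e (False, b) G) z else 0)"
    using b by (intro sum.cong) (auto simp: inner_Basis)
  finally show "partial b (PF e G) z = PF e (dual_letter e (False, b) G) z" using b by simp
qed

lemma PF_smooth:
  assumes "wbound \<rho> m G" shows "smooth (PF e G)"
proof (rule smooth_coinduct[where Q = "{PF e G | G m. wbound \<rho> m G}"])
  fix g and b :: "'a \<times> 'a" assume "g \<in> {PF e G | G m. wbound \<rho> m G}" and b: "b \<in> Basis"
  then obtain G m where G: "wbound \<rho> m G" "g = PF e G" by auto
  have "wbound \<rho> (\<lambda>i j. if sclass (flip \<rho>) (False, b) then m (Suc i) j else m i (Suc j)) (dual_letter e (False, b) G)"
    by (rule wbound_dual_letter[OF G(1) _ e]) (use b in simp)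
  then show "partial b g \<in> {PF e G | G m. wbound \<rho> m G}"
    using PF_partial[OF G(1) b] G(2) by blast
next
  fix g x assume "g \<in> {PF e G | G m. wbound \<rho> m G}"
  then show "g differentiable (at x)" using PF_derivative unfolding differentiable_def by blast
qed (use assms in auto)

text \<open>Integration by parts in \<open>y\<close>: the total derivative integrates to 0, and
  differentiating the exponential brings down the frequency.\<close>

lemma slice_parts:
  assumes G: "wbound \<rho> m G" and b: "b \<in> Basis"
  shows "(\<integral>y. slice e y (partial (0, b) G) z \<partial>lborel) = - \<i> * of_real (e * (snd z \<bullet> b)) * (\<integral>y. slice e y G z \<partial>lborel)"
proof -
  have sG: "smooth G" by (rule wboundD(1)[OF G])
  have bb: "(0, b) \<in> Basis" using b by simp
  have Gb: "wbound \<rho> (\<lambda>i j. if sclass \<rho> (False, (0, b)) then m (Suc i) j else m i (Suc j)) (partial (0, b) G)"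
    using wbound_letter[OF G, of "(False, (0, b))"] bb by simp
  let ?g = "\<lambda>y. slice e y G z"
  have der: "(?g has_derivative (\<lambda>v. partial (0, v) G (fst z, y) * cis (e * (y \<bullet> snd z)) +
      G (fst z, y) * (of_real (e * (snd z \<bullet> v)) * \<i> * cis (e * (y \<bullet> snd z))))) (at y)" for y
  proof -
    have 1: "((\<lambda>y. G (fst z, y)) has_derivative (\<lambda>v. partial (0, v) G (fst z, y))) (at y)"
      by (rule has_derivative_compose[where f = "\<lambda>y. (fst z, y)" and g = G, OF _ has_derivative_partial[OF smooth_differentiable[OF sG]]])
         (auto intro!: derivative_eq_intros)
    have "((\<lambda>y. cis (e * (snd z \<bullet> snd (0::'a, y)))) has_derivative (\<lambda>v. of_real (e * (snd z \<bullet> snd (0::'a, v))) * \<i> * cis (e * (snd z \<bullet> snd (0::'a, y))))) (at y)"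
      by (rule has_derivative_compose[where f = "\<lambda>y. (0::'a, y)" and g = "\<lambda>w. cis (e * (snd z \<bullet> snd w))", OF _ has_derivative_cis])
         (auto intro!: derivative_eq_intros)
    from has_derivative_mult[OF 1 this] show ?thesis unfolding slice_def by (simp add: add.commute inner_commute)
  qed
  have pg: "partial b ?g = (\<lambda>y. slice e y (partial (0, b) G) z + \<i> * of_real (e * (snd z \<bullet> b)) * slice e y G z)"
    by (rule ext, subst has_derivative_imp_partial[OF der]) (simp add: slice_def mult_ac)
  have cont: "continuous_on UNIV (\<lambda>y. slice e y H z)" if "smooth H" for H
    unfolding slice_def by (intro continuous_intros continuous_on_compose2[OF smooth_continuous_on[OF that]]) auto
  have "(\<integral>y. partial b ?g y \<partial>lborel) = 0"
  proof (rule integral_partial_zero)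
    show "?g differentiable (at y)" for y using der unfolding differentiable_def by blast
    show "continuous_on UNIV (partial b ?g)"
      unfolding pg by (intro continuous_intros cont sG wboundD(1)[OF Gb])
    show "integrable lborel ?g" by (rule slice_integrable[OF G])
    show "integrable lborel (partial b ?g)"
      unfolding pg by (intro Bochner_Integration.integrable_add integrable_mult_right slice_integrable[OF G] slice_integrable[OF Gb])
  qed
  then have "(\<integral>y. slice e y (partial (0, b) G) z \<partial>lborel) + \<i> * of_real (e * (snd z \<bullet> b)) * (\<integral>y. slice e y G z \<partial>lborel) = 0"
    unfolding pg using slice_integrable[OF G] slice_integrable[OF Gb] by (simp add: Bochner_Integration.integral_add)
  then show ?thesis by (simp add: eq_neg_iff_add_eq_0)
qed

lemma PF_mulc:
  assumes G: "wbound \<rho> m G" and b: "b \<in> Basis"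
  shows "mulc b (PF e G) = PF e (dual_letter e (True, b) G)"
proof
  fix z :: "'a \<times> 'a"
  show "mulc b (PF e G) z = PF e (dual_letter e (True, b) G) z"
    using b
  proof (cases rule: Basis_prod_cases)
    case (1 b')
    have "PF e (mulc b G) z = of_real (fst z \<bullet> b') * PF e G z"
    proof -
      have "slice e y (mulc b G) z = of_real (fst z \<bullet> b') * slice e y G z" for y
        by (simp add: slice_def mulc_def 1 mult_ac)
      then show ?thesis by (simp add: PF_slice mult_ac)
    qed
    then show ?thesis using 1 by (cases z) (simp add: mulc_def)
  next
    case (2 b')
    have "(\<integral>y. slice e y (\<lambda>z. (\<i> * of_real e) * partial b G z) z \<partial>lborel) = (\<i> * of_real e) * (\<integral>y. slice e y (partial b G) z \<partial>lborel)"
      unfolding slice_def by (simp only: mult.assoc integral_mult_right_zero)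
    also have "\<dots> = of_real (e * e * (snd z \<bullet> b')) * (\<integral>y. slice e y G z \<partial>lborel)"
      using slice_parts[OF G 2(2), of z] 2 by (simp add: mult_ac)
    \<comment> \<open>One factor \<open>e\<close> comes from \<open>dual_letter\<close>, the other
      from the exponential.\<close>
    also have "e * e = 1" using e by auto
    finally show ?thesis using 2 by (cases z) (auto simp: mulc_def PF_slice nonzero_Basis)
  qed
qed

lemma PF_letter:
  assumes "wbound \<rho> m G" "snd l \<in> Basis"
  shows "letter l (PF e G) = PF e (dual_letter e l G)"
proof -
  obtain k b where "l = (k, b)" by (cases l)
  then show ?thesis using PF_partial[OF assms(1), of b] PF_mulc[OF assms(1), of b] assms(2) 
    by (cases k) (simp_all del: dual_letter.simps)
qed

text \<open>The innermost letter is moved through the transform by \<open>PF_letter\<close>, which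
  leaves a transform with a shifted weight, and shifts commute with \<open>dec\<close>. Only the
  empty word requires an estimate of an integral.\<close>

lemma PF_wbound:
  assumes "wbound \<rho> m G"
  shows "wbound (flip \<rho>) (\<lambda>i j. (2 * pi) powr (- (real DIM('a) / 2)) * (\<integral>y. wt y \<partial>(lborel :: 'a measure)) * dec r DIM('a) m i j) (PF e G)"
proof -
  let ?C = "(2 * pi) powr (- (real DIM('a) / 2)) * (\<integral>y. wt y \<partial>(lborel :: 'a measure))"
  have "cmod (word w (PF e G) z) \<le> ?C * dec r DIM('a) m (sdeg (flip \<rho>) w) (tdeg (flip \<rho>) w)" if "snd ` set w \<subseteq> Basis" for w z
    using that assms
  proof (induction w arbitrary: G m rule: rev_induct)
    case Nil
    have "cmod (\<integral>y. slice e y G z \<partial>lborel) \<le> dec r DIM('a) m 0 0 * (\<integral>y. wt y \<partial>(lborel :: 'a measure))"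
      by (rule wt_integral_bound[OF slice_measurable[OF wboundD(1)] slice_bound]) (use Nil in auto)
    then show ?case by (simp add: PF_slice norm_mult mult_left_mono mult_ac)
  next
    case (snoc l w)
    have l: "snd l \<in> Basis" and w: "snd ` set w \<subseteq> Basis" using snoc.prems by auto
    let ?m = "\<lambda>i j. if sclass (flip \<rho>) l then m (Suc i) j else m i (Suc j)"
    have "cmod (word w (PF e (dual_letter e l G)) z) \<le> ?C * dec r DIM('a) ?m (sdeg (flip \<rho>) w) (tdeg (flip \<rho>) w)"
      by (rule snoc.IH[OF w wbound_dual_letter[OF snoc.prems(2) l e]])
    then show ?case using PF_letter[OF snoc.prems(2) l] by (cases "sclass (flip \<rho>) l") (simp_all add: dec_Suc)
  qed
  then show ?thesis using PF_smooth[OF assms] unfolding wbound_def by blast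
qed

end

text \<open>Decay in all coordinates at once with an unspecified constant: enough for integrability
  and Fubini, where the form of the weight does not matter.\<close>

lemma wbound_wt:
  fixes G :: "'a::euclidean_space \<Rightarrow> complex"
  assumes "wbound \<rho> m G"
  obtains B where "\<And>z. cmod (G z) \<le> B * wt z"
proof -
  have "\<exists>B. \<forall>z. (\<Prod>b\<leftarrow>bs. 1 + (z \<bullet> b)\<^sup>2) * cmod (G z) \<le> B" if "set bs \<subseteq> Basis" for bs
    using assms that
  proof (induction bs arbitrary: m G)
    case Nil
    then show ?case using wboundD(2)[of \<rho> m G "[]"] by auto
  next
    case (Cons b bs)
    let ?X = "letter (True, b)" and ?P = "\<lambda>z. \<Prod>b\<leftarrow>bs. 1 + (z \<bullet> b)\<^sup>2"
    have b: "snd (True, b) \<in> Basis" and bs: "set bs \<subseteq> Basis" using Cons.prems by auto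
    obtain B where B: "\<And>z. ?P z * cmod (G z) \<le> B" using Cons.IH[OF Cons.prems(1) bs] by blast
    obtain B' where B': "\<And>z. ?P z * cmod (?X (?X G) z) \<le> B'"
      using Cons.IH[OF wbound_letter[OF wbound_letter[OF Cons.prems(1) b] b] bs] by blast
    have "(\<Prod>b\<leftarrow>b # bs. 1 + (z \<bullet> b)\<^sup>2) * cmod (G z) = ?P z * cmod (G z) + ?P z * cmod (?X (?X G) z)" for z
      by (simp add: mulc_def norm_mult power2_eq_square algebra_simps)
    then have "(\<Prod>b\<leftarrow>b # bs. 1 + (z \<bullet> b)\<^sup>2) * cmod (G z) \<le> B + B'" for z
      using add_mono[OF B B'] by metis
    then show ?case by blast
  qed
  from this[of basis_list] obtain B where B: "\<And>z. (\<Prod>b\<leftarrow>basis_list. 1 + (z \<bullet> b)\<^sup>2) * cmod (G z) \<le> B"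
    by (auto simp: basis_list(2))
  then have "cmod (G z) \<le> B * wt z" for z by (intro wt_boundI)
  then show ?thesis by (rule that)
qed

lemma wt_Pair: "wt (x :: 'a::euclidean_space, y :: 'a) = wt x * wt y"
  unfolding wt_def Basis_prod_def
  by (subst prod.union_disjoint) (auto simp: prod.reindex inj_on_def)

lemma wt_le_1: "wt y \<le> 1"
proof -
  have "inverse (1 + (y \<bullet> b)\<^sup>2) \<le> 1" for b by (intro inverse_le_1_iff[THEN iffD2] disjI2) simp
  then show ?thesis unfolding wt_def by (intro prod_le_1) auto
qed

lemma wbound_slice_integrable:
  fixes G :: "'a::euclidean_space \<times> 'a \<Rightarrow> complex"
  assumes "wbound \<rho> m G" shows "integrable lborel (\<lambda>y. G (x, y))"
proof -
  obtain B where B: "\<And>z. cmod (G z) \<le> B * wt z" using wbound_wt[OF assms] by blast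
  show ?thesis
  proof (rule integrable_wt_bound)
    show "(\<lambda>y. G (x, y)) \<in> borel_measurable borel"
      by (intro borel_measurable_continuous_onI continuous_on_compose2[OF smooth_continuous_on[OF wboundD(1)[OF assms]]] continuous_intros) auto
    show "cmod (G (x, y)) \<le> (B * wt x) * wt y" for y using B[of "(x, y)"] by (simp add: wt_Pair)
  qed
qed

context partial_fourier
begin

lemma flip: "partial_fourier (flip \<rho>) (\<not> r) e" "partial_fourier (flip \<rho>) (\<not> r) (- e)" "partial_fourier \<rho> r (- e)"
  using \<rho> e by (auto simp: partial_fourier_def flip_def nonzero_Basis)

text \<open>For fixed \<open>x\<close> this is Fourier inversion in the second variable. The
  integrability of the transform that inversion demands is a consequence of
  \<open>PF_wbound\<close>.\<close>

lemma PF_inverse: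
  assumes G: "wbound \<rho> m G"
  shows "PF (- e) (PF e G) = G"
proof
  fix z :: "'a \<times> 'a"
  obtain x y where z: "z = (x, y)" by (cases z)
  define c where "c = complex_of_real ((2 * pi) powr (- (real DIM('a) / 2)))"
  have c0: "c \<noteq> 0" by (simp add: c_def)
  have "(2 * pi) powr (- (real DIM('a) / 2)) * (2 * pi) powr (- (real DIM('a) / 2)) * (2 * pi) ^ DIM('a) = (1::real)"
  proof -
    have "(2 * pi) ^ DIM('a) = (2 * pi) powr (real DIM('a))" by (simp add: powr_realpow)
    then show ?thesis by (simp only: powr_add[symmetric]) simp
  qed
  then have cc: "c * c * of_real ((2 * pi) ^ DIM('a)) = 1"
    unfolding c_def by (metis of_real_1 of_real_mult)
  define g where "g = (\<lambda>y. G (x, y))"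
  define h where "h = (\<lambda>\<xi>. \<integral>y. g y * cis (y \<bullet> \<xi>) \<partial>lborel)"
  have sG: "smooth G" by (rule wboundD(1)[OF G])
  have cont: "continuous_on UNIV g"
    unfolding g_def by (intro continuous_on_compose2[OF smooth_continuous_on[OF sG]] continuous_intros) auto
  \<comment> \<open>The sign moves from the exponential to the argument, leaving a transform with
    the fixed sign of \<open>Fourier_inversion\<close>; the reflection preserves Lebesgue
    measure.\<close>
  have PFh: "PF e G (x, \<xi>) = c * h (e *\<^sub>R \<xi>)" for \<xi>
    by (simp add: PF_def c_def g_def h_def)
  have "integrable lborel (\<lambda>\<xi>. PF e G (x, \<xi>))"
    by (rule wbound_slice_integrable[OF PF_wbound[OF G]])
  then have "integrable lborel (\<lambda>\<xi>. (1 / c) * (c * h (e *\<^sub>R \<xi>)))"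
    unfolding PFh by (rule integrable_mult_right)
  then have he: "integrable lborel (\<lambda>\<xi>. h (e *\<^sub>R \<xi>))" using c0 by simp
  have e0: "e \<noteq> 0" and ee: "e * e = 1" "\<bar>e\<bar> = 1" using e by auto
  have "integrable lborel (\<lambda>\<xi>. h (e *\<^sub>R (0 + e *\<^sub>R \<xi>)))"
    by (rule integral_lborel_affine(2)[OF _ e0 he]) (use borel_measurable_integrable[OF he] in simp)
  then have hi: "integrable lborel h" by (simp add: ee)
  have hm [measurable]: "h \<in> borel_measurable borel" using borel_measurable_integrable[OF hi] by simp
  obtain B where B: "\<And>z. cmod (G z) \<le> B * wt z" using wbound_wt[OF G] by blast
  have B0: "cmod (g y) \<le> \<bar>B\<bar>" for y
  proof -
    have "cmod (g y) \<le> B * wt (x, y)" unfolding g_def by (rule B)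
    also have "\<dots> \<le> \<bar>B\<bar> * 1" using wt_le_1[of "(x, y)"] wt_pos[of "(x, y)"] by (intro mult_mono) auto
    finally show ?thesis by simp
  qed
  have "(\<integral>\<xi>. h \<xi> * cis (- (y \<bullet> \<xi>)) \<partial>lborel) = of_real ((2 * pi) ^ DIM('a)) * g y"
    unfolding h_def
    by (rule Fourier_inversion[OF cont B0]) (use wbound_slice_integrable[OF G] hi in \<open>simp_all add: g_def h_def\<close>)
  moreover have "(\<integral>\<xi>. h \<xi> * cis (- (y \<bullet> \<xi>)) \<partial>lborel) = \<bar>e\<bar> ^ DIM('a) *\<^sub>R (\<integral>\<xi>. h (0 + e *\<^sub>R \<xi>) * cis (- (y \<bullet> (0 + e *\<^sub>R \<xi>))) \<partial>lborel)"
    by (rule integral_lborel_affine(1)[OF _ e0]) simp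
  ultimately have inv: "(\<integral>\<xi>. h (e *\<^sub>R \<xi>) * cis (- (e * (y \<bullet> \<xi>))) \<partial>lborel) = of_real ((2 * pi) ^ DIM('a)) * g y"
    by (simp add: ee)
  have "PF (- e) (PF e G) (x, y) = c * (\<integral>\<xi>. c * (h (e *\<^sub>R \<xi>) * cis (- (e * (y \<bullet> \<xi>)))) \<partial>lborel)"
    unfolding PF_def[of "- e"] c_def[symmetric] fst_conv snd_conv PFh by (simp add: mult.assoc inner_commute)
  also have "\<dots> = c * (c * (of_real ((2 * pi) ^ DIM('a)) * g y))"
    by (simp only: integral_mult_right_zero inv)
  also have "\<dots> = g y" using cc by (metis mult.assoc mult_1)
  finally show "PF (- e) (PF e G) z = G z" by (simp add: z g_def)
qed

text \<open>The kernel \<open>cis (e * (y \<bullet> \<xi>))\<close> is symmetric and the pairing is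
  bilinear, so for each fixed \<open>x\<close> Fubini exchanges the two functions and keeps the sign
  \<open>e\<close>.\<close>

lemma PF_transpose:
  assumes G: "wbound \<rho> m G" and A: "wbound \<rho>' m' A" and pf: "partial_fourier \<rho>' r' e"
  shows "(\<integral>z. A z * PF e G z \<partial>lborel) = (\<integral>z. PF e A z * G z \<partial>lborel)"
proof -
  define c where "c = complex_of_real ((2 * pi) powr (- (real DIM('a) / 2)))"
  have sG: "smooth G" and sA: "smooth A" using wboundD(1)[OF G] wboundD(1)[OF A] .
  obtain B where B: "\<And>z. cmod (G z) \<le> B * wt z" using wbound_wt[OF G] by blast
  obtain C where C: "\<And>z. cmod (A z) \<le> C * wt z" using wbound_wt[OF A] by blast
  have prod: "integrable lborel (\<lambda>z. F z * H z)" if F: "wbound \<rho>1 m1 F" and H: "wbound \<rho>2 m2 H" for F H :: "'a \<times> 'a \<Rightarrow> complex" and \<rho>1 \<rho>2 m1 m2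
  proof -
    obtain B where B: "\<And>z. cmod (F z) \<le> B * wt z" using wbound_wt[OF F] by blast
    show ?thesis
    proof (rule integrable_wt_bound)
      show "(\<lambda>z. F z * H z) \<in> borel_measurable borel"
        using smooth_measurable[OF wboundD(1)[OF F]] smooth_measurable[OF wboundD(1)[OF H]] by simp
      show "cmod (F z * H z) \<le> (B * m2 0 0) * wt z" for z
      proof -
        have "cmod (H z) \<le> m2 0 0" using wboundD(2)[OF H, of "[]" z] by simp
        then have "cmod (F z) * cmod (H z) \<le> (B * wt z) * m2 0 0" by (intro mult_mono B) (auto intro: order_trans[OF norm_ge_zero B])
        then show ?thesis by (simp add: norm_mult mult_ac)
      qed
    qed
  qed
  have fub: "(\<integral>z. F z \<partial>lborel) = (\<integral>x. \<integral>y. F (x, y) \<partial>lborel \<partial>lborel)" if "integrable lborel F" for F :: "'a \<times> 'a \<Rightarrow> complex"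
  proof -
    have "integrable (lborel \<Otimes>\<^sub>M lborel) F" using that by (simp only: lborel_prod)
    from lborel_pair.integral_fst'[OF this] show ?thesis by (simp only: lborel_prod)
  qed
  have "(\<integral>\<xi>. A (x, \<xi>) * PF e G (x, \<xi>) \<partial>lborel) = (\<integral>y. PF e A (x, y) * G (x, y) \<partial>lborel)" for x
  proof -
    let ?F = "\<lambda>\<xi> y. A (x, \<xi>) * (G (x, y) * cis (e * (y \<bullet> \<xi>)))"
    have "integrable lborel (case_prod ?F)"
    proof (rule integrable_wt_bound)
      have "continuous_on UNIV (\<lambda>p. A (x, fst p) * (G (x, snd p) * cis (e * (snd p \<bullet> fst p))))"
        by (intro continuous_intros continuous_on_compose2[OF smooth_continuous_on[OF sA, of UNIV]] continuous_on_compose2[OF smooth_continuous_on[OF sG, of UNIV]]) auto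
      then show "case_prod ?F \<in> borel_measurable borel"
        by (simp add: case_prod_unfold borel_measurable_continuous_onI)
      show "cmod (case_prod ?F p) \<le> (C * B * wt x * wt x) * wt p" for p
      proof (cases p)
        case (Pair \<xi> y)
        have "cmod (A (x, \<xi>)) * cmod (G (x, y)) \<le> (C * wt (x, \<xi>)) * (B * wt (x, y))"
          by (intro mult_mono B C) (auto intro: order_trans[OF norm_ge_zero C])
        then show ?thesis using Pair by (simp add: norm_mult wt_Pair mult_ac)
      qed
    qed
    then have F: "integrable (lborel \<Otimes>\<^sub>M lborel) (case_prod ?F)" by (simp only: lborel_prod)
    have "(\<integral>\<xi>. A (x, \<xi>) * PF e G (x, \<xi>) \<partial>lborel) = c * (\<integral>\<xi>. \<integral>y. ?F \<xi> y \<partial>lborel \<partial>lborel)"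
      by (simp add: PF_def c_def[symmetric] mult.left_commute)
    also have "\<dots> = c * (\<integral>y. \<integral>\<xi>. ?F \<xi> y \<partial>lborel \<partial>lborel)"
      using lborel_pair.Fubini_integral[OF F] by simp
    also have "\<dots> = c * (\<integral>y. (\<integral>\<xi>. A (x, \<xi>) * cis (e * (\<xi> \<bullet> y)) \<partial>lborel) * G (x, y) \<partial>lborel)"
    proof -
      have "(\<integral>\<xi>. ?F \<xi> y \<partial>lborel) = (\<integral>\<xi>. (A (x, \<xi>) * cis (e * (\<xi> \<bullet> y))) * G (x, y) \<partial>lborel)" for y
        by (intro Bochner_Integration.integral_cong refl) (simp add: inner_commute)
      then show ?thesis by (simp only: integral_mult_left_zero)
    qed
    also have "\<dots> = (\<integral>y. PF e A (x, y) * G (x, y) \<partial>lborel)"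
      by (simp add: PF_def c_def[symmetric] mult.assoc)
    finally show ?thesis .
  qed
  then show ?thesis
    by (subst (1 2) fub) (simp_all only: prod[OF A PF_wbound[OF G]] prod[OF partial_fourier.PF_wbound[OF pf A] G])
qed

end

section \<open>Averages over linear substitutions\<close>

abbreviation isotropic :: "'a \<Rightarrow> bool" where "isotropic \<equiv> \<lambda>_. True"

lemma wbound_lincomb:
  assumes f: "wbound \<rho> m f" and g: "wbound \<rho> m g" and "cmod \<alpha> \<le> R" "cmod \<beta> \<le> R"
  shows "wbound \<rho> (\<lambda>i j. 2 * R * m i j) (\<lambda>z. \<alpha> * f z + \<beta> * g z)"
  unfolding wbound_def
proof (intro conjI allI impI)
  note s = wboundD(1)[OF f] wboundD(1)[OF g]
  show "smooth (\<lambda>z. \<alpha> * f z + \<beta> * g z)" by (intro smooth_add smooth_cmult s)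
  fix w :: "(bool \<times> 'a) list" and z assume w: "snd ` set w \<subseteq> Basis"
  have "cmod (word w (\<lambda>z. \<alpha> * f z + \<beta> * g z) z) \<le> cmod \<alpha> * cmod (word w f z) + cmod \<beta> * cmod (word w g z)"
    by (simp add: word_add word_cmult smooth_cmult s w norm_triangle_le norm_mult)
  also have "\<dots> \<le> R * m (sdeg \<rho> w) (tdeg \<rho> w) + R * m (sdeg \<rho> w) (tdeg \<rho> w)"
    using order_trans[OF norm_ge_zero assms(3)] by (intro add_mono mult_mono assms wboundD(2)[OF f w] wboundD(2)[OF g w]) auto
  finally show "cmod (word w (\<lambda>z. \<alpha> * f z + \<beta> * g z) z) \<le> 2 * R * m (sdeg \<rho> w) (tdeg \<rho> w)" by simp
qed

text \<open>Both the kernel of \<open>W\<^sub>t\<close> (a constant family) and the averaged shears are averages over \<open>\<tau> \<in> [0, 1]\<close>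
  of a function composed with the matrix \<open>(a, b; c, d)\<close>, whose inverse is \<open>(a', b'; c', d')\<close>.\<close>

locale linear_family =
  fixes a b c d a' b' c' d' :: "real \<Rightarrow> real" and R :: real
  assumes cont: "continuous_on {0..1} a" "continuous_on {0..1} b" "continuous_on {0..1} c" "continuous_on {0..1} d"
      "continuous_on {0..1} a'" "continuous_on {0..1} b'" "continuous_on {0..1} c'" "continuous_on {0..1} d'"
    and R: "\<And>\<tau>. \<tau> \<in> {0..1} \<Longrightarrow> \<bar>a \<tau>\<bar> \<le> R \<and> \<bar>b \<tau>\<bar> \<le> R \<and> \<bar>c \<tau>\<bar> \<le> R \<and> \<bar>d \<tau>\<bar> \<le> R \<and>
        \<bar>a' \<tau>\<bar> \<le> R \<and> \<bar>b' \<tau>\<bar> \<le> R \<and> \<bar>c' \<tau>\<bar> \<le> R \<and> \<bar>d' \<tau>\<bar> \<le> R"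
    and inv: "\<And>\<tau>. a' \<tau> * a \<tau> + b' \<tau> * c \<tau> = 1" "\<And>\<tau>. a' \<tau> * b \<tau> + b' \<tau> * d \<tau> = 0"
      "\<And>\<tau>. c' \<tau> * a \<tau> + d' \<tau> * c \<tau> = 0" "\<And>\<tau>. c' \<tau> * b \<tau> + d' \<tau> * d \<tau> = 1"
begin

definition lin :: "real \<Rightarrow> 'a::euclidean_space \<times> 'a \<Rightarrow> 'a \<times> 'a" where
  "lin \<tau> z = (a \<tau> *\<^sub>R fst z + b \<tau> *\<^sub>R snd z, c \<tau> *\<^sub>R fst z + d \<tau> *\<^sub>R snd z)"

text \<open>A derivative of the composition with \<open>lin\<close> takes its coefficients from a
  column of the matrix, while a coordinate of \<open>z\<close> expressed through
  \<open>lin \<tau> z\<close> takes them from a row of the inverse. Hence the inverse, too, is part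
  of the locale and bounded by \<open>R\<close>.\<close>

definition coef1 :: "bool \<Rightarrow> bool \<Rightarrow> real \<Rightarrow> real" where
  "coef1 k first = (if k then if first then a' else c' else if first then a else b)"
definition coef2 :: "bool \<Rightarrow> bool \<Rightarrow> real \<Rightarrow> real" where
  "coef2 k first = (if k then if first then b' else d' else if first then c else d)"

text \<open>The family whose average is the letter \<open>l\<close> applied to the average of \<open>G\<close>.  One of the two components
  of \<open>snd l\<close> vanishes, so their sum is the direction of \<open>l\<close>.\<close>

definition pull_letter :: "bool \<times> 'a::euclidean_space \<times> 'a \<Rightarrow> (real \<Rightarrow> 'a \<times> 'a \<Rightarrow> complex) \<Rightarrow> real \<Rightarrow> 'a \<times> 'a \<Rightarrow> complex" where
  "pull_letter l G = (\<lambda>\<tau> z. of_real (coef1 (fst l) (snd (snd l) = 0) \<tau>) * letter (fst l, (fst (snd l) + snd (snd l), 0)) (G \<tau>) z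
     + of_real (coef2 (fst l) (snd (snd l) = 0) \<tau>) * letter (fst l, (0, fst (snd l) + snd (snd l))) (G \<tau>) z)"

definition Avg :: "(real \<Rightarrow> 'a::euclidean_space \<times> 'a \<Rightarrow> complex) \<Rightarrow> 'a \<times> 'a \<Rightarrow> complex" where
  "Avg G = (\<lambda>z. \<integral>\<tau>. indicator {0..1} \<tau> *\<^sub>R G \<tau> (lin \<tau> z) \<partial>lborel)"

text \<open>Uniform bounds in \<tau>, together with joint continuity of all words, so that the
  integral over \<tau> still exists after any number of letters.\<close>

definition fam :: "(nat \<Rightarrow> nat \<Rightarrow> real) \<Rightarrow> (real \<Rightarrow> 'a::euclidean_space \<times> 'a \<Rightarrow> complex) \<Rightarrow> bool" where
  "fam m G \<longleftrightarrow> (\<forall>\<tau>\<in>{0..1}. wbound isotropic m (G \<tau>)) \<and>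
     (\<forall>w. snd ` set w \<subseteq> Basis \<longrightarrow> continuous_on ({0..1} \<times> UNIV) (\<lambda>p. word w (G (fst p)) (snd p)))"

lemma coef: 
  "continuous_on {0..1} (coef1 k f)" "continuous_on {0..1} (coef2 k f)"
  "\<tau> \<in> {0..1} \<Longrightarrow> \<bar>coef1 k f \<tau>\<bar> \<le> R" "\<tau> \<in> {0..1} \<Longrightarrow> \<bar>coef2 k f \<tau>\<bar> \<le> R"
  using cont R unfolding coef1_def coef2_def by auto

lemma bounded_linear_lin: "bounded_linear (lin \<tau>)"
  unfolding lin_def[abs_def]
  by (intro bounded_linear_Pair bounded_linear_add bounded_linear_const_scaleR bounded_linear_fst bounded_linear_snd)

lemma pull_basis:
  assumes "snd l \<in> (Basis :: ('a::euclidean_space \<times> 'a) set)"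
  shows "(fst (snd l) + snd (snd l), 0) \<in> (Basis :: ('a \<times> 'a) set)" "(0, fst (snd l) + snd (snd l)) \<in> (Basis :: ('a \<times> 'a) set)"
  using assms by (auto elim!: Basis_prod_cases)

lemma sclass_iso [simp]: "sclass isotropic l = fst l"
  by (simp add: sclass_def)

lemma wbound_pull:
  fixes G :: "real \<Rightarrow> 'a::euclidean_space \<times> 'a \<Rightarrow> complex"
  assumes G: "wbound isotropic m (G \<tau>)" and l: "snd l \<in> Basis" and \<tau>: "\<tau> \<in> {0..1}"
  shows "wbound isotropic (\<lambda>i j. 2 * R * (if fst l then m (Suc i) j else m i (Suc j))) (pull_letter l G \<tau>)"
  unfolding pull_letter_def
  using wbound_letter[OF G, of "(fst l, (fst (snd l) + snd (snd l), 0))"] wbound_letter[OF G, of "(fst l, (0, fst (snd l) + snd (snd l)))"]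
  by (intro wbound_lincomb) (use pull_basis[OF l] coef(3,4)[OF \<tau>] in auto)

lemma fam_pull:
  fixes G :: "real \<Rightarrow> 'a::euclidean_space \<times> 'a \<Rightarrow> complex"
  assumes G: "fam m G" and l: "snd l \<in> Basis"
  shows "fam (\<lambda>i j. 2 * R * (if fst l then m (Suc i) j else m i (Suc j))) (pull_letter l G)"
  unfolding fam_def
proof (intro conjI ballI allI impI)
  fix \<tau> :: real assume "\<tau> \<in> {0..1}"
  then show "wbound isotropic (\<lambda>i j. 2 * R * (if fst l then m (Suc i) j else m i (Suc j))) (pull_letter l G \<tau>)"
    using G l unfolding fam_def by (intro wbound_pull) auto
next
  fix w :: "(bool \<times> 'a \<times> 'a) list" assume w: "snd ` set w \<subseteq> Basis"
  let ?l1 = "(fst l, (fst (snd l) + snd (snd l), 0))" and ?l2 = "(fst l, (0, fst (snd l) + snd (snd l)))"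
  \<comment> \<open>A word applied to the pulled family is read as a longer word applied to
    \<open>G\<close>, the new letter standing innermost; this is why \<open>fam\<close> speaks of
    all words.\<close>
  have c: "continuous_on ({0..1} \<times> UNIV) (\<lambda>p. word (w @ [l']) (G (fst p)) (snd p))" if "snd l' \<in> Basis" for l'
  proof -
    have "snd ` set (w @ [l']) \<subseteq> Basis" using w that by auto
    with G show ?thesis unfolding fam_def by blast
  qed
  have "continuous_on ({0..1} \<times> UNIV) (\<lambda>p :: real \<times> 'a \<times> 'a. of_real (coef1 (fst l) (snd (snd l) = 0) (fst p)) * word (w @ [?l1]) (G (fst p)) (snd p)
     + of_real (coef2 (fst l) (snd (snd l) = 0) (fst p)) * word (w @ [?l2]) (G (fst p)) (snd p))"
    by (intro continuous_intros c continuous_on_compose2[OF coef(1)] continuous_on_compose2[OF coef(2)]) (use pull_basis[OF l] in auto)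
  moreover have "word w (pull_letter l G \<tau>) z = of_real (coef1 (fst l) (snd (snd l) = 0) \<tau>) * word (w @ [?l1]) (G \<tau>) z
     + of_real (coef2 (fst l) (snd (snd l) = 0) \<tau>) * word (w @ [?l2]) (G \<tau>) z" if \<tau>: "\<tau> \<in> {0..1}" for \<tau> z
  proof -
    have "smooth (G \<tau>)" using G \<tau> unfolding fam_def by (auto dest: wboundD(1))
    then have s: "smooth (letter ?l1 (G \<tau>))" "smooth (letter ?l2 (G \<tau>))" using pull_basis[OF l] by (auto intro!: smooth_letter simp del: letter.simps)
    show ?thesis
      unfolding pull_letter_def by (subst word_add) (use s w in \<open>auto intro: smooth_cmult simp: word_cmult simp del: letter.simps\<close>)
  qed
  ultimately show "continuous_on ({0..1} \<times> UNIV) (\<lambda>p. word w (pull_letter l G (fst p)) (snd p))"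
    by (subst continuous_on_cong[OF refl]) auto
qed

lemma pull_partial:
  fixes G :: "real \<Rightarrow> 'a::euclidean_space \<times> 'a \<Rightarrow> complex"
  assumes G: "smooth (G \<tau>)" and v: "v \<in> Basis"
  shows "partial v (\<lambda>z. G \<tau> (lin \<tau> z)) = (\<lambda>z. pull_letter (False, v) G \<tau> (lin \<tau> z))"
proof
  fix z :: "'a \<times> 'a"
  have "((\<lambda>z. G \<tau> (lin \<tau> z)) has_derivative (\<lambda>v. partial (lin \<tau> v) (G \<tau>) (lin \<tau> z))) (at z)"
    by (rule has_derivative_compose[OF bounded_linear_imp_has_derivative[OF bounded_linear_lin] has_derivative_partial[OF smooth_differentiable[OF G]]])
  then have "partial v (\<lambda>z. G \<tau> (lin \<tau> z)) z = partial (lin \<tau> v) (G \<tau>) (lin \<tau> z)"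
    by (rule has_derivative_imp_partial)
  also have "lin \<tau> v = coef1 False (snd v = 0) \<tau> *\<^sub>R (fst v + snd v, 0) + coef2 False (snd v = 0) \<tau> *\<^sub>R (0, fst v + snd v)"
    using v by (cases rule: Basis_prod_cases) (auto simp: lin_def coef1_def coef2_def nonzero_Basis)
  also have "partial \<dots> (G \<tau>) (lin \<tau> z) = pull_letter (False, v) G \<tau> (lin \<tau> z)"
  proof -
    interpret linear "\<lambda>v. partial v (G \<tau>) (lin \<tau> z)"
      using has_derivative_partial[OF smooth_differentiable[OF G]] by (rule has_derivative_linear)
    show ?thesis unfolding pull_letter_def by (simp only: add scale) (simp add: scaleR_conv_of_real)
  qed
  finally show "partial v (\<lambda>z. G \<tau> (lin \<tau> z)) z = pull_letter (False, v) G \<tau> (lin \<tau> z)" .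
qed

lemma pull_mulc:
  fixes G :: "real \<Rightarrow> 'a::euclidean_space \<times> 'a \<Rightarrow> complex"
  assumes v: "v \<in> Basis"
  shows "mulc v (\<lambda>z. G \<tau> (lin \<tau> z)) = (\<lambda>z. pull_letter (True, v) G \<tau> (lin \<tau> z))"
proof
  fix z :: "'a \<times> 'a"
  let ?w = "fst v + snd v" and ?X = "lin \<tau> z"
  have "z \<bullet> v = coef1 True (snd v = 0) \<tau> * (fst ?X \<bullet> ?w) + coef2 True (snd v = 0) \<tau> * (snd ?X \<bullet> ?w)"
    using v
  proof (cases rule: Basis_prod_cases)
    case (1 u)
    have "a' \<tau> * (a \<tau> * (fst z \<bullet> u) + b \<tau> * (snd z \<bullet> u)) + b' \<tau> * (c \<tau> * (fst z \<bullet> u) + d \<tau> * (snd z \<bullet> u)) =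
      (a' \<tau> * a \<tau> + b' \<tau> * c \<tau>) * (fst z \<bullet> u) + (a' \<tau> * b \<tau> + b' \<tau> * d \<tau>) * (snd z \<bullet> u)" by (simp add: algebra_simps)
    then show ?thesis using 1 inv by (cases z) (simp add: lin_def coef1_def coef2_def inner_add_left)
  next
    case (2 u)
    have "c' \<tau> * (a \<tau> * (fst z \<bullet> u) + b \<tau> * (snd z \<bullet> u)) + d' \<tau> * (c \<tau> * (fst z \<bullet> u) + d \<tau> * (snd z \<bullet> u)) =
      (c' \<tau> * a \<tau> + d' \<tau> * c \<tau>) * (fst z \<bullet> u) + (c' \<tau> * b \<tau> + d' \<tau> * d \<tau>) * (snd z \<bullet> u)" by (simp add: algebra_simps)
    then show ?thesis using 2 inv by (cases z) (simp add: lin_def coef1_def coef2_def inner_add_left nonzero_Basis)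
  qed
  then have "complex_of_real (z \<bullet> v) = of_real (coef1 True (snd v = 0) \<tau>) * of_real (fst ?X \<bullet> ?w) + of_real (coef2 True (snd v = 0) \<tau>) * of_real (snd ?X \<bullet> ?w)"
    by simp
  then show "mulc v (\<lambda>z. G \<tau> (lin \<tau> z)) z = pull_letter (True, v) G \<tau> (lin \<tau> z)"
    unfolding pull_letter_def by (cases ?X) (simp add: mulc_def algebra_simps)
qed

lemma smooth_pull:
  fixes G :: "real \<Rightarrow> 'a::euclidean_space \<times> 'a \<Rightarrow> complex"
  assumes "smooth (G \<tau>)" shows "smooth (\<lambda>z. G \<tau> (lin \<tau> z))"
proof (rule smooth_coinduct[where Q = "{\<lambda>z. G \<tau> (lin \<tau> z) | G. smooth (G \<tau>)}"])
  fix g :: "'a \<times> 'a \<Rightarrow> complex" and x assume "g \<in> {\<lambda>z. G \<tau> (lin \<tau> z) | G. smooth (G \<tau>)}"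
  then obtain G where G: "smooth (G \<tau>)" "g = (\<lambda>z. G \<tau> (lin \<tau> z))" by auto
  show "g differentiable (at x)" unfolding G(2) differentiable_def
    using has_derivative_compose[OF bounded_linear_imp_has_derivative[OF bounded_linear_lin] has_derivative_partial[OF smooth_differentiable[OF G(1)]]] by blast
next
  fix g :: "'a \<times> 'a \<Rightarrow> complex" and v :: "'a \<times> 'a" assume "g \<in> {\<lambda>z. G \<tau> (lin \<tau> z) | G. smooth (G \<tau>)}" and v: "v \<in> Basis"
  then obtain G where G: "smooth (G \<tau>)" "g = (\<lambda>z. G \<tau> (lin \<tau> z))" by auto
  have "snd (False, v) \<in> Basis" using v by simp
  then have "smooth (pull_letter (False, v) G \<tau>)"
    unfolding pull_letter_def using pull_basis[of "(False, v)"] by (intro smooth_add smooth_cmult smooth_letter G) auto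
  then show "partial v g \<in> {\<lambda>z. G \<tau> (lin \<tau> z) | G. smooth (G \<tau>)}"
    unfolding G(2) pull_partial[of G \<tau> v, OF G(1) v] by blast
qed (use assms in blast)

lemma Avg_integrable:
  fixes G :: "real \<Rightarrow> 'a::euclidean_space \<times> 'a \<Rightarrow> complex"
  assumes G: "fam m G" shows "integrable lborel (\<lambda>\<tau>. indicator {0..1} \<tau> *\<^sub>R G \<tau> (lin \<tau> z))"
proof -
  have c: "continuous_on ({0..1} \<times> UNIV) (\<lambda>p. G (fst p) (snd p))" using G unfolding fam_def by (auto dest: spec[of _ "[]"])
  have "continuous_on {0..1} (\<lambda>\<tau>. (\<tau>, lin \<tau> z))" unfolding lin_def by (intro continuous_intros cont)
  from continuous_on_compose2[OF c this] have "continuous_on {0..1} (\<lambda>\<tau>. G \<tau> (lin \<tau> z))" by auto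
  from borel_integrable_atLeastAtMost'[OF this] show ?thesis by (simp add: set_integrable_def)
qed

lemma Avg_derivative:
  fixes G :: "real \<Rightarrow> 'a::euclidean_space \<times> 'a \<Rightarrow> complex"
  assumes G: "fam m G"
  shows "(Avg G has_derivative (\<lambda>v. \<Sum>b\<in>Basis. of_real (v \<bullet> b) * Avg (pull_letter (False, b) G) z)) (at z)"
proof -
  let ?D = "\<lambda>b. pull_letter (False, b)"
  define m1 where "m1 = (\<lambda>i j. 2 * R * m i (Suc j))"
  define m2 where "m2 = (\<lambda>i j. 2 * R * m1 i (Suc j))"
  have D1: "fam m1 (?D b G)" if "b \<in> Basis" for b using fam_pull[OF G, of "(False, b)"] that by (simp add: m1_def)
  have D2: "fam m2 (?D c (?D b G))" if "b \<in> Basis" "c \<in> Basis" for b c using fam_pull[OF D1[OF that(1)], of "(False, c)"] that by (simp add: m2_def)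
  have sm: "smooth (G \<tau>)" if "\<tau> \<in> {0..1}" "fam m G" for \<tau> G m using that unfolding fam_def by (auto dest: wboundD(1))
  show ?thesis unfolding Avg_def
  proof (rule has_derivative_integral)
    show "integrable lborel (\<lambda>\<tau>. indicator {0..1} \<tau> *\<^sub>R G \<tau> (lin \<tau> z))" for z by (rule Avg_integrable[OF G])
    show "integrable lborel (\<lambda>\<tau>. indicator {0..1} \<tau> *\<^sub>R ?D b G \<tau> (lin \<tau> z))" if "b \<in> Basis" for b by (rule Avg_integrable[OF D1[OF that]])
    show "integrable lborel (\<lambda>\<tau>. indicator {0..1::real} \<tau> * (\<Sum>b\<in>(Basis :: ('a \<times> 'a) set). \<Sum>c\<in>(Basis :: ('a \<times> 'a) set). m2 0 0))"
      by (intro integrable_mult_left) simp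
    show "cmod (indicator {0..1} \<tau> *\<^sub>R G \<tau> (lin \<tau> (z + v)) - indicator {0..1} \<tau> *\<^sub>R G \<tau> (lin \<tau> z)
        - (\<Sum>b\<in>Basis. of_real (v \<bullet> b) * indicator {0..1} \<tau> *\<^sub>R ?D b G \<tau> (lin \<tau> z)))
      \<le> (norm v)\<^sup>2 * (indicator {0..1::real} \<tau> * (\<Sum>b\<in>(Basis :: ('a \<times> 'a) set). \<Sum>c\<in>(Basis :: ('a \<times> 'a) set). m2 0 0))" for \<tau> v
    proof (cases "\<tau> \<in> {0..1}")
      case \<tau>: True
      let ?g = "\<lambda>z. G \<tau> (lin \<tau> z)"
      have sg: "smooth ?g" by (rule smooth_pull[of G \<tau>, OF sm[OF \<tau> G]])
      have "cmod (?g (z + v) - ?g z - (\<Sum>b\<in>Basis. of_real (v \<bullet> b) * partial b ?g z)) \<le> (norm v)\<^sup>2 * (\<Sum>b\<in>(Basis :: ('a \<times> 'a) set). \<Sum>c\<in>(Basis :: ('a \<times> 'a) set). m2 0 0)"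
      proof (rule smooth_taylor_bound[OF sg])
        fix b c :: "'a \<times> 'a" and z assume b: "b \<in> Basis" and c: "c \<in> Basis"
        have "partial c (partial b ?g) = (\<lambda>z. ?D c (?D b G) \<tau> (lin \<tau> z))"
          by (simp only: pull_partial[of G, OF sm[OF \<tau> G] b] pull_partial[of "?D b G", OF sm[OF \<tau> D1[OF b]] c])
        moreover have "cmod (?D c (?D b G) \<tau> (lin \<tau> z)) \<le> m2 0 0"
          using D2[OF b c] \<tau> wboundD(2)[of isotropic m2 "?D c (?D b G) \<tau>" "[]" "lin \<tau> z"] unfolding fam_def by auto
        ultimately show "cmod (partial c (partial b ?g) z) \<le> m2 0 0" by simp
      qed
      moreover have "(\<Sum>b\<in>Basis. of_real (v \<bullet> b) * partial b ?g z) = (\<Sum>b\<in>Basis. of_real (v \<bullet> b) * ?D b G \<tau> (lin \<tau> z))"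
        by (intro sum.cong refl) (simp only: pull_partial[of G, OF sm[OF \<tau> G]])
      ultimately show ?thesis using \<tau> by simp
    qed simp
  qed
qed

lemma Avg_partial:
  fixes G :: "real \<Rightarrow> 'a::euclidean_space \<times> 'a \<Rightarrow> complex"
  assumes G: "fam m G" and v: "v \<in> Basis"
  shows "partial v (Avg G) = Avg (pull_letter (False, v) G)"
proof
  fix z
  have "partial v (Avg G) z = (\<Sum>c\<in>Basis. of_real (v \<bullet> c) * Avg (pull_letter (False, c) G) z)"
    by (rule has_derivative_imp_partial[OF Avg_derivative[OF G]])
  also have "\<dots> = (\<Sum>c\<in>Basis. if c = v then Avg (pull_letter (False, v) G) z else 0)"
    using v by (intro sum.cong) (auto simp: inner_Basis)
  finally show "partial v (Avg G) z = Avg (pull_letter (False, v) G) z" using v by simp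
qed

lemma Avg_mulc:
  fixes G :: "real \<Rightarrow> 'a::euclidean_space \<times> 'a \<Rightarrow> complex"
  assumes "v \<in> Basis" shows "mulc v (Avg G) = Avg (pull_letter (True, v) G)"
proof
  fix z
  have "mulc v (Avg G) z = (\<integral>\<tau>. of_real (z \<bullet> v) * (indicator {0..1} \<tau> *\<^sub>R G \<tau> (lin \<tau> z)) \<partial>lborel)"
    by (simp only: mulc_def Avg_def integral_mult_right_zero)
  also have "\<dots> = Avg (pull_letter (True, v) G) z"
    unfolding Avg_def using fun_cong[OF pull_mulc[OF assms, of G], of _ z]
    by (intro Bochner_Integration.integral_cong refl) (simp add: mulc_def scaleR_conv_of_real mult.left_commute)
  finally show "mulc v (Avg G) z = Avg (pull_letter (True, v) G) z" .
qed

lemma Avg_letter: "fam m G \<Longrightarrow> snd l \<in> Basis \<Longrightarrow> letter l (Avg G) = Avg (pull_letter l G)"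
  by (cases l) (simp add: Avg_partial Avg_mulc)

lemma Avg_smooth:
  fixes G :: "real \<Rightarrow> 'a::euclidean_space \<times> 'a \<Rightarrow> complex"
  assumes "fam m G" shows "smooth (Avg G)"
proof (rule smooth_coinduct[where Q = "{Avg G | G m. fam m G}"])
  fix g :: "'a \<times> 'a \<Rightarrow> complex" and b :: "'a \<times> 'a" assume "g \<in> {Avg G | G m. fam m G}" and b: "b \<in> Basis"
  then obtain G m where G: "fam m G" "g = Avg G" by auto
  have "snd (False, b) \<in> Basis" using b by simp
  from fam_pull[OF G(1) this] show "partial b g \<in> {Avg G | G m. fam m G}"
    using Avg_partial[OF G(1) b] G(2) by blast
next
  fix g :: "'a \<times> 'a \<Rightarrow> complex" and x assume "g \<in> {Avg G | G m. fam m G}"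
  then show "g differentiable (at x)" using Avg_derivative unfolding differentiable_def by blast
qed (use assms in auto)

text \<open>Each letter becomes two letters with coefficients of size at most \<open>R\<close>,
  hence \<open>2 * R\<close> per letter. The interval has length 1, so the averaging itself costs
  nothing.\<close>

lemma Avg_wbound:
  fixes G :: "real \<Rightarrow> 'a::euclidean_space \<times> 'a \<Rightarrow> complex"
  assumes "fam m G"
  shows "wbound isotropic (\<lambda>i j. (2 * R) ^ (i + j) * m i j) (Avg G)"
proof -
  have "cmod (word w (Avg G) z) \<le> (2 * R) ^ length w * m (sdeg isotropic w) (tdeg isotropic w)" if "snd ` set w \<subseteq> Basis" for w z
    using that assms
  proof (induction w arbitrary: G m rule: rev_induct)
    case Nil
    have bd: "cmod (G \<tau> (lin \<tau> z)) \<le> m 0 0" if "\<tau> \<in> {0..1}" for \<tau>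
      using Nil that wboundD(2)[of isotropic m "G \<tau>" "[]" "lin \<tau> z"] unfolding fam_def by auto
    have "norm (\<integral>\<tau>. indicator {0..1} \<tau> *\<^sub>R G \<tau> (lin \<tau> z) \<partial>lborel) \<le> (\<integral>\<tau>. norm (indicator {0..1} \<tau> *\<^sub>R G \<tau> (lin \<tau> z)) \<partial>lborel)"
      by (rule integral_norm_bound)
    also have "\<dots> \<le> (\<integral>\<tau>. indicator {0..1::real} \<tau> * m 0 0 \<partial>lborel)"
    proof (rule integral_mono)
      show "integrable lborel (\<lambda>\<tau>. norm (indicator {0..1} \<tau> *\<^sub>R G \<tau> (lin \<tau> z)))" by (rule integrable_norm[OF Avg_integrable[OF Nil(2)]])
      show "integrable lborel (\<lambda>\<tau>. indicator {0..1::real} \<tau> * m 0 0)" by (intro integrable_mult_left) simp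
    qed (use bd in \<open>auto simp: indicator_def\<close>)
    finally show ?case by (simp add: Avg_def)
  next
    case (snoc l w)
    have l: "snd l \<in> Basis" and w: "snd ` set w \<subseteq> Basis" using snoc.prems by auto
    have "cmod (word w (Avg (pull_letter l G)) z) \<le> (2 * R) ^ length w * (2 * R * (if fst l then m (Suc (sdeg isotropic w)) (tdeg isotropic w) else m (sdeg isotropic w) (Suc (tdeg isotropic w))))"
      by (rule snoc.IH[OF w fam_pull[OF snoc.prems(2) l]])
    then show ?case using Avg_letter[OF snoc.prems(2) l] by (auto simp: mult_ac)
  qed
  then show ?thesis using Avg_smooth[OF assms] unfolding wbound_def by (auto simp: sdeg_add_tdeg)
qed

lemma fam_const:
  fixes F :: "'a::euclidean_space \<times> 'a \<Rightarrow> complex"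
  shows "wbound isotropic m F \<Longrightarrow> fam m (\<lambda>_. F)"
  unfolding fam_def
proof (intro conjI ballI allI impI)
  fix w :: "(bool \<times> 'a \<times> 'a) list" assume "wbound isotropic m F" "snd ` set w \<subseteq> Basis"
  then have "continuous_on UNIV (word w F)" by (intro smooth_continuous_on smooth_word) (auto dest: wboundD(1))
  then show "continuous_on ({0..1} \<times> UNIV) (\<lambda>p. word w F (snd p))"
    by (rule continuous_on_compose2) (auto intro!: continuous_intros)
qed

end

section \<open>The operator relating the two quantizations\<close>

definition tensor :: "('a \<Rightarrow> complex) \<Rightarrow> ('a \<Rightarrow> complex) \<Rightarrow> 'a \<times> 'a \<Rightarrow> complex" where
  "tensor f g = (\<lambda>z. f (fst z) * g (snd z))"

lemma tensor_derivative:
  assumes "smooth f" "smooth g"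
  shows "(tensor f g has_derivative (\<lambda>v. f (fst z) * partial (snd v) g (snd z) + partial (fst v) f (fst z) * g (snd z))) (at z)"
  unfolding tensor_def
  by (intro has_derivative_mult has_derivative_compose[OF has_derivative_fst[OF has_derivative_ident] has_derivative_partial]
      has_derivative_compose[OF has_derivative_snd[OF has_derivative_ident] has_derivative_partial] smooth_differentiable assms)

lemma partial_zero: "smooth f \<Longrightarrow> partial 0 f x = 0"
  using has_derivative_coordinates[OF smooth_differentiable, of f 0 x] by simp

lemma letter_tensor:
  assumes "smooth f" "smooth g"
  shows "letter (k, (b, 0)) (tensor f g) = tensor (letter (k, b) f) g"
    and "letter (k, (0, b)) (tensor f g) = tensor f (letter (k, b) g)"
proof -
  have "letter (k, (b, 0)) (tensor f g) z = tensor (letter (k, b) f) g z" for z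
    using has_derivative_imp_partial[OF tensor_derivative[OF assms], of "(b, 0)" z]
    by (cases z) (auto simp: mulc_def tensor_def partial_zero[OF assms(2)])
  then show "letter (k, (b, 0)) (tensor f g) = tensor (letter (k, b) f) g" by blast
  have "letter (k, (0, b)) (tensor f g) z = tensor f (letter (k, b) g) z" for z
    using has_derivative_imp_partial[OF tensor_derivative[OF assms], of "(0, b)" z]
    by (cases z) (auto simp: mulc_def tensor_def partial_zero[OF assms(1)])
  then show "letter (k, (0, b)) (tensor f g) = tensor f (letter (k, b) g)" by blast
qed

lemma smooth_tensor:
  fixes f g :: "'a::euclidean_space \<Rightarrow> complex"
  assumes "smooth f" "smooth g" shows "smooth (tensor f g)"
proof (rule smooth_coinduct[where Q = "{tensor f g | f g :: 'a \<Rightarrow> complex. smooth f \<and> smooth g}"])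
  fix h and b :: "'a \<times> 'a" assume "h \<in> {tensor f g | f g :: 'a \<Rightarrow> complex. smooth f \<and> smooth g}" and b: "b \<in> Basis"
  then obtain f g :: "'a \<Rightarrow> complex" where h: "h = tensor f g" "smooth f" "smooth g" by auto
  from b show "partial b h \<in> {tensor f g | f g :: 'a \<Rightarrow> complex. smooth f \<and> smooth g}"
  proof (cases rule: Basis_prod_cases)
    case (1 c)
    then have "partial b h = tensor (partial c f) g" using letter_tensor(1)[OF h(2,3), of False c] h by simp
    then show ?thesis using h 1 smooth_partial by blast
  next
    case (2 c)
    then have "partial b h = tensor f (partial c g)" using letter_tensor(2)[OF h(2,3), of False c] h by simp
    then show ?thesis using h 2 smooth_partial by blast
  qed
next
  fix h x assume "h \<in> {tensor f g | f g :: 'a \<Rightarrow> complex. smooth f \<and> smooth g}"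
  then show "h differentiable (at x)" using tensor_derivative unfolding differentiable_def by blast
qed (use assms in blast)

text \<open>Each letter acts on one factor only, so a word splits into two words whose degrees add
  up to its own.\<close>

lemma wbound_tensor:
  fixes f g :: "'a::euclidean_space \<Rightarrow> complex"
  assumes f: "wbound isotropic m1 f" and g: "wbound isotropic m2 g"
    and m: "\<And>i1 j1 i2 j2. m1 i1 j1 * m2 i2 j2 \<le> m (i1 + i2) (j1 + j2)"
  shows "wbound isotropic m (tensor f g)"
  unfolding wbound_def
proof (intro conjI allI impI)
  note sm = wboundD(1)[OF f] wboundD(1)[OF g]
  show "smooth (tensor f g)" by (rule smooth_tensor[OF sm])
  fix w :: "(bool \<times> 'a \<times> 'a) list" and z assume w: "snd ` set w \<subseteq> Basis"
  have "\<exists>u v. snd ` set u \<subseteq> Basis \<and> snd ` set v \<subseteq> Basis \<and> word w (tensor f g) = tensor (word u f) (word v g) \<and>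
      sdeg isotropic w = sdeg isotropic u + sdeg isotropic v \<and> tdeg isotropic w = tdeg isotropic u + tdeg isotropic v"
    using w
  proof (induction w)
    case Nil
    show ?case by (intro exI[of _ "[]"]) simp
  next
    case (Cons l w)
    then obtain u v where uv: "snd ` set u \<subseteq> Basis" "snd ` set v \<subseteq> Basis" "word w (tensor f g) = tensor (word u f) (word v g)"
      "sdeg isotropic w = sdeg isotropic u + sdeg isotropic v" "tdeg isotropic w = tdeg isotropic u + tdeg isotropic v" by auto
    have s: "smooth (word u f)" "smooth (word v g)" using smooth_word sm uv by auto
    obtain k b where l: "l = (k, b)" by (cases l)
    have b: "b \<in> Basis" using Cons.prems l by auto
    from b show ?case
    proof (cases rule: Basis_prod_cases)
      case (1 c)
      then show ?thesis using uv l letter_tensor(1)[OF s, of k c]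
        by (intro exI[of _ "(k, c) # u"] exI[of _ v]) (auto simp: sclass_def)
    next
      case (2 c)
      then show ?thesis using uv l letter_tensor(2)[OF s, of k c]
        by (intro exI[of _ u] exI[of _ "(k, c) # v"]) (auto simp: sclass_def)
    qed
  qed
  then obtain u v where uv: "snd ` set u \<subseteq> Basis" "snd ` set v \<subseteq> Basis" "word w (tensor f g) = tensor (word u f) (word v g)"
      "sdeg isotropic w = sdeg isotropic u + sdeg isotropic v" "tdeg isotropic w = tdeg isotropic u + tdeg isotropic v" by auto
  have "cmod (word w (tensor f g) z) = cmod (word u f (fst z)) * cmod (word v g (snd z))"
    unfolding uv(3) by (simp add: tensor_def norm_mult)
  also have "\<dots> \<le> m1 (sdeg isotropic u) (tdeg isotropic u) * m2 (sdeg isotropic v) (tdeg isotropic v)"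
    using order_trans[OF norm_ge_zero wboundD(2)[OF f uv(1)]]
    by (intro mult_mono wboundD(2)[OF f uv(1)] wboundD(2)[OF g uv(2)]) auto
  also have "\<dots> \<le> m (sdeg isotropic w) (tdeg isotropic w)" unfolding uv(4,5) by (rule m)
  finally show "cmod (word w (tensor f g) z) \<le> m (sdeg isotropic w) (tdeg isotropic w)" .
qed

text \<open>The function of \<open>(x, y)\<close> whose partial Fourier transform is the conjugated
  Wigner distribution of \<open>\<lambda>x. cnj (\<psi> x)\<close> and \<open>f\<close>; see
  \<open>cnj_wigner\<close>.\<close>

definition kern :: "real \<Rightarrow> ('a::euclidean_space \<Rightarrow> complex) \<Rightarrow> ('a \<Rightarrow> complex) \<Rightarrow> 'a \<times> 'a \<Rightarrow> complex" where
  "kern t \<psi> f = (\<lambda>z. \<psi> (fst z + t *\<^sub>R snd z) * f (fst z - (1 - t) *\<^sub>R snd z))"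

lemma wbound_kern:
  assumes "wbound isotropic m (tensor \<psi> f)"
  shows "wbound isotropic (\<lambda>i j. (2 * (2 + \<bar>t\<bar>)) ^ (i + j) * m i j) (kern t \<psi> f)"
proof -
  \<comment> \<open>The matrix takes \<open>(x, y)\<close> to
    \<open>(x + t y, x - (1 - t) y)\<close>. It is constant in \<tau> and the interval has length 1,
    so the average is the composition itself.\<close>
  interpret L: linear_family "\<lambda>_. 1" "\<lambda>_. t" "\<lambda>_. 1" "\<lambda>_. t - 1" "\<lambda>_. 1 - t" "\<lambda>_. t" "\<lambda>_. 1" "\<lambda>_. -1" "2 + \<bar>t\<bar>"
    by unfold_locales (auto simp: algebra_simps)
  have "L.Avg (\<lambda>_. tensor \<psi> f) z = kern t \<psi> f z" for z
  proof -
    have "L.Avg (\<lambda>_. tensor \<psi> f) z = (\<integral>\<tau>. indicator {0..1::real} \<tau> *\<^sub>R kern t \<psi> f z \<partial>lborel)"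
      unfolding L.Avg_def L.lin_def by (simp add: tensor_def kern_def algebra_simps)
    then show ?thesis by simp
  qed
  then have "L.Avg (\<lambda>_. tensor \<psi> f) = kern t \<psi> f" by blast
  then show ?thesis using L.Avg_wbound[OF L.fam_const[OF assms]] by simp
qed

text \<open>For \<open>e = 1\<close> the shears carry the kernel for \<open>t\<close> to the kernels
  for \<tau>; for \<open>e = -1\<close> they are the inverse shears, which occur in the
  transpose.\<close>

definition SA :: "real \<Rightarrow> real \<Rightarrow> ('a::euclidean_space \<times> 'a \<Rightarrow> complex) \<Rightarrow> 'a \<times> 'a \<Rightarrow> complex" where
  "SA t e G = (\<lambda>z. \<integral>\<tau>. indicator {0..1} \<tau> *\<^sub>R G (fst z + (e * (\<tau> - t)) *\<^sub>R snd z, snd z) \<partial>lborel)"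

lemma SA_wbound:
  assumes G: "wbound isotropic m G" and e: "e \<in> {1, -1}"
  shows "wbound isotropic (\<lambda>i j. (2 * (2 + \<bar>t\<bar>)) ^ (i + j) * m i j) (SA t e G)"
    and SA_integrable: "integrable lborel (\<lambda>\<tau>. indicator {0..1} \<tau> *\<^sub>R G (fst z + (e * (\<tau> - t)) *\<^sub>R snd z, snd z))"
proof -
  interpret L: linear_family "\<lambda>_. 1" "\<lambda>\<tau>. e * (\<tau> - t)" "\<lambda>_. 0" "\<lambda>_. 1" "\<lambda>_. 1" "\<lambda>\<tau>. - (e * (\<tau> - t))" "\<lambda>_. 0" "\<lambda>_. 1" "2 + \<bar>t\<bar>"
    using e by unfold_locales (auto intro!: continuous_intros simp: abs_mult)
  have "SA t e G = L.Avg (\<lambda>_. G)" unfolding L.Avg_def L.lin_def SA_def by simp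
  then show "wbound isotropic (\<lambda>i j. (2 * (2 + \<bar>t\<bar>)) ^ (i + j) * m i j) (SA t e G)"
    using L.Avg_wbound[OF L.fam_const[OF G]] by simp
  show "integrable lborel (\<lambda>\<tau>. indicator {0..1} \<tau> *\<^sub>R G (fst z + (e * (\<tau> - t)) *\<^sub>R snd z, snd z))"
    using L.Avg_integrable[OF L.fam_const[OF G], of z] by (simp add: L.lin_def)
qed

definition phase :: "'a \<times> 'a::zero \<Rightarrow> bool" where "phase b = (snd b = 0)"

lemma flip_phase: "flip isotropic = phase" "flip phase = isotropic"
  by (auto simp: fun_eq_iff flip_def phase_def)

lemma partial_fourier_iso: "e \<in> {1, -1} \<Longrightarrow> partial_fourier isotropic True e"
  by unfold_locales auto

lemma partial_fourier_phase: "e \<in> {1, -1} \<Longrightarrow> partial_fourier phase False e"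
  by unfold_locales (auto simp: phase_def nonzero_Basis)

text \<open>\<open>Phi t 1\<close> is the operator \<Phi> of the overview, and
  \<open>Phi t (- 1)\<close> its transpose (\<open>Phi_transpose\<close>).\<close>

definition Phi :: "real \<Rightarrow> real \<Rightarrow> ('a::euclidean_space \<times> 'a \<Rightarrow> complex) \<Rightarrow> 'a \<times> 'a \<Rightarrow> complex" where
  "Phi t e G = PF e (SA t e (PF (- e) G))"

text \<open>The effect of a transform on weights, detached from functions: continuity estimates can
  then be proved for weights alone and composed.\<close>

definition PF_weight :: "nat \<Rightarrow> real \<Rightarrow> bool \<Rightarrow> (nat \<Rightarrow> nat \<Rightarrow> real) \<Rightarrow> nat \<Rightarrow> nat \<Rightarrow> real" where
  "PF_weight n C r m = (\<lambda>i j. C * dec r n m i j)"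

definition PF_const :: "'a::euclidean_space itself \<Rightarrow> real" where
  "PF_const _ = (2 * pi) powr (- (real DIM('a) / 2)) * (\<integral>y. wt y \<partial>(lborel :: 'a measure))"

definition SA_weight :: "real \<Rightarrow> (nat \<Rightarrow> nat \<Rightarrow> real) \<Rightarrow> nat \<Rightarrow> nat \<Rightarrow> real" where
  "SA_weight t m = (\<lambda>i j. (2 * (2 + \<bar>t\<bar>)) ^ (i + j) * m i j)"

lemma PF_const_nonneg: "0 \<le> PF_const TYPE('a::euclidean_space)"
  unfolding PF_const_def by (intro mult_nonneg_nonneg Bochner_Integration.integral_nonneg) (auto simp: less_imp_le[OF wt_pos])

lemma PF_iso:
  fixes G :: "'a::euclidean_space \<times> 'a \<Rightarrow> complex"
  assumes "wbound isotropic m G" "e \<in> {1, -1}"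
  shows "wbound phase (PF_weight DIM('a) (PF_const TYPE('a)) True m) (PF e G)"
  using partial_fourier.PF_wbound[OF partial_fourier_iso[OF assms(2)] assms(1)] by (simp add: flip_phase PF_weight_def PF_const_def)

lemma PF_phase:
  fixes G :: "'a::euclidean_space \<times> 'a \<Rightarrow> complex"
  assumes "wbound phase m G" "e \<in> {1, -1}"
  shows "wbound isotropic (PF_weight DIM('a) (PF_const TYPE('a)) False m) (PF e G)"
  using partial_fourier.PF_wbound[OF partial_fourier_phase[OF assms(2)] assms(1)] by (simp add: flip_phase PF_weight_def PF_const_def)

lemma Phi_wbound:
  fixes G :: "'a::euclidean_space \<times> 'a \<Rightarrow> complex"
  assumes "wbound phase m G" "e \<in> {1, -1}"
  shows "wbound phase (PF_weight DIM('a) (PF_const TYPE('a)) True (SA_weight t (PF_weight DIM('a) (PF_const TYPE('a)) False m))) (Phi t e G)"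
  unfolding Phi_def SA_weight_def
  by (intro PF_iso SA_wbound PF_phase assms) (use assms(2) in auto)

lemma PF_linear:
  assumes "partial_fourier \<rho> r e" "wbound \<rho> m f" "wbound \<rho> m' g"
  shows "PF e (\<lambda>z. c * f z + d * g z) = (\<lambda>z. c * PF e f z + d * PF e g z)"
proof
  fix z
  interpret partial_fourier \<rho> r e by fact
  have "slice e y (\<lambda>z. c * f z + d * g z) z = c * slice e y f z + d * slice e y g z" for y
    by (simp add: slice_def algebra_simps)
  then show "PF e (\<lambda>z. c * f z + d * g z) z = c * PF e f z + d * PF e g z"
    using slice_integrable[OF assms(2)] slice_integrable[OF assms(3)]
    by (simp add: PF_slice Bochner_Integration.integral_add algebra_simps)
qed

lemma SA_linear:
  assumes "wbound isotropic m f" "wbound isotropic m' g" and e: "e \<in> {1, -1}"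
  shows "SA t e (\<lambda>z. c * f z + d * g z) = (\<lambda>z. c * SA t e f z + d * SA t e g z)"
proof
  fix z :: "'a \<times> 'a"
  let ?z = "\<lambda>\<tau>. (fst z + (e * (\<tau> - t)) *\<^sub>R snd z, snd z)"
  have "indicator {0..1} \<tau> *\<^sub>R (c * f (?z \<tau>) + d * g (?z \<tau>)) = c * (indicator {0..1} \<tau> *\<^sub>R f (?z \<tau>)) + d * (indicator {0..1} \<tau> *\<^sub>R g (?z \<tau>))" for \<tau> :: real
    by (simp add: scaleR_add_right)
  then show "SA t e (\<lambda>z. c * f z + d * g z) z = c * SA t e f z + d * SA t e g z"
    unfolding SA_def using SA_integrable[OF assms(1) e, of z t] SA_integrable[OF assms(2) e, of z t]
    by (simp only: Bochner_Integration.integral_add integrable_mult_right integral_mult_right_zero)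
qed

lemma Phi_linear:
  assumes f: "wbound phase m f" and g: "wbound phase m' g" and e: "e \<in> {1, -1}"
  shows "Phi t e (\<lambda>z. c * f z + d * g z) = (\<lambda>z. c * Phi t e f z + d * Phi t e g z)"
proof -
  have e': "- e \<in> {1, -1}" using e by auto
  show ?thesis unfolding Phi_def
    by (simp only: PF_linear[OF partial_fourier_phase[OF e'] f g] SA_linear[OF PF_phase[OF f e'] PF_phase[OF g e'] e]
      PF_linear[OF partial_fourier_iso[OF e] SA_wbound(1)[OF PF_phase[OF f e'] e] SA_wbound(1)[OF PF_phase[OF g e'] e]])
qed

section \<open>Conjugated Wigner distributions as partial Fourier transforms\<close>

lemma cnj_wigner:
  fixes \<psi> f :: "'a::euclidean_space \<Rightarrow> complex"
  shows "cnj (wigner t (\<lambda>x. cnj (\<psi> x)) f z) = PF 1 (kern t \<psi> f) z"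
proof (cases z)
  case (Pair x \<xi>)
  let ?c = "complex_of_real ((2 * pi) powr (- (real DIM('a) / 2)))"
  let ?F = "\<lambda>y. cnj (\<psi> (x + t *\<^sub>R y)) * cnj (f (x - (1 - t) *\<^sub>R y)) * exp (- (\<i> * complex_of_real (y \<bullet> \<xi>)))"
  have "cnj (exp (- (\<i> * complex_of_real (y \<bullet> \<xi>)))) = cis (y \<bullet> \<xi>)" for y
    by (simp add: cis_conv_exp exp_cnj)
  then have F: "cnj (?F y) = kern t \<psi> f (x, y) * cis (1 * (y \<bullet> \<xi>))" for y
    by (simp add: kern_def)
  have "cnj (wigner t (\<lambda>x. cnj (\<psi> x)) f z) = ?c * cnj (\<integral>y. ?F y \<partial>lborel)"
    by (simp add: wigner_def Pair)
  also have "cnj (\<integral>y. ?F y \<partial>lborel) = (\<integral>y. cnj (?F y) \<partial>lborel)" by (rule Bochner_Integration.integral_cnj[symmetric])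
  finally show ?thesis unfolding F by (simp add: PF_def Pair)
qed

lemma kern_shear: "kern \<tau> \<psi> f z = kern t \<psi> f (fst z + (1 * (\<tau> - t)) *\<^sub>R snd z, snd z)"
  by (simp add: kern_def algebra_simps)

text \<open>\<open>kern_shear\<close> writes the kernel for \<tau> as a shear of the kernel for
  \<open>t\<close>, Fubini brings the average over \<tau> inside the Fourier integral, and
  \<open>PF_inverse\<close> recovers the kernel from its transform.\<close>

lemma cnj_wigner_BJ:
  fixes \<psi> f :: "'a::euclidean_space \<Rightarrow> complex"
  assumes K: "wbound isotropic m (kern t \<psi> f)"
  shows "cnj (wigner_BJ (\<lambda>x. cnj (\<psi> x)) f z) = Phi t 1 (PF 1 (kern t \<psi> f)) z"
proof -
  let ?K = "kern t \<psi> f" and ?c = "complex_of_real ((2 * pi) powr (- (real DIM('a) / 2)))"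
  let ?F = "\<lambda>(\<tau>::real) y. (indicator {0..1} \<tau> *\<^sub>R ?K (fst z + (1 * (\<tau> - t)) *\<^sub>R y, y)) * cis (1 * (y \<bullet> snd z))"
  have sK: "smooth ?K" by (rule wboundD(1)[OF K])
  have dec: "cmod (?K (x, y)) \<le> dec True DIM('a) m 0 0 * wt y" for x y
    by (rule wbound_decay[OF K]) simp
  let ?B = "dec True DIM('a) m 0 0"
  have cont: "continuous_on UNIV (\<lambda>p :: real \<times> 'a. ?K (fst z + (1 * (fst p - t)) *\<^sub>R snd p, snd p))"
    by (intro continuous_on_compose2[OF smooth_continuous_on[OF sK, of UNIV]] continuous_intros) auto
  \<comment> \<open>The decay of the kernel in \<open>y\<close> is uniform in its first argument, so
    the shear does not disturb it; the range of \<tau> is bounded.\<close>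
  have F: "integrable (lborel \<Otimes>\<^sub>M lborel) (case_prod ?F)"
  proof (rule Bochner_Integration.integrable_bound)
    show "integrable (lborel \<Otimes>\<^sub>M lborel) (\<lambda>(\<tau>::real, y::'a). indicator {0..1} \<tau> * (?B * wt y))"
    proof (rule lborel_pair.Fubini_integrable)
      have [measurable]: "(wt :: 'a \<Rightarrow> real) \<in> borel_measurable borel" using borel_measurable_integrable[OF integrable_wt] by simp
      show "(\<lambda>(\<tau>::real, y::'a). indicator {0..1} \<tau> * (?B * wt y)) \<in> borel_measurable (lborel \<Otimes>\<^sub>M lborel)" by measurable
      have "integrable lborel (\<lambda>\<tau>. indicator {0..1::real} \<tau> * (\<integral>y. \<bar>?B * wt y\<bar> \<partial>(lborel :: 'a measure)))"
        by (intro integrable_mult_left) simp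
      then show "integrable lborel (\<lambda>\<tau>. \<integral>y. norm (case (\<tau>, y) of (\<tau>::real, y::'a) \<Rightarrow> indicator {0..1} \<tau> * (?B * wt y)) \<partial>lborel)"
        by (simp add: abs_mult)
    qed (auto intro!: AE_I2 integrable_mult_right integrable_wt)
    have [measurable]: "(\<lambda>p :: real \<times> 'a. ?K (fst z + (1 * (fst p - t)) *\<^sub>R snd p, snd p)) \<in> borel_measurable borel"
      by (rule borel_measurable_continuous_onI[OF cont])
    have "(\<lambda>p :: real \<times> 'a. (indicator {0..1} (fst p) *\<^sub>R ?K (fst z + (1 * (fst p - t)) *\<^sub>R snd p, snd p)) * cis (1 * (snd p \<bullet> snd z))) \<in> borel_measurable borel"
    proof -
      have [measurable]: "fst \<in> borel_measurable (borel :: (real \<times> 'a) measure)" "snd \<in> borel_measurable (borel :: (real \<times> 'a) measure)"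
        by (intro borel_measurable_continuous_onI continuous_intros)+
      show ?thesis by measurable
    qed
    then show "case_prod ?F \<in> borel_measurable (lborel \<Otimes>\<^sub>M lborel)"
      by (simp add: lborel_prod case_prod_unfold)
    show "AE p in lborel \<Otimes>\<^sub>M lborel. norm (case_prod ?F p) \<le> norm (case p of (\<tau>, y) \<Rightarrow> indicator {0..1} \<tau> * (?B * wt y))"
    proof (rule AE_I2)
      fix p :: "real \<times> 'a"
      have "cmod (?K (x, y)) \<le> \<bar>?B * wt y\<bar>" for x y by (rule order_trans[OF dec abs_ge_self])
      then show "norm (case_prod ?F p) \<le> norm (case p of (\<tau>, y) \<Rightarrow> indicator {0..1} \<tau> * (?B * wt y))"
        by (auto simp: case_prod_unfold norm_mult indicator_def)
    qed
  qed
  have "cnj (wigner_BJ (\<lambda>x. cnj (\<psi> x)) f z) = (\<integral>\<tau>. cnj (indicator {0..1} \<tau> *\<^sub>R wigner \<tau> (\<lambda>x. cnj (\<psi> x)) f z) \<partial>lborel)"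
    unfolding wigner_BJ_def set_lebesgue_integral_def by (rule Bochner_Integration.integral_cnj[symmetric])
  also have "\<dots> = (\<integral>\<tau>. indicator {0..1} \<tau> *\<^sub>R PF 1 (kern \<tau> \<psi> f) z \<partial>lborel)"
    by (intro Bochner_Integration.integral_cong refl) (simp add: cnj_wigner)
  also have "\<dots> = (\<integral>\<tau>. ?c * (\<integral>y. ?F \<tau> y \<partial>lborel) \<partial>lborel)"
  proof (rule Bochner_Integration.integral_cong[OF refl])
    fix \<tau> :: real
    have "?F \<tau> y = indicator {0..1} \<tau> *\<^sub>R (kern \<tau> \<psi> f (fst z, y) * cis (1 * (y \<bullet> snd z)))" for y
      using kern_shear[of \<tau> \<psi> f "(fst z, y)" t] by simp
    then show "indicator {0..1} \<tau> *\<^sub>R PF 1 (kern \<tau> \<psi> f) z = ?c * (\<integral>y. ?F \<tau> y \<partial>lborel)"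
      unfolding PF_def by (simp only: integral_scaleR_right) simp
  qed
  also have "\<dots> = ?c * (\<integral>y. \<integral>\<tau>. ?F \<tau> y \<partial>lborel \<partial>lborel)"
    by (simp only: integral_mult_right_zero lborel_pair.Fubini_integral[OF F])
  also have "\<dots> = PF 1 (SA t 1 ?K) z"
    unfolding PF_def SA_def by (simp only: integral_mult_left_zero fst_conv snd_conv)
  also have "\<dots> = Phi t 1 (PF 1 ?K) z"
    unfolding Phi_def using partial_fourier.PF_inverse[OF partial_fourier_iso K, of 1] by simp
  finally show ?thesis .
qed

section \<open>Transposes of the shear averages and of \<open>Phi\<close>\<close>

lemma integrable_mult_bounded:
  fixes F H :: "'a::euclidean_space \<Rightarrow> complex"
  assumes "continuous_on UNIV F" "continuous_on UNIV H" "\<And>z. cmod (F z) \<le> M" "\<And>z. cmod (H z) \<le> B * wt z"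
  shows "integrable lborel (\<lambda>z. F z * H z)"
proof (rule integrable_wt_bound)
  show "(\<lambda>z. F z * H z) \<in> borel_measurable borel"
    by (intro borel_measurable_continuous_onI continuous_intros assms)
  show "cmod (F z * H z) \<le> (M * B) * wt z" for z
    using mult_mono[OF assms(3)[of z] assms(4)[of z]] order_trans[OF norm_ge_zero assms(3)[of z]]
    by (simp add: norm_mult mult.assoc)
qed

text \<open>For a fixed second variable a shear is a translation of the first one, so the iterated
  integral is taken with the first variable inside.\<close>

lemma integral_shear:
  fixes F H :: "'a::euclidean_space \<times> 'a \<Rightarrow> complex"
  assumes F: "continuous_on UNIV F" "\<And>z. cmod (F z) \<le> M" "\<And>z. cmod (F z) \<le> B * wt z"
    and H: "continuous_on UNIV H" "\<And>z. cmod (H z) \<le> M'" "\<And>z. cmod (H z) \<le> B' * wt z"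
  shows "(\<integral>z. F (fst z + s *\<^sub>R snd z, snd z) * H z \<partial>lborel) = (\<integral>z. F z * H (fst z - s *\<^sub>R snd z, snd z) \<partial>lborel)"
proof -
  have fub: "(\<integral>z. g z \<partial>lborel) = (\<integral>y. \<integral>x. g (x, y) \<partial>lborel \<partial>lborel)" if "integrable lborel g" for g :: "'a \<times> 'a \<Rightarrow> complex"
  proof -
    have "integrable (lborel \<Otimes>\<^sub>M lborel) (case_prod (\<lambda>x y. g (x, y)))" using that by (simp add: lborel_prod)
    from lborel_pair.integral_snd[OF this] show ?thesis by (simp add: lborel_prod)
  qed
  have c1: "continuous_on UNIV (\<lambda>z :: 'a \<times> 'a. F (fst z + s *\<^sub>R snd z, snd z))"
    and c2: "continuous_on UNIV (\<lambda>z :: 'a \<times> 'a. H (fst z - s *\<^sub>R snd z, snd z))"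
    by (intro continuous_on_compose2[OF F(1)] continuous_on_compose2[OF H(1)] continuous_intros; simp)+
  have 1: "integrable lborel (\<lambda>z. F (fst z + s *\<^sub>R snd z, snd z) * H z)"
    by (rule integrable_mult_bounded[OF c1 H(1) F(2) H(3)])
  have "integrable lborel (\<lambda>z. H (fst z - s *\<^sub>R snd z, snd z) * F z)"
    by (rule integrable_mult_bounded[OF c2 F(1) H(2) F(3)])
  then have 2: "integrable lborel (\<lambda>z. F z * H (fst z - s *\<^sub>R snd z, snd z))" by (simp add: mult.commute)
  have "(\<integral>x. F (x + s *\<^sub>R y, y) * H (x, y) \<partial>lborel) = (\<integral>x. F (x, y) * H (x - s *\<^sub>R y, y) \<partial>lborel)" for y
  proof -
    have "(\<lambda>x. F (x, y) * H (x - s *\<^sub>R y, y)) \<in> borel_measurable borel"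
      by (intro borel_measurable_continuous_onI continuous_intros continuous_on_compose2[OF F(1)] continuous_on_compose2[OF H(1)]) auto
    from integral_lborel_translate(1)[OF this, of "s *\<^sub>R y"] show ?thesis by simp
  qed
  then show ?thesis by (simp add: fub[OF 1] fub[OF 2])
qed

text \<open>Shears preserve measure, so the transpose of a shear is its inverse, which changes the
  sign \<open>e\<close>. Fubini exchanges the average with the pairing on either side
  (\<open>sw\<close>).\<close>

lemma SA_transpose:
  fixes G H :: "'a::euclidean_space \<times> 'a \<Rightarrow> complex"
  assumes G: "wbound isotropic m G" and H: "wbound isotropic m' H"
  shows "(\<integral>z. SA t e G z * H z \<partial>lborel) = (\<integral>z. G z * SA t (- e) H z \<partial>lborel)"
proof -
  obtain B where B: "\<And>z. cmod (G z) \<le> B * wt z" using wbound_wt[OF G] by blast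
  obtain B' where B': "\<And>z. cmod (H z) \<le> B' * wt z" using wbound_wt[OF H] by blast
  have M: "cmod (G z) \<le> m 0 0" "cmod (H z) \<le> m' 0 0" for z
    using wboundD(2)[OF G, of "[]" z] wboundD(2)[OF H, of "[]" z] by simp_all
  have cG: "continuous_on UNIV G" and cH: "continuous_on UNIV H"
    using smooth_continuous_on wboundD(1)[OF G] wboundD(1)[OF H] by auto
  have sw: "(\<integral>z. (\<integral>\<tau>. indicator {0..1} \<tau> *\<^sub>R F (fst z + (k * (\<tau> - t)) *\<^sub>R snd z, snd z) \<partial>lborel) * L z \<partial>lborel)
      = (\<integral>\<tau>. indicator {0..1::real} \<tau> *\<^sub>R (\<integral>z. F (fst z + (k * (\<tau> - t)) *\<^sub>R snd z, snd z) * L z \<partial>lborel) \<partial>lborel)"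
    if cF: "continuous_on UNIV F" and cL: "continuous_on UNIV L" and MF: "\<And>z. cmod (F z) \<le> M" and BL: "\<And>z. cmod (L z) \<le> B * wt z"
    for F L :: "'a \<times> 'a \<Rightarrow> complex" and k M B
  proof -
    let ?I = "\<lambda>(\<tau>::real) z. indicator {0..1} \<tau> *\<^sub>R (F (fst z + (k * (\<tau> - t)) *\<^sub>R snd z, snd z) * L z)"
    have I: "integrable (lborel \<Otimes>\<^sub>M lborel) (case_prod ?I)"
    proof (rule Bochner_Integration.integrable_bound)
      show "integrable (lborel \<Otimes>\<^sub>M lborel) (\<lambda>(\<tau>::real, z::'a \<times> 'a). indicator {0..1} \<tau> * (M * B * wt z))"
      proof (rule lborel_pair.Fubini_integrable)
        have [measurable]: "(wt :: 'a \<times> 'a \<Rightarrow> real) \<in> borel_measurable borel" using borel_measurable_integrable[OF integrable_wt] by simp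
        show "(\<lambda>(\<tau>::real, z::'a \<times> 'a). indicator {0..1} \<tau> * (M * B * wt z)) \<in> borel_measurable (lborel \<Otimes>\<^sub>M lborel)" by measurable
        have "integrable lborel (\<lambda>\<tau>. indicator {0..1::real} \<tau> * (\<integral>z. \<bar>M * B * wt z\<bar> \<partial>(lborel :: ('a \<times> 'a) measure)))"
          by (intro integrable_mult_left) simp
        then show "integrable lborel (\<lambda>\<tau>. \<integral>z. norm (case (\<tau>, z) of (\<tau>::real, z::'a \<times> 'a) \<Rightarrow> indicator {0..1} \<tau> * (M * B * wt z)) \<partial>lborel)"
          by (simp add: abs_mult)
      qed (auto intro!: AE_I2 integrable_mult_right integrable_wt)
      have [measurable]: "(\<lambda>p :: real \<times> 'a \<times> 'a. F (fst (snd p) + (k * (fst p - t)) *\<^sub>R snd (snd p), snd (snd p)) * L (snd p)) \<in> borel_measurable borel"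
        by (intro borel_measurable_continuous_onI continuous_intros continuous_on_compose2[OF cF] continuous_on_compose2[OF cL]) auto
      have [measurable]: "fst \<in> borel_measurable (borel :: (real \<times> 'a \<times> 'a) measure)"
        by (intro borel_measurable_continuous_onI continuous_intros)
      have "(\<lambda>p :: real \<times> 'a \<times> 'a. indicator {0..1} (fst p) *\<^sub>R (F (fst (snd p) + (k * (fst p - t)) *\<^sub>R snd (snd p), snd (snd p)) * L (snd p))) \<in> borel_measurable borel"
        by measurable
      then show "case_prod ?I \<in> borel_measurable (lborel \<Otimes>\<^sub>M lborel)"
        by (simp add: lborel_prod case_prod_unfold)
      show "AE p in lborel \<Otimes>\<^sub>M lborel. norm (case_prod ?I p) \<le> norm (case p of (\<tau>, z) \<Rightarrow> indicator {0..1} \<tau> * (M * B * wt z))"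
      proof (rule AE_I2)
        fix p :: "real \<times> 'a \<times> 'a"
        have "cmod (F z') * cmod (L z) \<le> \<bar>M * B * wt z\<bar>" for z z'
          using mult_mono[OF MF[of z'] BL[of z]] order_trans[OF norm_ge_zero MF[of z']] by (simp add: mult.assoc order_trans[OF _ abs_ge_self])
        then show "norm (case_prod ?I p) \<le> norm (case p of (\<tau>, z) \<Rightarrow> indicator {0..1} \<tau> * (M * B * wt z))"
          by (auto simp: case_prod_unfold norm_mult indicator_def)
      qed
    qed
    have "(\<integral>z. (\<integral>\<tau>. indicator {0..1} \<tau> *\<^sub>R F (fst z + (k * (\<tau> - t)) *\<^sub>R snd z, snd z) \<partial>lborel) * L z \<partial>lborel) = (\<integral>z. \<integral>\<tau>. ?I \<tau> z \<partial>lborel \<partial>lborel)"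
      by (simp only: integral_mult_left_zero[symmetric] mult_scaleR_left)
    also have "\<dots> = (\<integral>\<tau>. \<integral>z. ?I \<tau> z \<partial>lborel \<partial>lborel)" by (rule lborel_pair.Fubini_integral[OF I])
    finally show ?thesis by simp
  qed
  have "(\<integral>z. SA t e G z * H z \<partial>lborel) = (\<integral>\<tau>. indicator {0..1::real} \<tau> *\<^sub>R (\<integral>z. G (fst z + (e * (\<tau> - t)) *\<^sub>R snd z, snd z) * H z \<partial>lborel) \<partial>lborel)"
    unfolding SA_def by (rule sw[OF cG cH M(1) B'])
  also have "\<dots> = (\<integral>\<tau>. indicator {0..1::real} \<tau> *\<^sub>R (\<integral>z. H (fst z + (- e * (\<tau> - t)) *\<^sub>R snd z, snd z) * G z \<partial>lborel) \<partial>lborel)"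
  proof -
    have "(\<integral>z. G (fst z + k *\<^sub>R snd z, snd z) * H z \<partial>lborel) = (\<integral>z. H (fst z + (- k) *\<^sub>R snd z, snd z) * G z \<partial>lborel)" for k
      unfolding integral_shear[OF cG M(1) B cH M(2) B']
      by (intro Bochner_Integration.integral_cong refl) (simp add: mult.commute)
    then show ?thesis by (simp only: minus_mult_left)
  qed
  also have "\<dots> = (\<integral>z. SA t (- e) H z * G z \<partial>lborel)"
    unfolding SA_def by (rule sw[OF cH cG M(2) B, symmetric])
  finally show ?thesis by (simp add: mult.commute)
qed

text \<open>Transposition reverses the order of the three factors. The transforms keep their signs
  and thereby exchange places, the shears change theirs, and the outcome is again of the form
  \<open>Phi\<close>.\<close>

lemma Phi_transpose:
  fixes G A :: "'a::euclidean_space \<times> 'a \<Rightarrow> complex"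
  assumes G: "wbound phase m G" and A: "wbound phase m' A"
  shows "(\<integral>z. A z * Phi t 1 G z \<partial>lborel) = (\<integral>z. Phi t (- 1) A z * G z \<partial>lborel)"
proof -
  have e: "(1::real) \<in> {1, -1}" "(- 1::real) \<in> {1, -1}" by auto
  note PG = PF_phase[OF G e(2)] and PA = PF_phase[OF A e(1)]
  have "(\<integral>z. A z * Phi t 1 G z \<partial>lborel) = (\<integral>z. PF 1 A z * SA t 1 (PF (- 1) G) z \<partial>lborel)"
    unfolding Phi_def
    by (rule partial_fourier.PF_transpose[OF partial_fourier_iso[OF e(1)] SA_wbound(1)[OF PG e(1)] A partial_fourier_phase[OF e(1)]])
  also have "\<dots> = (\<integral>z. SA t 1 (PF (- 1) G) z * PF 1 A z \<partial>lborel)" by (simp add: mult.commute)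
  also have "\<dots> = (\<integral>z. PF (- 1) G z * SA t (- 1) (PF 1 A) z \<partial>lborel)"
    by (rule SA_transpose[OF PG PA])
  also have "\<dots> = (\<integral>z. SA t (- 1) (PF 1 A) z * PF (- 1) G z \<partial>lborel)" by (simp add: mult.commute)
  also have "\<dots> = (\<integral>z. PF (- 1) (SA t (- 1) (PF 1 A)) z * G z \<partial>lborel)"
    by (rule partial_fourier.PF_transpose[OF partial_fourier_phase[OF e(2)] G SA_wbound(1)[OF PA e(2)] partial_fourier_iso[OF e(2)]])
  finally show ?thesis by (simp add: Phi_def)
qed

text \<open>What the transfer of symbols asks of test functions \<open>V\<close> and symbols
  \<open>U\<close>. Both signs occur: 1 for functionals on \<open>U\<close>, -1 for symbols that are
  functions in \<open>U\<close>.\<close>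

definition dual_closed :: "('a::euclidean_space \<Rightarrow> complex) set \<Rightarrow> ('a \<times> 'a \<Rightarrow> complex) set \<Rightarrow> bool" where
  "dual_closed V U \<longleftrightarrow> (\<forall>F\<in>U. \<exists>m. wbound phase m F) \<and>
     (\<forall>\<psi>\<in>V. \<forall>f\<in>V. \<forall>t. \<exists>m. wbound isotropic m (kern t \<psi> f)) \<and>
     (\<forall>\<psi>\<in>V. \<forall>f\<in>V. \<forall>t. PF 1 (kern t \<psi> f) \<in> U) \<and>
     (\<forall>F\<in>U. \<forall>t. \<forall>e\<in>{1, -1}. Phi t e F \<in> U)"

lemma dual_closed_wbound: "dual_closed V U \<Longrightarrow> F \<in> U \<Longrightarrow> \<exists>m. wbound phase m F"
  unfolding dual_closed_def by simp

lemma Op_BJ_eq_Op_t: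
  assumes "dual_closed V U" "\<And>F. F \<in> U \<Longrightarrow> b F = a (Phi t 1 F)"
  shows "Op_BJ V a = Op_t V t b"
proof -
  have "a (\<lambda>z. cnj (wigner_BJ (\<lambda>x. cnj (\<psi> x)) f z)) = b (\<lambda>z. cnj (wigner t (\<lambda>x. cnj (\<psi> x)) f z))"
    if "f \<in> V" "\<psi> \<in> V" for f \<psi>
  proof -
    obtain m where m: "wbound isotropic m (kern t \<psi> f)" using assms(1) \<open>f \<in> V\<close> \<open>\<psi> \<in> V\<close> unfolding dual_closed_def by blast
    have "PF 1 (kern t \<psi> f) \<in> U" using assms(1) \<open>f \<in> V\<close> \<open>\<psi> \<in> V\<close> unfolding dual_closed_def by blast
    from assms(2)[OF this] show ?thesis
      by (simp only: cnj_wigner cnj_wigner_BJ[OF m]) 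
  qed
  then show ?thesis
    unfolding Op_BJ_def Op_t_def pairing_def by (auto simp: fun_eq_iff restrict_def)
qed

text \<open>Stated for an arbitrary topology \<open>T\<close>, so that the inductive limit, the
  projective limit and the Schwartz topology share one argument: continuity of
  \<open>Phi t 1\<close> makes the composed functional continuous.\<close>

lemma dual_space_symbol:
  assumes VU: "dual_closed V U"
    and lin: "\<And>f g c d. f \<in> U \<Longrightarrow> g \<in> U \<Longrightarrow> (\<lambda>z. c * f z + d * g z) \<in> U"
    and T: "topspace T = U" "continuous_map T T (Phi t 1)"
    and a: "a \<in> dual_space U T"
  shows "\<exists>b\<in>dual_space U T. Op_BJ V a = Op_t V t b"
proof
  \<comment> \<open>Restricted to \<open>U\<close>, since the dual space consists of extensional
    functionals.\<close>
  let ?b = "\<lambda>F\<in>U. a (Phi t 1 F)"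
  have e: "(1::real) \<in> {1, -1}" by simp
  have Phi: "Phi t 1 F \<in> U" if "F \<in> U" for F using VU that unfolding dual_closed_def by blast
  show "?b \<in> dual_space U T"
    unfolding dual_space_def
  proof (intro CollectI conjI ballI allI)
    fix f g c d assume f: "f \<in> U" and g: "g \<in> U"
    obtain m m' where "wbound phase m f" "wbound phase m' g"  using dual_closed_wbound[OF VU f] dual_closed_wbound[OF VU g] by metis
    then have "Phi t 1 (\<lambda>z. c * f z + d * g z) = (\<lambda>z. c * Phi t 1 f z + d * Phi t 1 g z)" by (rule Phi_linear[OF _ _ e])
    moreover have "a (\<lambda>z. c * Phi t 1 f z + d * Phi t 1 g z) = c * a (Phi t 1 f) + d * a (Phi t 1 g)"
      using a Phi[OF f] Phi[OF g] unfolding dual_space_def by blast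
    ultimately show "?b (\<lambda>x. c * f x + d * g x) = c * ?b f + d * ?b g"
      using f g lin by simp
  next
    have "continuous_map T euclidean a" using a unfolding dual_space_def by blast
    from continuous_map_compose[OF T(2) this] show "continuous_map T euclidean ?b"
      by (rule continuous_map_eq) (simp add: T(1))
  qed simp
  show "Op_BJ V a = Op_t V t ?b"
    by (rule Op_BJ_eq_Op_t[OF VU]) simp
qed

lemma function_symbol:
  assumes VU: "dual_closed V U" and a: "a \<in> U"
  shows "\<exists>b\<in>U. Op_BJ V (dist_of U a) = Op_t V t (dist_of U b)"
proof
  show "Phi t (- 1) a \<in> U" using VU a unfolding dual_closed_def by blast
  show "Op_BJ V (dist_of U a) = Op_t V t (dist_of U (Phi t (- 1) a))"
  proof (rule Op_BJ_eq_Op_t[OF VU])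
    fix F assume F: "F \<in> U"
    then have "Phi t 1 F \<in> U" using VU unfolding dual_closed_def by blast
    moreover obtain m m' where "wbound phase m F" "wbound phase m' a" using dual_closed_wbound[OF VU F] dual_closed_wbound[OF VU a] by metis
    ultimately show "dist_of U (Phi t (- 1) a) F = dist_of U a (Phi t 1 F)"
      using F by (simp add: dist_of_def Phi_transpose)
  qed
qed

section \<open>Transformations of weights\<close>

lemma power_powr_swap: "(x::real) > 0 \<Longrightarrow> (x ^ n) powr r = (x powr r) ^ n"
  by (simp add: powr_realpow[symmetric] powr_powr mult.commute)

lemma power_le_exp_fact:
  fixes x :: real assumes "0 \<le> x" shows "x ^ k \<le> exp x * fact k"
proof -
  have "(\<Sum>n\<in>{k}. x ^ n /\<^sub>R fact n) \<le> (\<Sum>n. x ^ n /\<^sub>R fact n)"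
    by (rule sum_le_suminf) (use assms summable_exp_generic[of x] in auto)
  then have "x ^ k / fact k \<le> exp x" by (simp add: exp_def divide_inverse mult.commute)
  then show ?thesis by (simp add: pos_divide_le_eq)
qed

text \<open>The condition under which \<open>k! \<le> K h\<^sup>2\<^sup>k k!\<^sup>s\<^sup>+\<^sup>\<sigma>\<close> for all \<open>k\<close>, hence under which words can be reordered
  on the step \<open>h\<close>.\<close>

definition admissible :: "real \<Rightarrow> real \<Rightarrow> real \<Rightarrow> bool" where
  "admissible s \<sigma> h \<longleftrightarrow> 0 < s \<and> 0 < \<sigma> \<and> 0 < h \<and> (s + \<sigma> > 1 \<or> s + \<sigma> = 1 \<and> h \<ge> 1)"

text \<open>For \<open>s + \<sigma> > 1\<close> the surplus power of \<open>fact k\<close> beats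
  every geometric sequence, however small \<open>h\<close> is; for \<open>s + \<sigma> = 1\<close>
  there is no surplus and \<open>h \<ge> 1\<close> must do.\<close>

lemma fact_growth:
  assumes "admissible s \<sigma> h"
  shows "\<exists>K\<ge>0. \<forall>k. fact k \<le> K * h ^ (2 * k) * (fact k powr s * fact k powr \<sigma>)"
proof (cases "s + \<sigma> = 1")
  case True
  then have "1 \<le> h" using assms by (auto simp: admissible_def)
  have "fact k \<le> 1 * h ^ (2 * k) * (fact k powr s * fact k powr \<sigma>)" for k
    using \<open>1 \<le> h\<close> True by (simp add: powr_add[symmetric] one_le_power)
  then show ?thesis by (intro exI[of _ 1]) auto
next
  case False
  define \<delta> where "\<delta> = s + \<sigma> - 1"
  have \<delta>: "0 < \<delta>" and h: "0 < h" using False assms by (auto simp: admissible_def \<delta>_def)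
  \<comment> \<open>Chosen with \<open>x powr \<delta> = 1 / h\<^sup>2\<close>, so that
    \<open>x ^ k \<le> exp x * fact k\<close> raised to \<delta> becomes the required bound on
    \<open>(1 / h\<^sup>2) ^ k\<close>.\<close>
  define x where "x = (1 / h\<^sup>2) powr (1 / \<delta>)"
  have x: "0 < x" using h by (simp add: x_def)
  have "fact k \<le> (exp x powr \<delta>) * h ^ (2 * k) * (fact k powr s * fact k powr \<sigma>)" for k
  proof -
    have xk: "(x ^ k) powr \<delta> = (1 / h\<^sup>2) ^ k"
    proof -
      have "x powr \<delta> = (1 / h\<^sup>2) powr 1" unfolding x_def powr_powr using \<delta> by simp
      then have "x powr \<delta> = 1 / h\<^sup>2" using h by simp
      then show ?thesis unfolding power_powr_swap[OF x] by simp
    qed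
    have "(x ^ k) powr \<delta> \<le> (exp x * fact k) powr \<delta>"
      using x \<delta> by (intro powr_mono2 power_le_exp_fact) auto
    then have 1: "(1 / h\<^sup>2) ^ k \<le> exp x powr \<delta> * fact k powr \<delta>"
      unfolding xk by (simp add: powr_mult)
    have hk: "h ^ (2 * k) * (1 / h\<^sup>2) ^ k = 1"
      using h by (simp add: power_mult power_mult_distrib[symmetric])
    have "1 \<le> h ^ (2 * k) * (exp x powr \<delta> * fact k powr \<delta>)"
      using mult_left_mono[OF 1, of "h ^ (2 * k)"] h hk by simp
    then have "fact k * 1 \<le> fact k * (h ^ (2 * k) * (exp x powr \<delta> * fact k powr \<delta>))"
      by (intro mult_left_mono) auto
    also have "fact k * (h ^ (2 * k) * (exp x powr \<delta> * fact k powr \<delta>)) = exp x powr \<delta> * h ^ (2 * k) * (fact k powr 1 * fact k powr \<delta>)"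
      by (simp add: mult_ac)
    also have "fact k powr 1 * fact k powr \<delta> = (fact k powr s * fact k powr \<sigma> :: real)"
      unfolding powr_add[symmetric] \<delta>_def by simp
    finally show ?thesis by simp
  qed
  then show ?thesis by (intro exI[of _ "exp x powr \<delta>"]) auto
qed

lemma Suc_le_pow2: "real (Suc n) \<le> 2 ^ n"
  by (induction n) auto

text \<open>\<open>k\<close> contractions remove \<open>k\<close> letters of each class and so set
  free \<open>h ^ (2 * k)\<close> and \<open>fact k powr s * fact k powr \<sigma>\<close>; by
  \<open>fact_growth\<close> these pay for \<open>fact k\<close>. The 4 collects the binomial
  coefficients and the number of summands, each at most \<open>2 ^ (i + j)\<close>.\<close>

lemma reorder_gsw:
  assumes "admissible s \<sigma> h"
  shows "\<exists>K\<ge>0. \<forall>B\<ge>0. \<forall>i j. reorder (\<lambda>i j. B * gsw s \<sigma> h i j) i j \<le> B * K * gsw s \<sigma> (4 * h) i j"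
proof -
  have s: "0 < s" "0 < \<sigma>" "0 < h" using assms by (auto simp: admissible_def)
  obtain K where K: "0 \<le> K" "\<And>k. fact k \<le> K * h ^ (2 * k) * (fact k powr s * fact k powr \<sigma>)"
    using fact_growth[OF assms] by blast
  have "reorder (\<lambda>i j. B * gsw s \<sigma> h i j) i j \<le> B * K * gsw s \<sigma> (4 * h) i j" if B: "0 \<le> B" for B i j
  proof -
    have trm: "real (i choose k) * real (j choose k) * fact k * (B * gsw s \<sigma> h (i - k) (j - k)) \<le> 2 ^ (i + j) * (B * K * gsw s \<sigma> h i j)" for k
    proof (cases "k \<le> i \<and> k \<le> j")
      case False
      then have "real (i choose k) * real (j choose k) = 0" by (auto simp: binomial_eq_0)
      moreover have "0 \<le> 2 ^ (i + j) * (B * K * gsw s \<sigma> h i j)" using B K s by simp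
      ultimately show ?thesis by (metis mult_zero_left)
    next
      case True
      have fp: "fact k powr p * fact (n - k) powr p \<le> fact n powr p" if "k \<le> n" "0 < p" for n and p :: real
      proof -
        have "fact k powr p * fact (n - k) powr p = (fact k * fact (n - k)) powr p" by (simp add: powr_mult)
        also have "\<dots> \<le> fact n powr p" using fact_mult_le[of k "n - k"] that by (intro powr_mono2) auto
        finally show ?thesis .
      qed
      have ch: "real (i choose k) * real (j choose k) \<le> 2 ^ i * 2 ^ j"
        using binomial_le_pow2[of i k] binomial_le_pow2[of j k]
        by (intro mult_mono) (metis of_nat_le_iff of_nat_numeral of_nat_power, metis of_nat_le_iff of_nat_numeral of_nat_power, auto)
      have "fact k * gsw s \<sigma> h (i - k) (j - k) \<le> (K * h ^ (2 * k) * (fact k powr s * fact k powr \<sigma>)) * gsw s \<sigma> h (i - k) (j - k)"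
        using s by (intro mult_right_mono K) auto
      also have "\<dots> = K * (h ^ (2 * k) * h ^ (i - k + (j - k))) * ((fact k powr s * fact (i - k) powr s) * (fact k powr \<sigma> * fact (j - k) powr \<sigma>))"
        by (simp add: gsw_def mult_ac)
      also have "h ^ (2 * k) * h ^ (i - k + (j - k)) = h ^ (i + j)"
        using True by (simp add: power_add[symmetric])
      also have "K * h ^ (i + j) * ((fact k powr s * fact (i - k) powr s) * (fact k powr \<sigma> * fact (j - k) powr \<sigma>)) \<le> K * h ^ (i + j) * (fact i powr s * fact j powr \<sigma>)"
        using True s K by (intro mult_left_mono mult_mono fp) auto
      finally have g: "fact k * gsw s \<sigma> h (i - k) (j - k) \<le> K * gsw s \<sigma> h i j" by (simp add: gsw_def mult_ac)
      have "real (i choose k) * real (j choose k) * (fact k * gsw s \<sigma> h (i - k) (j - k)) \<le> (2 ^ i * 2 ^ j) * (K * gsw s \<sigma> h i j)"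
        using s by (intro mult_mono ch g) auto
      from mult_left_mono[OF this B] show ?thesis by (simp add: power_add mult_ac)
    qed
    have "reorder (\<lambda>i j. B * gsw s \<sigma> h i j) i j \<le> (\<Sum>k\<le>i + j. 2 ^ (i + j) * (B * K * gsw s \<sigma> h i j))"
      unfolding reorder_def by (rule sum_mono) (rule trm)
    also have "\<dots> = real (Suc (i + j)) * (2 ^ (i + j) * (B * K * gsw s \<sigma> h i j))" by simp
    also have "\<dots> \<le> 2 ^ (i + j) * (2 ^ (i + j) * (B * K * gsw s \<sigma> h i j))"
      using B K s by (intro mult_right_mono Suc_le_pow2) auto
    also have "\<dots> = B * K * gsw s \<sigma> (4 * h) i j"
    proof -
      have "(4::real) ^ (i + j) = 2 ^ (i + j) * 2 ^ (i + j)"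
        unfolding power_mult_distrib[symmetric] by simp
      then show ?thesis by (simp only: gsw_def power_mult_distrib mult_ac)
    qed
    finally show ?thesis .
  qed
  then show ?thesis using K(1) by blast
qed

text \<open>Two more letters multiply a factorial by a quadratic expression in the degree, which an
  enlargement of \<open>h\<close> by a fixed factor absorbs.\<close>

lemma gsw_shift:
  assumes "0 < s" "0 < \<sigma>" "0 < h"
  shows "gsw s \<sigma> h (Suc (Suc i)) j \<le> (h\<^sup>2 * 8 powr (s + \<sigma>)) * gsw s \<sigma> (2 powr (s + \<sigma>) * h) i j"
    and "gsw s \<sigma> h i (Suc (Suc j)) \<le> (h\<^sup>2 * 8 powr (s + \<sigma>)) * gsw s \<sigma> (2 powr (s + \<sigma>) * h) i j"
    and "gsw s \<sigma> h i j \<le> gsw s \<sigma> (2 powr (s + \<sigma>) * h) i j"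
proof -
  let ?\<kappa> = "2 powr (s + \<sigma>)"
  have \<kappa>: "1 \<le> ?\<kappa>" using assms by (simp add: ge_one_powr_ge_zero)
  have F: "fact (Suc (Suc n)) powr p \<le> 8 powr (s + \<sigma>) * (?\<kappa> ^ n * fact n powr p)" if "0 < p" "p \<le> s + \<sigma>" for n and p :: real
  proof -
    \<comment> \<open>The 8 is \<open>2 ^ 2 * fact 2\<close> from
      \<open>fact_add_le\<close>.\<close>
    have "fact (Suc (Suc n)) \<le> (8 * (2 ^ n * fact n) :: real)"
      using fact_add_le[of 2 n] by (simp add: fact_numeral)
    then have "fact (Suc (Suc n)) powr p \<le> (8 * (2 ^ n * fact n)) powr p" using that by (intro powr_mono2) auto
    also have "\<dots> = 8 powr p * ((2 ^ n) powr p * fact n powr p)" by (simp add: powr_mult)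
    also have "(2 ^ n) powr p = (2 powr p) ^ n" by (rule power_powr_swap) simp
    also have "8 powr p * ((2 powr p) ^ n * fact n powr p) \<le> 8 powr (s + \<sigma>) * (?\<kappa> ^ n * fact n powr p)"
      using that by (intro mult_mono power_mono powr_mono) auto
    finally show ?thesis .
  qed
  have k: "?\<kappa> ^ i \<le> ?\<kappa> ^ (i + j)" "?\<kappa> ^ j \<le> ?\<kappa> ^ (i + j)" for i j using \<kappa> by (auto intro: power_increasing)
  show "gsw s \<sigma> h i j \<le> gsw s \<sigma> (?\<kappa> * h) i j"
    unfolding gsw_def using \<kappa> assms by (intro mult_right_mono power_mono) auto
  have "gsw s \<sigma> h (Suc (Suc i)) j = h\<^sup>2 * h ^ (i + j) * fact (Suc (Suc i)) powr s * fact j powr \<sigma>"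
    by (simp add: gsw_def power2_eq_square mult_ac)
  also have "\<dots> \<le> h\<^sup>2 * h ^ (i + j) * (8 powr (s + \<sigma>) * (?\<kappa> ^ (i + j) * fact i powr s)) * fact j powr \<sigma>"
    using assms by (intro mult_right_mono mult_left_mono order_trans[OF F] k) auto
  also have "\<dots> = (h\<^sup>2 * 8 powr (s + \<sigma>)) * gsw s \<sigma> (?\<kappa> * h) i j"
    by (simp add: gsw_def power_mult_distrib mult_ac)
  finally show "gsw s \<sigma> h (Suc (Suc i)) j \<le> (h\<^sup>2 * 8 powr (s + \<sigma>)) * gsw s \<sigma> (?\<kappa> * h) i j" .
  have "gsw s \<sigma> h i (Suc (Suc j)) = h\<^sup>2 * h ^ (i + j) * fact (Suc (Suc j)) powr \<sigma> * fact i powr s"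
    by (simp add: gsw_def power2_eq_square mult_ac)
  also have "\<dots> \<le> h\<^sup>2 * h ^ (i + j) * (8 powr (s + \<sigma>) * (?\<kappa> ^ (i + j) * fact j powr \<sigma>)) * fact i powr s"
    using assms by (intro mult_right_mono mult_left_mono order_trans[OF F] k) auto
  also have "\<dots> = (h\<^sup>2 * 8 powr (s + \<sigma>)) * gsw s \<sigma> (?\<kappa> * h) i j"
    by (simp add: gsw_def power_mult_distrib mult_ac)
  finally show "gsw s \<sigma> h i (Suc (Suc j)) \<le> (h\<^sup>2 * 8 powr (s + \<sigma>)) * gsw s \<sigma> (?\<kappa> * h) i j" .
qed

text \<open>Each level of \<open>dec\<close> enlarges the step by the same factor, by
  \<open>gsw_shift\<close>; the induction therefore has to range over all \<open>h\<close>.\<close>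

lemma dec_gsw:
  assumes s: "0 < s" "0 < \<sigma>"
  shows "0 < h \<Longrightarrow> \<exists>K\<ge>0. \<forall>m. \<forall>B\<ge>0. (\<forall>i j. m i j \<le> B * gsw s \<sigma> h i j) \<longrightarrow>
     (\<forall>i j. dec r n m i j \<le> B * K * gsw s \<sigma> ((2 powr (s + \<sigma>)) ^ n * h) i j)"
proof (induction n arbitrary: h)
  case 0
  show ?case by (intro exI[of _ 1]) auto
next
  case (Suc n)
  let ?\<kappa> = "2 powr (s + \<sigma>)"
  let ?C = "h\<^sup>2 * 8 powr (s + \<sigma>)"
  have h: "0 < h" "0 < ?\<kappa> * h" using Suc.prems by auto
  obtain K where K0: "0 \<le> K" and K1: "\<forall>m. \<forall>B\<ge>0. (\<forall>i j. m i j \<le> B * gsw s \<sigma> (?\<kappa> * h) i j) \<longrightarrow>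
     (\<forall>i j. dec r n m i j \<le> B * K * gsw s \<sigma> (?\<kappa> ^ n * (?\<kappa> * h)) i j)"
    using Suc.IH[OF h(2)] by blast
  note K = K0 K1[rule_format]
  have main: "dec r (Suc n) m i j \<le> B * ((1 + ?C) * K) * gsw s \<sigma> (?\<kappa> ^ Suc n * h) i j"
    if B: "0 \<le> B" and m: "\<And>i j. m i j \<le> B * gsw s \<sigma> h i j" for m B i j
  proof -
    have m1: "m i j \<le> B * gsw s \<sigma> (?\<kappa> * h) i j" for i j
      using order_trans[OF m mult_left_mono[OF gsw_shift(3)[OF s h(1)] B]] .
    have m2: "m (Suc (Suc i)) j \<le> (B * ?C) * gsw s \<sigma> (?\<kappa> * h) i j" for i j
      using order_trans[OF m mult_left_mono[OF gsw_shift(1)[OF s h(1)] B]] by (simp add: mult_ac)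
    have m3: "m i (Suc (Suc j)) \<le> (B * ?C) * gsw s \<sigma> (?\<kappa> * h) i j" for i j
      using order_trans[OF m mult_left_mono[OF gsw_shift(2)[OF s h(1)] B]] by (simp add: mult_ac)
    have BC: "0 \<le> B * ?C" using B by simp
    have "dec r n m i j \<le> B * K * gsw s \<sigma> (?\<kappa> ^ n * (?\<kappa> * h)) i j" by (rule K(2)[OF B]) (rule m1)
    moreover have "dec r n (\<lambda>i j. if r then m (Suc (Suc i)) j else m i (Suc (Suc j))) i j \<le> (B * ?C) * K * gsw s \<sigma> (?\<kappa> ^ n * (?\<kappa> * h)) i j"
      by (rule K(2)[OF BC]) (use m2 m3 in auto)
    ultimately have "dec r (Suc n) m i j \<le> B * K * gsw s \<sigma> (?\<kappa> ^ n * (?\<kappa> * h)) i j + (B * ?C) * K * gsw s \<sigma> (?\<kappa> ^ n * (?\<kappa> * h)) i j"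
      by simp
    also have "\<dots> = B * ((1 + ?C) * K) * gsw s \<sigma> (?\<kappa> ^ n * (?\<kappa> * h)) i j" by (simp add: algebra_simps)
    finally show ?thesis by (simp add: mult_ac)
  qed
  show ?case
  proof (intro exI[of _ "(1 + ?C) * K"] conjI allI impI)
    show "0 \<le> (1 + ?C) * K" using K(1) by simp
    fix m :: "nat \<Rightarrow> nat \<Rightarrow> real" and B :: real and i j
    assume "0 \<le> B" and m: "\<forall>i j. m i j \<le> B * gsw s \<sigma> h i j"
    from this(1) show "dec r (Suc n) m i j \<le> B * ((1 + ?C) * K) * gsw s \<sigma> (?\<kappa> ^ Suc n * h) i j"
      by (rule main) (rule m[rule_format])
  qed
qed

text \<open>The constant \<open>B\<close> is kept apart so that the estimates are linear in the norm of the function.\<close>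

definition gs_map :: "real \<Rightarrow> real \<Rightarrow> real \<Rightarrow> real \<Rightarrow> real \<Rightarrow> ((nat \<Rightarrow> nat \<Rightarrow> real) \<Rightarrow> nat \<Rightarrow> nat \<Rightarrow> real) \<Rightarrow> bool" where
  "gs_map s \<sigma> h h' K T \<longleftrightarrow> (\<forall>m. \<forall>B\<ge>0. (\<forall>i j. m i j \<le> B * gsw s \<sigma> h i j) \<longrightarrow>
     (\<forall>i j. T m i j \<le> B * K * gsw s \<sigma> h' i j))"

text \<open>\<kappa> is chosen before \<open>h\<close>, and only \<open>K\<close> may depend on
  \<open>h\<close>: dividing by \<kappa> then yields a source step for any prescribed target
  step.\<close>

definition gs_tame :: "real \<Rightarrow> real \<Rightarrow> ((nat \<Rightarrow> nat \<Rightarrow> real) \<Rightarrow> nat \<Rightarrow> nat \<Rightarrow> real) \<Rightarrow> bool" where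
  "gs_tame s \<sigma> T \<longleftrightarrow> (\<exists>\<kappa>>0. \<forall>h>0. \<exists>K\<ge>0. gs_map s \<sigma> h (\<kappa> * h) K T)"

lemma gs_map_comp:
  assumes "gs_map s \<sigma> h h' K T" "gs_map s \<sigma> h' h'' K' T'" "0 \<le> K"
  shows "gs_map s \<sigma> h h'' (K * K') (\<lambda>m. T' (T m))"
  unfolding gs_map_def
proof (intro allI impI)
  fix m :: "nat \<Rightarrow> nat \<Rightarrow> real" and B :: real and i j
  assume B: "0 \<le> B" and m: "\<forall>i j. m i j \<le> B * gsw s \<sigma> h i j"
  have "\<forall>i j. T m i j \<le> (B * K) * gsw s \<sigma> h' i j"
    using assms(1)[unfolded gs_map_def, rule_format, OF B m[rule_format]] by blast
  from assms(2)[unfolded gs_map_def, rule_format, OF _ this[rule_format]] B assms(3)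
  have "T' (T m) i j \<le> (B * K) * K' * gsw s \<sigma> h'' i j" by simp
  then show "T' (T m) i j \<le> B * (K * K') * gsw s \<sigma> h'' i j" by (simp only: mult.assoc)
qed

lemma gs_tame_comp:
  assumes "gs_tame s \<sigma> T" "gs_tame s \<sigma> T'"
  shows "gs_tame s \<sigma> (\<lambda>m. T' (T m))"
proof -
  obtain \<kappa> where \<kappa>: "0 < \<kappa>" "\<forall>h>0. \<exists>K\<ge>0. gs_map s \<sigma> h (\<kappa> * h) K T" using assms(1) unfolding gs_tame_def by blast
  obtain \<kappa>' where \<kappa>': "0 < \<kappa>'" "\<forall>h>0. \<exists>K\<ge>0. gs_map s \<sigma> h (\<kappa>' * h) K T'" using assms(2) unfolding gs_tame_def by blast
  have "\<exists>K\<ge>0. gs_map s \<sigma> h (\<kappa>' * \<kappa> * h) K (\<lambda>m. T' (T m))" if h: "0 < h" for h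
  proof -
    obtain K where K: "0 \<le> K" "gs_map s \<sigma> h (\<kappa> * h) K T" using \<kappa>(2) h by blast
    have "0 < \<kappa> * h" using \<kappa> h by simp
    then obtain K' where K': "0 \<le> K'" "gs_map s \<sigma> (\<kappa> * h) (\<kappa>' * (\<kappa> * h)) K' T'" using \<kappa>'(2) by blast
    have "gs_map s \<sigma> h (\<kappa>' * \<kappa> * h) (K * K') (\<lambda>m. T' (T m))"
      using gs_map_comp[OF K(2) K'(2) K(1)] by (simp only: mult.assoc)
    then show ?thesis using K(1) K'(1) mult_nonneg_nonneg by blast
  qed
  moreover have "0 < \<kappa>' * \<kappa>" using \<kappa> \<kappa>' by simp
  ultimately show ?thesis unfolding gs_tame_def by blast
qed

lemma gs_tame_PF_weight:
  assumes "0 < s" "0 < \<sigma>" "0 \<le> C" shows "gs_tame s \<sigma> (PF_weight n C r)"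
proof -
  have "\<exists>K\<ge>0. gs_map s \<sigma> h ((2 powr (s + \<sigma>)) ^ n * h) K (PF_weight n C r)" if h: "0 < h" for h
  proof -
    obtain K where K: "0 \<le> K" "gs_map s \<sigma> h ((2 powr (s + \<sigma>)) ^ n * h) K (dec r n)"
      using dec_gsw[OF assms(1,2) h] unfolding gs_map_def[symmetric] by blast
    have "gs_map s \<sigma> h ((2 powr (s + \<sigma>)) ^ n * h) (C * K) (PF_weight n C r)"
      unfolding gs_map_def
    proof (intro allI impI)
      fix m :: "nat \<Rightarrow> nat \<Rightarrow> real" and B :: real and i j
      assume B: "0 \<le> B" and m: "\<forall>i j. m i j \<le> B * gsw s \<sigma> h i j"
      have "dec r n m i j \<le> B * K * gsw s \<sigma> ((2 powr (s + \<sigma>)) ^ n * h) i j"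
        by (rule K(2)[unfolded gs_map_def, rule_format, OF B m[rule_format]])
      from mult_left_mono[OF this assms(3)] show "PF_weight n C r m i j \<le> B * (C * K) * gsw s \<sigma> ((2 powr (s + \<sigma>)) ^ n * h) i j"
        by (simp add: PF_weight_def mult_ac)
    qed
    then show ?thesis using assms(3) K(1) mult_nonneg_nonneg by blast
  qed
  moreover have "0 < (2 powr (s + \<sigma>)) ^ n" by simp
  ultimately show ?thesis unfolding gs_tame_def by blast
qed

lemma gs_tame_SA_weight: "gs_tame s \<sigma> (SA_weight t)"
proof -
  let ?c = "2 * (2 + \<bar>t\<bar>)"
  have "gs_map s \<sigma> h (?c * h) 1 (SA_weight t)" for h
    unfolding gs_map_def
  proof (intro allI impI)
    fix m :: "nat \<Rightarrow> nat \<Rightarrow> real" and B :: real and i j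
    assume B: "0 \<le> B" and m: "\<forall>i j. m i j \<le> B * gsw s \<sigma> h i j"
    have "?c ^ (i + j) * m i j \<le> ?c ^ (i + j) * (B * gsw s \<sigma> h i j)" using m by (intro mult_left_mono) auto
    also have "\<dots> = B * gsw s \<sigma> (?c * h) i j" unfolding gsw_def power_mult_distrib[of ?c h] by (simp only: mult_ac)
    finally show "SA_weight t m i j \<le> B * 1 * gsw s \<sigma> (?c * h) i j" by (simp add: SA_weight_def)
  qed
  moreover have "0 < ?c" by simp
  ultimately show ?thesis unfolding gs_tame_def by (meson zero_le_one)
qed

text \<open>The Schwartz counterpart of \<open>gs_tame\<close>: only the total degree counts, and a
  loss of \<open>L\<close> orders with a constant depending on the degree is allowed. Monotone
  majorants \<open>q\<close> let lower degrees be estimated by higher ones.\<close>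

definition sc_tame :: "((nat \<Rightarrow> nat \<Rightarrow> real) \<Rightarrow> nat \<Rightarrow> nat \<Rightarrow> real) \<Rightarrow> bool" where
  "sc_tame T \<longleftrightarrow> (\<exists>L c. mono c \<and> (\<forall>n. 0 \<le> c n) \<and> (\<forall>m q. mono q \<longrightarrow> (\<forall>n. 0 \<le> q n) \<longrightarrow>
     (\<forall>i j. m i j \<le> q (i + j)) \<longrightarrow> (\<forall>i j. T m i j \<le> c (i + j) * q (i + j + L))))"

lemma sc_tameI:
  fixes c :: "nat \<Rightarrow> real"
  assumes "mono c" "\<And>n. 0 \<le> c n" "\<And>m q i j. mono q \<Longrightarrow> (\<And>n. 0 \<le> q n) \<Longrightarrow> (\<And>i j. m i j \<le> q (i + j)) \<Longrightarrow> T m i j \<le> c (i + j) * q (i + j + L)"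
  shows "sc_tame T"
  unfolding sc_tame_def by (rule exI[of _ L], rule exI[of _ c]) (use assms in simp)

lemma sc_tame_comp:
  assumes "sc_tame T" "sc_tame T'" shows "sc_tame (\<lambda>m. T' (T m))"
proof -
  obtain L c where c: "mono c" "\<And>n. 0 \<le> c n" and T: "\<And>m q i j. mono q \<Longrightarrow> (\<And>n. 0 \<le> q n) \<Longrightarrow>
     (\<And>i j. m i j \<le> q (i + j)) \<Longrightarrow> T m i j \<le> c (i + j) * q (i + j + L)" using assms(1) unfolding sc_tame_def by metis
  obtain L' c' where c': "mono c'" "\<And>n. 0 \<le> c' n" and T': "\<And>m q i j. mono q \<Longrightarrow> (\<And>n. 0 \<le> q n) \<Longrightarrow>
     (\<And>i j. m i j \<le> q (i + j)) \<Longrightarrow> T' m i j \<le> c' (i + j) * q (i + j + L')" using assms(2) unfolding sc_tame_def by metis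
  show ?thesis
  proof (rule sc_tameI)
    show "mono (\<lambda>n. c' n * c (n + L'))" using c c' by (auto intro!: monoI mult_mono monoD[of c] monoD[of c'])
    show "0 \<le> c' n * c (n + L')" for n using c c' by simp
    fix m and q :: "nat \<Rightarrow> real" and i j assume q: "mono q" "\<And>n. 0 \<le> q n" "\<And>i j. m i j \<le> q (i + j)"
    have "T' (T m) i j \<le> c' (i + j) * (c (i + j + L') * q (i + j + L' + L))"
    proof (rule T'[where q = "\<lambda>n. c n * q (n + L)"])
      show "mono (\<lambda>n. c n * q (n + L))" using c q by (auto intro!: monoI mult_mono monoD[of c] monoD[of q])
      show "0 \<le> c n * q (n + L)" for n using c q by simp
      show "T m i j \<le> c (i + j) * q (i + j + L)" for i j by (rule T[OF q])
    qed
    then show "T' (T m) i j \<le> c' (i + j) * c (i + j + L') * q (i + j + (L' + L))" by (simp add: mult.assoc add.assoc)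
  qed
qed

text \<open>Contractions only lower the degree, so no order is lost; factorial growth of the
  constant is harmless here.\<close>

lemma sc_tame_reorder: "sc_tame reorder"
proof (rule sc_tameI)
  show "mono (\<lambda>n. real (Suc n) * (2 ^ n * 2 ^ n * fact n))"
    by (intro monoI mult_mono power_increasing fact_mono) auto
  show "0 \<le> real (Suc n) * (2 ^ n * 2 ^ n * fact n)" for n by simp
  fix m and q :: "nat \<Rightarrow> real" and i j assume q: "mono q" "\<And>n. 0 \<le> q n" "\<And>i j. m i j \<le> q (i + j)"
  have p: "real (a choose k) \<le> 2 ^ (i + j)" if "a \<le> i + j" for a k
  proof -
    have "real (a choose k) \<le> 2 ^ a" using binomial_le_pow2[of a k] by (metis of_nat_le_iff of_nat_numeral of_nat_power)
    also have "(2::real) ^ a \<le> 2 ^ (i + j)" using that by (intro power_increasing) auto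
    finally show ?thesis .
  qed
  have "reorder m i j \<le> (\<Sum>k\<le>i + j. 2 ^ (i + j) * 2 ^ (i + j) * fact (i + j) * q (i + j))"
    unfolding reorder_def
  proof (rule sum_mono)
    fix k assume k: "k \<in> {..i + j}"
    have "real (i choose k) * real (j choose k) * fact k * m (i - k) (j - k) \<le> real (i choose k) * real (j choose k) * fact k * q (i + j)"
      using order_trans[OF q(3) monoD[OF q(1), of "i - k + (j - k)" "i + j"]] by (intro mult_left_mono) auto
    also have "\<dots> \<le> 2 ^ (i + j) * 2 ^ (i + j) * fact (i + j) * q (i + j)"
      using k q(2) by (intro mult_mono p fact_mono) auto
    finally show "real (i choose k) * real (j choose k) * fact k * m (i - k) (j - k) \<le> 2 ^ (i + j) * 2 ^ (i + j) * fact (i + j) * q (i + j)" .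
  qed
  also have "\<dots> = real (Suc (i + j)) * (2 ^ (i + j) * 2 ^ (i + j) * fact (i + j)) * q (i + j + 0)" by simp
  finally show "reorder m i j \<le> real (Suc (i + j)) * (2 ^ (i + j) * 2 ^ (i + j) * fact (i + j)) * q (i + j + 0)" .
qed

text \<open>Each level of \<open>dec\<close> doubles the number of terms and raises the degree by at
  most two.\<close>

lemma dec_sc:
  fixes q :: "nat \<Rightarrow> real"
  shows "mono q \<Longrightarrow> (\<And>n. 0 \<le> q n) \<Longrightarrow> (\<And>i j. m i j \<le> q (i + j)) \<Longrightarrow> dec r n m i j \<le> 2 ^ n * q (i + j + 2 * n)"
proof (induction n arbitrary: m q i j)
  case (Suc n)
  have "dec r n m i j \<le> 2 ^ n * q (i + j + 2 * n)" by (rule Suc.IH[OF Suc.prems])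
  also have "\<dots> \<le> 2 ^ n * q (i + j + 2 * Suc n)" by (intro mult_left_mono monoD[OF Suc.prems(1)]) auto
  finally have 1: "dec r n m i j \<le> 2 ^ n * q (i + j + 2 * Suc n)" .
  have "dec r n (\<lambda>i j. if r then m (Suc (Suc i)) j else m i (Suc (Suc j))) i j \<le> 2 ^ n * q (Suc (Suc (i + j + 2 * n)))"
  proof (rule Suc.IH[where q = "\<lambda>n. q (Suc (Suc n))"])
    show "mono (\<lambda>n. q (Suc (Suc n)))" using Suc.prems(1) by (auto intro!: monoI monoD[of q])
    show "(if r then m (Suc (Suc i)) j else m i (Suc (Suc j))) \<le> q (Suc (Suc (i + j)))" for i j
      using Suc.prems(3)[of "Suc (Suc i)" j] Suc.prems(3)[of i "Suc (Suc j)"] by simp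
  qed (rule Suc.prems(2))
  with 1 show ?case by simp
qed simp

lemma sc_tame_PF_weight: "0 \<le> C \<Longrightarrow> sc_tame (PF_weight n C r)"
proof (rule sc_tameI)
  show "mono (\<lambda>_::nat. C * 2 ^ n)" by (rule monoI) simp
  fix m and q :: "nat \<Rightarrow> real" and i j assume "0 \<le> C" and q: "mono q" "\<And>n. 0 \<le> q n" "\<And>i j. m i j \<le> q (i + j)"
  from mult_left_mono[OF dec_sc[OF q] \<open>0 \<le> C\<close>] show "PF_weight n C r m i j \<le> C * 2 ^ n * q (i + j + 2 * n)"
    by (simp add: PF_weight_def mult.assoc)
qed simp

lemma sc_tame_SA_weight: "sc_tame (SA_weight t)"
proof (rule sc_tameI)
  show "mono (\<lambda>n. (2 * (2 + \<bar>t\<bar>)) ^ n)" by (intro monoI power_increasing) auto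
  fix m and q :: "nat \<Rightarrow> real" and i j assume q: "mono q" "\<And>n. 0 \<le> q n" "\<And>i j. m i j \<le> q (i + j)"
  show "SA_weight t m i j \<le> (2 * (2 + \<bar>t\<bar>)) ^ (i + j) * q (i + j + 0)"
    unfolding SA_weight_def using q(3)[of i j] by (intro mult_left_mono) auto
qed simp

section \<open>Continuous maps of the function spaces\<close>

text \<open>The balls are only a subbase, so a neighbourhood of a point is built as a finite
  intersection of balls around that very point, one for each seminorm in \<open>Q\<close>.\<close>

lemma continuous_map_seminorm:
  fixes \<Phi> :: "('a \<Rightarrow> complex) \<Rightarrow> 'a \<Rightarrow> complex"
  assumes V: "\<And>f. f \<in> V \<Longrightarrow> \<Phi> f \<in> V'" "V \<noteq> {}" "P \<noteq> {}"
    and diff: "\<And>f g. f \<in> V \<Longrightarrow> g \<in> V \<Longrightarrow> (\<lambda>x. f x - g x) \<in> V" "\<And>f g. f \<in> V' \<Longrightarrow> g \<in> V' \<Longrightarrow> (\<lambda>x. f x - g x) \<in> V'"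
    and zero: "\<And>p. p \<in> P \<Longrightarrow> p (\<lambda>x. 0) = 0"
    and lin: "\<And>f g. f \<in> V \<Longrightarrow> g \<in> V \<Longrightarrow> \<Phi> (\<lambda>x. f x - g x) = (\<lambda>x. \<Phi> f x - \<Phi> g x)"
    and tri: "\<And>p f g. p \<in> P' \<Longrightarrow> f \<in> V' \<Longrightarrow> g \<in> V' \<Longrightarrow> p (\<lambda>x. f x + g x) \<le> p f + p g"
    and bound: "\<And>p. p \<in> P' \<Longrightarrow> \<exists>Q C. finite Q \<and> Q \<subseteq> P \<and> 0 \<le> C \<and> (\<forall>f\<in>V. p (\<Phi> f) \<le> C * (\<Sum>q\<in>Q. q f))"
    and P': "V' \<subseteq> topspace (seminorm_topology V' P')"
  shows "continuous_map (seminorm_topology V P) (seminorm_topology V' P') \<Phi>"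
proof -
  have ball: "openin (seminorm_topology V P) {g \<in> V. p (\<lambda>x. g x - f x) < e}" if "p \<in> P" "f \<in> V" "0 < e" for p f e
    unfolding seminorm_topology_def by (rule topology_generated_by_Basis) (use that in blast)
  have ts: "topspace (seminorm_topology V P) \<subseteq> V"
    unfolding seminorm_topology_def by auto
  show ?thesis
    unfolding seminorm_topology_def[of V']
  proof (rule continuous_on_generated_topo)
    show "\<Phi> ` topspace (seminorm_topology V P) \<subseteq> \<Union> {{g \<in> V'. p (\<lambda>x. g x - f x) < e} | p f e. p \<in> P' \<and> f \<in> V' \<and> 0 < e}"
      using ts V(1) P' unfolding seminorm_topology_def[of V'] topology_generated_by_topspace by blast
    fix U assume "U \<in> {{g \<in> V'. p (\<lambda>x. g x - f x) < e} | p f e. p \<in> P' \<and> f \<in> V' \<and> 0 < e}"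
    then obtain p f0 e where U: "U = {g \<in> V'. p (\<lambda>x. g x - f0 x) < e}" "p \<in> P'" "f0 \<in> V'" "0 < e" by blast
    obtain Q C where Q: "finite Q" "Q \<subseteq> P" "0 \<le> C" "\<And>f. f \<in> V \<Longrightarrow> p (\<Phi> f) \<le> C * (\<Sum>q\<in>Q. q f)"
      using bound[OF U(2)] by blast
    show "openin (seminorm_topology V P) (\<Phi> -` U \<inter> topspace (seminorm_topology V P))"
    proof (subst openin_subopen, intro ballI)
      fix x0 assume x0: "x0 \<in> \<Phi> -` U \<inter> topspace (seminorm_topology V P)"
      then have x0V: "x0 \<in> V" using ts by blast
      have lt: "p (\<lambda>x. \<Phi> x0 x - f0 x) < e" using x0 U(1) by simp
      \<comment> \<open>\<open>C * card Q * d\<close> has to stay below the distance left to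
        \<open>e\<close>; the added 1 covers an empty \<open>Q\<close> and
        \<open>C = 0\<close>.\<close>
      define d where "d = (e - p (\<lambda>x. \<Phi> x0 x - f0 x)) / (C * real (card Q) + 1)"
      have Cp: "0 < C * real (card Q) + 1" using Q(3) by (simp add: add_nonneg_pos)
      have d: "0 < d" using lt Cp by (simp add: d_def)
      \<comment> \<open>The intersection with the whole space keeps \<open>N\<close> open when
        \<open>Q\<close> is empty.\<close>
      define N where "N = topspace (seminorm_topology V P) \<inter> (\<Inter>q\<in>Q. {g \<in> V. q (\<lambda>x. g x - x0 x) < d})"
      have oN: "openin (seminorm_topology V P) N"
      proof (cases "Q = {}")
        case True then show ?thesis by (simp add: N_def)
      next
        case False
        show ?thesis unfolding N_def
          by (intro openin_Int openin_topspace openin_INT2 Q(1) False) (use ball d x0V Q(2) in blast)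
      qed
      have "q (\<lambda>x. x0 x - x0 x) < d" if "q \<in> Q" for q using zero[of q] that Q(2) d by auto
      then have xN: "x0 \<in> N" using x0 x0V unfolding N_def by blast
      have sub: "N \<subseteq> \<Phi> -` U \<inter> topspace (seminorm_topology V P)"
      proof
        fix g assume g: "g \<in> N"
        then have gV: "g \<in> V" using ts unfolding N_def by blast
        have "p (\<lambda>x. \<Phi> g x - f0 x) = p (\<lambda>x. (\<Phi> g x - \<Phi> x0 x) + (\<Phi> x0 x - f0 x))" by simp
        also have "\<dots> \<le> p (\<lambda>x. \<Phi> g x - \<Phi> x0 x) + p (\<lambda>x. \<Phi> x0 x - f0 x)"
          by (intro tri U(2) diff V(1) gV x0V U(3))
        also have "p (\<lambda>x. \<Phi> g x - \<Phi> x0 x) = p (\<Phi> (\<lambda>x. g x - x0 x))" by (simp only: lin[OF gV x0V])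
        also have "\<dots> \<le> C * (\<Sum>q\<in>Q. q (\<lambda>x. g x - x0 x))" by (rule Q(4)[OF diff(1)[OF gV x0V]])
        also have "\<dots> \<le> C * (\<Sum>q\<in>Q. d)"
          using g Q(3) unfolding N_def by (intro mult_left_mono sum_mono) auto
        also have "\<dots> = (C * real (card Q)) * d" by simp
        also have "\<dots> < (C * real (card Q) + 1) * d" using d by (intro mult_strict_right_mono) auto
        also have "\<dots> = e - p (\<lambda>x. \<Phi> x0 x - f0 x)" using Cp by (simp add: d_def)
        finally have "p (\<lambda>x. \<Phi> g x - f0 x) < e" by simp
        then show "g \<in> \<Phi> -` U \<inter> topspace (seminorm_topology V P)"
          using g V(1)[OF gV] U(1) unfolding N_def by auto
      qed
      show "\<exists>T. openin (seminorm_topology V P) T \<and> x0 \<in> T \<and> T \<subseteq> \<Phi> -` U \<inter> topspace (seminorm_topology V P)"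
        using oN xN sub by blast
    qed
  qed
qed

lemma topspace_seminorm:
  assumes "P \<noteq> {}" "\<And>p. p \<in> P \<Longrightarrow> p (\<lambda>x. 0) = (0::real)"
  shows "topspace (seminorm_topology V P) = V"
proof -
  obtain p where p: "p \<in> P" using assms(1) by blast
  let ?S = "{{g \<in> V. p (\<lambda>x. g x - f x) < e} | p f e. p \<in> P \<and> f \<in> V \<and> 0 < e}"
  have "f \<in> \<Union> ?S" if f: "f \<in> V" for f
  proof (rule UnionI)
    show "{g \<in> V. p (\<lambda>x. g x - f x) < 1} \<in> ?S" using p f zero_less_one by blast
    show "f \<in> {g \<in> V. p (\<lambda>x. g x - f x) < 1}" using f assms(2)[OF p] by simp
  qed
  moreover have "\<Union> ?S \<subseteq> V" by auto
  ultimately show ?thesis unfolding seminorm_topology_def topology_generated_by_topspace by (intro subset_antisym subsetI) auto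
qed

text \<open>A subbasic set lives on one step \<open>j\<close>; its preimage is the trace of an open
  set of the source step that \<open>cont\<close> provides for \<open>j\<close>.\<close>

lemma continuous_map_proj_limit:
  assumes V: "\<And>f. f \<in> V \<Longrightarrow> \<Phi> f \<in> V" and sub: "\<And>i. i \<in> I \<Longrightarrow> V \<subseteq> topspace (T i)" "I \<noteq> {}"
    and cont: "\<And>j. j \<in> I \<Longrightarrow> \<exists>i\<in>I. continuous_map (T i) (T j) \<Phi>"
  shows "continuous_map (proj_limit_topology V I T) (proj_limit_topology V I T) \<Phi>"
    and "topspace (proj_limit_topology V I T) = V"
proof -
  obtain i where i: "i \<in> I" using sub(2) by blast
  show ts: "topspace (proj_limit_topology V I T) = V"
  proof
    show "V \<subseteq> topspace (proj_limit_topology V I T)"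
      unfolding proj_limit_topology_def topology_generated_by_topspace using i sub(1)[OF i] openin_topspace[of "T i"] by blast
  qed (auto simp: proj_limit_topology_def)
  have eq: "proj_limit_topology V I T = topology_generated_by {V \<inter> U | U i. i \<in> I \<and> openin (T i) U}"
    by (rule proj_limit_topology_def)
  have "continuous_map (proj_limit_topology V I T) (topology_generated_by {V \<inter> U | U i. i \<in> I \<and> openin (T i) U}) \<Phi>"
  proof (rule continuous_on_generated_topo)
    show "\<Phi> ` topspace (proj_limit_topology V I T) \<subseteq> \<Union> {V \<inter> U | U i. i \<in> I \<and> openin (T i) U}"
      using V i sub(1)[OF i] openin_topspace[of "T i"] unfolding ts by blast
    fix W assume "W \<in> {V \<inter> U | U i. i \<in> I \<and> openin (T i) U}"
    then obtain U j where W: "W = V \<inter> U" "j \<in> I" "openin (T j) U" by blast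
    obtain i where i: "i \<in> I" "continuous_map (T i) (T j) \<Phi>" using cont[OF W(2)] by blast
    have "openin (T i) {x \<in> topspace (T i). \<Phi> x \<in> U}" using i(2) W(3) by (rule openin_continuous_map_preimage)
    then have "openin (proj_limit_topology V I T) (V \<inter> {x \<in> topspace (T i). \<Phi> x \<in> U})"
      unfolding proj_limit_topology_def by (intro topology_generated_by_Basis) (use i(1) in blast)
    moreover have "\<Phi> -` W \<inter> topspace (proj_limit_topology V I T) = V \<inter> {x \<in> topspace (T i). \<Phi> x \<in> U}"
      unfolding ts W(1) using V sub(1)[OF i(1)] by auto
    ultimately show "openin (proj_limit_topology V I T) (\<Phi> -` W \<inter> topspace (proj_limit_topology V I T))" by simp
  qed
  then show "continuous_map (proj_limit_topology V I T) (proj_limit_topology V I T) \<Phi>"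
    by (simp only: eq[symmetric])
qed

text \<open>Here a target step is provided for every source step. By linearity the preimage of an
  absolutely convex neighbourhood of 0 is again one, and translates map to translates.\<close>

lemma continuous_map_ind_limit:
  fixes \<Phi> :: "('a \<Rightarrow> complex) \<Rightarrow> 'a \<Rightarrow> complex"
  assumes V: "\<And>f. f \<in> V \<Longrightarrow> \<Phi> f \<in> V" "(\<lambda>x. 0) \<in> V" and sub: "\<And>i. i \<in> I \<Longrightarrow> topspace (T i) \<subseteq> V" "\<And>i. i \<in> I \<Longrightarrow> (\<lambda>x. 0) \<in> topspace (T i)"
    and comb: "\<And>f g c d. f \<in> V \<Longrightarrow> g \<in> V \<Longrightarrow> (\<lambda>x. c * f x + d * g x) \<in> V"
    and lin: "\<And>f g c d. f \<in> V \<Longrightarrow> g \<in> V \<Longrightarrow> \<Phi> (\<lambda>x. c * f x + d * g x) = (\<lambda>x. c * \<Phi> f x + d * \<Phi> g x)"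
    and cont: "\<And>i. i \<in> I \<Longrightarrow> \<exists>j\<in>I. continuous_map (T i) (T j) \<Phi>"
  shows "continuous_map (ind_limit_topology V I T) (ind_limit_topology V I T) \<Phi>"
    and "topspace (ind_limit_topology V I T) = V"
proof -
  let ?T = "ind_limit_topology V I T"
  have "ind_limit_nhd V I T V"
    unfolding ind_limit_nhd_def abs_convex_def using comb sub by (meson openin_topspace order_refl)
  moreover have "(\<lambda>x. f x + g x) \<in> V" if "f \<in> V" "g \<in> V" for f g using comb[OF that, of 1 1] by simp
  ultimately have "openin ?T V" unfolding openin_ind_limit_topology by blast
  then show ts: "topspace ?T = V"
    by (metis openin_ind_limit_topology openin_subset openin_topspace subset_antisym)
  have P0: "\<Phi> (\<lambda>x. 0) = (\<lambda>x. 0)" using lin[OF V(2) V(2), of 0 0] by simp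
  have "openin ?T {x \<in> V. \<Phi> x \<in> U}" if U: "openin ?T U" for U
    unfolding openin_ind_limit_topology
  proof (intro conjI ballI)
    fix f assume f: "f \<in> {x \<in> V. \<Phi> x \<in> U}"
    then obtain W where W: "ind_limit_nhd V I T W" "\<forall>g\<in>W. (\<lambda>x. \<Phi> f x + g x) \<in> U"
      using U unfolding openin_ind_limit_topology by blast
    let ?W = "{g \<in> V. \<Phi> g \<in> W}"
    have "abs_convex ?W"
      using W(1) comb lin unfolding ind_limit_nhd_def abs_convex_def by auto
    moreover have "\<exists>N. openin (T i) N \<and> (\<lambda>x. 0) \<in> N \<and> N \<subseteq> ?W" if i: "i \<in> I" for i
    proof -
      obtain j where j: "j \<in> I" "continuous_map (T i) (T j) \<Phi>" using cont[OF i] by blast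
      obtain N where N: "openin (T j) N" "(\<lambda>x. 0) \<in> N" "N \<subseteq> W" using W(1) j(1) unfolding ind_limit_nhd_def by blast
      have "openin (T i) {x \<in> topspace (T i). \<Phi> x \<in> N}" using j(2) N(1) by (rule openin_continuous_map_preimage)
      then show ?thesis using N sub[OF i] P0 by (intro exI[of _ "{x \<in> topspace (T i). \<Phi> x \<in> N}"]) auto
    qed
    ultimately have "ind_limit_nhd V I T ?W" unfolding ind_limit_nhd_def by auto
    moreover have "(\<lambda>x. f x + g x) \<in> {x \<in> V. \<Phi> x \<in> U}" if g: "g \<in> ?W" for g
    proof -
      have fV: "f \<in> V" and gV: "g \<in> V" using f g by auto
      have "\<Phi> (\<lambda>x. f x + g x) = (\<lambda>x. \<Phi> f x + \<Phi> g x)" "(\<lambda>x. f x + g x) \<in> V"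
        using lin[OF fV gV, of 1 1] comb[OF fV gV, of 1 1] by simp_all
      then show ?thesis using W(2) g by simp
    qed
    ultimately show "\<exists>W. ind_limit_nhd V I T W \<and> (\<forall>g\<in>W. (\<lambda>x. f x + g x) \<in> {x \<in> V. \<Phi> x \<in> U})" by blast
  qed auto
  then show "continuous_map ?T ?T \<Phi>"
    unfolding continuous_map_def ts using V(1) by auto
qed

section \<open>Linear structure of the Gelfand-Shilov steps\<close>

lemma foldr_partial_lincomb:
  assumes "smooth f" "smooth g" "set bs \<subseteq> Basis"
  shows "foldr partial bs (\<lambda>x. c * f x + d * g x) = (\<lambda>x. c * foldr partial bs f x + d * foldr partial bs g x)"
  using assms(3)
proof (induction bs)
  case (Cons b bs)
  then have s: "smooth (foldr partial bs f)" "smooth (foldr partial bs g)" using assms(1,2) by (auto intro!: foldr_partial_smooth)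
  show ?case using Cons by (simp add: partial_add partial_cmult smooth_cmult s)
qed simp

lemma mderiv_lincomb:
  "smooth f \<Longrightarrow> smooth g \<Longrightarrow> mderiv \<beta> (\<lambda>x. c * f x + d * g x) = (\<lambda>x. c * mderiv \<beta> f x + d * mderiv \<beta> g x)"
  unfolding mderiv_eq by (rule foldr_partial_lincomb[OF _ _ set_mlist])

lemma smooth_lincomb: "smooth f \<Longrightarrow> smooth g \<Longrightarrow> smooth (\<lambda>x. c * f x + d * g x)"
  by (intro smooth_add smooth_cmult)

lemma gs_step_lincomb:
  assumes f: "f \<in> gs_step p q h" and g: "g \<in> gs_step p q h" and h: "0 < h"
  shows "(\<lambda>x. c * f x + d * g x) \<in> gs_step p q h"
    and "gs_norm p q h (\<lambda>x. c * f x + d * g x) \<le> cmod c * gs_norm p q h f + cmod d * gs_norm p q h g"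
proof -
  have s: "smooth f" "smooth g" using f g by (auto simp: gs_step_def)
  let ?B = "cmod c * gs_norm p q h f + cmod d * gs_norm p q h g"
  have "\<bar>mpower x \<alpha>\<bar> * cmod (mderiv \<beta> (\<lambda>x. c * f x + d * g x) x) \<le> ?B * (h ^ (mlen \<alpha> + mlen \<beta>) * mfact_powr p \<alpha> * mfact_powr q \<beta>)" for x \<alpha> \<beta>
  proof -
    have "\<bar>mpower x \<alpha>\<bar> * cmod (mderiv \<beta> (\<lambda>x. c * f x + d * g x) x) \<le> \<bar>mpower x \<alpha>\<bar> * (cmod c * cmod (mderiv \<beta> f x) + cmod d * cmod (mderiv \<beta> g x))"
      unfolding mderiv_lincomb[OF s] by (intro mult_left_mono norm_triangle_le) (auto simp: norm_mult)
    also have "\<dots> = cmod c * (\<bar>mpower x \<alpha>\<bar> * cmod (mderiv \<beta> f x)) + cmod d * (\<bar>mpower x \<alpha>\<bar> * cmod (mderiv \<beta> g x))"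
      by (simp add: algebra_simps)
    also have "\<dots> \<le> cmod c * (gs_norm p q h f * (h ^ (mlen \<alpha> + mlen \<beta>) * mfact_powr p \<alpha> * mfact_powr q \<beta>)) + cmod d * (gs_norm p q h g * (h ^ (mlen \<alpha> + mlen \<beta>) * mfact_powr p \<alpha> * mfact_powr q \<beta>))"
      by (intro add_mono mult_left_mono gs_step_bound f g h) auto
    also have "\<dots> = ?B * (h ^ (mlen \<alpha> + mlen \<beta>) * mfact_powr p \<alpha> * mfact_powr q \<beta>)" by (simp add: algebra_simps)
    finally show ?thesis .
  qed
  then show "(\<lambda>x. c * f x + d * g x) \<in> gs_step p q h" "gs_norm p q h (\<lambda>x. c * f x + d * g x) \<le> ?B"
    using gs_stepI[OF smooth_lincomb[OF s] h] by blast+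
qed

lemma smooth_zero: "smooth (\<lambda>x. 0)"
proof (rule smooth_coinduct[where Q = "{\<lambda>x. 0}"])
  show "partial b g \<in> {\<lambda>x. 0}" if "g \<in> {\<lambda>x. 0}" for g and b :: 'a using that by (simp add: partial_def)
qed auto

lemma mderiv_zero: "mderiv \<beta> (\<lambda>x. 0) x = 0"
  using mderiv_lincomb[OF smooth_zero smooth_zero, of \<beta> 0 0] by (simp add: fun_eq_iff)

lemma gs_step_zero:
  assumes "0 < h" shows "(\<lambda>x. 0) \<in> gs_step p q h" "gs_norm p q h (\<lambda>x. 0) = 0"
proof -
  have "\<bar>mpower x \<alpha>\<bar> * cmod (mderiv \<beta> (\<lambda>x. 0) x) \<le> 0 * (h ^ (mlen \<alpha> + mlen \<beta>) * mfact_powr p \<alpha> * mfact_powr q \<beta>)" for x \<alpha> \<beta>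
    by (simp add: mderiv_zero)
  from gs_stepI[OF smooth_zero assms this] show "(\<lambda>x. 0) \<in> gs_step p q h" "gs_norm p q h (\<lambda>x. 0) = 0"
    using gs_norm_nonneg[OF _ assms] by (auto intro: antisym)
qed

lemma gs_step_mono:
  assumes f: "f \<in> gs_step p q h" and h: "0 < h" "h \<le> h'"
  shows "f \<in> gs_step p q h'" "gs_norm p q h' f \<le> gs_norm p q h f"
proof -
  have "\<bar>mpower x \<alpha>\<bar> * cmod (mderiv \<beta> f x) \<le> gs_norm p q h f * (h' ^ (mlen \<alpha> + mlen \<beta>) * mfact_powr p \<alpha> * mfact_powr q \<beta>)" for x \<alpha> \<beta>
  proof (rule order_trans[OF gs_step_bound[OF f h(1)]])
    have "0 \<le> mfact_powr p \<alpha>" "0 \<le> mfact_powr q \<beta>" by (auto simp: mfact_powr_def intro!: prod_nonneg)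
    then show "gs_norm p q h f * (h ^ (mlen \<alpha> + mlen \<beta>) * mfact_powr p \<alpha> * mfact_powr q \<beta>) \<le> gs_norm p q h f * (h' ^ (mlen \<alpha> + mlen \<beta>) * mfact_powr p \<alpha> * mfact_powr q \<beta>)"
      using h by (intro mult_left_mono mult_right_mono power_mono gs_norm_nonneg[OF f h(1)]) auto
  qed
  then show "f \<in> gs_step p q h'" "gs_norm p q h' f \<le> gs_norm p q h f"
    using gs_stepI[of f h' "gs_norm p q h f" p q] f h by (auto simp: gs_step_def)
qed

lemma topspace_gs_step: "0 < h \<Longrightarrow> topspace (gs_step_topology p q h) = gs_step p q h"
  unfolding gs_step_topology_def by (rule topspace_seminorm) (auto simp: gs_step_zero)

lemma continuous_map_gs_step:
  fixes \<Phi> :: "('a::euclidean_space \<Rightarrow> complex) \<Rightarrow> 'a \<Rightarrow> complex"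
  assumes h: "0 < h" "0 < h'"
    and lin: "\<And>f g c d. f \<in> gs_step p q h \<Longrightarrow> g \<in> gs_step p q h \<Longrightarrow> \<Phi> (\<lambda>x. c * f x + d * g x) = (\<lambda>x. c * \<Phi> f x + d * \<Phi> g x)"
    and bound: "\<And>f. f \<in> gs_step p q h \<Longrightarrow> \<Phi> f \<in> gs_step p q h'" "0 \<le> K" "\<And>f. f \<in> gs_step p q h \<Longrightarrow> gs_norm p q h' (\<Phi> f) \<le> K * gs_norm p q h f"
  shows "continuous_map (gs_step_topology p q h) (gs_step_topology p q h') \<Phi>"
proof -
  have d: "(\<lambda>x. f x - g x) \<in> gs_step p q h" if "f \<in> gs_step p q h" "g \<in> gs_step p q h" "0 < h" for f g :: "'a \<Rightarrow> complex" and h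
    using gs_step_lincomb(1)[OF that, of 1 "-1"] by simp
  have ts: "gs_step p q h' \<subseteq> topspace (seminorm_topology (gs_step p q h') {gs_norm p q h'})"
    using topspace_gs_step[OF h(2), of p q] unfolding gs_step_topology_def by simp
  show ?thesis
    unfolding gs_step_topology_def
  proof (rule continuous_map_seminorm)
    show "gs_step p q h \<noteq> {}" using gs_step_zero(1)[OF h(1)] by blast
    show "\<Phi> (\<lambda>x. f x - g x) = (\<lambda>x. \<Phi> f x - \<Phi> g x)" if "f \<in> gs_step p q h" "g \<in> gs_step p q h" for f g
      using lin[OF that, of 1 "-1"] by simp
    show "r (\<lambda>x. f x + g x) \<le> r f + r g" if "r \<in> {gs_norm p q h'}" "f \<in> gs_step p q h'" "g \<in> gs_step p q h'" for r f g
      using gs_step_lincomb(2)[OF that(2,3) h(2), of 1 1] that(1) by simp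
    show "\<exists>Q C. finite Q \<and> Q \<subseteq> {gs_norm p q h} \<and> 0 \<le> C \<and> (\<forall>f\<in>gs_step p q h. r (\<Phi> f) \<le> C * (\<Sum>q\<in>Q. q f))" if "r \<in> {gs_norm p q h'}" for r
      using that bound(2,3) by (intro exI[of _ "{gs_norm p q h}"] exI[of _ K]) auto
  qed (use h d bound(1) ts in \<open>auto simp: gs_step_zero\<close>)
qed

section \<open>Triviality of the Beurling space for exponents of sum one\<close>

text \<open>Replaces \<open>wbound_decay_list\<close> where reordering is impossible, for
  \<open>s + \<sigma> = 1\<close> and small \<open>h\<close>. The extra multiplications are placed
  outermost, so the words stay normally ordered.\<close>

lemma nbound_decay_list:
  assumes nb: "nbound isotropic m f" and sets: "set bs \<subseteq> Basis" "set cs \<subseteq> Basis" "set ds \<subseteq> Basis"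
  shows "(\<Prod>b\<leftarrow>bs. 1 + (z \<bullet> b)\<^sup>2) * cmod (foldr mulc cs (foldr partial ds f) z) \<le> dec True (length bs) m (length cs) (length ds)"
  using sets(1,2)
proof (induction bs arbitrary: cs)
  case Nil
  have "cmod (foldr mulc cs (foldr partial ds f) z) \<le> m (sdeg isotropic (map (Pair True) cs @ map (Pair False) ds)) (tdeg isotropic (map (Pair True) cs @ map (Pair False) ds))"
    using nb Nil sets(3) unfolding nbound_def by blast
  then show ?case by (simp add: deg_map_mulc_partial)
next
  case (Cons b bs)
  let ?P = "\<Prod>b\<leftarrow>bs. 1 + (z \<bullet> b)\<^sup>2" and ?g = "foldr partial ds f"
  have 1: "?P * cmod (foldr mulc cs ?g z) \<le> dec True (length bs) m (length cs) (length ds)"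
    using Cons by simp
  have 2: "?P * cmod (foldr mulc (b # b # cs) ?g z) \<le> dec True (length bs) m (Suc (Suc (length cs))) (length ds)"
    using Cons.IH[of "b # b # cs"] Cons.prems by (simp del: foldr.simps)
  have "(\<Prod>b\<leftarrow>b # bs. 1 + (z \<bullet> b)\<^sup>2) * cmod (foldr mulc cs ?g z) = ?P * cmod (foldr mulc cs ?g z) + ?P * cmod (foldr mulc (b # b # cs) ?g z)"
    by (simp add: mulc_def norm_mult power2_eq_square algebra_simps)
  also have "\<dots> \<le> dec True (length bs) m (length cs) (length ds) + dec True (length bs) m (Suc (Suc (length cs))) (length ds)"
    by (rule add_mono[OF 1 2])
  also have "dec True (length bs) m (Suc (Suc (length cs))) (length ds) = dec True (length bs) (\<lambda>i j. m (Suc (Suc i)) j) (length cs) (length ds)"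
    using dec_shift[of True "length bs" m 2 0 "length cs" "length ds"] by simp
  finally show ?case by simp
qed

locale sigma_trivial =
  fixes s \<sigma> :: real and f :: "'a::euclidean_space \<Rightarrow> complex" and b :: 'a
  assumes s: "0 < s" "0 < \<sigma>" "s + \<sigma> = 1" and b: "b \<in> Basis"
    and f: "\<And>h. 0 < h \<Longrightarrow> f \<in> gs_step (\<lambda>_. s) (\<lambda>_. \<sigma>) h"
begin

definition D :: "nat \<Rightarrow> 'a \<Rightarrow> complex" where "D k = (partial b ^^ k) f"

text \<open>The \<open>n\<close>-th derivative of \<open>\<bar>f\<bar>\<^sup>2\<close> in the direction \<open>b\<close>, expanded by the Leibniz rule.\<close>

definition u :: "nat \<Rightarrow> 'a \<Rightarrow> complex" where
  "u n = (\<lambda>x. \<Sum>k\<le>n. of_nat (n choose k) * (D k x * cnj (D (n - k) x)))"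

definition N :: "real \<Rightarrow> real" where "N h = gs_norm (\<lambda>_. s) (\<lambda>_. \<sigma>) h f"

lemma smooth_f: "smooth f" using f[of 1] by (simp add: gs_step_def)

lemma D_foldr: "D k = foldr partial (replicate k b) f"
  unfolding D_def by (simp add: foldr_replicate)

lemma smooth_D: "smooth (D k)"
  unfolding D_foldr using b by (intro foldr_partial_smooth smooth_f) auto

lemma D_Suc: "partial b (D k) = D (Suc k)"
  by (simp add: D_def)

lemma nb: "0 < h \<Longrightarrow> nbound isotropic (\<lambda>i j. N h * gsw s \<sigma> h i j) f"
  unfolding N_def
  using gs_step_imp_nbound[of f isotropic s \<sigma> h] f[of h] s by (simp add: pexp_def[abs_def])

lemma N_nonneg: "0 < h \<Longrightarrow> 0 \<le> N h"
  unfolding N_def by (rule gs_norm_nonneg[OF f])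

lemma D_bound: "0 < h \<Longrightarrow> cmod (D k x) \<le> N h * gsw s \<sigma> h 0 k"
  using nbound_decay_list[OF nb, of h "[]" "[]" "replicate k b" x] b by (simp add: D_foldr set_replicate_conv_if)

lemma XD_bound:
  assumes "0 < h"
  shows "cmod (of_real ((x \<bullet> b) ^ m) * D k x) \<le> dec True DIM('a) (\<lambda>i j. N h * gsw s \<sigma> h i j) m k * wt x"
proof -
  have "(\<Prod>b\<leftarrow>basis_list. 1 + (x \<bullet> b)\<^sup>2) * cmod (foldr mulc (replicate m b) (foldr partial (replicate k b) f) x)
      \<le> dec True (length (basis_list :: 'a list)) (\<lambda>i j. N h * gsw s \<sigma> h i j) (length (replicate m b)) (length (replicate k b))"
    by (rule nbound_decay_list[OF nb[OF assms]]) (use b in \<open>auto simp: basis_list(2)\<close>)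
  then have "cmod (foldr mulc (replicate m b) (foldr partial (replicate k b) f) x) \<le> dec True DIM('a) (\<lambda>i j. N h * gsw s \<sigma> h i j) m k * wt x"
    by (intro wt_boundI) (simp add: length_basis_list)
  moreover have "foldr mulc (replicate m b) g x = of_real ((x \<bullet> b) ^ m) * g x" for g
    unfolding foldr_mulc by (simp add: prod_list_replicate map_replicate)
  ultimately show ?thesis by (simp add: D_foldr)
qed

text \<open>In each Leibniz term the power of the coordinate and the integrable decay are charged to
  the first factor; the second factor is merely bounded.\<close>

lemma Xu_bound:
  assumes h: "0 < h"
  shows "cmod (of_real ((x \<bullet> b) ^ m) * u n x) \<le>
    (\<Sum>k\<le>n. real (n choose k) * (dec True DIM('a) (\<lambda>i j. N h * gsw s \<sigma> h i j) m k * (N h * gsw s \<sigma> h 0 (n - k)))) * wt x"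
proof -
  have "cmod (of_real ((x \<bullet> b) ^ m) * u n x) = cmod (\<Sum>k\<le>n. of_nat (n choose k) * ((of_real ((x \<bullet> b) ^ m) * D k x) * cnj (D (n - k) x)))"
    unfolding u_def sum_distrib_left by (intro arg_cong[where f = cmod] sum.cong) (auto simp: mult_ac)
  also have "\<dots> \<le> (\<Sum>k\<le>n. cmod (of_nat (n choose k) * ((of_real ((x \<bullet> b) ^ m) * D k x) * cnj (D (n - k) x))))"
    by (rule norm_sum)
  also have "\<dots> \<le> (\<Sum>k\<le>n. real (n choose k) * ((dec True DIM('a) (\<lambda>i j. N h * gsw s \<sigma> h i j) m k * wt x) * (N h * gsw s \<sigma> h 0 (n - k))))"
  proof (rule sum_mono)
    fix k
    have "cmod (of_real ((x \<bullet> b) ^ m) * D k x) * cmod (D (n - k) x) \<le> (dec True DIM('a) (\<lambda>i j. N h * gsw s \<sigma> h i j) m k * wt x) * (N h * gsw s \<sigma> h 0 (n - k))"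
      by (intro mult_mono XD_bound[OF h] D_bound[OF h] order_trans[OF norm_ge_zero XD_bound[OF h]]) auto
    from mult_left_mono[OF this, of "real (n choose k)"]
    show "cmod (of_nat (n choose k) * ((of_real ((x \<bullet> b) ^ m) * D k x) * cnj (D (n - k) x))) \<le> real (n choose k) * ((dec True DIM('a) (\<lambda>i j. N h * gsw s \<sigma> h i j) m k * wt x) * (N h * gsw s \<sigma> h 0 (n - k)))"
      by (simp add: norm_mult)
  qed
  also have "\<dots> = (\<Sum>k\<le>n. real (n choose k) * (dec True DIM('a) (\<lambda>i j. N h * gsw s \<sigma> h i j) m k * (N h * gsw s \<sigma> h 0 (n - k)))) * wt x"
    unfolding sum_distrib_right by (intro sum.cong) (auto simp: mult_ac)
  finally show ?thesis .
qed

lemma u_cont: "continuous_on UNIV (u n)"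
  unfolding u_def by (intro continuous_intros smooth_continuous_on smooth_D)

lemma Xu_cont: "continuous_on UNIV (\<lambda>x. of_real ((x \<bullet> b) ^ m) * u n x)"
  by (intro continuous_intros u_cont)

lemma Xu_integrable: "integrable lborel (\<lambda>x. of_real ((x \<bullet> b) ^ m) * u n x)"
  by (rule integrable_wt_bound[OF borel_measurable_continuous_onI[OF Xu_cont] Xu_bound[OF zero_less_one]])

lemma u_derivative:
  "(u n has_derivative (\<lambda>v. \<Sum>k\<le>n. of_nat (n choose k) * (D k x * cnj (partial v (D (n - k)) x) + partial v (D k) x * cnj (D (n - k) x)))) (at x)"
  unfolding u_def
  by (intro has_derivative_sum has_derivative_mult_right has_derivative_mult bounded_linear.has_derivative[OF bounded_linear_cnj]
      has_derivative_partial smooth_differentiable smooth_D)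

lemma u_partial: "partial b (u n) = u (Suc n)"
proof
  fix x
  let ?A = "\<lambda>k l. D k x * cnj (D l x)"
  have "partial b (u n) x = (\<Sum>k\<le>n. of_nat (n choose k) * ?A k (Suc n - k)) + (\<Sum>k\<le>n. of_nat (n choose k) * ?A (Suc k) (n - k))"
    unfolding has_derivative_imp_partial[OF u_derivative] D_Suc sum.distrib[symmetric]
    by (intro sum.cong) (auto simp: distrib_left Suc_diff_le)
  also have "(\<Sum>k\<le>n. of_nat (n choose k) * ?A k (Suc n - k)) = (\<Sum>k\<le>Suc n. of_nat (n choose k) * ?A k (Suc n - k))" by simp
  also have "\<dots> = ?A 0 (Suc n) + (\<Sum>k\<le>n. of_nat (n choose Suc k) * ?A (Suc k) (n - k))"
    by (simp only: sum.atMost_Suc_shift) simp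
  also have "?A 0 (Suc n) + (\<Sum>k\<le>n. of_nat (n choose Suc k) * ?A (Suc k) (n - k)) + (\<Sum>k\<le>n. of_nat (n choose k) * ?A (Suc k) (n - k))
    = ?A 0 (Suc n) + (\<Sum>k\<le>n. of_nat (Suc n choose Suc k) * ?A (Suc k) (n - k))"
    by (simp add: sum.distrib[symmetric] distrib_right[symmetric] add.commute)
  also have "\<dots> = (\<Sum>k\<le>Suc n. of_nat (Suc n choose k) * ?A k (Suc n - k))"
    by (simp only: sum.atMost_Suc_shift) simp
  finally show "partial b (u n) x = u (Suc n) x" by (simp only: u_def)
qed

text \<open>Integration by parts along \<open>b\<close>: the derivative falls either on
  \<open>u n\<close> or on the power, and the sum of both contributions integrates to 0. Iteration
  produces the factorial in \<open>moment\<close>.\<close>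

lemma moment_Suc:
  "(\<integral>x. of_real ((x \<bullet> b) ^ Suc n) * u (Suc n) x \<partial>lborel) = - of_nat (Suc n) * (\<integral>x. of_real ((x \<bullet> b) ^ n) * u n x \<partial>lborel)"
proof -
  let ?g = "\<lambda>x. of_real ((x \<bullet> b) ^ Suc n) * u n x"
  have der: "(?g has_derivative (\<lambda>v. of_real ((x \<bullet> b) ^ Suc n) * partial v (u n) x + of_real (real (Suc n) * (v \<bullet> b) * (x \<bullet> b) ^ n) * u n x)) (at x)" for x
  proof (rule has_derivative_mult)
    show "((\<lambda>x. complex_of_real ((x \<bullet> b) ^ Suc n)) has_derivative (\<lambda>v. of_real (real (Suc n) * (v \<bullet> b) * (x \<bullet> b) ^ n))) (at x)"
      by (rule has_derivative_of_real) (auto intro!: derivative_eq_intros simp del: power_Suc simp: mult_ac)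
    show "(u n has_derivative (\<lambda>v. partial v (u n) x)) (at x)"
      using u_derivative by (intro has_derivative_partial) (auto simp: differentiable_def)
  qed
  have bb: "b \<bullet> b = 1" using b by (simp add: inner_Basis)
  have pg: "partial b ?g = (\<lambda>x. of_real ((x \<bullet> b) ^ Suc n) * u (Suc n) x + of_nat (Suc n) * (of_real ((x \<bullet> b) ^ n) * u n x))"
    by (rule ext, subst has_derivative_imp_partial[OF der]) (simp add: u_partial bb mult_ac del: power_Suc of_nat_Suc)
  have "(\<integral>x. partial b ?g x \<partial>lborel) = 0"
  proof (rule integral_partial_zero)
    show "?g differentiable (at x)" for x using der unfolding differentiable_def by blast
    show "continuous_on UNIV (partial b ?g)" unfolding pg by (intro continuous_on_add continuous_on_mult continuous_on_const Xu_cont continuous_intros u_cont)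
    show "integrable lborel ?g" by (rule Xu_integrable)
    show "integrable lborel (partial b ?g)" unfolding pg
      by (intro Bochner_Integration.integrable_add integrable_mult_right Xu_integrable)
  qed
  then have "(\<integral>x. of_real ((x \<bullet> b) ^ Suc n) * u (Suc n) x \<partial>lborel) + of_nat (Suc n) * (\<integral>x. of_real ((x \<bullet> b) ^ n) * u n x \<partial>lborel) = 0"
    unfolding pg by (simp only: Bochner_Integration.integral_add[OF Xu_integrable integrable_mult_right[OF Xu_integrable]] integral_mult_right_zero)
  then show ?thesis by (simp only: eq_neg_iff_add_eq_0 mult_minus_left)
qed

lemma moment: "cmod (\<integral>x. of_real ((x \<bullet> b) ^ n) * u n x \<partial>lborel) = fact n * cmod (\<integral>x. u 0 x \<partial>lborel)"
proof (induction n)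
  case (Suc n)
  show ?case unfolding moment_Suc norm_mult Suc by (simp del: of_nat_Suc)
qed simp

lemma u0_integral_zero: "(\<integral>x. u 0 x \<partial>lborel) = 0"
proof -
  define \<kappa> where "\<kappa> = (2 powr (s + \<sigma>)) ^ DIM('a)"
  have \<kappa>: "1 \<le> \<kappa>" unfolding \<kappa>_def using s by (intro one_le_power) simp
  \<comment> \<open>With \<open>\<kappa> * h = 1 / 2\<close> the powers of the step combine to
    \<open>(1/4) ^ n\<close> for every \<open>k\<close>; the binomial sum contributes
    \<open>2 ^ n\<close>, so that \<open>(1/2) ^ n\<close> remains.\<close>
  define h where "h = 1 / (2 * \<kappa>)"
  have h: "0 < h" "\<kappa> * h = 1 / 2" using \<kappa> by (auto simp: h_def)
  obtain K where K: "0 \<le> K" "\<forall>m. \<forall>B\<ge>0. (\<forall>i j. m i j \<le> B * gsw s \<sigma> h i j) \<longrightarrow> (\<forall>i j. dec True DIM('a) m i j \<le> B * K * gsw s \<sigma> (\<kappa> * h) i j)"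
    using dec_gsw[OF s(1,2) h(1), of True "DIM('a)"] unfolding \<kappa>_def by blast
  have N: "0 \<le> N h" by (rule N_nonneg[OF h(1)])
  have dK: "dec True DIM('a) (\<lambda>i j. N h * gsw s \<sigma> h i j) i j \<le> N h * K * gsw s \<sigma> (\<kappa> * h) i j" for i j
    using K(2)[rule_format, of "N h" "\<lambda>i j. N h * gsw s \<sigma> h i j"] N by blast
  let ?W = "\<integral>y. wt y \<partial>(lborel :: 'a measure)"
  have W: "0 \<le> ?W" by (intro Bochner_Integration.integral_nonneg) (simp add: less_imp_le[OF wt_pos])
  let ?C = "N h * K * N h"
  have C: "0 \<le> ?C" using N K(1) by simp
  have g: "gsw s \<sigma> (\<kappa> * h) n k * gsw s \<sigma> h 0 (n - k) \<le> (1/4) ^ n * fact n" if k: "k \<le> n" for n k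
  proof -
    \<comment> \<open>Both factors are brought to the step \<open>\<kappa> * h\<close>; then the
      exponents \<open>n + k\<close> and \<open>n - k\<close> add up to
      \<open>2 * n\<close>.\<close>
    have "gsw s \<sigma> h 0 (n - k) \<le> gsw s \<sigma> (\<kappa> * h) 0 (n - k)"
      unfolding gsw_def using \<kappa> h(1) by (intro mult_right_mono power_mono) auto
    then have "gsw s \<sigma> (\<kappa> * h) n k * gsw s \<sigma> h 0 (n - k) \<le> gsw s \<sigma> (\<kappa> * h) n k * gsw s \<sigma> (\<kappa> * h) 0 (n - k)"
      by (rule mult_left_mono) (simp add: h(2))
    also have "\<dots> = ((1/2) ^ (n + k) * (1/2) ^ (n - k)) * (fact n powr s * (fact k powr \<sigma> * fact (n - k) powr \<sigma>))"
      unfolding gsw_def h(2) by simp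
    also have "(1/2::real) ^ (n + k) * (1/2) ^ (n - k) = (1/4) ^ n"
    proof -
      have "(1/2::real) ^ (n + k) * (1/2) ^ (n - k) = (1/2) ^ (2 * n)" using k by (simp add: power_add[symmetric] mult_2)
      also have "\<dots> = ((1/2)^2) ^ n" by (rule power_mult)
      finally show ?thesis by (simp add: power2_eq_square)
    qed
    also have "fact k powr \<sigma> * fact (n - k) powr \<sigma> = (fact k * fact (n - k) :: real) powr \<sigma>" by (simp add: powr_mult)
    also have "(1/4) ^ n * (fact n powr s * (fact k * fact (n - k)) powr \<sigma>) \<le> (1/4) ^ n * (fact n powr s * fact n powr \<sigma>)"
      using fact_mult_le[of k "n - k"] k s by (intro mult_left_mono powr_mono2) auto
    also have "\<dots> = (1/4) ^ n * fact n" using s(3) by (simp add: powr_add[symmetric])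
    finally show ?thesis .
  qed
  have "cmod (\<integral>x. u 0 x \<partial>lborel) \<le> ?C * ?W * (1/2) ^ n" for n
  proof -
    have "fact n * cmod (\<integral>x. u 0 x \<partial>lborel) = cmod (\<integral>x. of_real ((x \<bullet> b) ^ n) * u n x \<partial>lborel)" by (rule moment[symmetric])
    also have "\<dots> \<le> (\<Sum>k\<le>n. real (n choose k) * (dec True DIM('a) (\<lambda>i j. N h * gsw s \<sigma> h i j) n k * (N h * gsw s \<sigma> h 0 (n - k)))) * ?W"
      by (rule wt_integral_bound[OF borel_measurable_continuous_onI[OF Xu_cont] Xu_bound[OF h(1)]])
    also have "\<dots> \<le> (\<Sum>k\<le>n. real (n choose k) * (?C * ((1/4) ^ n * fact n))) * ?W"
    proof (intro mult_right_mono[OF _ W] sum_mono mult_left_mono)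
      fix k assume "k \<in> {..n}"
      then have k: "k \<le> n" by simp
      have "dec True DIM('a) (\<lambda>i j. N h * gsw s \<sigma> h i j) n k * (N h * gsw s \<sigma> h 0 (n - k)) \<le> (N h * K * gsw s \<sigma> (\<kappa> * h) n k) * (N h * gsw s \<sigma> h 0 (n - k))"
        using N h(1) by (intro mult_right_mono dK) auto
      also have "\<dots> = ?C * (gsw s \<sigma> (\<kappa> * h) n k * gsw s \<sigma> h 0 (n - k))" by (simp only: mult_ac)
      also have "\<dots> \<le> ?C * ((1/4) ^ n * fact n)" by (intro mult_left_mono g k C)
      finally show "dec True DIM('a) (\<lambda>i j. N h * gsw s \<sigma> h i j) n k * (N h * gsw s \<sigma> h 0 (n - k)) \<le> ?C * ((1/4) ^ n * fact n)" .
    qed simp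
    also have "(\<Sum>k\<le>n. real (n choose k) * (?C * ((1/4) ^ n * fact n))) = 2 ^ n * (?C * ((1/4) ^ n * fact n))"
      unfolding sum_distrib_right[symmetric] of_nat_sum[symmetric] choose_row_sum by simp
    also have "2 ^ n * (?C * ((1/4) ^ n * fact n)) * ?W = fact n * (?C * ?W * (2 ^ n * (1/4) ^ n))" by (simp only: mult_ac)
    also have "(2::real) ^ n * (1/4) ^ n = (1/2) ^ n" unfolding power_mult_distrib[symmetric] by simp
    finally show ?thesis by simp
  qed
  moreover have "(\<lambda>n. ?C * ?W * (1/2) ^ n) \<longlonglongrightarrow> ?C * ?W * 0" by (intro tendsto_mult tendsto_const LIMSEQ_power_zero) simp
  ultimately have "cmod (\<integral>x. u 0 x \<partial>lborel) \<le> ?C * ?W * 0" by (intro LIMSEQ_le_const) auto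
  then show ?thesis by simp
qed

text \<open>\<open>u 0\<close> is the squared modulus of \<open>f\<close>, so \<open>f\<close>
  vanishes almost everywhere; by continuity it vanishes everywhere, since balls have positive
  measure.\<close>

lemma f_zero: "f x = 0"
proof -
  have u0: "u 0 = (\<lambda>x. of_real ((cmod (f x))\<^sup>2))"
    unfolding u_def D_def by (rule ext) (simp add: complex_norm_square del: of_real_power)
  have int: "integrable lborel (\<lambda>x. complex_of_real ((cmod (f x))\<^sup>2))"
    using Xu_integrable[of 0 0] by (simp add: u0)
  then have int': "integrable lborel (\<lambda>x. (cmod (f x))\<^sup>2)" by (simp only: complex_of_real_integrable_eq)
  have "(\<integral>x. (cmod (f x))\<^sup>2 \<partial>lborel) = 0"
    using u0_integral_zero unfolding u0 integral_complex_of_real by simp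
  then have ae: "AE x in lborel. f x = 0"
    using integral_nonneg_eq_0_iff_AE[OF int'] by simp
  show ?thesis
  proof (rule ccontr)
    assume "f x \<noteq> 0"
    have "open {x. f x \<noteq> 0}"
      using smooth_continuous_on[OF smooth_f, of UNIV] by (intro open_Collect_neq continuous_on_const)
    then obtain r where r: "0 < r" "ball x r \<subseteq> {x. f x \<noteq> 0}" using \<open>f x \<noteq> 0\<close> open_contains_ball by blast
    have "AE y in lborel. y \<notin> ball x r" using ae by eventually_elim (use r(2) in auto)
    then have "emeasure lborel (ball x r) = 0" by (subst (asm) AE_iff_measurable[of "ball x r"]) auto
    then show False using emeasure_ball[of r x] r(1) unit_ball_vol_pos[of "real DIM('a)"] by simp
  qed
qed

end

lemma gs_beurling_trivial:
  fixes f :: "'a::euclidean_space \<Rightarrow> complex"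
  assumes "0 < s" "0 < \<sigma>" "s + \<sigma> = 1" "f \<in> gs_beurling (\<lambda>_. s) (\<lambda>_. \<sigma>)"
  shows "f = (\<lambda>_. 0)"
proof
  fix x
  obtain b :: 'a where "b \<in> Basis" using nonempty_Basis by blast
  then interpret sigma_trivial s \<sigma> f b
    using assms by unfold_locales (auto simp: gs_beurling_def)
  show "f x = 0" by (rule f_zero)
qed

section \<open>The Gelfand--Shilov spaces of symbols\<close>

definition Phi_weight :: "nat \<Rightarrow> real \<Rightarrow> real \<Rightarrow> (nat \<Rightarrow> nat \<Rightarrow> real) \<Rightarrow> nat \<Rightarrow> nat \<Rightarrow> real" where
  "Phi_weight n C t m = PF_weight n C True (SA_weight t (PF_weight n C False m))"

lemma Phi_Phi_weight:
  fixes G :: "'a::euclidean_space \<times> 'a \<Rightarrow> complex"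
  assumes "wbound phase m G" "e \<in> {1, -1}"
  shows "wbound phase (Phi_weight DIM('a) (PF_const TYPE('a)) t m) (Phi t e G)"
  unfolding Phi_weight_def by (rule Phi_wbound[OF assms])

lemma gs_tame_Phi_weight:
  assumes "0 < s" "0 < \<sigma>" "0 \<le> C" shows "gs_tame s \<sigma> (Phi_weight n C t)"
  unfolding Phi_weight_def[abs_def]
  by (rule gs_tame_comp[OF gs_tame_comp[OF gs_tame_PF_weight[OF assms] gs_tame_SA_weight] gs_tame_PF_weight[OF assms]])

lemma sc_tame_Phi_weight:
  assumes "0 \<le> C" shows "sc_tame (Phi_weight n C t)"
  unfolding Phi_weight_def[abs_def]
  by (rule sc_tame_comp[OF sc_tame_comp[OF sc_tame_PF_weight[OF assms] sc_tame_SA_weight] sc_tame_PF_weight[OF assms]])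

abbreviation gsp :: "('a::euclidean_space \<Rightarrow> bool) \<Rightarrow> real \<Rightarrow> real \<Rightarrow> real \<Rightarrow> ('a \<Rightarrow> complex) set" where
  "gsp \<rho> s \<sigma> h \<equiv> gs_step (pexp \<rho> s \<sigma>) (pexp \<rho> \<sigma> s) h"

abbreviation gsn :: "('a::euclidean_space \<Rightarrow> bool) \<Rightarrow> real \<Rightarrow> real \<Rightarrow> real \<Rightarrow> ('a \<Rightarrow> complex) \<Rightarrow> real" where
  "gsn \<rho> s \<sigma> h f \<equiv> gs_norm (pexp \<rho> s \<sigma>) (pexp \<rho> \<sigma> s) h f"

lemma pexp_iso: "pexp isotropic u v = (\<lambda>_. u)"
  by (simp add: pexp_def[abs_def])

lemma pexp_phase: "pexp phase u v = phase_exps u v"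
  by (simp add: pexp_def[abs_def] phase_def phase_exps_def)

lemma gs_step_wbound:
  assumes "admissible s \<sigma> h"
  shows "\<exists>K\<ge>0. \<forall>f\<in>gsp \<rho> s \<sigma> h. wbound \<rho> (\<lambda>i j. gsn \<rho> s \<sigma> h f * K * gsw s \<sigma> (4 * h) i j) f"
proof -
  have s: "0 < s" "0 < \<sigma>" "0 < h" using assms by (auto simp: admissible_def)
  obtain K where K: "0 \<le> K" "\<forall>B\<ge>0. \<forall>i j. reorder (\<lambda>i j. B * gsw s \<sigma> h i j) i j \<le> B * K * gsw s \<sigma> (4 * h) i j"
    using reorder_gsw[OF assms] by blast
  have "wbound \<rho> (\<lambda>i j. gsn \<rho> s \<sigma> h f * K * gsw s \<sigma> (4 * h) i j) f" if f: "f \<in> gsp \<rho> s \<sigma> h" for f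
  proof -
    have N: "0 \<le> gsn \<rho> s \<sigma> h f" by (rule gs_norm_nonneg[OF f s(3)])
    have "wbound \<rho> (reorder (\<lambda>i j. gsn \<rho> s \<sigma> h f * gsw s \<sigma> h i j)) f"
      using s N by (intro nbound_imp_wbound gs_step_imp_nbound[OF f]) auto
    then show ?thesis by (rule wbound_mono) (use K(2) N in blast)
  qed
  then show ?thesis using K(1) by blast
qed

lemma wbound_gs_map:
  assumes "wbound \<rho> (T m) F" "gs_map s \<sigma> h h' K T" "0 \<le> B" "\<And>i j. m i j \<le> B * gsw s \<sigma> h i j"
  shows "wbound \<rho> (\<lambda>i j. B * K * gsw s \<sigma> h' i j) F"
  using assms(1) by (rule wbound_mono) (rule assms(2)[unfolded gs_map_def, rule_format, OF assms(3) assms(4)])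

text \<open>The step changes three times: by 4 for reordering, by \<open>\<kappa>1\<close> for
  transforms and shears, by \<open>\<kappa>2\<close> for the return from total degrees to
  multi-indices.\<close>

lemma gs_Phi:
  assumes s: "0 < s" "0 < \<sigma>"
  shows "\<exists>\<kappa>>0. \<forall>h. admissible s \<sigma> h \<longrightarrow> (\<exists>K\<ge>0. \<forall>F\<in>(gsp phase s \<sigma> h :: ('a::euclidean_space \<times> 'a \<Rightarrow> complex) set). \<forall>e\<in>{1, -1}.
     Phi t e F \<in> gsp phase s \<sigma> (\<kappa> * h) \<and> gsn phase s \<sigma> (\<kappa> * h) (Phi t e F) \<le> K * gsn phase s \<sigma> h F)"
proof -
  let ?T = "Phi_weight DIM('a) (PF_const TYPE('a)) t"
  obtain \<kappa>1 where \<kappa>1: "0 < \<kappa>1" "\<forall>h>0. \<exists>K\<ge>0. gs_map s \<sigma> h (\<kappa>1 * h) K ?T"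
    using gs_tame_Phi_weight[OF s PF_const_nonneg[where 'a = 'a]] unfolding gs_tame_def by blast
  define \<kappa>2 where "\<kappa>2 = (2 ^ DIM('a \<times> 'a)) powr (s + \<sigma>)"
  have \<kappa>2: "0 < \<kappa>2" by (simp add: \<kappa>2_def)
  have "\<exists>K\<ge>0. \<forall>F\<in>(gsp phase s \<sigma> h :: ('a \<times> 'a \<Rightarrow> complex) set). \<forall>e\<in>{1, -1}.
     Phi t e F \<in> gsp phase s \<sigma> (\<kappa>2 * \<kappa>1 * 4 * h) \<and> gsn phase s \<sigma> (\<kappa>2 * \<kappa>1 * 4 * h) (Phi t e F) \<le> K * gsn phase s \<sigma> h F"
    if adm: "admissible s \<sigma> h" for h
  proof -
    have h: "0 < h" using adm by (simp add: admissible_def)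
    obtain K where K: "0 \<le> K" "\<forall>F\<in>(gsp phase s \<sigma> h :: ('a \<times> 'a \<Rightarrow> complex) set). wbound phase (\<lambda>i j. gsn phase s \<sigma> h F * K * gsw s \<sigma> (4 * h) i j) F"
      using gs_step_wbound[OF adm] by blast
    have h4: "0 < 4 * h" using h by simp
    obtain K' where K': "0 \<le> K'" "gs_map s \<sigma> (4 * h) (\<kappa>1 * (4 * h)) K' ?T" using \<kappa>1(2) h4 by blast
    have "Phi t e F \<in> gsp phase s \<sigma> (\<kappa>2 * \<kappa>1 * 4 * h) \<and> gsn phase s \<sigma> (\<kappa>2 * \<kappa>1 * 4 * h) (Phi t e F) \<le> (K * K') * gsn phase s \<sigma> h F"
      if F: "F \<in> (gsp phase s \<sigma> h :: ('a \<times> 'a \<Rightarrow> complex) set)" and e: "e \<in> {1, -1}" for F e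
    proof -
      have N: "0 \<le> gsn phase s \<sigma> h F" by (rule gs_norm_nonneg[OF F h])
      let ?B = "gsn phase s \<sigma> h F * K"
      have B: "0 \<le> ?B" using N K(1) by simp
      have "wbound phase (?T (\<lambda>i j. ?B * gsw s \<sigma> (4 * h) i j)) (Phi t e F)"
        using K(2) F by (intro Phi_Phi_weight e) blast
      from wbound_gs_map[OF this K'(2) B order_refl]
      have w: "wbound phase (\<lambda>i j. (?B * K') * gsw s \<sigma> (\<kappa>1 * (4 * h)) i j) (Phi t e F)" .
      have "0 < \<kappa>1 * (4 * h)" "0 \<le> s" "0 \<le> \<sigma>" "0 \<le> ?B * K'" using \<kappa>1 h s B K' by simp_all
      from wbound_imp_gs_step[OF w this \<kappa>2_def] show ?thesis by (simp only: mult.assoc) (simp only: mult_ac simp_thms)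
    qed
    then show ?thesis using K(1) K'(1) by (intro exI[of _ "K * K'"]) auto
  qed
  moreover have "0 < \<kappa>2 * \<kappa>1 * 4" using \<kappa>1 \<kappa>2 by simp
  ultimately show ?thesis by blast
qed

text \<open>Since \<open>fact k * fact l \<le> fact (k + l)\<close>, the weights of the two factors
  combine in the tensor product without loss in \<open>h\<close>; the other losses arise as in
  \<open>gs_Phi\<close>.\<close>

lemma gs_kern:
  assumes s: "0 < s" "0 < \<sigma>"
  shows "\<exists>\<kappa>>0. \<forall>h. admissible s \<sigma> h \<longrightarrow> (\<forall>\<psi>\<in>(gsp isotropic s \<sigma> h :: ('a::euclidean_space \<Rightarrow> complex) set). \<forall>f\<in>gsp isotropic s \<sigma> h.
     (\<exists>m. wbound isotropic m (kern t \<psi> f)) \<and> PF 1 (kern t \<psi> f) \<in> gsp phase s \<sigma> (\<kappa> * h))"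
proof -
  let ?T = "\<lambda>m. PF_weight DIM('a) (PF_const TYPE('a)) True (SA_weight t m)"
  have "gs_tame s \<sigma> ?T"
    by (rule gs_tame_comp[OF gs_tame_SA_weight gs_tame_PF_weight[OF s PF_const_nonneg]])
  then obtain \<kappa>1 where \<kappa>1: "0 < \<kappa>1" "\<forall>h>0. \<exists>K\<ge>0. gs_map s \<sigma> h (\<kappa>1 * h) K ?T"
    unfolding gs_tame_def by blast
  define \<kappa>2 where "\<kappa>2 = (2 ^ DIM('a \<times> 'a)) powr (s + \<sigma>)"
  have \<kappa>2: "0 < \<kappa>2" by (simp add: \<kappa>2_def)
  have "(\<exists>m. wbound isotropic m (kern t \<psi> f)) \<and> PF 1 (kern t \<psi> f) \<in> gsp phase s \<sigma> (\<kappa>2 * \<kappa>1 * 4 * h)"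
    if adm: "admissible s \<sigma> h" and \<psi>: "\<psi> \<in> (gsp isotropic s \<sigma> h :: ('a \<Rightarrow> complex) set)" and f: "f \<in> gsp isotropic s \<sigma> h" for h \<psi> f
  proof -
    have h: "0 < h" using adm by (simp add: admissible_def)
    obtain K where K: "0 \<le> K" "\<forall>F\<in>(gsp isotropic s \<sigma> h :: ('a \<Rightarrow> complex) set). wbound isotropic (\<lambda>i j. gsn isotropic s \<sigma> h F * K * gsw s \<sigma> (4 * h) i j) F"
      using gs_step_wbound[OF adm] by blast
    have h4: "0 < 4 * h" using h by simp
    obtain K' where K': "0 \<le> K'" "gs_map s \<sigma> (4 * h) (\<kappa>1 * (4 * h)) K' ?T" using \<kappa>1(2) h4 by blast
    let ?A = "gsn isotropic s \<sigma> h \<psi> * K" and ?B = "gsn isotropic s \<sigma> h f * K"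
    have AB: "0 \<le> ?A" "0 \<le> ?B" using gs_norm_nonneg[OF \<psi> h] gs_norm_nonneg[OF f h] K(1) by simp_all
    have "wbound isotropic (\<lambda>i j. (?A * ?B) * gsw s \<sigma> (4 * h) i j) (tensor \<psi> f)"
    proof (rule wbound_tensor)
      show "wbound isotropic (\<lambda>i j. ?A * gsw s \<sigma> (4 * h) i j) \<psi>" "wbound isotropic (\<lambda>i j. ?B * gsw s \<sigma> (4 * h) i j) f" using K(2) \<psi> f by blast+
      have fp: "fact k powr p * fact l powr p \<le> fact (k + l) powr p" if "0 < p" for k l and p :: real
      proof -
        have "fact k powr p * fact l powr p = (fact k * fact l) powr p" by (simp add: powr_mult)
        also have "\<dots> \<le> fact (k + l) powr p" using fact_mult_le[of k l] that by (intro powr_mono2) auto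
        finally show ?thesis .
      qed
      fix i1 j1 i2 j2
      have "gsw s \<sigma> (4 * h) i1 j1 * gsw s \<sigma> (4 * h) i2 j2 = (4 * h) ^ ((i1 + i2) + (j1 + j2)) * ((fact i1 powr s * fact i2 powr s) * (fact j1 powr \<sigma> * fact j2 powr \<sigma>))"
        unfolding gsw_def by (simp only: power_add mult_ac)
      also have "\<dots> \<le> (4 * h) ^ ((i1 + i2) + (j1 + j2)) * (fact (i1 + i2) powr s * fact (j1 + j2) powr \<sigma>)"
        using h s by (intro mult_left_mono mult_mono fp) auto
      finally have "gsw s \<sigma> (4 * h) i1 j1 * gsw s \<sigma> (4 * h) i2 j2 \<le> gsw s \<sigma> (4 * h) (i1 + i2) (j1 + j2)" by (simp add: gsw_def mult.assoc)
      from mult_left_mono[OF this mult_nonneg_nonneg[OF AB]]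
      show "(?A * gsw s \<sigma> (4 * h) i1 j1) * (?B * gsw s \<sigma> (4 * h) i2 j2) \<le> (?A * ?B) * gsw s \<sigma> (4 * h) (i1 + i2) (j1 + j2)"
        by (simp only: mult_ac)
    qed
    from wbound_kern[OF this, of t] have k: "wbound isotropic (SA_weight t (\<lambda>i j. (?A * ?B) * gsw s \<sigma> (4 * h) i j)) (kern t \<psi> f)"
      by (simp only: SA_weight_def)
    have "(1::real) \<in> {1, -1}" by simp
    from wbound_gs_map[where T = ?T, OF PF_iso[OF k this] K'(2) mult_nonneg_nonneg[OF AB] order_refl]
    have w: "wbound phase (\<lambda>i j. (?A * ?B * K') * gsw s \<sigma> (\<kappa>1 * (4 * h)) i j) (PF 1 (kern t \<psi> f))" .
    have "0 < \<kappa>1 * (4 * h)" "0 \<le> s" "0 \<le> \<sigma>" "0 \<le> ?A * ?B * K'" using \<kappa>1 h s AB K' by simp_all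
    from wbound_imp_gs_step(1)[OF w this \<kappa>2_def] k show ?thesis by (auto simp: mult.assoc)
  qed
  moreover have "0 < \<kappa>2 * \<kappa>1 * 4" using \<kappa>1 \<kappa>2 by simp
  ultimately show ?thesis by blast
qed

text \<open>The source step \<open>h\<close> is first included in an admissible step
  \<open>h'\<close>, which takes care of small \<open>h\<close> when
  \<open>s + \<sigma> = 1\<close>.\<close>

lemma gs_Phi_continuous:
  fixes t :: real
  assumes adm: "admissible s \<sigma> h'" "0 < h" "h \<le> h'" and \<kappa>: "0 < \<kappa>" and K: "0 \<le> K"
    and bd: "\<forall>F\<in>(gsp phase s \<sigma> h' :: ('a::euclidean_space \<times> 'a \<Rightarrow> complex) set).
     Phi t 1 F \<in> gsp phase s \<sigma> (\<kappa> * h') \<and> gsn phase s \<sigma> (\<kappa> * h') (Phi t 1 F) \<le> K * gsn phase s \<sigma> h' F"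
  shows "continuous_map (gs_step_topology (pexp phase s \<sigma>) (pexp phase \<sigma> s) h :: ('a \<times> 'a \<Rightarrow> complex) topology)
     (gs_step_topology (pexp phase s \<sigma>) (pexp phase \<sigma> s) (\<kappa> * h')) (Phi t 1)"
proof (rule continuous_map_gs_step[OF adm(2) _ _ _ K])
  have h': "0 < h'" using adm by simp
  then show "0 < \<kappa> * h'" using \<kappa> by simp
  obtain L where L: "\<forall>F\<in>(gsp phase s \<sigma> h' :: ('a \<times> 'a \<Rightarrow> complex) set). wbound phase (\<lambda>i j. gsn phase s \<sigma> h' F * L * gsw s \<sigma> (4 * h') i j) F"
    using gs_step_wbound[OF adm(1)] by blast
  have mono: "F \<in> gsp phase s \<sigma> h'" "gsn phase s \<sigma> h' F \<le> gsn phase s \<sigma> h F" if "F \<in> gsp phase s \<sigma> h" for F :: "'a \<times> 'a \<Rightarrow> complex"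
    using gs_step_mono[OF that adm(2,3)] .
  show "Phi t 1 (\<lambda>x. c * F x + d * G x) = (\<lambda>x. c * Phi t 1 F x + d * Phi t 1 G x)"
    if "F \<in> gsp phase s \<sigma> h" "G \<in> gsp phase s \<sigma> h" for F G :: "'a \<times> 'a \<Rightarrow> complex" and c d
    by (rule Phi_linear[OF L[rule_format, OF mono(1)[OF that(1)]] L[rule_format, OF mono(1)[OF that(2)]]]) simp
  show "Phi t 1 F \<in> gsp phase s \<sigma> (\<kappa> * h')" if "F \<in> gsp phase s \<sigma> h" for F :: "'a \<times> 'a \<Rightarrow> complex"
    using bd mono(1)[OF that] by blast
  show "gsn phase s \<sigma> (\<kappa> * h') (Phi t 1 F) \<le> K * gsn phase s \<sigma> h F" if "F \<in> gsp phase s \<sigma> h" for F :: "'a \<times> 'a \<Rightarrow> complex"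
    using bd mono[OF that] mult_left_mono[OF mono(2)[OF that] K] by fastforce
qed

lemma admissible_max: "0 < s \<Longrightarrow> 0 < \<sigma> \<Longrightarrow> 1 \<le> s + \<sigma> \<Longrightarrow> 1 \<le> h \<Longrightarrow> admissible s \<sigma> h"
  by (auto simp: admissible_def)

text \<open>In a union of steps every step may be enlarged, so all estimates are made for
  \<open>h \<ge> 1\<close>, where the exponents are admissible even when their sum is one.\<close>

lemma roumieu_case:
  fixes s \<sigma> t :: real
  assumes s: "0 < s" "0 < \<sigma>" "1 \<le> s + \<sigma>"
  defines "U \<equiv> GS_phase s \<sigma> :: ('a::euclidean_space \<times> 'a \<Rightarrow> complex) set"
  shows "dual_closed (GS s \<sigma>) U"
    and "\<And>f g c d. f \<in> U \<Longrightarrow> g \<in> U \<Longrightarrow> (\<lambda>z. c * f z + d * g z) \<in> U"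
    and "topspace (ind_limit_topology U {0<..} (gs_step_topology (phase_exps s \<sigma>) (phase_exps \<sigma> s))) = U"
    and "continuous_map (ind_limit_topology U {0<..} (gs_step_topology (phase_exps s \<sigma>) (phase_exps \<sigma> s)))
       (ind_limit_topology U {0<..} (gs_step_topology (phase_exps s \<sigma>) (phase_exps \<sigma> s))) (Phi t 1)"
proof -
  have Udef: "U = (\<Union>h\<in>{0<..}. gsp phase s \<sigma> h)" unfolding U_def GS_phase_def gs_roumieu_def pexp_phase ..
  have Vdef: "GS s \<sigma> = (\<Union>h\<in>{0<..}. gsp isotropic s \<sigma> h :: ('a \<Rightarrow> complex) set)" unfolding GS_def gs_roumieu_def pexp_iso ..
  \<comment> \<open>Two functions are brought to a common admissible step.\<close>
  have big: "\<exists>h\<ge>1. f \<in> gs_step p q h \<and> g \<in> gs_step p q h" if "f \<in> gs_step p q h1" "g \<in> gs_step p q h2" "0 < h1" "0 < h2"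
    for f g :: "'c::euclidean_space \<Rightarrow> complex" and p q h1 h2
    using that gs_step_mono(1)[of f p q h1 "max (max h1 h2) 1"] gs_step_mono(1)[of g p q h2 "max (max h1 h2) 1"]
    by (intro exI[of _ "max (max h1 h2) 1"]) auto
  have bigU: "\<exists>h\<ge>1. f \<in> gsp phase s \<sigma> h \<and> g \<in> gsp phase s \<sigma> h" if "f \<in> U" "g \<in> U" for f g
    using that big unfolding Udef by blast
  have bigV: "\<exists>h\<ge>1. f \<in> gsp isotropic s \<sigma> h \<and> g \<in> gsp isotropic s \<sigma> h" if "f \<in> GS s \<sigma>" "g \<in> GS s \<sigma>" for f g :: "'a \<Rightarrow> complex"
    using that big unfolding Vdef by blast
  have adm: "admissible s \<sigma> h" if "1 \<le> h" for h using admissible_max[OF s that] .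
  have wb: "\<exists>m. wbound phase m F" if "F \<in> U" for F
    using bigU[OF that that] gs_step_wbound[OF adm] by metis
  have Phi_in: "Phi t e F \<in> U" if F: "F \<in> U" and e: "e \<in> {1, -1}" for F t e
  proof -
    obtain \<kappa> where \<kappa>: "0 < \<kappa>" "\<forall>h. admissible s \<sigma> h \<longrightarrow> (\<exists>K\<ge>0. \<forall>F\<in>(gsp phase s \<sigma> h :: ('a \<times> 'a \<Rightarrow> complex) set). \<forall>e\<in>{1, -1}.
     Phi t e F \<in> gsp phase s \<sigma> (\<kappa> * h) \<and> gsn phase s \<sigma> (\<kappa> * h) (Phi t e F) \<le> K * gsn phase s \<sigma> h F)"
      using gs_Phi[OF s(1,2)] by blast
    obtain h where h: "1 \<le> h" "F \<in> gsp phase s \<sigma> h" using bigU[OF F F] by blast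
    have "Phi t e F \<in> gsp phase s \<sigma> (\<kappa> * h)" using \<kappa>(2)[rule_format, OF adm[OF h(1)]] h(2) e by blast
    moreover have "\<kappa> * h \<in> {0<..}" using \<kappa>(1) h(1) by simp
    ultimately show ?thesis unfolding Udef by blast
  qed
  have kern_in: "(\<exists>m. wbound isotropic m (kern t \<psi> f)) \<and> PF 1 (kern t \<psi> f) \<in> U" if V: "\<psi> \<in> GS s \<sigma>" "f \<in> GS s \<sigma>" for \<psi> f :: "'a \<Rightarrow> complex" and t
  proof -
    obtain \<kappa> where \<kappa>: "0 < \<kappa>" "\<forall>h. admissible s \<sigma> h \<longrightarrow> (\<forall>\<psi>\<in>(gsp isotropic s \<sigma> h :: ('a \<Rightarrow> complex) set). \<forall>f\<in>gsp isotropic s \<sigma> h.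
     (\<exists>m. wbound isotropic m (kern t \<psi> f)) \<and> PF 1 (kern t \<psi> f) \<in> gsp phase s \<sigma> (\<kappa> * h))"
      using gs_kern[OF s(1,2)] by blast
    obtain h where h: "1 \<le> h" "\<psi> \<in> gsp isotropic s \<sigma> h" "f \<in> gsp isotropic s \<sigma> h" using bigV[OF V] by blast
    have "\<kappa> * h \<in> {0<..}" using \<kappa>(1) h(1) by simp
    then show ?thesis using \<kappa>(2)[rule_format, OF adm[OF h(1)] h(2,3)] unfolding Udef by blast
  qed
  show "dual_closed (GS s \<sigma>) U"
    unfolding dual_closed_def using wb Phi_in kern_in by blast
  show comb: "(\<lambda>z. c * f z + d * g z) \<in> U" if fg: "f \<in> U" "g \<in> U" for f g c d
  proof -
    obtain h where h: "1 \<le> h" "f \<in> gsp phase s \<sigma> h" "g \<in> gsp phase s \<sigma> h" using bigU[OF fg] by blast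
    then have "0 < h" by simp
    with gs_step_lincomb(1)[OF h(2,3)] show ?thesis unfolding Udef by blast
  qed
  obtain \<kappa> where \<kappa>: "0 < \<kappa>" "\<forall>h. admissible s \<sigma> h \<longrightarrow> (\<exists>K\<ge>0. \<forall>F\<in>(gsp phase s \<sigma> h :: ('a \<times> 'a \<Rightarrow> complex) set). \<forall>e\<in>{1, -1}.
     Phi t e F \<in> gsp phase s \<sigma> (\<kappa> * h) \<and> gsn phase s \<sigma> (\<kappa> * h) (Phi t e F) \<le> K * gsn phase s \<sigma> h F)"
    using gs_Phi[OF s(1,2)] by blast
  have cont: "\<exists>j\<in>{0<..}. continuous_map (gs_step_topology (phase_exps s \<sigma>) (phase_exps \<sigma> s) i :: ('a \<times> 'a \<Rightarrow> complex) topology) (gs_step_topology (phase_exps s \<sigma>) (phase_exps \<sigma> s) j) (Phi t 1)"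
    if "i \<in> {0<..}" for i
  proof -
    let ?h = "max i 1"
    have a: "admissible s \<sigma> ?h" by (rule adm) simp
    obtain K where K: "0 \<le> K" "\<forall>F\<in>(gsp phase s \<sigma> ?h :: ('a \<times> 'a \<Rightarrow> complex) set). \<forall>e\<in>{1, -1}.
     Phi t e F \<in> gsp phase s \<sigma> (\<kappa> * ?h) \<and> gsn phase s \<sigma> (\<kappa> * ?h) (Phi t e F) \<le> K * gsn phase s \<sigma> ?h F"
      using \<kappa>(2)[rule_format, OF a] by blast
    have "continuous_map (gs_step_topology (pexp phase s \<sigma>) (pexp phase \<sigma> s) i :: ('a \<times> 'a \<Rightarrow> complex) topology) (gs_step_topology (pexp phase s \<sigma>) (pexp phase \<sigma> s) (\<kappa> * ?h)) (Phi t 1)"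
      by (rule gs_Phi_continuous[OF a _ _ \<kappa>(1) K(1)]) (use that K(2) in auto)
    moreover have "\<kappa> * ?h \<in> {0<..}" using \<kappa>(1) by simp
    ultimately show ?thesis unfolding pexp_phase by blast
  qed
  have ts: "topspace (gs_step_topology (phase_exps s \<sigma>) (phase_exps \<sigma> s) i :: ('a \<times> 'a \<Rightarrow> complex) topology) = gsp phase s \<sigma> i" if "i \<in> {0<..}" for i
    using topspace_gs_step[of i] that unfolding pexp_phase by simp
  have z: "(\<lambda>x. 0) \<in> (gsp phase s \<sigma> i :: ('a \<times> 'a \<Rightarrow> complex) set)" if "i \<in> {0<..}" for i using gs_step_zero(1) that by simp
  have lin: "Phi t 1 (\<lambda>x. c * f x + d * g x) = (\<lambda>x. c * Phi t 1 f x + d * Phi t 1 g x)" if "f \<in> U" "g \<in> U" for f g c d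
    using wb[OF that(1)] wb[OF that(2)] Phi_linear[of _ f _ g 1 t c d] by auto
  have U0: "(\<lambda>x. 0) \<in> U" using z[of 1] unfolding Udef by (auto intro: bexI[of _ 1])
  have e1: "(1::real) \<in> {1, -1}" by simp
  note ind = continuous_map_ind_limit[of U "Phi t 1" "{0<..}" "gs_step_topology (phase_exps s \<sigma>) (phase_exps \<sigma> s)"]
  have sub: "topspace (gs_step_topology (phase_exps s \<sigma>) (phase_exps \<sigma> s) i) \<subseteq> U" "(\<lambda>x. 0) \<in> topspace (gs_step_topology (phase_exps s \<sigma>) (phase_exps \<sigma> s) i :: ('a \<times> 'a \<Rightarrow> complex) topology)" if "i \<in> {0<..}" for i
    using that z[OF that] unfolding ts[OF that] Udef by blast+
  show "topspace (ind_limit_topology U {0<..} (gs_step_topology (phase_exps s \<sigma>) (phase_exps \<sigma> s))) = U"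
    by (rule ind(2)[OF Phi_in[OF _ e1] U0 sub comb lin cont])
  show "continuous_map (ind_limit_topology U {0<..} (gs_step_topology (phase_exps s \<sigma>) (phase_exps \<sigma> s)))
       (ind_limit_topology U {0<..} (gs_step_topology (phase_exps s \<sigma>) (phase_exps \<sigma> s))) (Phi t 1)"
    by (rule ind(1)[OF Phi_in[OF _ e1] U0 sub comb lin cont])
qed

text \<open>An intersection requires estimates on arbitrarily small steps; the strict inequality
  makes all of them admissible.\<close>

lemma beurling_case:
  fixes s \<sigma> t :: real
  assumes s: "0 < s" "0 < \<sigma>" "1 < s + \<sigma>"
  defines "U \<equiv> GS_Sigma_phase s \<sigma> :: ('a::euclidean_space \<times> 'a \<Rightarrow> complex) set"
  shows "dual_closed (GS_Sigma s \<sigma>) U"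
    and "\<And>f g c d. f \<in> U \<Longrightarrow> g \<in> U \<Longrightarrow> (\<lambda>z. c * f z + d * g z) \<in> U"
    and "topspace (proj_limit_topology U {0<..} (gs_step_topology (phase_exps s \<sigma>) (phase_exps \<sigma> s))) = U"
    and "continuous_map (proj_limit_topology U {0<..} (gs_step_topology (phase_exps s \<sigma>) (phase_exps \<sigma> s)))
       (proj_limit_topology U {0<..} (gs_step_topology (phase_exps s \<sigma>) (phase_exps \<sigma> s))) (Phi t 1)"
proof -
  have Udef: "U = (\<Inter>h\<in>{0<..}. gsp phase s \<sigma> h)" unfolding U_def GS_Sigma_phase_def gs_beurling_def pexp_phase ..
  have Vdef: "GS_Sigma s \<sigma> = (\<Inter>h\<in>{0<..}. gsp isotropic s \<sigma> h :: ('a \<Rightarrow> complex) set)" unfolding GS_Sigma_def gs_beurling_def pexp_iso ..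
  have adm: "admissible s \<sigma> h" if "0 < h" for h using s that by (simp add: admissible_def)
  have wb: "\<exists>m. wbound phase m F" if "F \<in> U" for F
    using gs_step_wbound[OF adm[OF zero_less_one]] that unfolding Udef by fastforce
  have Phi_in: "Phi t e F \<in> U" if F: "F \<in> U" and e: "e \<in> {1, -1}" for F t e
  proof -
    obtain \<kappa> where \<kappa>: "0 < \<kappa>" "\<forall>h. admissible s \<sigma> h \<longrightarrow> (\<exists>K\<ge>0. \<forall>F\<in>(gsp phase s \<sigma> h :: ('a \<times> 'a \<Rightarrow> complex) set). \<forall>e\<in>{1, -1}.
     Phi t e F \<in> gsp phase s \<sigma> (\<kappa> * h) \<and> gsn phase s \<sigma> (\<kappa> * h) (Phi t e F) \<le> K * gsn phase s \<sigma> h F)"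
      using gs_Phi[OF s(1,2)] by blast
    have "Phi t e F \<in> gsp phase s \<sigma> h" if h: "0 < h" for h
    proof -
      have h': "0 < h / \<kappa>" using h \<kappa>(1) by simp
      then have "F \<in> gsp phase s \<sigma> (h / \<kappa>)" using F unfolding Udef by simp
      then have "Phi t e F \<in> gsp phase s \<sigma> (\<kappa> * (h / \<kappa>))" using \<kappa>(2)[rule_format, OF adm[OF h']] e by blast
      then show ?thesis using \<kappa>(1) by simp
    qed
    then show ?thesis unfolding Udef by simp
  qed
  have kern_in: "(\<exists>m. wbound isotropic m (kern t \<psi> f)) \<and> PF 1 (kern t \<psi> f) \<in> U" if V: "\<psi> \<in> GS_Sigma s \<sigma>" "f \<in> GS_Sigma s \<sigma>" for \<psi> f :: "'a \<Rightarrow> complex" and t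
  proof -
    obtain \<kappa> where \<kappa>: "0 < \<kappa>" "\<forall>h. admissible s \<sigma> h \<longrightarrow> (\<forall>\<psi>\<in>(gsp isotropic s \<sigma> h :: ('a \<Rightarrow> complex) set). \<forall>f\<in>gsp isotropic s \<sigma> h.
     (\<exists>m. wbound isotropic m (kern t \<psi> f)) \<and> PF 1 (kern t \<psi> f) \<in> gsp phase s \<sigma> (\<kappa> * h))"
      using gs_kern[OF s(1,2)] by blast
    have "(\<exists>m. wbound isotropic m (kern t \<psi> f)) \<and> PF 1 (kern t \<psi> f) \<in> gsp phase s \<sigma> h" if h: "0 < h" for h
    proof -
      have h': "0 < h / \<kappa>" using h \<kappa>(1) by simp
      then have "\<psi> \<in> gsp isotropic s \<sigma> (h / \<kappa>)" "f \<in> gsp isotropic s \<sigma> (h / \<kappa>)" using V unfolding Vdef by simp_all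
      then have "(\<exists>m. wbound isotropic m (kern t \<psi> f)) \<and> PF 1 (kern t \<psi> f) \<in> gsp phase s \<sigma> (\<kappa> * (h / \<kappa>))"
        using \<kappa>(2)[rule_format, OF adm[OF h']] by blast
      then show ?thesis using \<kappa>(1) by simp
    qed
    then show ?thesis unfolding Udef using zero_less_one[where 'a = real] by blast
  qed
  show "dual_closed (GS_Sigma s \<sigma>) U"
    unfolding dual_closed_def using wb Phi_in kern_in by blast
  show "(\<lambda>z. c * f z + d * g z) \<in> U" if fg: "f \<in> U" "g \<in> U" for f g c d
    using fg unfolding Udef by (auto intro: gs_step_lincomb(1))
  obtain \<kappa> where \<kappa>: "0 < \<kappa>" "\<forall>h. admissible s \<sigma> h \<longrightarrow> (\<exists>K\<ge>0. \<forall>F\<in>(gsp phase s \<sigma> h :: ('a \<times> 'a \<Rightarrow> complex) set). \<forall>e\<in>{1, -1}.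
     Phi t e F \<in> gsp phase s \<sigma> (\<kappa> * h) \<and> gsn phase s \<sigma> (\<kappa> * h) (Phi t e F) \<le> K * gsn phase s \<sigma> h F)"
    using gs_Phi[OF s(1,2)] by blast
  have cont: "\<exists>i\<in>{0<..}. continuous_map (gs_step_topology (phase_exps s \<sigma>) (phase_exps \<sigma> s) i :: ('a \<times> 'a \<Rightarrow> complex) topology) (gs_step_topology (phase_exps s \<sigma>) (phase_exps \<sigma> s) j) (Phi t 1)"
    if "j \<in> {0<..}" for j
  proof -
    \<comment> \<open>The source step from which \<open>Phi\<close> arrives exactly at
      \<open>j\<close>, available because \<kappa> does not depend on the step.\<close>
    let ?h = "j / \<kappa>"
    have h: "0 < ?h" using that \<kappa>(1) by simp
    have a: "admissible s \<sigma> ?h" by (rule adm[OF h])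
    obtain K where K: "0 \<le> K" "\<forall>F\<in>(gsp phase s \<sigma> ?h :: ('a \<times> 'a \<Rightarrow> complex) set). \<forall>e\<in>{1, -1}.
     Phi t e F \<in> gsp phase s \<sigma> (\<kappa> * ?h) \<and> gsn phase s \<sigma> (\<kappa> * ?h) (Phi t e F) \<le> K * gsn phase s \<sigma> ?h F"
      using \<kappa>(2)[rule_format, OF a] by blast
    have "continuous_map (gs_step_topology (pexp phase s \<sigma>) (pexp phase \<sigma> s) ?h :: ('a \<times> 'a \<Rightarrow> complex) topology) (gs_step_topology (pexp phase s \<sigma>) (pexp phase \<sigma> s) (\<kappa> * ?h)) (Phi t 1)"
      by (rule gs_Phi_continuous[OF a h order_refl \<kappa>(1) K(1)]) (use K(2) in blast)
    moreover have "\<kappa> * ?h = j" using \<kappa>(1) by simp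
    ultimately show ?thesis using h unfolding pexp_phase by (intro bexI[of _ ?h]) auto
  qed
  have sub: "U \<subseteq> topspace (gs_step_topology (phase_exps s \<sigma>) (phase_exps \<sigma> s) i)" if "i \<in> {0<..}" for i
    using topspace_gs_step[of i] that unfolding pexp_phase Udef by auto
  have e1: "(1::real) \<in> {1, -1}" by simp
  have ne: "{0::real<..} \<noteq> {}" using zero_less_one by blast
  note proj = continuous_map_proj_limit[of U "Phi t 1" "{0<..}" "gs_step_topology (phase_exps s \<sigma>) (phase_exps \<sigma> s)"]
  show "topspace (proj_limit_topology U {0<..} (gs_step_topology (phase_exps s \<sigma>) (phase_exps \<sigma> s))) = U"
    by (rule proj(2)[OF Phi_in[OF _ e1] sub ne cont])
  show "continuous_map (proj_limit_topology U {0<..} (gs_step_topology (phase_exps s \<sigma>) (phase_exps \<sigma> s)))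
       (proj_limit_topology U {0<..} (gs_step_topology (phase_exps s \<sigma>) (phase_exps \<sigma> s))) (Phi t 1)"
    by (rule proj(1)[OF Phi_in[OF _ e1] sub ne cont])
qed

section \<open>The Schwartz space and the theorem\<close>

lemma schwartz_bound:
  "f \<in> schwartz \<Longrightarrow> \<bar>mpower x \<alpha>\<bar> * cmod (mderiv \<beta> f x) \<le> schwartz_seminorm \<alpha> \<beta> f"
  unfolding schwartz_seminorm_def schwartz_def by (intro cSUP_upper) auto

lemma schwartz_seminorm_nonneg: "f \<in> schwartz \<Longrightarrow> 0 \<le> schwartz_seminorm \<alpha> \<beta> f"
  by (rule order_trans[OF _ schwartz_bound]) auto

lemma schwartz_seminorm_le:
  assumes "\<And>x. \<bar>mpower x \<alpha>\<bar> * cmod (mderiv \<beta> f x) \<le> B"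
  shows "schwartz_seminorm \<alpha> \<beta> f \<le> B"
  unfolding schwartz_seminorm_def by (rule cSUP_least) (use assms in auto)

lemma schwartz_lincomb:
  assumes f: "f \<in> schwartz" and g: "g \<in> schwartz"
  shows "(\<lambda>x. c * f x + d * g x) \<in> schwartz"
    and "schwartz_seminorm \<alpha> \<beta> (\<lambda>x. c * f x + d * g x) \<le> cmod c * schwartz_seminorm \<alpha> \<beta> f + cmod d * schwartz_seminorm \<alpha> \<beta> g"
proof -
  have s: "smooth f" "smooth g" using f g by (auto simp: schwartz_def)
  have b: "\<bar>mpower x \<alpha>\<bar> * cmod (mderiv \<beta> (\<lambda>x. c * f x + d * g x) x) \<le> cmod c * schwartz_seminorm \<alpha> \<beta> f + cmod d * schwartz_seminorm \<alpha> \<beta> g" for x \<alpha> \<beta>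
  proof -
    have "\<bar>mpower x \<alpha>\<bar> * cmod (mderiv \<beta> (\<lambda>x. c * f x + d * g x) x) \<le> \<bar>mpower x \<alpha>\<bar> * (cmod c * cmod (mderiv \<beta> f x) + cmod d * cmod (mderiv \<beta> g x))"
      unfolding mderiv_lincomb[OF s] by (intro mult_left_mono norm_triangle_le) (auto simp: norm_mult)
    also have "\<dots> = cmod c * (\<bar>mpower x \<alpha>\<bar> * cmod (mderiv \<beta> f x)) + cmod d * (\<bar>mpower x \<alpha>\<bar> * cmod (mderiv \<beta> g x))"
      by (simp add: algebra_simps)
    also have "\<dots> \<le> cmod c * schwartz_seminorm \<alpha> \<beta> f + cmod d * schwartz_seminorm \<alpha> \<beta> g"
      by (intro add_mono mult_left_mono schwartz_bound f g) auto
    finally show ?thesis .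
  qed
  show "(\<lambda>x. c * f x + d * g x) \<in> schwartz"
    unfolding schwartz_def using b by (intro CollectI conjI allI smooth_lincomb s bdd_aboveI2)
  show "schwartz_seminorm \<alpha> \<beta> (\<lambda>x. c * f x + d * g x) \<le> cmod c * schwartz_seminorm \<alpha> \<beta> f + cmod d * schwartz_seminorm \<alpha> \<beta> g"
    by (rule schwartz_seminorm_le[OF b])
qed

text \<open>Values off \<open>Basis\<close> are fixed to 0, as otherwise the set would be infinite;
  \<open>count_list\<close> of a list of basis vectors is of this form.\<close>

definition bounded_index :: "nat \<Rightarrow> ('a::euclidean_space \<Rightarrow> nat) set" where
  "bounded_index n = {\<alpha>. \<forall>b. (b \<in> Basis \<longrightarrow> \<alpha> b \<in> {..n}) \<and> (b \<notin> Basis \<longrightarrow> \<alpha> b = 0)}"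

lemma finite_bounded_index: "finite (bounded_index n)"
  unfolding bounded_index_def by (rule finite_set_of_finite_funs) auto

lemma count_list_bounded_index:
  assumes "set bs \<subseteq> Basis" "length bs \<le> n" shows "count_list bs \<in> bounded_index n"
proof -
  have "count_list bs b = 0" if "b \<notin> Basis" for b using that assms(1) by (intro count_notin) blast
  moreover have "count_list bs b \<le> n" for b using order_trans[OF count_le_length assms(2)] .
  ultimately show ?thesis unfolding bounded_index_def by simp
qed

text \<open>Condenses the seminorms into one increasing sequence indexed by the degree, the kind of
  majorant that \<open>sc_tame\<close> works with.\<close>

definition schwartz_sum :: "nat \<Rightarrow> ('a::euclidean_space \<Rightarrow> complex) \<Rightarrow> real" where
  "schwartz_sum n f = (\<Sum>(\<alpha>, \<beta>)\<in>bounded_index n \<times> bounded_index n. schwartz_seminorm \<alpha> \<beta> f)"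

lemma schwartz_sum_nonneg: "f \<in> schwartz \<Longrightarrow> 0 \<le> schwartz_sum n f"
  unfolding schwartz_sum_def by (intro sum_nonneg) (auto simp: schwartz_seminorm_nonneg)

lemma schwartz_sum_mono: "f \<in> schwartz \<Longrightarrow> mono (\<lambda>n. schwartz_sum n f)"
  unfolding schwartz_sum_def
  by (intro monoI sum_mono2 finite_cartesian_product finite_bounded_index) (auto simp: bounded_index_def schwartz_seminorm_nonneg intro: order_trans)

lemma schwartz_nbound:
  fixes f :: "'a::euclidean_space \<Rightarrow> complex"
  assumes f: "f \<in> schwartz" shows "nbound \<rho> (\<lambda>i j. schwartz_sum (i + j) f) f"
  unfolding nbound_def
proof (intro conjI allI impI)
  show sf: "smooth f" using f by (simp add: schwartz_def)
  fix bs cs :: "'a list" and z assume bs: "set bs \<subseteq> Basis" and cs: "set cs \<subseteq> Basis"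
  let ?w = "map (Pair True) bs @ map (Pair False) cs"
  let ?n = "sdeg \<rho> ?w + tdeg \<rho> ?w"
  have n: "?n = length bs + length cs" unfolding sdeg_add_tdeg by simp
  have "cmod (foldr mulc bs (foldr partial cs f) z) \<le> schwartz_seminorm (count_list bs) (count_list cs) f"
    unfolding cmod_count_list[OF sf bs cs] by (rule schwartz_bound[OF f])
  also have "\<dots> = (\<Sum>(\<alpha>, \<beta>)\<in>{(count_list bs, count_list cs)}. schwartz_seminorm \<alpha> \<beta> f)" by simp
  also have "\<dots> \<le> schwartz_sum ?n f"
    unfolding schwartz_sum_def
  proof (rule sum_mono2)
    show "{(count_list bs, count_list cs)} \<subseteq> bounded_index ?n \<times> bounded_index ?n"
      using count_list_bounded_index[OF bs, of ?n] count_list_bounded_index[OF cs, of ?n] n by auto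
  qed (auto simp: finite_bounded_index schwartz_seminorm_nonneg[OF f])
  finally show "cmod (foldr mulc bs (foldr partial cs f) z) \<le> schwartz_sum ?n f" .
qed

lemma schwartz_wbound:
  assumes f: "f \<in> schwartz" shows "wbound \<rho> (reorder (\<lambda>i j. schwartz_sum (i + j) f)) f"
  by (rule nbound_imp_wbound[OF schwartz_nbound[OF f] schwartz_sum_nonneg[OF f]])

lemma wbound_imp_schwartz:
  fixes f :: "'a::euclidean_space \<Rightarrow> complex"
  assumes f: "wbound \<rho> m f"
  shows "f \<in> schwartz"
    and "schwartz_seminorm \<alpha> \<beta> f \<le> m (\<Sum>b\<in>Basis. if \<rho> b then \<alpha> b else \<beta> b) (\<Sum>b\<in>Basis. if \<rho> b then \<beta> b else \<alpha> b)"
proof -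
  have b: "\<bar>mpower x \<alpha>\<bar> * cmod (mderiv \<beta> f x) \<le> m (\<Sum>b\<in>Basis. if \<rho> b then \<alpha> b else \<beta> b) (\<Sum>b\<in>Basis. if \<rho> b then \<beta> b else \<alpha> b)" for x \<alpha> \<beta>
  proof -
    let ?w = "map (Pair True) (mlist \<alpha>) @ map (Pair False) (mlist \<beta>)"
    have "\<bar>mpower x \<alpha>\<bar> * cmod (mderiv \<beta> f x) = cmod (word ?w f x)"
      by (simp only: cmod_mlist[symmetric] word_map_mulc_partial)
    also have "\<dots> \<le> m (sdeg \<rho> ?w) (tdeg \<rho> ?w)"
      by (rule wboundD(2)[OF f]) (use set_mlist in \<open>force simp: image_Un image_image\<close>)
    finally show ?thesis unfolding deg_mlist .
  qed
  show "f \<in> schwartz"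
    unfolding schwartz_def using b by (intro CollectI conjI allI wboundD(1)[OF f] bdd_aboveI2)
  show "schwartz_seminorm \<alpha> \<beta> f \<le> m (\<Sum>b\<in>Basis. if \<rho> b then \<alpha> b else \<beta> b) (\<Sum>b\<in>Basis. if \<rho> b then \<beta> b else \<alpha> b)"
    by (rule schwartz_seminorm_le[OF b])
qed

lemma wbound_tensor_ex:
  fixes f g :: "'a::euclidean_space \<Rightarrow> complex"
  assumes f: "wbound isotropic m1 f" and g: "wbound isotropic m2 g" and pos: "\<And>i j. 0 \<le> m1 i j" "\<And>i j. 0 \<le> m2 i j"
  shows "\<exists>m. wbound isotropic m (tensor f g)"
proof -
  \<comment> \<open>The sum over all splittings of the two degrees; as the weights are nonnegative
    it dominates each single product.\<close>
  let ?m = "\<lambda>i j. \<Sum>k\<le>i. \<Sum>l\<le>j. m1 k l * m2 (i - k) (j - l)"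
  have "m1 i1 j1 * m2 i2 j2 \<le> ?m (i1 + i2) (j1 + j2)" for i1 j1 i2 j2
  proof -
    have "m1 i1 j1 * m2 i2 j2 = (\<Sum>k\<in>{i1}. \<Sum>l\<in>{j1}. m1 k l * m2 (i1 + i2 - k) (j1 + j2 - l))" by simp
    also have "\<dots> \<le> (\<Sum>k\<in>{i1}. \<Sum>l\<le>j1 + j2. m1 k l * m2 (i1 + i2 - k) (j1 + j2 - l))"
      by (intro sum_mono sum_mono2) (auto simp: pos)
    also have "\<dots> \<le> ?m (i1 + i2) (j1 + j2)"
      by (rule sum_mono2) (auto simp: pos intro!: sum_nonneg)
    finally show ?thesis .
  qed
  from wbound_tensor[OF f g this] show ?thesis by blast
qed

lemma reorder_nonneg: "(\<And>i j. 0 \<le> m i j) \<Longrightarrow> 0 \<le> reorder m i j"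
  unfolding reorder_def by (intro sum_nonneg) auto

lemma dual_closed_schwartz: "dual_closed (schwartz :: ('a::euclidean_space \<Rightarrow> complex) set) schwartz"
proof -
  have k: "\<exists>m. wbound isotropic m (kern t \<psi> f)" if psi: "\<psi> \<in> schwartz" and f: "f \<in> schwartz" for \<psi> f :: "'a \<Rightarrow> complex" and t
  proof -
    obtain m where "wbound isotropic m (tensor \<psi> f)"
      using wbound_tensor_ex[OF schwartz_wbound[OF psi] schwartz_wbound[OF f]
        reorder_nonneg[OF schwartz_sum_nonneg[OF psi]] reorder_nonneg[OF schwartz_sum_nonneg[OF f]]] by blast
    from wbound_kern[OF this] show ?thesis by blast
  qed
  have e: "(1::real) \<in> {1, -1}" by simp
  have "PF 1 (kern t \<psi> f) \<in> schwartz" if psi: "\<psi> \<in> schwartz" and f: "f \<in> schwartz" for \<psi> f :: "'a \<Rightarrow> complex" and t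
  proof -
    obtain m where "wbound isotropic m (kern t \<psi> f)" using k[OF psi f] by blast
    from wbound_imp_schwartz(1)[OF PF_iso[OF this e]] show ?thesis .
  qed
  moreover have "Phi t e F \<in> schwartz" if "F \<in> schwartz" "e \<in> {1, -1}" for F :: "'a \<times> 'a \<Rightarrow> complex" and t e
    by (rule wbound_imp_schwartz(1)[OF Phi_Phi_weight[OF schwartz_wbound[OF that(1)] that(2)]])
  moreover have "\<exists>m. wbound phase m F" if "F \<in> schwartz" for F :: "'a \<times> 'a \<Rightarrow> complex" using schwartz_wbound[OF that] by blast
  ultimately show ?thesis unfolding dual_closed_def using k by blast
qed

lemma schwartz_zero: "(\<lambda>x. 0) \<in> schwartz" "schwartz_seminorm \<alpha> \<beta> (\<lambda>x. 0) = 0"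
  by (auto simp: schwartz_def smooth_zero mderiv_zero schwartz_seminorm_def)

lemma topspace_schwartz: "topspace schwartz_topology = schwartz"
  unfolding schwartz_topology_def by (rule topspace_seminorm) (auto simp: schwartz_zero)

lemma schwartz_Phi_bound:
  "\<exists>Q C. finite Q \<and> Q \<subseteq> {schwartz_seminorm \<alpha> \<beta> | \<alpha> \<beta>. True} \<and> 0 \<le> C \<and>
     (\<forall>F\<in>(schwartz :: ('a::euclidean_space \<times> 'a \<Rightarrow> complex) set). schwartz_seminorm \<alpha> \<beta> (Phi t 1 F) \<le> C * (\<Sum>q\<in>Q. q F))"
proof -
  let ?T = "\<lambda>m. Phi_weight DIM('a) (PF_const TYPE('a)) t (reorder m)"
  have "sc_tame ?T" by (rule sc_tame_comp[OF sc_tame_reorder sc_tame_Phi_weight[OF PF_const_nonneg]])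
  then obtain L c where c: "\<forall>n. 0 \<le> (c n :: real)" and "\<forall>m q. mono q \<longrightarrow> (\<forall>n. 0 \<le> q n) \<longrightarrow>
     (\<forall>i j. m i j \<le> q (i + j)) \<longrightarrow> (\<forall>i j. ?T m i j \<le> c (i + j) * q (i + j + L))" unfolding sc_tame_def by blast
  note T = this(2)[rule_format]
  let ?i = "\<Sum>b\<in>Basis. if phase b then \<alpha> b else \<beta> b" and ?j = "\<Sum>b\<in>Basis. if phase b then \<beta> b else \<alpha> b"
  let ?I = "bounded_index (?i + ?j + L) \<times> bounded_index (?i + ?j + L) :: (('a \<times> 'a \<Rightarrow> nat) \<times> ('a \<times> 'a \<Rightarrow> nat)) set"
  let ?Q = "(\<lambda>(\<alpha>, \<beta>). schwartz_seminorm \<alpha> \<beta>) ` ?I"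
  have fin: "finite ?I" by (intro finite_cartesian_product finite_bounded_index)
  have "schwartz_seminorm \<alpha> \<beta> (Phi t 1 F) \<le> (c (?i + ?j) * real (card ?I)) * (\<Sum>q\<in>?Q. q F)" if F: "F \<in> schwartz" for F :: "'a \<times> 'a \<Rightarrow> complex"
  proof -
    have e: "(1::real) \<in> {1, -1}" by simp
    have "schwartz_seminorm \<alpha> \<beta> (Phi t 1 F) \<le> ?T (\<lambda>i j. schwartz_sum (i + j) F) ?i ?j"
      by (rule wbound_imp_schwartz(2)[OF Phi_Phi_weight[OF schwartz_wbound[OF F] e]])
    also have "\<dots> \<le> c (?i + ?j) * schwartz_sum (?i + ?j + L) F"
      by (rule T[OF schwartz_sum_mono[OF F] schwartz_sum_nonneg[OF F] order_refl])
    \<comment> \<open>\<open>?Q\<close> is a set of seminorms, in which different pairs of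
      multi-indices may coincide. Estimating each summand by the full sum avoids the comparison at
      the price of the factor \<open>card ?I\<close>.\<close>
    also have "schwartz_sum (?i + ?j + L) F \<le> (\<Sum>p\<in>?I. \<Sum>q\<in>?Q. q F)"
      unfolding schwartz_sum_def
    proof (rule sum_mono)
      fix p assume p: "p \<in> ?I"
      obtain \<alpha>' \<beta>' where p': "p = (\<alpha>', \<beta>')" by (cases p)
      have "schwartz_seminorm \<alpha>' \<beta>' \<in> ?Q" using p p' by (metis (no_types, lifting) case_prod_conv imageI)
      moreover have "0 \<le> q F" if "q \<in> ?Q" for q using that schwartz_seminorm_nonneg[OF F] by auto
      ultimately have "schwartz_seminorm \<alpha>' \<beta>' F \<le> (\<Sum>q\<in>?Q. q F)"
        using fin by (intro member_le_sum[where f = "\<lambda>q. q F"]) auto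
      then show "(case p of (\<alpha>, \<beta>) \<Rightarrow> schwartz_seminorm \<alpha> \<beta> F) \<le> (\<Sum>q\<in>?Q. q F)" by (simp add: p')
    qed
    also have "(\<Sum>p\<in>?I. \<Sum>q\<in>?Q. q F) = real (card ?I) * (\<Sum>q\<in>?Q. q F)" by simp
    finally show ?thesis using c by (simp only: mult.assoc mult_left_mono)
  qed
  moreover have "0 \<le> c (?i + ?j) * real (card ?I)" using c by simp
  moreover have "finite ?Q" using fin by simp
  moreover have "?Q \<subseteq> {schwartz_seminorm \<alpha> \<beta> | \<alpha> \<beta>. True}" by auto
  ultimately show ?thesis by blast
qed

lemma continuous_map_Phi_schwartz:
  "continuous_map schwartz_topology schwartz_topology (Phi t 1 :: ('a::euclidean_space \<times> 'a \<Rightarrow> complex) \<Rightarrow> _)"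
  unfolding schwartz_topology_def
proof (rule continuous_map_seminorm)
  have e: "(1::real) \<in> {1, -1}" by simp
  show "Phi t 1 F \<in> schwartz" if "F \<in> schwartz" for F :: "'a \<times> 'a \<Rightarrow> complex"
    using dual_closed_schwartz that e unfolding dual_closed_def by blast
  show "(schwartz :: ('a \<times> 'a \<Rightarrow> complex) set) \<noteq> {}" using schwartz_zero(1) by blast
  show d: "(\<lambda>x. F x - G x) \<in> schwartz" if "F \<in> schwartz" "G \<in> schwartz" for F G :: "'a \<times> 'a \<Rightarrow> complex"
    using schwartz_lincomb(1)[OF that, of 1 "-1"] by simp
  show "(\<lambda>x. F x - G x) \<in> schwartz" if "F \<in> schwartz" "G \<in> schwartz" for F G :: "'a \<times> 'a \<Rightarrow> complex"
    by (rule d[OF that])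
  show "Phi t 1 (\<lambda>x. F x - G x) = (\<lambda>x. Phi t 1 F x - Phi t 1 G x)" if "F \<in> schwartz" "G \<in> schwartz" for F G :: "'a \<times> 'a \<Rightarrow> complex"
    using Phi_linear[OF schwartz_wbound[OF that(1)] schwartz_wbound[OF that(2)] e, of t 1 "-1"] by simp
  show "p (\<lambda>x. F x + G x) \<le> p F + p G" if "p \<in> {schwartz_seminorm \<alpha> \<beta> | \<alpha> \<beta>. True}" "F \<in> schwartz" "G \<in> schwartz" for p and F G :: "'a \<times> 'a \<Rightarrow> complex"
    using schwartz_lincomb(2)[OF that(2,3), of _ _ 1 1] that(1) by auto
  show "\<exists>Q C. finite Q \<and> Q \<subseteq> {schwartz_seminorm \<alpha> \<beta> | \<alpha> \<beta>. True} \<and> 0 \<le> C \<and> (\<forall>F\<in>schwartz. p (Phi t 1 F) \<le> C * (\<Sum>q\<in>Q. q F))"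
    if "p \<in> {schwartz_seminorm \<alpha> \<beta> | \<alpha> \<beta>. True}" for p :: "('a \<times> 'a \<Rightarrow> complex) \<Rightarrow> real"
    using that schwartz_Phi_bound by auto
  show "(schwartz :: ('a \<times> 'a \<Rightarrow> complex) set) \<subseteq> topspace (seminorm_topology schwartz {schwartz_seminorm \<alpha> \<beta> | \<alpha> \<beta>. True})"
    using topspace_schwartz unfolding schwartz_topology_def by blast
qed (auto simp: schwartz_zero)

text \<open>Only the Wigner distribution of zero functions is ever tested, and it is 0 for every
  quantization, so the symbol can be kept.\<close>

lemma Op_trivial:
  assumes "V \<subseteq> {\<lambda>_. 0}" shows "Op_BJ V a = Op_t V t a"
proof -
  have w: "wigner t (\<lambda>_. 0) (\<lambda>_. 0) = (\<lambda>_. 0)" for t by (auto simp: wigner_def)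
  have BJ: "wigner_BJ (\<lambda>_. 0) (\<lambda>_. 0) = (\<lambda>_. 0)" by (simp add: wigner_BJ_def w set_lebesgue_integral_def)
  have "pairing a (wigner_BJ (\<lambda>x. cnj (\<psi> x)) f) = pairing a (wigner t (\<lambda>x. cnj (\<psi> x)) f)" if "f \<in> V" "\<psi> \<in> V" for f \<psi>
  proof -
    have "f = (\<lambda>_. 0)" "\<psi> = (\<lambda>_. 0)" using that assms by auto
    then show ?thesis by (simp add: w BJ)
  qed
  then show ?thesis unfolding Op_BJ_def Op_t_def by (auto simp: fun_eq_iff restrict_def)
qed

theorem theorem3p3:
  fixes s \<sigma> t :: real
  assumes "s > 0" and "\<sigma> > 0" and "s + \<sigma> \<ge> 1"
  shows
    "(\<forall>a \<in> GS_phase_dual s \<sigma>. \<exists>b \<in> GS_phase_dual s \<sigma>.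
        Op_BJ (GS s \<sigma> :: (real ^ 'n \<Rightarrow> complex) set) a = Op_t (GS s \<sigma>) t b) \<and>
     (\<forall>a \<in> GS_phase s \<sigma>. \<exists>b \<in> GS_phase s \<sigma>.
        Op_BJ (GS s \<sigma> :: (real ^ 'n \<Rightarrow> complex) set) (dist_of (GS_phase s \<sigma>) a) =
        Op_t (GS s \<sigma>) t (dist_of (GS_phase s \<sigma>) b)) \<and>
     (\<forall>a \<in> tempered. \<exists>b \<in> tempered.
        Op_BJ (schwartz :: (real ^ 'n \<Rightarrow> complex) set) a = Op_t schwartz t b) \<and>
     (\<forall>a \<in> schwartz. \<exists>b \<in> schwartz.
        Op_BJ (schwartz :: (real ^ 'n \<Rightarrow> complex) set) (dist_of schwartz a) =
        Op_t schwartz t (dist_of schwartz b)) \<and>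
     (\<forall>a \<in> GS_Sigma_phase_dual s \<sigma>. \<exists>b \<in> GS_Sigma_phase_dual s \<sigma>.
        Op_BJ (GS_Sigma s \<sigma> :: (real ^ 'n \<Rightarrow> complex) set) a = Op_t (GS_Sigma s \<sigma>) t b) \<and>
     (\<forall>a \<in> GS_Sigma_phase s \<sigma>. \<exists>b \<in> GS_Sigma_phase s \<sigma>.
        Op_BJ (GS_Sigma s \<sigma> :: (real ^ 'n \<Rightarrow> complex) set) (dist_of (GS_Sigma_phase s \<sigma>) a) =
        Op_t (GS_Sigma s \<sigma>) t (dist_of (GS_Sigma_phase s \<sigma>) b))"
proof (intro conjI ballI)
  note R = roumieu_case[OF assms, where 'a = "real ^ 'n"]
  fix a :: "((real ^ 'n) \<times> (real ^ 'n) \<Rightarrow> complex) \<Rightarrow> complex" assume "a \<in> GS_phase_dual s \<sigma>"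
  then show "\<exists>b \<in> GS_phase_dual s \<sigma>. Op_BJ (GS s \<sigma> :: (real ^ 'n \<Rightarrow> complex) set) a = Op_t (GS s \<sigma>) t b"
    using dual_space_symbol[OF R] unfolding GS_phase_dual_def gs_roumieu_dual_def GS_phase_def by blast
next
  fix a :: "(real ^ 'n) \<times> (real ^ 'n) \<Rightarrow> complex" assume "a \<in> GS_phase s \<sigma>"
  then show "\<exists>b \<in> GS_phase s \<sigma>. Op_BJ (GS s \<sigma> :: (real ^ 'n \<Rightarrow> complex) set) (dist_of (GS_phase s \<sigma>) a) =
        Op_t (GS s \<sigma>) t (dist_of (GS_phase s \<sigma>) b)"
    by (rule function_symbol[OF roumieu_case(1)[OF assms]])
next
  fix a :: "((real ^ 'n) \<times> (real ^ 'n) \<Rightarrow> complex) \<Rightarrow> complex" assume "a \<in> tempered"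
  then show "\<exists>b \<in> tempered. Op_BJ (schwartz :: (real ^ 'n \<Rightarrow> complex) set) a = Op_t schwartz t b"
    using dual_space_symbol[OF dual_closed_schwartz schwartz_lincomb(1) topspace_schwartz continuous_map_Phi_schwartz]
    unfolding tempered_def by blast
next
  fix a :: "(real ^ 'n) \<times> (real ^ 'n) \<Rightarrow> complex" assume "a \<in> schwartz"
  then show "\<exists>b \<in> schwartz. Op_BJ (schwartz :: (real ^ 'n \<Rightarrow> complex) set) (dist_of schwartz a) =
        Op_t schwartz t (dist_of schwartz b)"
    by (rule function_symbol[OF dual_closed_schwartz])
next
  fix a :: "((real ^ 'n) \<times> (real ^ 'n) \<Rightarrow> complex) \<Rightarrow> complex" assume a: "a \<in> GS_Sigma_phase_dual s \<sigma>"
  show "\<exists>b \<in> GS_Sigma_phase_dual s \<sigma>. Op_BJ (GS_Sigma s \<sigma> :: (real ^ 'n \<Rightarrow> complex) set) a = Op_t (GS_Sigma s \<sigma>) t b"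
  \<comment> \<open>For sum one the test functions reduce to 0 and \<open>b = a\<close> serves;
    otherwise every step is admissible.\<close>
  proof (cases "s + \<sigma> = 1")
    case True
    have "(GS_Sigma s \<sigma> :: (real ^ 'n \<Rightarrow> complex) set) \<subseteq> {\<lambda>_. 0}"
      using gs_beurling_trivial[OF assms(1,2) True] unfolding GS_Sigma_def by blast
    from Op_trivial[OF this] a show ?thesis by blast
  next
    case False
    then have "1 < s + \<sigma>" using assms(3) by simp
    note B = beurling_case[OF assms(1,2) this, where 'a = "real ^ 'n"]
    show ?thesis
      using a dual_space_symbol[OF B] unfolding GS_Sigma_phase_dual_def gs_beurling_dual_def GS_Sigma_phase_def by blast
  qed
next
  fix a :: "(real ^ 'n) \<times> (real ^ 'n) \<Rightarrow> complex" assume a: "a \<in> GS_Sigma_phase s \<sigma>"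
  show "\<exists>b \<in> GS_Sigma_phase s \<sigma>. Op_BJ (GS_Sigma s \<sigma> :: (real ^ 'n \<Rightarrow> complex) set) (dist_of (GS_Sigma_phase s \<sigma>) a) =
        Op_t (GS_Sigma s \<sigma>) t (dist_of (GS_Sigma_phase s \<sigma>) b)"
  proof (cases "s + \<sigma> = 1")
    case True
    have "(GS_Sigma s \<sigma> :: (real ^ 'n \<Rightarrow> complex) set) \<subseteq> {\<lambda>_. 0}"
      using gs_beurling_trivial[OF assms(1,2) True] unfolding GS_Sigma_def by blast
    from Op_trivial[OF this] a show ?thesis by blast
  next
    case False
    then have "1 < s + \<sigma>" using assms(3) by simp
    from function_symbol[OF beurling_case(1)[OF assms(1,2) this] a] show ?thesis .
  qed
qed

end
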